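(* Let $\mathcal W$ be an admissible potential with space $W$ (defined in the context), and let $w_0,w_1\in W$. For every $\varepsilon\in(0,1)$ the functional $$F_\varepsilon(w)=\frac{\varepsilon^2}{2}\int_0^\infty\!\!\int_{\mathbb R^n} e^{-t/\varepsilon}|w''(t,x)|^2\,dx\,dt+\int_0^\infty e^{-t/\varepsilon}\,\mathcal W(w(t,\cdot))\,dt$$ has a minimizer $w_\varepsilon$ in the class of those $w\in H^2_{\rm loc}([0,\infty);L^2)$ that satisfy $w(0)=w_0$, $w'(0)=w_1$. Moreover: (a) Estimates. There exists a constant $C$, independent of $\varepsilon$, such that $$\int_\tau^{\tau+T}\mathcal W(w_\varepsilon(t,\cdot))\,dt\le CT\qquad\forall \tau\ge 0,\ \forall T\ge\varepsilon,$$ $$\int_{\mathbb R^n}|w_\varepsilon'(t,x)|^2\,dx\le C,\qquad \int_{\mathbb R^n}|w_\varepsilon(t,x)|^2\,dx\le C(1+t^2)\qquad\forall t\ge 0,$$ $$\|w_\varepsilon''\|_{L^\infty(\mathbb R^+;W')}\le C.$$ (b) Convergence. Every sequence $w_{\varepsilon_i}$ (with $\varepsilon_i\downarrow 0$) admits a subsequence which converges, in the weak topology of $H^1((0,T);L^2)$ for every $T>0$, to a function $w$ such that $$w\in H^1_{\rm loc}([0,\infty);L^2),\qquad w'\in L^\infty(\mathbb R^+;L^2),\qquad w''\in L^\infty(\mathbb R^+;W').$$ Moreover, $w$ satisfies the initial conditions $w(0)=w_0$, $w'(0)=w_1$. (c) Energy inequality. Letting $$\mathcal E(t)=\frac12\int_{\mathbb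 R^n}|w'(t,x)|^2\,dx+\mathcal W(w(t,\cdot)),$$ the function $w$ satisfies $$\mathcal E(t)\le \mathcal E(0)=\frac12\int_{\mathbb R^n}|w_1(x)|^2\,dx+\mathcal W(w_0)\qquad\text{for a.e. } t>0.$$
   Context: Notation: $L^2=L^2(\mathbb R^n)$, $C_0^\infty=C_0^\infty(\mathbb R^n)$ (smooth, compactly supported); functions are real valued; $\mathbb R^+=(0,\infty)$; a prime on a function of $(t,x)$ denotes the derivative in time $t$, while $W'$ denotes the dual of the Banach space $W$; $w(t)=w(t,\cdot)$; $\langle\cdot,\cdot\rangle$ is the duality pairing. Admissible potential: a functional $\mathcal W:L^2\to[0,+\infty]$ is an admissible potential with space $W$ if: (i) $\mathcal W(v)\le\liminf_{k}\mathcal W(v_k)$ whenever $v_k\rightharpoonup v$ weakly in $L^2$; (ii) $\mathcal W(v)<\infty\iff v\in W$, where $W$ is a Banach space with $C_0^\infty\hookrightarrow W\hookrightarrow L^2$ (dense and continuous inclusions); (iii) $\mathcal W$ is Gâteaux differentiable on $W$, with derivative $\nabla\mathcal W:W\to W'$, and there are $C\ge0$ and $\theta\in(0,1)$ such that $\|\nabla\mathcal W(v)\|_{W'}\le C(1+\mathcal W(v)^\theta)$ for all $v\in W$. By (ii), $L^2$ is identified with a subspace of $W'$ (via the $L^2$ inner product), so $L^2$-valued functions are also viewed as $W'$-valued. The initial condition $w'(0)=w_1$ for the limit function $w$ is understood as an equality in $W'$ (it makes sense because $w'$ is Lipschitz in time with values in $W'$). The constant $C$ in (a) may depend on all data ($\mathcal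 W$, $w_0$, $w_1$, ...) except $\varepsilon$. In (b) and (c), $w_\varepsilon$ are the minimizers above and $w$ in (c) is a limit function as in (b). *)

theory Defs
  imports "HOL-Analysis.Analysis"
begin

section \<open>The Hilbert space of square integrable functions\<close>

text \<open>The type \<open>'a L2\<close> is the space of real valued square integrable functions on a Euclidean
  space modulo equality almost everywhere. Representatives are Borel measurable; this is no
  restriction, since every Lebesgue measurable function agrees almost everywhere with a Borel one.\<close>


definition sq_integrable :: "('a::euclidean_space \<Rightarrow> real) \<Rightarrow> bool" where
  "sq_integrable f \<longleftrightarrow> f \<in> borel_measurable lborel \<and> integrable lborel (\<lambda>x. (f x)\<^sup>2)"

definition L2_rel :: "('a::euclidean_space \<Rightarrow> real) \<Rightarrow> ('a \<Rightarrow> real) \<Rightarrow> bool" where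
  "L2_rel f g \<longleftrightarrow> sq_integrable f \<and> sq_integrable g \<and> (AE x in lborel. f x = g x)"

lemma sq_integrable_meas: "sq_integrable f \<Longrightarrow> f \<in> borel_measurable borel"
  by (simp add: sq_integrable_def)

lemma sq_integrable_0: "sq_integrable (\<lambda>x. 0)"
  by (simp add: sq_integrable_def)

lemma sq_integrable_dominated:
  assumes "sq_integrable f" "g \<in> borel_measurable borel" "AE x in lborel. \<bar>g x\<bar> \<le> C * \<bar>f x\<bar>"
  shows "sq_integrable g"
  unfolding sq_integrable_def
proof (intro conjI)
  show "integrable lborel (\<lambda>x. (g x)\<^sup>2)"
  proof (rule Bochner_Integration.integrable_bound)
    show "integrable lborel (\<lambda>x. C\<^sup>2 * (f x)\<^sup>2)"
      using assms by (simp add: sq_integrable_def)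
    show "AE x in lborel. norm ((g x)\<^sup>2) \<le> norm (C\<^sup>2 * (f x)\<^sup>2)"
      using assms(3)
    proof eventually_elim
      case (elim x)
      then have "\<bar>g x\<bar>\<^sup>2 \<le> (C * \<bar>f x\<bar>)\<^sup>2" by (intro power_mono) auto
      then show ?case by (simp add: power_mult_distrib)
    qed
  qed (use assms in auto)
qed (use assms in auto)

lemma sq_integrable_prod:
  assumes "sq_integrable f" "sq_integrable g"
  shows "integrable lborel (\<lambda>x. f x * g x)"
proof (rule Bochner_Integration.integrable_bound)
  show "integrable lborel (\<lambda>x. (f x)\<^sup>2 + (g x)\<^sup>2)"
    using assms by (simp add: sq_integrable_def)
  have "\<bar>a * b\<bar> \<le> a\<^sup>2 + b\<^sup>2" for a b :: real
  proof -
    have "0 \<le> (\<bar>a\<bar> - \<bar>b\<bar>)\<^sup>2" by simp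
    then have "2 * (\<bar>a\<bar> * \<bar>b\<bar>) \<le> a\<^sup>2 + b\<^sup>2" by (simp add: power2_diff)
    moreover have "0 \<le> \<bar>a\<bar> * \<bar>b\<bar>" by simp
    ultimately show ?thesis unfolding abs_mult by linarith
  qed
  then show "AE x in lborel. norm (f x * g x) \<le> norm ((f x)\<^sup>2 + (g x)\<^sup>2)"
    by auto
  show "(\<lambda>x. f x * g x) \<in> borel_measurable lborel"
    using assms by (auto simp: sq_integrable_def intro!: borel_measurable_times)
qed

lemma sq_integrable_add:
  assumes "sq_integrable f" "sq_integrable g"
  shows "sq_integrable (\<lambda>x. f x + g x)"
  using assms sq_integrable_prod[OF assms]
  by (auto simp: sq_integrable_def power2_sum mult.assoc)

lemma sq_integrable_scale: "sq_integrable f \<Longrightarrow> sq_integrable (\<lambda>x. c * f x)"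
  by (auto simp: sq_integrable_def power_mult_distrib)

lemma sq_integrable_minus: "sq_integrable f \<Longrightarrow> sq_integrable (\<lambda>x. - f x)"
  by (auto simp: sq_integrable_def)

lemma sq_integrable_diff: "sq_integrable f \<Longrightarrow> sq_integrable g \<Longrightarrow> sq_integrable (\<lambda>x. f x - g x)"
  using sq_integrable_add[of f "\<lambda>x. - g x"] by (simp add: sq_integrable_minus)

lemma part_equivp_L2_rel: "part_equivp (L2_rel :: ('a::euclidean_space \<Rightarrow> real) \<Rightarrow> _)"
proof (rule part_equivpI)
  show "\<exists>f :: 'a \<Rightarrow> real. L2_rel f f"
    using sq_integrable_0 by (auto simp: L2_rel_def)
  show "symp (L2_rel :: ('a \<Rightarrow> real) \<Rightarrow> _)" by (auto intro!: sympI simp: L2_rel_def elim: eventually_mono)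
  show "transp (L2_rel :: ('a \<Rightarrow> real) \<Rightarrow> _)"
  proof (intro transpI)
    fix f g h :: "'a \<Rightarrow> real"
    assume "L2_rel f g" "L2_rel g h"
    then show "L2_rel f h" unfolding L2_rel_def by (auto elim: eventually_elim2)
  qed
qed

quotient_type (overloaded) 'a L2 = "'a::euclidean_space \<Rightarrow> real" / partial: L2_rel
  morphisms rep_L2 to_L2
  by (rule part_equivp_L2_rel)

instantiation L2 :: (euclidean_space) real_vector
begin

lift_definition zero_L2 :: "'a L2" is "\<lambda>x. 0"
  by (simp add: L2_rel_def sq_integrable_0)

lift_definition plus_L2 :: "'a L2 \<Rightarrow> 'a L2 \<Rightarrow> 'a L2" is "\<lambda>f g x. f x + g x"
  by (auto simp: L2_rel_def sq_integrable_add elim: eventually_elim2)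

lift_definition minus_L2 :: "'a L2 \<Rightarrow> 'a L2 \<Rightarrow> 'a L2" is "\<lambda>f g x. f x - g x"
  by (auto simp: L2_rel_def sq_integrable_diff elim: eventually_elim2)

lift_definition uminus_L2 :: "'a L2 \<Rightarrow> 'a L2" is "\<lambda>f x. - f x"
  by (auto simp: L2_rel_def sq_integrable_minus elim: eventually_mono)

lift_definition scaleR_L2 :: "real \<Rightarrow> 'a L2 \<Rightarrow> 'a L2" is "\<lambda>c f x. c * f x"
  by (auto simp: L2_rel_def sq_integrable_scale elim: eventually_mono)

instance
  by standard
    (transfer; auto simp: L2_rel_def algebra_simps
       intro!: sq_integrable_add sq_integrable_diff sq_integrable_minus sq_integrable_scale sq_integrable_0)+

end

instantiation L2 :: (euclidean_space) real_inner
begin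

lift_definition inner_L2 :: "'a L2 \<Rightarrow> 'a L2 \<Rightarrow> real" is "\<lambda>f g. LINT x|lborel. f x * g x"
  unfolding L2_rel_def
  by (intro integral_cong_AE) (auto simp: sq_integrable_def elim: eventually_elim2)

definition norm_L2 :: "'a L2 \<Rightarrow> real" where "norm_L2 u = sqrt (inner u u)"
definition sgn_L2 :: "'a L2 \<Rightarrow> 'a L2" where "sgn_L2 u = u /\<^sub>R norm u"
definition dist_L2 :: "'a L2 \<Rightarrow> 'a L2 \<Rightarrow> real" where "dist_L2 u v = norm (u - v)"
definition uniformity_L2 :: "('a L2 \<times> 'a L2) filter" where
  "uniformity_L2 = (INF e\<in>{0<..}. principal {(u, v). dist u v < e})"
definition open_L2 :: "'a L2 set \<Rightarrow> bool" where
  "open_L2 U \<longleftrightarrow> (\<forall>u\<in>U. eventually (\<lambda>(u', v). u' = u \<longrightarrow> v \<in> U) uniformity)"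

instance
proof
  fix u v w :: "'a L2" and c :: real and U :: "'a L2 set"
  show "dist u v = norm (u - v)" by (rule dist_L2_def)
  show "sgn u = u /\<^sub>R norm u" by (rule sgn_L2_def)
  show "(uniformity :: ('a L2 \<times> 'a L2) filter) = (INF e\<in>{0<..}. principal {(u, v). dist u v < e})"
    by (rule uniformity_L2_def)
  show "open U \<longleftrightarrow> (\<forall>u\<in>U. eventually (\<lambda>(u', v). u' = u \<longrightarrow> v \<in> U) uniformity)"
    by (rule open_L2_def)
  show "norm u = sqrt (inner u u)" by (rule norm_L2_def)
  show "inner u v = inner v u"
    by transfer (simp add: mult.commute)
  show "inner (u + v) w = inner u w + inner v w"
    by transfer (simp add: L2_rel_def ring_distribs sq_integrable_prod)
  show "inner (c *\<^sub>R u) v = c * inner u v"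
    by transfer (simp add: L2_rel_def mult.assoc)
  show "0 \<le> inner u u"
    by transfer (simp add: L2_rel_def)
  show "inner u u = 0 \<longleftrightarrow> u = 0"
  proof (transfer)
    fix f :: "'a \<Rightarrow> real" assume "L2_rel f f"
    then have f: "sq_integrable f" by (simp add: L2_rel_def)
    have "(LINT x|lborel. f x * f x) = 0 \<longleftrightarrow> (AE x in lborel. f x * f x = 0)"
      using sq_integrable_prod[OF f f] by (intro integral_nonneg_eq_0_iff_AE) auto
    then show "(LINT x|lborel. f x * f x) = 0 \<longleftrightarrow> L2_rel f (\<lambda>x. 0)"
      using f by (simp add: L2_rel_def sq_integrable_0)
  qed
qed

end

lemma sq_integrable_rep_L2: "sq_integrable (rep_L2 u)"
  using Quotient3_rep_reflp[OF Quotient3_L2, of u] by (simp add: L2_rel_def)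

lemma to_L2_rep_L2 [simp]: "to_L2 (rep_L2 u) = u"
  by (rule Quotient3_abs_rep[OF Quotient3_L2])

lemma L2_rel_iff: "sq_integrable f \<Longrightarrow> sq_integrable g \<Longrightarrow>
   to_L2 f = to_L2 g \<longleftrightarrow> (AE x in lborel. f x = g x)"
  using Quotient3_rel[OF Quotient3_L2, of f g] by (auto simp: L2_rel_def)

lemma to_L2_0: "to_L2 (\<lambda>x. 0) = 0"
  by (simp add: zero_L2_def)

lemma to_L2_add: "sq_integrable f \<Longrightarrow> sq_integrable g \<Longrightarrow> to_L2 (\<lambda>x. f x + g x) = to_L2 f + to_L2 g"
  by (rule plus_L2.abs_eq[symmetric]) (simp_all add: L2_rel_def)

lemma to_L2_diff: "sq_integrable f \<Longrightarrow> sq_integrable g \<Longrightarrow> to_L2 (\<lambda>x. f x - g x) = to_L2 f - to_L2 g"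
  by (rule minus_L2.abs_eq[symmetric]) (simp_all add: L2_rel_def)

lemma to_L2_scale: "sq_integrable f \<Longrightarrow> to_L2 (\<lambda>x. c * f x) = c *\<^sub>R to_L2 f"
  by (rule scaleR_L2.abs_eq[symmetric]) (simp_all add: L2_rel_def)

lemma inner_to_L2: "sq_integrable f \<Longrightarrow> sq_integrable g \<Longrightarrow> inner (to_L2 f) (to_L2 g) = (LINT x|lborel. f x * g x)"
  by (rule inner_L2.abs_eq) (simp_all add: L2_rel_def)

lemma norm_to_L2: "sq_integrable f \<Longrightarrow> (norm (to_L2 f))\<^sup>2 = (LINT x|lborel. (f x)\<^sup>2)"
  unfolding power2_norm_eq_inner by (simp only: inner_to_L2 power2_eq_square)

lemma nn_norm_to_L2: "sq_integrable f \<Longrightarrow> (\<integral>\<^sup>+x. ennreal ((f x)\<^sup>2) \<partial>lborel) = ennreal ((norm (to_L2 f))\<^sup>2)"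
  unfolding norm_to_L2 by (rule nn_integral_eq_integral) (auto simp: sq_integrable_def)

lemma sq_integrable_nn:
  assumes "f \<in> borel_measurable borel" "(\<integral>\<^sup>+x. ennreal ((f x)\<^sup>2) \<partial>lborel) < \<infinity>"
  shows "sq_integrable f"
  unfolding sq_integrable_def using assms
  by (auto intro!: integrableI_nonneg)

lemma summable_subseq_L2:
  fixes f :: "nat \<Rightarrow> 'a::euclidean_space \<Rightarrow> real"
  assumes f: "\<And>k. sq_integrable (f k)"
    and d: "\<And>k. (norm (to_L2 (f (Suc k)) - to_L2 (f k)))\<^sup>2 \<le> (1/8)^k"
  shows "AE x in lborel. convergent (\<lambda>k. f k x)"
proof -
  have [measurable]: "f k \<in> borel_measurable borel" for k by (rule sq_integrable_meas[OF f])
  have "(\<integral>\<^sup>+x. (\<Sum>k. ennreal (4^k * (f (Suc k) x - f k x)\<^sup>2)) \<partial>lborel)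
      = (\<Sum>k. \<integral>\<^sup>+x. ennreal (4^k * (f (Suc k) x - f k x)\<^sup>2) \<partial>lborel)"
    by (rule nn_integral_suminf) simp
  also have "\<dots> \<le> (\<Sum>k. ennreal ((1/2)^k))"
  proof (rule suminf_le)
    fix k
    have "(\<integral>\<^sup>+x. ennreal (4^k * (f (Suc k) x - f k x)\<^sup>2) \<partial>lborel)
        = ennreal (4^k) * (\<integral>\<^sup>+x. ennreal ((f (Suc k) x - f k x)\<^sup>2) \<partial>lborel)"
      by (subst nn_integral_cmult[symmetric]) (simp_all only: ennreal_mult' zero_le_power zero_le_numeral, simp)
    also have "\<dots> = ennreal (4^k) * ennreal ((norm (to_L2 (f (Suc k)) - to_L2 (f k)))\<^sup>2)"
      by (simp add: nn_norm_to_L2 sq_integrable_diff f to_L2_diff[symmetric])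
    also have "\<dots> \<le> ennreal (4^k) * ennreal ((1/8)^k)"
      by (intro mult_left_mono ennreal_leI d) auto
    also have "\<dots> = ennreal (4^k * (1/8)^k)"
      by (rule ennreal_mult'[symmetric]) simp
    also have "(4::real)^k * (1/8)^k = (1/2)^k"
      unfolding power_mult_distrib[symmetric] by simp
    finally show "(\<integral>\<^sup>+x. ennreal (4^k * (f (Suc k) x - f k x)\<^sup>2) \<partial>lborel) \<le> ennreal ((1/2)^k)" .
  qed auto
  also have "\<dots> = ennreal (\<Sum>k. (1/2)^k)"
    by (rule suminf_ennreal2) (auto simp: summable_geometric)
  also have "\<dots> < \<infinity>" by simp
  finally have fin: "(\<integral>\<^sup>+x. (\<Sum>k. ennreal (4^k * (f (Suc k) x - f k x)\<^sup>2)) \<partial>lborel) \<noteq> \<infinity>"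
    by (rule less_imp_neq)
  have "AE x in lborel. (\<Sum>k. ennreal (4^k * (f (Suc k) x - f k x)\<^sup>2)) \<noteq> \<infinity>"
    by (rule nn_integral_PInf_AE[OF _ fin]) (rule borel_measurable_suminf_order, simp)
  then show ?thesis
  proof (rule eventually_mono)
    fix x assume elim: "(\<Sum>k. ennreal (4^k * (f (Suc k) x - f k x)\<^sup>2)) \<noteq> \<infinity>"
    let ?S = "\<Sum>k. ennreal (4^k * (f (Suc k) x - f k x)\<^sup>2)"
    define M where "M = enn2real ?S"
    have le: "4^k * (f (Suc k) x - f k x)\<^sup>2 \<le> M" for k
    proof -
      have "(\<Sum>k\<in>{k}. ennreal (4^k * (f (Suc k) x - f k x)\<^sup>2)) \<le> ?S"
        by (rule sum_le_suminf) (rule summableI, rule finite.intros, rule finite.intros, rule zero_le)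
      then have "ennreal (4^k * (f (Suc k) x - f k x)\<^sup>2) \<le> ?S"
        by (simp only: sum.insert finite.intros empty_iff not_False_eq_True sum.empty add_0_right)
      also have "\<dots> = ennreal M" unfolding M_def using elim by (intro ennreal_enn2real[symmetric]) (simp only: less_top infinity_ennreal_def)
      finally show ?thesis
        by (rule ennreal_le_iff[THEN iffD1, rotated]) (simp only: M_def enn2real_nonneg)
    qed
    have M: "0 \<le> M" unfolding M_def by (rule enn2real_nonneg)
    have b: "\<bar>f (Suc k) x - f k x\<bar> \<le> sqrt M * (1/2)^k" for k
    proof (rule power2_le_imp_le)
      have "(1/4)^k * (4^k * (f (Suc k) x - f k x)\<^sup>2) \<le> (1/4)^k * M"
        by (intro mult_left_mono le) auto
      also have "(1/4)^k * (4^k * (f (Suc k) x - f k x)\<^sup>2) = (f (Suc k) x - f k x)\<^sup>2"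
        unfolding mult.assoc[symmetric] power_mult_distrib[symmetric] by simp
      finally have "(f (Suc k) x - f k x)\<^sup>2 \<le> (1/4)^k * M" .
      moreover have "((1/2::real)^k)\<^sup>2 = (1/4)^k"
        unfolding power2_eq_square power_mult_distrib[symmetric] by simp
      ultimately show "\<bar>f (Suc k) x - f k x\<bar>\<^sup>2 \<le> (sqrt M * (1/2)^k)\<^sup>2"
        using M by (simp add: power_mult_distrib mult.commute)
    qed (use M in auto)
    have "summable (\<lambda>k. sqrt M * (1/2)^k)"
      by (rule summable_mult, rule summable_geometric) simp
    then have "summable (\<lambda>k. f (Suc k) x - f k x)"
      by (rule summable_comparison_test'[where N = 0]) (simp only: real_norm_def b)
    then have "convergent (\<lambda>n. \<Sum>k<n. f (Suc k) x - f k x)"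
      by (simp add: summable_iff_convergent)
    then have "convergent (\<lambda>n. (\<Sum>k<n. f (Suc k) x - f k x) + f 0 x)"
      by (intro convergent_add convergent_const)
    moreover have "(\<Sum>k<n. f (Suc k) x - f k x) + f 0 x = f n x" for n
      using sum_lessThan_telescope[of "\<lambda>k. f k x" n] by simp
    ultimately show "convergent (\<lambda>k. f k x)"
      by (simp only:)
  qed
qed

instance L2 :: (euclidean_space) complete_space
proof
  fix X :: "nat \<Rightarrow> 'a L2" assume X: "Cauchy X"
  have "\<exists>r. \<forall>k. strict_mono r \<and> (\<forall>m\<ge>r k. \<forall>n\<ge>r k. norm (X m - X n) < sqrt ((1/8)^k))"
  proof -
    have ex: "\<exists>N>M. \<forall>m\<ge>N. \<forall>n\<ge>N. norm (X m - X n) < sqrt ((1/8)^k)" for M k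
    proof -
      obtain N where "\<forall>m\<ge>N. \<forall>n\<ge>N. norm (X m - X n) < sqrt ((1/8)^k)"
        using CauchyD[OF X, of "sqrt ((1/8)^k)"] by auto
      then show ?thesis by (intro exI[of _ "max N (Suc M)"]) auto
    qed
    have "\<exists>r. \<forall>k. (\<forall>m\<ge>r k. \<forall>n\<ge>r k. norm (X m - X n) < sqrt ((1/8)^k)) \<and> r k < r (Suc k)"
      by (rule dependent_nat_choice) (use ex in blast)+
    then show ?thesis by (auto simp: strict_mono_Suc_iff)
  qed
  then obtain r where r: "strict_mono r"
    and rX: "\<And>k m n. m \<ge> r k \<Longrightarrow> n \<ge> r k \<Longrightarrow> norm (X m - X n) < sqrt ((1/8)^k)"
    by blast
  have mono: "r k \<le> r m" if "k \<le> m" for k m using r that by (simp add: strict_mono_less_eq)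
  define f where "f k = rep_L2 (X (r k))" for k
  have f: "sq_integrable (f k)" for k by (simp add: f_def sq_integrable_rep_L2)
  have tf: "to_L2 (f k) = X (r k)" for k by (simp add: f_def)
  have [measurable]: "f k \<in> borel_measurable borel" for k by (rule sq_integrable_meas[OF f])
  have bd: "(norm (to_L2 (f m) - to_L2 (f k)))\<^sup>2 \<le> (1/8)^k" if "k \<le> m" for k m
  proof -
    have "norm (X (r m) - X (r k)) \<le> sqrt ((1/8)^k)"
      using rX[of k "r m" "r k"] mono[OF that] by auto
    then have "(norm (X (r m) - X (r k)))\<^sup>2 \<le> (sqrt ((1/8)^k))\<^sup>2"
      by (intro power_mono) auto
    then show ?thesis by (simp add: tf)
  qed
  define g where "g x = lim (\<lambda>k. f k x)" for x
  have [measurable]: "g \<in> borel_measurable borel"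
    unfolding g_def by measurable
  have conv: "AE x in lborel. (\<lambda>k. f k x) \<longlonglongrightarrow> g x"
    using summable_subseq_L2[of f] f bd[OF le_SucI[OF order_refl]]
    by (auto simp: convergent_LIMSEQ_iff g_def)
  have fat: "(\<integral>\<^sup>+x. ennreal ((g x - f k x)\<^sup>2) \<partial>lborel) \<le> ennreal ((1/8)^k)" for k
  proof -
    have "(\<integral>\<^sup>+x. ennreal ((g x - f k x)\<^sup>2) \<partial>lborel)
        = (\<integral>\<^sup>+x. liminf (\<lambda>m. ennreal ((f m x - f k x)\<^sup>2)) \<partial>lborel)"
    proof (rule nn_integral_cong_AE)
      show "AE x in lborel. ennreal ((g x - f k x)\<^sup>2) = liminf (\<lambda>m. ennreal ((f m x - f k x)\<^sup>2))"
        using conv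
      proof eventually_elim
        case (elim x)
        have "(\<lambda>m. ennreal ((f m x - f k x)\<^sup>2)) \<longlonglongrightarrow> ennreal ((g x - f k x)\<^sup>2)"
          by (intro tendsto_ennrealI tendsto_intros elim)
        then show ?case by (intro lim_imp_Liminf[symmetric]) auto
      qed
    qed
    also have "\<dots> \<le> liminf (\<lambda>m. \<integral>\<^sup>+x. ennreal ((f m x - f k x)\<^sup>2) \<partial>lborel)"
      by (rule nn_integral_liminf) simp
    also have "\<dots> \<le> liminf (\<lambda>m. ennreal ((1/8)^k))"
    proof (rule Liminf_mono)
      show "\<forall>\<^sub>F m in sequentially. (\<integral>\<^sup>+x. ennreal ((f m x - f k x)\<^sup>2) \<partial>lborel) \<le> ennreal ((1/8)^k)"
        using eventually_ge_at_top[of k]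
        by eventually_elim
           (auto simp: nn_norm_to_L2 sq_integrable_diff f to_L2_diff intro!: ennreal_leI bd)
    qed
    also have "\<dots> = ennreal ((1/8)^k)" by (simp add: Liminf_const)
    finally show ?thesis .
  qed
  have gd: "sq_integrable (\<lambda>x. g x - f k x)" for k
  proof (rule sq_integrable_nn)
    show "(\<integral>\<^sup>+x. ennreal ((g x - f k x)\<^sup>2) \<partial>lborel) < \<infinity>"
      by (rule le_less_trans[OF fat]) simp
  qed simp
  have g: "sq_integrable g" using sq_integrable_add[OF gd f, of 0 0] by simp
  have nb: "(norm (to_L2 g - X (r k)))\<^sup>2 \<le> (1/8)^k" for k
    using fat[of k] by (simp add: nn_norm_to_L2 gd to_L2_diff g f tf)
  have "(\<lambda>k. X (r k)) \<longlonglongrightarrow> to_L2 g"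
  proof (rule LIM_zero_cancel, rule tendsto_norm_zero_cancel)
    have "(\<lambda>k. (norm (X (r k) - to_L2 g))\<^sup>2) \<longlonglongrightarrow> 0"
      by (rule Lim_null_comparison[of _ "\<lambda>k. (1/8)^k"])
         (use nb in \<open>auto simp: norm_minus_commute intro!: LIMSEQ_power_zero\<close>)
    then have "(\<lambda>k. sqrt ((norm (X (r k) - to_L2 g))\<^sup>2)) \<longlonglongrightarrow> sqrt 0"
      by (rule tendsto_real_sqrt)
    then show "(\<lambda>k. norm (X (r k) - to_L2 g)) \<longlonglongrightarrow> 0" by simp
  qed
  then have "X \<longlonglongrightarrow> to_L2 g"
    using Cauchy_converges_subseq[OF X r, of "to_L2 g"] by (simp add: o_def)
  then show "convergent X" by (auto simp: convergent_def)
qed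

instance L2 :: (euclidean_space) banach ..


lemma to_L2_dominated_convergence:
  assumes f: "sq_integrable f" and [measurable]: "\<And>i. s i \<in> borel_measurable borel"
    and bd: "\<And>i x. \<bar>s i x\<bar> \<le> C * \<bar>f x\<bar>" and lim: "\<And>x. (\<lambda>i. s i x) \<longlonglongrightarrow> f x"
  shows "(\<lambda>i. to_L2 (s i)) \<longlonglongrightarrow> to_L2 f"
proof -
  have [measurable]: "f \<in> borel_measurable borel" using f by (rule sq_integrable_meas)
  have s: "sq_integrable (s i)" for i
    by (rule sq_integrable_dominated[OF f]) (use bd in auto)
  have "(\<lambda>i. LINT x|lborel. (s i x - f x)\<^sup>2) \<longlonglongrightarrow> (LINT x|(lborel :: 'a measure). 0)"
  proof (rule integral_dominated_convergence)
    show "integrable lborel (\<lambda>x. (C + 1)\<^sup>2 * (f x)\<^sup>2)"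
      using f by (simp add: sq_integrable_def)
    show "AE x in lborel. (\<lambda>i. (s i x - f x)\<^sup>2) \<longlonglongrightarrow> 0"
    proof (rule AE_I2)
      fix x
      have "(\<lambda>i. (s i x - f x)\<^sup>2) \<longlonglongrightarrow> (f x - f x)\<^sup>2"
        by (intro tendsto_intros lim)
      then show "(\<lambda>i. (s i x - f x)\<^sup>2) \<longlonglongrightarrow> 0" by simp
    qed
    show "AE x in lborel. norm ((s i x - f x)\<^sup>2) \<le> (C + 1)\<^sup>2 * (f x)\<^sup>2" for i
    proof (rule AE_I2)
      fix x
      have "\<bar>s i x - f x\<bar> \<le> (C + 1) * \<bar>f x\<bar>"
        using bd[of i x] by (simp add: distrib_right)
      then have "\<bar>s i x - f x\<bar>\<^sup>2 \<le> ((C + 1) * \<bar>f x\<bar>)\<^sup>2" by (intro power_mono) auto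
      then show "norm ((s i x - f x)\<^sup>2) \<le> (C + 1)\<^sup>2 * (f x)\<^sup>2"
        by (simp add: power_mult_distrib)
    qed
  qed measurable
  moreover have "(norm (to_L2 (s i) - to_L2 f))\<^sup>2 = (LINT x|lborel. (s i x - f x)\<^sup>2)" for i
    by (simp only: to_L2_diff[symmetric] s f norm_to_L2 sq_integrable_diff)
  ultimately have "(\<lambda>i. (norm (to_L2 (s i) - to_L2 f))\<^sup>2) \<longlonglongrightarrow> 0" by simp
  then have "(\<lambda>i. sqrt ((norm (to_L2 (s i) - to_L2 f))\<^sup>2)) \<longlonglongrightarrow> sqrt 0"
    by (rule tendsto_real_sqrt)
  then have "(\<lambda>i. norm (to_L2 (s i) - to_L2 f)) \<longlonglongrightarrow> 0" by simp
  then show ?thesis by (rule LIM_zero_cancel[OF tendsto_norm_zero_cancel])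
qed

lemma sq_integrable_indicator:
  fixes A :: "'a::euclidean_space set"
  assumes "A \<in> sets borel"
  shows "sq_integrable (indicator (A \<inter> ball 0 r) :: 'a \<Rightarrow> real)"
proof -
  have e: "(indicator (A \<inter> ball 0 r) x :: real)\<^sup>2 = indicator (A \<inter> ball 0 r) x" for x
    by (cases "x \<in> A \<inter> ball 0 r") (simp_all only: indicator_simps, simp_all)
  have "emeasure lborel (A \<inter> ball 0 r) \<le> emeasure lborel (ball (0 :: 'a) r)"
    by (rule emeasure_mono) (use assms in auto)
  also have "\<dots> < \<infinity>" by (rule emeasure_lborel_ball_finite)
  finally show ?thesis
    unfolding sq_integrable_def e using assms by (auto intro!: integrable_real_indicator borel_measurable_indicator)
qed

text \<open>Rational combinations of indicators of countably many bounded sets are dense.\<close>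

lemma countable_dense_L2: "\<exists>D :: 'a::euclidean_space L2 set. countable D \<and> closure D = UNIV"
proof -
  obtain B :: "'a set set" where B: "countable B" "topological_basis B"
    using ex_countable_basis by blast
  define G where "G = Inter ` {F. finite F \<and> F \<subseteq> B}"
  have cG: "countable G" unfolding G_def
    by (intro countable_image countable_Collect_finite_subset B)
  have Gopen: "open A" if "A \<in> G" for A
    using that B(2) unfolding G_def by (auto intro!: open_Inter simp: topological_basis_open)
  have GInt: "Int_stable G"
  proof (rule Int_stableI)
    fix a b assume "a \<in> G" "b \<in> G"
    then obtain F F' where F: "finite F" "F \<subseteq> B" "a = \<Inter>F" "finite F'" "F' \<subseteq> B" "b = \<Inter>F'"
      unfolding G_def by auto
    then have "a \<inter> b = \<Inter>(F \<union> F')" "finite (F \<union> F')" "F \<union> F' \<subseteq> B" by auto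
    then show "a \<inter> b \<in> G" unfolding G_def by blast
  qed
  have BG: "B \<subseteq> G"
  proof
    fix b assume "b \<in> B"
    then show "b \<in> G" unfolding G_def by (intro image_eqI[of _ _ "{b}"]) auto
  qed
  have UG: "UNIV \<in> G" unfolding G_def by (intro image_eqI[of _ _ "{}"]) auto
  have bor: "sets borel = sigma_sets UNIV G"
  proof
    have "sets borel = sigma_sets UNIV B"
      by (subst borel_eq_countable_basis[OF B]) (rule sets_measure_of, simp)
    then show "sets borel \<subseteq> sigma_sets UNIV G"
      using sigma_sets_mono'[OF BG, of UNIV] by simp
    show "sigma_sets UNIV G \<subseteq> sets borel"
    proof -
      have "G \<subseteq> sets borel" using Gopen by (auto intro!: borel_open)
      then show ?thesis using sets.sigma_sets_subset[of G borel] by simp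
    qed
  qed
  define E where "E = (\<lambda>(A, n::nat). to_L2 (indicator (A \<inter> ball 0 (real n)))) ` (G \<times> UNIV)"
  define D where "D = (\<lambda>xs. \<Sum>(q, e)\<leftarrow>xs. q *\<^sub>R e) ` lists (\<rat> \<times> E)"
  have "countable E" unfolding E_def by (intro countable_image countable_SIGMA cG) auto
  then have cD: "countable D" unfolding D_def
    by (intro countable_image countable_lists countable_SIGMA countable_rat) auto
  have ED: "E \<subseteq> D"
  proof
    fix e assume "e \<in> E"
    then show "e \<in> D" unfolding D_def by (intro image_eqI[of _ _ "[(1, e)]"]) auto
  qed
  have D0: "0 \<in> D" unfolding D_def by (intro image_eqI[of _ _ "[]"]) auto
  have Dadd: "a + b \<in> D" if "a \<in> D" "b \<in> D" for a b
  proof -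
    from that obtain xs ys where "xs \<in> lists (\<rat> \<times> E)" "ys \<in> lists (\<rat> \<times> E)"
      "a = (\<Sum>(q, e)\<leftarrow>xs. q *\<^sub>R e)" "b = (\<Sum>(q, e)\<leftarrow>ys. q *\<^sub>R e)"
      unfolding D_def by auto
    then show ?thesis unfolding D_def by (intro image_eqI[of _ _ "xs @ ys"]) auto
  qed
  have Dscale: "c *\<^sub>R a \<in> D" if c: "c \<in> \<rat>" and a: "a \<in> D" for c a
  proof -
    have "xs \<in> lists (\<rat> \<times> E) \<Longrightarrow>
       c *\<^sub>R (\<Sum>(q, e)\<leftarrow>xs. q *\<^sub>R e) = (\<Sum>(q, e)\<leftarrow>map (\<lambda>(q, e). (c * q, e)) xs. q *\<^sub>R e)
       \<and> map (\<lambda>(q, e). (c * q, e)) xs \<in> lists (\<rat> \<times> E)" for xs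
      by (induction xs) (use c in \<open>auto simp: scaleR_add_right\<close>)
    then show ?thesis using a unfolding D_def by blast
  qed
  define S where "S = closure D"
  have S0: "0 \<in> S" using D0 closure_subset unfolding S_def by blast
  have Sadd: "a + b \<in> S" if "a \<in> S" "b \<in> S" for a b
  proof -
    from that obtain x y where "\<And>n. x n \<in> D" "x \<longlonglongrightarrow> a" "\<And>n. y n \<in> D" "y \<longlonglongrightarrow> b"
      unfolding S_def closure_sequential by blast
    then show ?thesis unfolding S_def closure_sequential
      by (intro exI[of _ "\<lambda>n. x n + y n"]) (auto intro: Dadd tendsto_add)
  qed
  have Sscale: "c *\<^sub>R a \<in> S" if "a \<in> S" for c a
  proof -
    from that obtain x where x: "\<And>n. x n \<in> D" "x \<longlonglongrightarrow> a"
      unfolding S_def closure_sequential by blast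
    have "c \<in> closure \<rat>" by (simp add: Rats_closure_real)
    then obtain q where q: "\<And>n. q n \<in> \<rat>" "q \<longlonglongrightarrow> c"
      unfolding closure_sequential by blast
    show ?thesis unfolding S_def closure_sequential
      using x q by (intro exI[of _ "\<lambda>n. q n *\<^sub>R x n"]) (auto intro: Dscale tendsto_scaleR)
  qed
  have Sdiff: "a - b \<in> S" if "a \<in> S" "b \<in> S" for a b
    using Sadd[OF that(1) Sscale[OF that(2), of "-1"]] by simp
  have Ssum: "(\<Sum>i\<in>I. a i) \<in> S" if "\<And>i. i \<in> I \<Longrightarrow> a i \<in> S" for I and a :: "real \<Rightarrow> 'a L2"
    using that by (induction I rule: infinite_finite_induct) (auto intro: S0 Sadd)
  have Slim: "l \<in> S" if "\<And>n. x n \<in> S" "x \<longlonglongrightarrow> l" for x :: "nat \<Rightarrow> 'a L2" and l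
    using that closed_sequentially[of S x l] unfolding S_def by auto
  let ?i = "\<lambda>A n x. indicator (A \<inter> ball 0 (real n)) x :: real"
  have SG: "to_L2 (?i A n) \<in> S" if "A \<in> G" for A n
    using that ED closure_subset[of D] unfolding S_def E_def by fastforce
  have SB: "to_L2 (?i A n) \<in> S" if "A \<in> sets borel" for A :: "'a set" and n
  proof -
    have "A \<in> sigma_sets UNIV G" using that bor by simp
    with GInt subset_UNIV[of "G", folded Pow_UNIV] show ?thesis
    proof (induction A rule: sigma_sets_induct_disjoint)
      case (basic A) then show ?case by (rule SG)
    next
      case empty
      have "?i {} n = (\<lambda>x. 0)" by auto
      then show ?case using S0 by (simp add: to_L2_0)
    next
      case (compl A)
      have A: "A \<in> sets borel" using compl bor by simp
      have "?i (UNIV - A) n = (\<lambda>x. ?i UNIV n x - ?i A n x)"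
        by (auto simp: indicator_def fun_eq_iff)
      moreover have "to_L2 (\<lambda>x. ?i UNIV n x - ?i A n x) = to_L2 (?i UNIV n) - to_L2 (?i A n)"
        by (rule to_L2_diff; rule sq_integrable_indicator) (use A in auto)
      ultimately show ?case using Sdiff[OF SG[OF UG, of n] compl(2)] by simp
    next
      case (union A)
      have A [measurable]: "A k \<in> sets borel" for k using union bor by auto
      define U where "U k = (\<Union>j<k. A j)" for k
      have [measurable]: "U k \<in> sets borel" for k unfolding U_def by auto
      have "to_L2 (?i (U k) n) \<in> S" for k
      proof (induction k)
        case 0
        have "?i (U 0) n = (\<lambda>x. 0)" by (auto simp: U_def)
        then show ?case using S0 by (simp add: to_L2_0)
      next
        case (Suc k)
        have "A j \<inter> A k = {}" if "j < k" for j
          using disjoint_family_onD[OF union(1), of j k] that by simp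
        then have disj: "U k \<inter> A k = {}" unfolding U_def by blast
        have "?i (U (Suc k)) n = (\<lambda>x. ?i (U k) n x + ?i (A k) n x)"
        proof
          fix x
          have "U (Suc k) = U k \<union> A k" by (auto simp: U_def lessThan_Suc)
          then show "?i (U (Suc k)) n x = ?i (U k) n x + ?i (A k) n x"
            using disj by (auto simp: indicator_def)
        qed
        moreover have "to_L2 (\<lambda>x. ?i (U k) n x + ?i (A k) n x) = to_L2 (?i (U k) n) + to_L2 (?i (A k) n)"
          by (rule to_L2_add; rule sq_integrable_indicator) auto
        ultimately show ?case using Sadd[OF Suc union(3)[of k]] by simp
      qed
      moreover have "(\<lambda>k. to_L2 (?i (U k) n)) \<longlonglongrightarrow> to_L2 (?i (\<Union>k. A k) n)"
      proof (rule to_L2_dominated_convergence[where C = 1])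
        show "sq_integrable (?i (\<Union>k. A k) n)"
          by (rule sq_integrable_indicator) auto
        show "?i (U k) n \<in> borel_measurable borel" for k
          by (rule sq_integrable_meas, rule sq_integrable_indicator) measurable
        show "\<bar>?i (U k) n x\<bar> \<le> 1 * \<bar>?i (\<Union>k. A k) n x\<bar>" for k x
          by (auto simp: indicator_def U_def)
        show "(\<lambda>k. ?i (U k) n x) \<longlonglongrightarrow> ?i (\<Union>k. A k) n x" for x
        proof (cases "x \<in> (\<Union>k. A k)")
          case True
          then obtain j where "x \<in> A j" by auto
          then have "\<forall>\<^sub>F k in sequentially. ?i (U k) n x = ?i (\<Union>k. A k) n x"
            by (intro eventually_mono[OF eventually_gt_at_top[of j]])
               (auto simp: indicator_def U_def)
          then show ?thesis by (rule tendsto_eventually)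
        next
          case False
          then show ?thesis by (auto simp: indicator_def U_def)
        qed
      qed
      ultimately show ?case by (rule Slim)
    qed
  qed
  have "u \<in> S" for u :: "'a L2"
  proof -
    define f where "f = rep_L2 u"
    have f: "sq_integrable f" and u: "u = to_L2 f"
      by (simp_all add: f_def sq_integrable_rep_L2)
    have [measurable]: "f \<in> borel_measurable borel" using f by (rule sq_integrable_meas)
    obtain s where s: "\<And>i. simple_function borel (s i)" "\<And>x. (\<lambda>i. s i x) \<longlonglongrightarrow> f x"
      and sb: "\<And>i x. dist (s i x) 0 \<le> 2 * dist (f x) 0"
      using borel_measurable_implies_sequence_metric[of f borel 0] by auto
    have [measurable]: "s i \<in> borel_measurable borel" for i
      using s(1) by (rule borel_measurable_simple_function)
    define h where "h i x = ?i UNIV i x * s i x" for i x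
    have "to_L2 (h i) \<in> S" for i
    proof -
      have fin: "finite (range (s i))"
        using s(1)[of i] by (simp add: simple_function_def)
      have m: "s i -` {y} \<in> sets borel" for y
        using measurable_sets[of "s i" borel borel "{y}"] by simp
      have "h i = (\<lambda>x. \<Sum>y\<in>range (s i). y * ?i (s i -` {y}) i x)"
      proof
        fix x
        have "(\<Sum>y\<in>range (s i). y * ?i (s i -` {y}) i x)
            = (\<Sum>y\<in>{s i x}. y * ?i (s i -` {y}) i x)"
          by (rule sum.mono_neutral_right) (use fin in \<open>auto simp: indicator_def\<close>)
        then show "h i x = (\<Sum>y\<in>range (s i). y * ?i (s i -` {y}) i x)"
          by (simp add: h_def indicator_def)
      qed
      moreover have "sq_integrable (\<lambda>x. \<Sum>y\<in>I. y * ?i (s i -` {y}) i x) \<and>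
          to_L2 (\<lambda>x. \<Sum>y\<in>I. y * ?i (s i -` {y}) i x) \<in> S" if "finite I" for I
        using that
      proof induction
        case empty
        then show ?case using S0 by (simp add: to_L2_0 sq_integrable_0)
      next
        case (insert y I)
        have q: "sq_integrable (\<lambda>x. y * ?i (s i -` {y}) i x)"
          by (rule sq_integrable_scale, rule sq_integrable_indicator, rule m)
        have "to_L2 (\<lambda>x. y * ?i (s i -` {y}) i x) = y *\<^sub>R to_L2 (?i (s i -` {y}) i)"
          by (rule to_L2_scale, rule sq_integrable_indicator, rule m)
        then have "to_L2 (\<lambda>x. y * ?i (s i -` {y}) i x) \<in> S"
          by (simp add: Sscale SB m)
        with insert.IH q show ?case
          unfolding sum.insert[OF insert.hyps]
          by (simp only: sq_integrable_add to_L2_add Sadd simp_thms)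
      qed
      ultimately show ?thesis using fin by simp
    qed
    moreover have "(\<lambda>i. to_L2 (h i)) \<longlonglongrightarrow> to_L2 f"
    proof (rule to_L2_dominated_convergence[where C = 2, OF f])
      show "h i \<in> borel_measurable borel" for i
        unfolding h_def
        by (intro borel_measurable_times sq_integrable_meas[OF sq_integrable_indicator]) auto
      show "\<bar>h i x\<bar> \<le> 2 * \<bar>f x\<bar>" for i x
        using sb[of i x] by (auto simp: h_def indicator_def)
      show "(\<lambda>i. h i x) \<longlonglongrightarrow> f x" for x
      proof -
        obtain N :: nat where "norm x < real N" using reals_Archimedean2 by blast
        then have "\<forall>\<^sub>F i in sequentially. h i x = s i x"
          by (intro eventually_mono[OF eventually_ge_at_top[of N]])
             (auto simp: h_def indicator_def)
        then show ?thesis using s(2)[of x] by (simp add: tendsto_cong)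
      qed
    qed
    ultimately show ?thesis unfolding u by (rule Slim)
  qed
  then show ?thesis using cD unfolding S_def by blast
qed

instance L2 :: (euclidean_space) second_countable_topology
proof
  obtain D :: "'a L2 set" where D: "countable D" "closure D = UNIV"
    using countable_dense_L2 by blast
  define B where "B = (\<lambda>(d, n::nat). ball d (1 / Suc n)) ` (D \<times> UNIV)"
  have "topological_basis B"
  proof (rule topological_basisI)
    show "open b" if "b \<in> B" for b using that by (auto simp: B_def)
    fix O' and x :: "'a L2" assume O': "open O'" "x \<in> O'"
    then obtain e where e: "0 < e" "ball x e \<subseteq> O'" by (auto simp: open_contains_ball)
    obtain n where n: "1 / Suc n < e / 2"
      using nat_approx_posE[of "e/2"] e(1) by auto
    have "x \<in> closure D" using D by simp
    moreover have "0 < 1 / real (Suc n)" by simp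
    ultimately obtain d where d: "d \<in> D" "dist d x < 1 / Suc n"
      unfolding closure_approachable by blast
    show "\<exists>B'\<in>B. x \<in> B' \<and> B' \<subseteq> O'"
    proof (intro bexI[of _ "ball d (1 / Suc n)"] conjI)
      show "x \<in> ball d (1 / Suc n)" using d by simp
      show "ball d (1 / Suc n) \<subseteq> O'"
      proof
        fix y assume "y \<in> ball d (1 / Suc n)"
        then have "dist x y < e"
          using d n dist_triangle[of x y d] by (auto simp: dist_commute)
        then show "y \<in> O'" using e by auto
      qed
      show "ball d (1 / Suc n) \<in> B" using d by (auto simp: B_def)
    qed
  qed
  then have "open = generate_topology B" by (rule topological_basis_imp_subbasis)
  moreover have "countable B" unfolding B_def by (intro countable_image countable_SIGMA D) auto
  ultimately show "\<exists>B :: 'a L2 set set. countable B \<and> open = generate_topology B" by blast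
qed


section \<open>Test functions\<close>

text \<open>Iterated partial derivatives; the direction at the head of the list is applied last.\<close>

primrec iter_pd :: "'a::euclidean_space list \<Rightarrow> ('a \<Rightarrow> real) \<Rightarrow> 'a \<Rightarrow> real" where
  "iter_pd [] f = f"
| "iter_pd (b # bs) f = (\<lambda>x. frechet_derivative (iter_pd bs f) (at x) b)"

definition smooth :: "('a::euclidean_space \<Rightarrow> real) \<Rightarrow> bool" where
  "smooth f \<longleftrightarrow> (\<forall>bs\<in>lists Basis. \<forall>x. iter_pd bs f differentiable (at x))"

definition test_fun_on :: "'a::euclidean_space set \<Rightarrow> ('a \<Rightarrow> real) \<Rightarrow> bool" where
  "test_fun_on U \<phi> \<longleftrightarrow> smooth \<phi> \<and> (\<exists>K. compact K \<and> K \<subseteq> U \<and> (\<forall>x. x \<notin> K \<longrightarrow> \<phi> x = 0))"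

text \<open>Convergence in the space of test functions on the whole space: supports in a common compact
  set, and uniform convergence of all derivatives. A linear map from the space of test functions to
  a Banach space is continuous if and only if it is sequentially continuous for this convergence.\<close>

definition test_conv :: "(nat \<Rightarrow> 'a::euclidean_space \<Rightarrow> real) \<Rightarrow> ('a \<Rightarrow> real) \<Rightarrow> bool" where
  "test_conv \<phi>s \<phi> \<longleftrightarrow>
     (\<forall>k. test_fun_on UNIV (\<phi>s k)) \<and> test_fun_on UNIV \<phi> \<and>
     (\<exists>K. compact K \<and> (\<forall>k x. x \<notin> K \<longrightarrow> \<phi>s k x = 0)) \<and>
     (\<forall>bs\<in>lists Basis. uniform_limit UNIV (\<lambda>k. iter_pd bs (\<phi>s k)) (iter_pd bs \<phi>) sequentially)"


section \<open>Admissible potentials\<close>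

definition weak_conv :: "(nat \<Rightarrow> 'b::real_normed_vector) \<Rightarrow> 'b \<Rightarrow> bool" where
  "weak_conv x l \<longleftrightarrow> (\<forall>\<Lambda> :: 'b \<Rightarrow>\<^sub>L real. (\<lambda>k. blinfun_apply \<Lambda> (x k)) \<longlonglongrightarrow> blinfun_apply \<Lambda> l)"

text \<open>The space \<open>W\<close> is a Banach space type together with the inclusion map \<open>J\<close> into \<open>L2\<close>, so its
  dual is the type \<open>'w \<Rightarrow>\<^sub>L real\<close> with the operator norm. The inclusion of the test functions
  sends \<open>\<phi>\<close> to the unique \<open>v\<close> such that \<open>J v\<close> is the class of \<open>\<phi>\<close>.\<close>

definition admissible_space :: "('w::banach \<Rightarrow> 'a::euclidean_space L2) \<Rightarrow> bool" where
  "admissible_space J \<longleftrightarrow>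
     bounded_linear J \<and> inj J \<and> closure (range J) = UNIV \<and>
     (\<forall>\<phi>. test_fun_on UNIV \<phi> \<longrightarrow> to_L2 \<phi> \<in> range J) \<and>
     closure {v. \<exists>\<phi>. test_fun_on UNIV \<phi> \<and> J v = to_L2 \<phi>} = UNIV \<and>
     (\<forall>\<phi>s \<phi>. test_conv \<phi>s \<phi> \<longrightarrow> (\<lambda>k. inv J (to_L2 (\<phi>s k))) \<longlonglongrightarrow> inv J (to_L2 \<phi>))"

definition gateaux_gradient ::
    "('w::real_normed_vector \<Rightarrow> real) \<Rightarrow> ('w \<Rightarrow> ('w \<Rightarrow>\<^sub>L real)) \<Rightarrow> bool" where
  "gateaux_gradient f G \<longleftrightarrow>
     (\<forall>v h. ((\<lambda>s. f (v + s *\<^sub>R h)) has_real_derivative blinfun_apply (G v) h) (at 0))"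

definition admissible_potential ::
    "('w::banach \<Rightarrow> 'a::euclidean_space L2) \<Rightarrow> ('a L2 \<Rightarrow> ennreal) \<Rightarrow> bool" where
  "admissible_potential J \<W> \<longleftrightarrow>
     (\<forall>vs v. weak_conv vs v \<longrightarrow> \<W> v \<le> liminf (\<lambda>k. \<W> (vs k))) \<and>
     admissible_space J \<and> (\<forall>v. \<W> v < \<infinity> \<longleftrightarrow> v \<in> range J) \<and>
     (\<exists>G C \<theta>. gateaux_gradient (\<lambda>v. enn2real (\<W> (J v))) G \<and> 0 \<le> C \<and> 0 < \<theta> \<and> \<theta> < 1 \<and>
        (\<forall>v. norm (G v) \<le> C * (1 + enn2real (\<W> (J v)) powr \<theta>)))"

text \<open>An element of \<open>L2\<close>, regarded as an element of the dual of \<open>W\<close>.\<close>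

definition to_dual :: "('w::real_normed_vector \<Rightarrow> 'a::euclidean_space L2) \<Rightarrow> 'a L2 \<Rightarrow> ('w \<Rightarrow>\<^sub>L real)" where
  "to_dual J u = Blinfun (\<lambda>v. inner u (J v))"


section \<open>Vector valued Sobolev spaces in time\<close>

text \<open>Below \<open>I\<close> is an open set of times. Functions are defined on all of \<open>real\<close>, but only their
  restrictions to \<open>I\<close> matter.\<close>

definition L2_on :: "real set \<Rightarrow> (real \<Rightarrow> 'b::{banach, second_countable_topology}) \<Rightarrow> bool" where
  "L2_on I u \<longleftrightarrow> set_borel_measurable lborel I u \<and> (\<integral>\<^sup>+t\<in>I. ennreal ((norm (u t))\<^sup>2) \<partial>lborel) < \<infinity>"

definition Linf_on :: "real set \<Rightarrow> (real \<Rightarrow> 'b::{banach, second_countable_topology}) \<Rightarrow> bool" where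
  "Linf_on I u \<longleftrightarrow> set_borel_measurable lborel I u \<and> (\<exists>C. AE t in lborel. t \<in> I \<longrightarrow> norm (u t) \<le> C)"

definition loc_integrable_on :: "real set \<Rightarrow> (real \<Rightarrow> 'b::{banach, second_countable_topology}) \<Rightarrow> bool" where
  "loc_integrable_on I u \<longleftrightarrow> (\<forall>K. compact K \<and> K \<subseteq> I \<longrightarrow> set_integrable lborel K u)"

definition weak_deriv_on ::
    "real set \<Rightarrow> (real \<Rightarrow> 'b::{banach, second_countable_topology}) \<Rightarrow> (real \<Rightarrow> 'b) \<Rightarrow> bool" where
  "weak_deriv_on I u v \<longleftrightarrow> loc_integrable_on I u \<and> loc_integrable_on I v \<and>
     (\<forall>\<phi>. test_fun_on I \<phi> \<longrightarrow>
        (LINT t:I|lborel. deriv \<phi> t *\<^sub>R u t) = - (LINT t:I|lborel. \<phi> t *\<^sub>R v t))"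

text \<open>A weak derivative is unique almost everywhere. If it has a representative that is continuous
  up to the boundary of \<open>I\<close>, then such a representative is selected, so that pointwise values
  (in particular at time \<open>0\<close>) make sense.\<close>

definition wderiv :: "real set \<Rightarrow> (real \<Rightarrow> 'b::{banach, second_countable_topology}) \<Rightarrow> real \<Rightarrow> 'b" where
  "wderiv I u =
     (if \<exists>v. weak_deriv_on I u v \<and> continuous_on (closure I) v
      then SOME v. weak_deriv_on I u v \<and> continuous_on (closure I) v
      else SOME v. weak_deriv_on I u v)"

definition H1_on :: "real set \<Rightarrow> (real \<Rightarrow> 'b::{banach, second_countable_topology}) \<Rightarrow> bool" where
  "H1_on I u \<longleftrightarrow> L2_on I u \<and> (\<exists>v. weak_deriv_on I u v \<and> L2_on I v)"

definition H2_on :: "real set \<Rightarrow> (real \<Rightarrow> 'b::{banach, second_countable_topology}) \<Rightarrow> bool" where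
  "H2_on I u \<longleftrightarrow> L2_on I u \<and> (\<exists>v. weak_deriv_on I u v \<and> H1_on I v)"

definition H1_loc :: "(real \<Rightarrow> 'b::{banach, second_countable_topology}) \<Rightarrow> bool" where
  "H1_loc u \<longleftrightarrow> (\<forall>T>0. H1_on {0<..<T} u)"

definition H2_loc :: "(real \<Rightarrow> 'b::{banach, second_countable_topology}) \<Rightarrow> bool" where
  "H2_loc u \<longleftrightarrow> (\<forall>T>0. H2_on {0<..<T} u)"

definition H1_norm :: "real set \<Rightarrow> (real \<Rightarrow> 'b::{banach, second_countable_topology}) \<Rightarrow> real" where
  "H1_norm I u =
     sqrt ((LINT t:I|lborel. (norm (u t))\<^sup>2) + (LINT t:I|lborel. (norm (wderiv I u t))\<^sup>2))"

text \<open>Continuous linear functionals on \<open>H1\<close>, as functions of representatives; the bound implies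
  that the value depends only on the class.\<close>

definition H1_functional ::
    "real set \<Rightarrow> ((real \<Rightarrow> 'b::{banach, second_countable_topology}) \<Rightarrow> real) \<Rightarrow> bool" where
  "H1_functional I \<Lambda> \<longleftrightarrow>
     (\<forall>u v. H1_on I u \<and> H1_on I v \<longrightarrow> \<Lambda> (\<lambda>t. u t + v t) = \<Lambda> u + \<Lambda> v) \<and>
     (\<forall>c u. H1_on I u \<longrightarrow> \<Lambda> (\<lambda>t. c *\<^sub>R u t) = c * \<Lambda> u) \<and>
     (\<exists>C. \<forall>u. H1_on I u \<longrightarrow> \<bar>\<Lambda> u\<bar> \<le> C * H1_norm I u)"

definition H1_weak_conv ::
    "real set \<Rightarrow> (nat \<Rightarrow> real \<Rightarrow> 'b::{banach, second_countable_topology}) \<Rightarrow> (real \<Rightarrow> 'b) \<Rightarrow> bool" where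
  "H1_weak_conv I us u \<longleftrightarrow>
     (\<forall>k. H1_on I (us k)) \<and> H1_on I u \<and> (\<forall>\<Lambda>. H1_functional I \<Lambda> \<longrightarrow> (\<lambda>k. \<Lambda> (us k)) \<longlonglongrightarrow> \<Lambda> u)"


section \<open>The minimization problem\<close>

definition weighted_functional ::
    "('a::euclidean_space L2 \<Rightarrow> ennreal) \<Rightarrow> real \<Rightarrow> (real \<Rightarrow> 'a L2) \<Rightarrow> ennreal" where
  "weighted_functional \<W> \<epsilon> w =
     ennreal (\<epsilon>\<^sup>2 / 2) * (\<integral>\<^sup>+t\<in>{0..}. ennreal (exp (- t / \<epsilon>) *
         (norm (wderiv {0<..} (wderiv {0<..} w) t))\<^sup>2) \<partial>lborel)
     + (\<integral>\<^sup>+t\<in>{0..}. ennreal (exp (- t / \<epsilon>)) * \<W> (w t) \<partial>lborel)"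

text \<open>An element of the \<open>H2_loc\<close> class is represented by its continuous representative on
  \<open>[0, \<infinity>)\<close>; its derivative then has a continuous representative there, which is the one that
  \<open>wderiv\<close> selects.\<close>

definition competitor ::
    "('w \<Rightarrow> 'a::euclidean_space L2) \<Rightarrow> 'w \<Rightarrow> 'w \<Rightarrow> (real \<Rightarrow> 'a L2) \<Rightarrow> bool" where
  "competitor J w0 w1 w \<longleftrightarrow>
     H2_loc w \<and> continuous_on {0..} w \<and> w 0 = J w0 \<and> wderiv {0<..} w 0 = J w1"

definition minimizer ::
    "('w \<Rightarrow> 'a::euclidean_space L2) \<Rightarrow> ('a L2 \<Rightarrow> ennreal) \<Rightarrow> 'w \<Rightarrow> 'w \<Rightarrow> real \<Rightarrow> (real \<Rightarrow> 'a L2) \<Rightarrow> bool" where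
  "minimizer J \<W> w0 w1 \<epsilon> w \<longleftrightarrow> competitor J w0 w1 w \<and>
     (\<forall>u. competitor J w0 w1 u \<longrightarrow> weighted_functional \<W> \<epsilon> w \<le> weighted_functional \<W> \<epsilon> u)"


section \<open>Limit functions\<close>

text \<open>As above, the limit is represented by its continuous representative.\<close>

definition weak_limit :: "(nat \<Rightarrow> real \<Rightarrow> 'b::{banach, second_countable_topology}) \<Rightarrow> (real \<Rightarrow> 'b) \<Rightarrow> bool" where
  "weak_limit us w \<longleftrightarrow> continuous_on {0..} w \<and> (\<forall>T>0. H1_weak_conv {0<..<T} us w)"

text \<open>The dual of \<open>W\<close> need not be separable, so bounded measurable functions with values in it are
  understood in the weak-* sense, i.e. as the dual of the space of Bochner integrable functions
  with values in the separable space \<open>W\<close>. For functions with values in \<open>L2\<close> this makes no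
  difference.\<close>

definition dual_Linf_on :: "real set \<Rightarrow> (real \<Rightarrow> ('w::real_normed_vector \<Rightarrow>\<^sub>L real)) \<Rightarrow> bool" where
  "dual_Linf_on I z \<longleftrightarrow> (\<forall>v. set_borel_measurable lborel I (\<lambda>t. blinfun_apply (z t) v)) \<and>
     (\<exists>C. AE t in lborel. t \<in> I \<longrightarrow> norm (z t) \<le> C)"

definition dual_weak_deriv_on ::
    "real set \<Rightarrow> (real \<Rightarrow> ('w::real_normed_vector \<Rightarrow>\<^sub>L real)) \<Rightarrow> (real \<Rightarrow> ('w \<Rightarrow>\<^sub>L real)) \<Rightarrow> bool" where
  "dual_weak_deriv_on I y z \<longleftrightarrow>
     (\<forall>v. weak_deriv_on I (\<lambda>t. blinfun_apply (y t) v) (\<lambda>t. blinfun_apply (z t) v))"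

text \<open>\<open>w'(0) = p\<close> as an equality in the dual of \<open>W\<close>, where \<open>w'\<close> is identified with its Lipschitz
  continuous representative \<open>y\<close> with values in the dual of \<open>W\<close>.\<close>

definition initial_velocity ::
    "('w::real_normed_vector \<Rightarrow> 'a::euclidean_space L2) \<Rightarrow> (real \<Rightarrow> 'a L2) \<Rightarrow> 'a L2 \<Rightarrow> bool" where
  "initial_velocity J w p \<longleftrightarrow>
     (\<exists>y L. L-lipschitz_on {0..} y \<and>
        (AE t in lborel. 0 < t \<longrightarrow> y t = to_dual J (wderiv {0<..} w t)) \<and> y 0 = to_dual J p)"

definition energy :: "('a::euclidean_space L2 \<Rightarrow> ennreal) \<Rightarrow> 'a L2 \<Rightarrow> 'a L2 \<Rightarrow> ennreal" where
  "energy \<W> u v = ennreal ((norm v)\<^sup>2 / 2) + \<W> u"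

end

theory Submission imports Defs "HOL-Complex_Analysis.Great_Picard" "HOL-Probability.Distributions" begin

text \<open>Minimality is only used through comparison with two kinds of competitors. A time change
  \<open>t + \<delta> * gen t\<close> of the minimizer, with a generator adapted to a time \<open>b\<close>, bounds
  \<open>(norm (w' b))\<^sup>2 / 2\<close> plus the average of \<open>\<W> (w t)\<close> against the kernel
  \<open>(t - b) / \<epsilon>\<^sup>2 * exp (- (t - b) / \<epsilon>)\<close> by the initial energy plus \<open>O(\<epsilon>)\<close>. Adding to the acceleration a small
  multiple of a fixed element of \<open>W\<close> on a set of times and shrinking this set bounds the acceleration in
  the dual of \<open>W\<close>; here the growth condition (iii) enters. Both bounds are uniform in \<open>\<epsilon>\<close>, so
  the velocities converge weakly at every time along a subsequence. Since the kernels have mass one and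
  concentrate at \<open>b\<close>, Fatou's lemma turns the first bound into the energy inequality.\<close>

section \<open>Test functions on the real line\<close>

text \<open>Under \<open>t + \<delta> * gen t\<close> the first variation of the potential term
  carries the weight \<open>exp (- t / \<epsilon>) * (gen' - gen / \<epsilon>)\<close>, and the
  cross term of acceleration and velocity carries the derivative of \<open>gen'\<close>; the terms
  with the squared acceleration have a favourable sign. Taking
  \<open>gen' t = exp (t / \<epsilon>)\<close> on \<open>[0, b]\<close> cancels the weight in the
  cross term, which becomes half the increment of the squared velocity; freezing \<open>gen'\<close>
  after \<open>b\<close> removes the cross term there and leaves the kernel in front of
  \<open>\<W>\<close>. The obstacle is the initial velocity, which a time change rescales. It is
  restored by adding a small multiple of \<open>s * w1\<close> at time \<open>s\<close>; the weight
  concentrates on times of order \<open>\<epsilon>\<close> and \<open>w1\<close> lies in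
  \<open>W\<close>, so condition (iii) prices this at \<open>O(\<epsilon>)\<close>. Since
  \<open>\<W>\<close> is not convex in general, convex combinations of paths may not be inserted
  into it: paths converge weakly at each time along a subsequence, and convex combinations are used
  only in linear and quadratic expressions.\<close>

text \<open>A set of functions closed under differentiation consists of smooth functions.\<close>

definition deriv_closed :: "(real \<Rightarrow> real) set \<Rightarrow> bool" where
  "deriv_closed S \<longleftrightarrow> (\<forall>f\<in>S. \<exists>g\<in>S. \<forall>x. (f has_real_derivative g x) (at x))"

text \<open>On the real line \<open>Basis\<close> is \<open>{1}\<close>, so \<open>iter_pd\<close>
  iterates the ordinary derivative, and by induction on the list every iterate stays inside the
  family.\<close>

lemma deriv_closed_smooth:
  assumes "deriv_closed S" "f \<in> S"
  shows "smooth f"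
proof -
  have fd: "(\<lambda>x. frechet_derivative h (at x) 1) = g" if "\<And>x. (h has_real_derivative g x) (at x)" for h g :: "real \<Rightarrow> real"
  proof
    fix x
    have "(h has_derivative (\<lambda>t. g x * t)) (at x)"
      using that[of x] by (simp add: has_field_derivative_def)
    then have "frechet_derivative h (at x) = (\<lambda>t. g x * t)"
      by (rule frechet_derivative_at[symmetric])
    then show "frechet_derivative h (at x) 1 = g x" by simp
  qed
  have "iter_pd bs f \<in> S" if "bs \<in> lists Basis" for bs
    using that
  proof (induction bs)
    case Nil then show ?case using assms by simp
  next
    case (Cons b bs)
    then have b: "b = 1" by simp
    from Cons assms(1) obtain g where g: "g \<in> S" "\<And>x. (iter_pd bs f has_real_derivative g x) (at x)"
      unfolding deriv_closed_def by auto
    have "iter_pd (b # bs) f = g" using fd[OF g(2)] by (simp add: b)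
    then show ?case using g by simp
  qed
  then show ?thesis unfolding smooth_def
    using assms(1) unfolding real_differentiable_def by (meson deriv_closed_def)
qed

text \<open>The iterated derivatives of a smooth function form such a family. With this converse,
  smoothness of a compound function is proved by exhibiting a family that contains it and is
  invariant under differentiation.\<close>

lemma smooth_deriv_closed:
  assumes "smooth f"
  obtains S where "deriv_closed S" "f \<in> S"
proof
  let ?S = "(\<lambda>bs. iter_pd bs f) ` lists {1::real}"
  show "f \<in> ?S" by (intro image_eqI[of _ _ "[]"]) auto
  show "deriv_closed ?S" unfolding deriv_closed_def
  proof
    fix h assume "h \<in> ?S"
    then obtain bs where bs: "bs \<in> lists {1}" "h = iter_pd bs f" by auto
    have d: "h differentiable (at x)" for x
      using assms bs unfolding smooth_def by auto
    have "(h has_real_derivative iter_pd (1 # bs) f x) (at x)" for x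
    proof -
      obtain D where D: "(h has_real_derivative D) (at x)"
        using d[of x] by (auto simp: real_differentiable_def)
      then have "frechet_derivative h (at x) = (\<lambda>t. D * t)"
        by (intro frechet_derivative_at[symmetric]) (simp add: has_field_derivative_def)
      then show ?thesis using D bs by simp
    qed
    moreover have "iter_pd (1 # bs) f \<in> ?S" using bs by (intro imageI) auto
    ultimately show "\<exists>g\<in>?S. \<forall>x. (h has_real_derivative g x) (at x)" by blast
  qed
qed

lemma smooth_deriv:
  assumes "smooth f"
  shows "(f has_real_derivative deriv f x) (at x)" "smooth (deriv f)"
proof -
  obtain S where S: "deriv_closed S" "f \<in> S" using assms by (rule smooth_deriv_closed)
  then obtain g where g: "g \<in> S" "\<And>x. (f has_real_derivative g x) (at x)"
    unfolding deriv_closed_def by blast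
  then have "deriv f = g" by (auto intro!: DERIV_imp_deriv)
  then show "(f has_real_derivative deriv f x) (at x)" "smooth (deriv f)"
    using g deriv_closed_smooth[OF S(1)] by auto
qed

lemma smooth_antiderivative:
  assumes "smooth g" "\<And>x. (f has_real_derivative g x) (at x)"
  shows "smooth f"
proof -
  obtain S where S: "deriv_closed S" "g \<in> S" using assms(1) by (rule smooth_deriv_closed)
  have "deriv_closed (insert f S)" using S assms(2) unfolding deriv_closed_def by blast
  then show ?thesis by (rule deriv_closed_smooth) simp
qed

lemma smooth_continuous: "smooth f \<Longrightarrow> continuous_on A f" for f :: "real \<Rightarrow> real"
  by (meson DERIV_isCont continuous_at_imp_continuous_on smooth_deriv(1))

text \<open>Leibniz' rule leaves the class of single products, so the invariant family consists of
  finite sums of products, coded as lists of pairs of factors.\<close>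

lemma smooth_mult:
  assumes "smooth f" "smooth g"
  shows "smooth (\<lambda>x::real. f x * g x)"
proof -
  obtain S where S: "deriv_closed S" "f \<in> S" using assms(1) by (rule smooth_deriv_closed)
  obtain T where T: "deriv_closed T" "g \<in> T" using assms(2) by (rule smooth_deriv_closed)
  let ?m = "\<lambda>xs x. \<Sum>(a, b)\<leftarrow>xs. a x * (b x :: real)"
  let ?P = "?m ` lists (S \<times> T)"
  have "deriv_closed ?P" unfolding deriv_closed_def
  proof
    fix h assume "h \<in> ?P"
    then obtain xs where xs: "xs \<in> lists (S \<times> T)" and h: "h = ?m xs" by auto
    from xs have "\<exists>ys\<in>lists (S \<times> T). \<forall>x. (?m xs has_real_derivative ?m ys x) (at x)"
    proof (induction xs)
      case Nil then show ?case by (intro bexI[of _ "[]"]) auto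
    next
      case (Cons p xs)
      obtain a b where p: "p = (a, b)" by force
      with Cons obtain ys where ys: "ys \<in> lists (S \<times> T)" "\<And>x. (?m xs has_real_derivative ?m ys x) (at x)"
        by auto
      obtain a' where a': "a' \<in> S" "\<And>x. (a has_real_derivative a' x) (at x)"
        using S(1) Cons p unfolding deriv_closed_def by auto
      obtain b' where b': "b' \<in> T" "\<And>x. (b has_real_derivative b' x) (at x)"
        using T(1) Cons p unfolding deriv_closed_def by auto
      show ?case
      proof (intro bexI[of _ "(a', b) # (a, b') # ys"] allI)
        fix x
        have "((\<lambda>x. a x * b x + ?m xs x) has_real_derivative (a' x * b x + a x * b' x) + ?m ys x) (at x)"
          using DERIV_add[OF DERIV_mult[OF a'(2) b'(2)] ys(2), of x] by (simp add: mult.commute)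
        then show "(?m (p # xs) has_real_derivative ?m ((a', b) # (a, b') # ys) x) (at x)"
          by (simp add: p add.assoc)
      qed (use a' b' ys Cons p in auto)
    qed
    then obtain ys where "ys \<in> lists (S \<times> T)" "\<forall>x. (?m xs has_real_derivative ?m ys x) (at x)" ..
    then show "\<exists>g\<in>?P. \<forall>x. (h has_real_derivative g x) (at x)"
      unfolding h by (intro bexI[of _ "?m ys"] imageI) auto
  qed
  moreover have "(\<lambda>x. f x * g x) \<in> ?P"
    by (intro image_eqI[of _ _ "[(f, g)]"]) (use S T in auto)
  ultimately show ?thesis by (rule deriv_closed_smooth)
qed

text \<open>The factor \<open>k\<close> in the family collects the powers of \<open>c\<close> that
  the chain rule produces.\<close>

lemma smooth_affine:
  assumes "smooth f"
  shows "smooth (\<lambda>x::real. f (c * x + d))"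
proof -
  obtain S where S: "deriv_closed S" "f \<in> S" using assms(1) by (rule smooth_deriv_closed)
  let ?P = "(\<lambda>(k, g) x. k * g (c * x + d) :: real) ` (UNIV \<times> S)"
  have "deriv_closed ?P" unfolding deriv_closed_def
  proof
    fix h assume "h \<in> ?P"
    then obtain k g where g: "g \<in> S" "h = (\<lambda>x. k * g (c * x + d))" by auto
    then obtain g' where g': "g' \<in> S" "\<And>x. (g has_real_derivative g' x) (at x)"
      using S(1) unfolding deriv_closed_def by blast
    have "(h has_real_derivative (k * c) * g' (c * x + d)) (at x)" for x
      unfolding g by (auto intro!: derivative_eq_intros DERIV_chain2[OF g'(2)])
    then show "\<exists>g\<in>?P. \<forall>x. (h has_real_derivative g x) (at x)" using g'
      by (intro bexI[of _ "\<lambda>x. (k * c) * g' (c * x + d)"] image_eqI[of _ _ "(k * c, g')"]) auto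
  qed
  moreover have "(\<lambda>x. f (c * x + d)) \<in> ?P"
    by (intro image_eqI[of _ _ "(1, f)"]) (use S in auto)
  ultimately show ?thesis by (rule deriv_closed_smooth)
qed

lemma smooth_cmult: "smooth f \<Longrightarrow> smooth (\<lambda>x::real. k * f x)"
proof -
  have "deriv_closed {\<lambda>x. k, \<lambda>x. 0}" unfolding deriv_closed_def by (auto intro!: derivative_eq_intros)
  then have "smooth (\<lambda>x::real. k)" by (rule deriv_closed_smooth) simp
  then show "smooth f \<Longrightarrow> smooth (\<lambda>x::real. k * f x)" by (rule smooth_mult)
qed

lemma smooth_add: "smooth f \<Longrightarrow> smooth g \<Longrightarrow> smooth (\<lambda>x::real. f x + g x)"
proof -
  assume f: "smooth f" and g: "smooth g"
  obtain S where S: "deriv_closed S" "f \<in> S" using f by (rule smooth_deriv_closed)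
  obtain T where T: "deriv_closed T" "g \<in> T" using g by (rule smooth_deriv_closed)
  let ?P = "(\<lambda>(a, b) x. a x + b x :: real) ` (S \<times> T)"
  have "deriv_closed ?P" unfolding deriv_closed_def
  proof
    fix h assume "h \<in> ?P"
    then obtain a b where h: "a \<in> S" "b \<in> T" "h = (\<lambda>x. a x + b x)" by auto
    obtain a' where a': "a' \<in> S" "\<And>x. (a has_real_derivative a' x) (at x)"
      using S(1) h unfolding deriv_closed_def by blast
    obtain b' where b': "b' \<in> T" "\<And>x. (b has_real_derivative b' x) (at x)"
      using T(1) h unfolding deriv_closed_def by blast
    show "\<exists>g\<in>?P. \<forall>x. (h has_real_derivative g x) (at x)"
      unfolding h using a' b'
      by (intro bexI[of _ "\<lambda>x. a' x + b' x"] image_eqI[of _ _ "(a', b')"]) (auto intro!: DERIV_add)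
  qed
  then show ?thesis by (rule deriv_closed_smooth) (use S T in \<open>auto intro!: image_eqI[of _ _ "(f, g)"]\<close>)
qed

section \<open>Bump functions that converge to the indicator of an interval\<close>

definition cutoff :: "real \<Rightarrow> real" where
  "cutoff x = (if x > 0 then exp (- (1 / x)) else 0)"

lemma cutoff_nonneg: "0 \<le> cutoff x" and cutoff_le_1: "cutoff x \<le> 1"
  by (auto simp: cutoff_def)

text \<open>The invariant family consists of \<open>poly p (1 / x) * exp (- (1 / x))\<close>
  extended by zero. In the variable \<open>y = 1 / x\<close> differentiation replaces
  \<open>p\<close> by \<open>y\<^sup>2 * (p - pderiv p)\<close>. At \<open>0\<close> the difference
  quotient is again of this form, with polynomial \<open>y * p\<close>, and tends to zero because
  the exponential dominates.\<close>

lemma smooth_cutoff: "smooth cutoff"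
proof -
  let ?S = "{f. \<exists>p::real poly. f = (\<lambda>x. if x > 0 then poly p (1 / x) * exp (- (1 / x)) else 0)}"
  have decay: "((\<lambda>x. poly p (1 / x) * exp (- (1 / x))) \<longlongrightarrow> 0) (at_right 0)" for p :: "real poly"
  proof -
    have "((\<lambda>y. poly p y / exp y) \<longlongrightarrow> 0) at_top"
    proof -
      have "((\<lambda>y. \<Sum>i\<le>degree p. coeff p i * (y ^ i / exp y)) \<longlongrightarrow> (\<Sum>i\<le>degree p. coeff p i * 0)) at_top"
        by (intro tendsto_intros tendsto_power_div_exp_0)
      then show ?thesis by (simp add: poly_altdef sum_divide_distrib)
    qed
    from filterlim_compose[OF this filterlim_inverse_at_top_right]
    show ?thesis by (simp add: exp_minus field_simps)
  qed
  have "deriv_closed ?S" unfolding deriv_closed_def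
  proof
    fix f assume "f \<in> ?S"
    then obtain p where f: "f = (\<lambda>x. if x > 0 then poly p (1 / x) * exp (- (1 / x)) else 0)" by auto
    define q where "q = monom 1 2 * (p - pderiv p)"
    define g where "g = (\<lambda>x. if x > 0 then poly q (1 / x) * exp (- (1 / x)) else 0)"
    have q: "poly q y = y\<^sup>2 * (poly p y - poly (pderiv p) y)" for y
      by (simp add: q_def poly_monom)
    have "(f has_real_derivative g x) (at x)" for x
    proof -
      consider "x > 0" | "x < 0" | "x = 0" by linarith
      then show ?thesis
      proof cases
        case 1
        have "((\<lambda>x. poly p (1 / x) * exp (- (1 / x))) has_real_derivative g x) (at x)"
          using 1 by (auto intro!: derivative_eq_intros DERIV_chain2[OF poly_DERIV]
              simp: g_def q power2_eq_square field_simps)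
        then show ?thesis
          by (rule has_field_derivative_transform_within_open[of _ _ _ "{0<..}"]) (use 1 f in auto)
      next
        case 2
        have "((\<lambda>x. 0) has_real_derivative 0) (at x)" by simp
        then have "(f has_real_derivative 0) (at x)"
          by (rule has_field_derivative_transform_within_open[of _ _ _ "{..<0}"]) (use 2 f in auto)
        then show ?thesis using 2 by (simp add: g_def)
      next
        case 3
        have "((\<lambda>h. f h / h) \<longlongrightarrow> 0) (at 0)"
        proof (rule filterlim_split_at_real)
          show "((\<lambda>h. f h / h) \<longlongrightarrow> 0) (at_left 0)"
            by (rule tendsto_eventually) (auto simp: f eventually_at_left_field intro!: exI[of _ "-1"])
          have "\<forall>\<^sub>F h in at_right 0. poly (pCons 0 p) (1 / h) * exp (- (1 / h)) = f h / h"
            using eventually_at_right_less[of 0] by eventually_elim (auto simp: f)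
          then show "((\<lambda>h. f h / h) \<longlongrightarrow> 0) (at_right 0)"
            using decay[of "pCons 0 p"] by (rule Lim_transform_eventually[rotated])
        qed
        moreover have "(\<lambda>h. (f (0 + h) - f 0) / h) = (\<lambda>h. f h / h)" by (simp add: f fun_eq_iff)
        ultimately show ?thesis unfolding 3 DERIV_def by (simp add: g_def)
      qed
    qed
    moreover have "g \<in> ?S" unfolding g_def by blast
    ultimately show "\<exists>g\<in>?S. \<forall>x. (f has_real_derivative g x) (at x)"
      by (intro bexI[of _ g] allI)
  qed
  moreover have "cutoff \<in> ?S"
    by (auto simp: cutoff_def fun_eq_iff intro!: exI[of _ 1])
  ultimately show ?thesis by (rule deriv_closed_smooth)
qed

text \<open>Both cutoffs are steepened by \<open>Suc n\<close>. The function is positive exactly on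
  the open interval and at most one, and it tends to the indicator of the interval because
  \<open>cutoff\<close> tends to one at infinity.\<close>

definition bump :: "real \<Rightarrow> real \<Rightarrow> nat \<Rightarrow> real \<Rightarrow> real" where
  "bump a b n x = cutoff (real (Suc n) * x + - real (Suc n) * a) * cutoff (- real (Suc n) * x + real (Suc n) * b)"

lemma bump_nonneg: "0 \<le> bump a b n x" and bump_le_1: "bump a b n x \<le> 1"
  using mult_mono[OF cutoff_le_1 cutoff_le_1] by (auto simp: bump_def cutoff_nonneg)

lemma bump_eq_0_iff: "bump a b n x = 0 \<longleftrightarrow> x \<notin> {a<..<b}"
proof -
  have 1: "real (Suc n) * x + - real (Suc n) * a > 0 \<longleftrightarrow> a < x"
    using mult_less_cancel_left_pos[of "real (Suc n)" a x] by (simp del: of_nat_Suc)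
  have 2: "- real (Suc n) * x + real (Suc n) * b > 0 \<longleftrightarrow> x < b"
    using mult_less_cancel_left_pos[of "real (Suc n)" x b] by (simp del: of_nat_Suc)
  show ?thesis unfolding bump_def cutoff_def using 1 2 by auto
qed

lemma smooth_bump: "smooth (bump a b n)"
  unfolding bump_def by (intro smooth_mult smooth_affine smooth_cutoff)

lemma test_fun_bump: "{a..b} \<subseteq> I \<Longrightarrow> test_fun_on I (bump a b n)"
  unfolding test_fun_on_def using smooth_bump bump_eq_0_iff[of a b n]
  by (intro conjI exI[of _ "{a..b}"]) auto

lemma bump_tendsto: "(\<lambda>n. bump a b n x) \<longlonglongrightarrow> indicator {a<..<b} x"
proof (cases "x \<in> {a<..<b}")
  case True
  have c: "(\<lambda>n. cutoff (real (Suc n) * y)) \<longlonglongrightarrow> 1" if "y > 0" for y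
  proof -
    have "(\<lambda>n. exp (- (inverse (real (Suc n)) * (1 / y)))) \<longlonglongrightarrow> exp (- (0 * (1 / y)))"
      by (intro tendsto_intros LIMSEQ_inverse_real_of_nat)
    moreover have "cutoff (real (Suc n) * y) = exp (- (inverse (real (Suc n)) * (1 / y)))" for n
      using that by (simp add: cutoff_def inverse_eq_divide del: of_nat_Suc)
    ultimately show ?thesis by simp
  qed
  have "(\<lambda>n. cutoff (real (Suc n) * (x - a)) * cutoff (real (Suc n) * (b - x))) \<longlonglongrightarrow> 1 * 1"
    by (intro tendsto_mult c) (use True in auto)
  then show ?thesis using True by (simp add: bump_def algebra_simps)
next
  case False
  then show ?thesis using bump_eq_0_iff[of a b _ x] by simp
qed

lemma bump_measurable [measurable]: "bump a b n \<in> borel_measurable borel"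
  by (intro borel_measurable_continuous_onI smooth_continuous smooth_bump)

section \<open>Primitives and weak derivatives\<close>

definition locint :: "(real \<Rightarrow> 'b::{banach, second_countable_topology}) \<Rightarrow> bool" where
  "locint f \<longleftrightarrow> (\<forall>T. set_integrable lborel {0..T} f)"

text \<open>For negative \<open>t\<close> the interval is empty and the value is \<open>0\<close>.
  The primitive is thus continuous on the whole line, and the signs of reversed integrals never
  appear.\<close>

definition prim :: "(real \<Rightarrow> 'b::{banach, second_countable_topology}) \<Rightarrow> real \<Rightarrow> 'b" where
  "prim f t = (LINT s:{0..t}|lborel. f s)"

lemma locintD: "locint f \<Longrightarrow> set_integrable lborel {0..T} f"
  by (simp add: locint_def)

lemma locint_integrable: "locint f \<Longrightarrow> integrable lborel (\<lambda>s. indicator {0..T} s *\<^sub>R f s)"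
  by (simp add: locint_def set_integrable_def)

lemma set_integrable_measurable:
  "set_integrable lborel A f \<Longrightarrow> (\<lambda>s. indicator A s *\<^sub>R f s) \<in> borel_measurable borel"
  unfolding set_integrable_def by (auto dest: borel_measurable_integrable)

lemma locint_subset: "locint f \<Longrightarrow> A \<in> sets borel \<Longrightarrow> A \<subseteq> {0..T} \<Longrightarrow> set_integrable lborel A f"
  by (rule set_integrable_subset[OF locintD]) auto

lemma locint_continuous: "continuous_on {0..} f \<Longrightarrow> locint f"
  unfolding locint_def
  by (auto intro!: borel_integrable_compact simp: set_integrable_def intro: continuous_on_subset)

lemma locint_add: "locint f \<Longrightarrow> locint g \<Longrightarrow> locint (\<lambda>t. f t + g t)"
  by (simp add: locint_def set_integral_add)

lemma locint_bounded_linear: "bounded_linear L \<Longrightarrow> locint f \<Longrightarrow> locint (\<lambda>t. L (f t))"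
  unfolding locint_def set_integrable_def
proof
  fix T assume "bounded_linear L" "\<forall>T. integrable lborel (\<lambda>x. indicat_real {0..T} x *\<^sub>R f x)"
  then show "integrable lborel (\<lambda>x. indicat_real {0..T} x *\<^sub>R L (f x))"
    using integrable_bounded_linear[of L lborel "\<lambda>x. indicat_real {0..T} x *\<^sub>R f x"]
    by (simp add: linear_simps)
qed

lemma prim_0 [simp]: "t \<le> 0 \<Longrightarrow> prim f t = 0"
proof -
  assume "t \<le> 0"
  then have "{0..t} = {} \<or> {0..t} = {0}" by auto
  then show ?thesis unfolding prim_def set_lebesgue_integral_def
    by (auto intro!: integral_eq_zero_AE AE_I[of _ _ "{0}"] simp: indicator_def)
qed

lemma prim_zero [simp]: "prim (\<lambda>s. 0) t = 0"
  by (simp add: prim_def)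

lemma prim_add: "locint f \<Longrightarrow> locint g \<Longrightarrow> prim (\<lambda>t. f t + g t) t = prim f t + prim g t"
  by (simp add: locint_def prim_def set_integral_add)

lemma prim_diff: "locint f \<Longrightarrow> locint g \<Longrightarrow> prim (\<lambda>t. f t - g t) t = prim f t - prim g t"
  by (simp add: locint_def prim_def set_integral_diff)

lemma prim_bounded_linear: "bounded_linear L \<Longrightarrow> locint f \<Longrightarrow> prim (\<lambda>t. L (f t)) t = L (prim f t)"
  unfolding locint_def prim_def set_integrable_def set_lebesgue_integral_def
  by (subst integral_bounded_linear[symmetric, where T = L]) (auto simp: linear_simps)

lemma prim_const: "t \<ge> 0 \<Longrightarrow> prim (\<lambda>s. c) t = t *\<^sub>R c"
  unfolding prim_def by (subst set_integral_const) auto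

lemma prim_cong: "(\<And>s. 0 \<le> s \<Longrightarrow> s \<le> t \<Longrightarrow> f s = g s) \<Longrightarrow> prim f t = prim g t"
  unfolding prim_def by (intro set_lebesgue_integral_cong) auto

lemma prim_cong_AE:
  assumes "locint f" "locint g" "AE s in lborel. 0 < s \<and> s < t \<longrightarrow> f s = g s"
  shows "prim f t = prim g t"
  unfolding prim_def set_lebesgue_integral_def
proof (rule integral_cong_AE)
  show "AE s in lborel. indicator {0..t} s *\<^sub>R f s = indicator {0..t} s *\<^sub>R g s"
    using AE_lborel_singleton[of 0] AE_lborel_singleton[of t] assms(3) by eventually_elim (auto simp: indicator_def)
qed (use assms in \<open>auto intro!: set_integrable_measurable locintD\<close>)

lemma prim_norm_le:
  "norm (prim f t) \<le> prim (\<lambda>s. norm (f s)) t"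
  unfolding prim_def set_lebesgue_integral_def
  using integral_norm_bound[of lborel "\<lambda>s. indicator {0..t} s *\<^sub>R f s"] by simp

lemma prim_diff_interval:
  assumes "locint f" "0 \<le> s" "s \<le> t"
  shows "prim f t - prim f s = (LINT r:{s..t}|lborel. f r)"
proof -
  have "(LINT r:{0..s} \<union> {s<..t}|lborel. f r) = (LINT r:{0..s}|lborel. f r) + (LINT r:{s<..t}|lborel. f r)"
    by (rule set_integral_Un) (use assms in \<open>auto intro!: locint_subset[of f _ t]\<close>)
  moreover have "{0..s} \<union> {s<..t} = {0..t}" using assms by auto
  moreover have "(LINT r:{s<..t}|lborel. f r) = (LINT r:{s..t}|lborel. f r)"
    unfolding set_lebesgue_integral_def
  proof (rule integral_cong_AE)
    show "AE r in lborel. indicator {s<..t} r *\<^sub>R f r = indicator {s..t} r *\<^sub>R f r"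
      using AE_lborel_singleton[of s] by eventually_elim (auto simp: indicator_def)
  qed (use assms in \<open>auto intro!: set_integrable_measurable locint_subset[of f _ t]\<close>)
  ultimately show ?thesis by (simp add: prim_def)
qed

lemma continuous_prim:
  assumes "locint f"
  shows "continuous_on A (prim f)"
proof -
  have "isCont (prim f) x" for x
    unfolding continuous_at_sequentially comp_def
  proof (intro allI impI)
    fix u :: "nat \<Rightarrow> real" assume u: "u \<longlonglongrightarrow> x"
    then obtain T where T: "\<And>n. norm (u n) \<le> T"
      using convergent_imp_Bseq[of u] by (auto simp: convergent_def Bseq_def)
    have i: "set_integrable lborel {0..t} f" for t using assms by (rule locintD)
    show "(\<lambda>n. prim f (u n)) \<longlonglongrightarrow> prim f x"
      unfolding prim_def set_lebesgue_integral_def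
    proof (rule integral_dominated_convergence)
      show "integrable lborel (\<lambda>s. norm (indicator {0..T} s *\<^sub>R f s))"
        using i[of T] unfolding set_integrable_def by (rule integrable_norm)
      show "AE s in lborel. (\<lambda>n. indicator {0..u n} s *\<^sub>R f s) \<longlonglongrightarrow> indicator {0..x} s *\<^sub>R f s"
        using AE_lborel_singleton[of x]
      proof eventually_elim
        case (elim s)
        have "\<forall>\<^sub>F n in sequentially. s \<le> u n \<longleftrightarrow> s \<le> x"
        proof (cases "s < x")
          case True
          then show ?thesis using order_tendstoD(1)[OF u, of s] by (auto elim!: eventually_mono)
        next
          case False
          then show ?thesis using order_tendstoD(2)[OF u, of s] elim by (auto elim!: eventually_mono)
        qed
        then show ?case by (intro tendsto_eventually) (auto elim!: eventually_mono simp: indicator_def)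
      qed
      show "AE s in lborel. norm (indicator {0..u n} s *\<^sub>R f s) \<le> norm (indicator {0..T} s *\<^sub>R f s)" for n
        using T[of n] by (auto simp: indicator_def)
    qed (use i in \<open>auto simp: set_integrable_def\<close>)
  qed
  then show ?thesis by (simp add: continuous_at_imp_continuous_on)
qed

lemma measurable_prim [measurable (raw)]:
  "locint f \<Longrightarrow> g \<in> borel_measurable M \<Longrightarrow> (\<lambda>x. prim f (g x)) \<in> borel_measurable M"
  using borel_measurable_continuous_onI[OF continuous_prim[of f UNIV]]
  by (rule measurable_compose[rotated])

text \<open>Fubini's theorem on the two triangles of a square.\<close>

lemma prim_by_parts:
  fixes prod :: "'b::{banach, second_countable_topology} \<Rightarrow> 'c::{banach, second_countable_topology} \<Rightarrow> 'd::{banach, second_countable_topology}"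
  assumes pr: "bounded_bilinear prod" and f: "locint f" and g: "locint g"
  shows "locint (\<lambda>s. prod (f s) (prim g s))" (is ?A)
    and "locint (\<lambda>s. prod (prim f s) (g s))" (is ?B)
    and "prod (prim f t) (prim g t) = prim (\<lambda>s. prod (f s) (prim g s)) t + prim (\<lambda>s. prod (prim f s) (g s)) t" (is ?C)
proof -
  interpret bounded_bilinear prod by (rule pr)
  have main: "set_integrable lborel {0..T} (\<lambda>s. prod (f s) (prim g s)) \<and>
     set_integrable lborel {0..T} (\<lambda>s. prod (prim f s) (g s)) \<and>
     prod (prim f T) (prim g T) = prim (\<lambda>s. prod (f s) (prim g s)) T + prim (\<lambda>s. prod (prim f s) (g s)) T" for T
  proof -
    define F where "F s = indicator {0..T} s *\<^sub>R f s" for s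
    define G where "G s = indicator {0..T} s *\<^sub>R g s" for s
    have F: "integrable lborel F" and G: "integrable lborel G"
      using f g by (simp_all add: F_def[abs_def] G_def[abs_def] locint_def set_integrable_def)
    have [measurable]: "F \<in> borel_measurable borel" "G \<in> borel_measurable borel"
      using F G by auto
    have [measurable]: "(\<lambda>x. prod (a x) (b x)) \<in> borel_measurable M"
      if "a \<in> borel_measurable M" "b \<in> borel_measurable M" for a b and M :: "(real \<times> real) measure"
      by (rule borel_measurable_continuous_Pair[OF that])
         (intro continuous_intros continuous_on)
    obtain K where K: "\<And>a b. norm (prod a b) \<le> norm a * norm b * K" and K0: "K > 0"
      using pos_bounded by blast
    define H where "H = (\<lambda>(s, t). prod (F s) (G t))"
    have Hm [measurable]: "H \<in> borel_measurable (lborel \<Otimes>\<^sub>M lborel)"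
      unfolding H_def split_beta by measurable
    have H: "integrable (lborel \<Otimes>\<^sub>M lborel) H"
    proof (rule Bochner_Integration.integrable_bound[OF _ Hm])
      show "integrable (lborel \<Otimes>\<^sub>M lborel) (\<lambda>(s, t). norm (F s) * (norm (G t) * K))"
        by (intro lborel_pair.Fubini_integrable)
           (use F G in \<open>auto intro!: integrable_mult_left simp: split_beta abs_mult\<close>)
      show "AE x in lborel \<Otimes>\<^sub>M lborel. norm (H x) \<le> norm (case x of (s, t) \<Rightarrow> norm (F s) * (norm (G t) * K))"
        using K K0 by (auto simp: H_def split_beta abs_mult mult.assoc)
    qed
    \<comment> \<open>\<open>H1\<close> and \<open>H2\<close> restrict the product to the triangles
      \<open>t \<le> s\<close> and \<open>s < t\<close>. Integrating over one variable turns the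
      factor that depends on it into a primitive evaluated at the other variable.\<close>
    define H1 where "H1 = (\<lambda>(s, t). indicator {t. t \<le> s} t *\<^sub>R prod (F s) (G t))"
    define H2 where "H2 = (\<lambda>(s, t). indicator {s. s < t} s *\<^sub>R prod (F s) (G t))"
    have H1m [measurable]: "H1 \<in> borel_measurable (lborel \<Otimes>\<^sub>M lborel)"
      and H2m [measurable]: "H2 \<in> borel_measurable (lborel \<Otimes>\<^sub>M lborel)"
      unfolding H1_def H2_def split_beta indicator_def by measurable
    have H1: "integrable (lborel \<Otimes>\<^sub>M lborel) H1"
      by (rule Bochner_Integration.integrable_bound[OF H H1m]) (auto simp: H1_def H_def indicator_def)
    have H2: "integrable (lborel \<Otimes>\<^sub>M lborel) H2"
      by (rule Bochner_Integration.integrable_bound[OF H H2m]) (auto simp: H2_def H_def indicator_def)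
    have sum: "H x = H1 x + H2 x" for x
      by (cases x) (auto simp: H_def H1_def H2_def indicator_def)
    have blr: "(\<integral>t. prod a (k t) \<partial>lborel) = prod a (integral\<^sup>L lborel k)" if "integrable lborel k" for a k
      by (rule integral_bounded_linear[OF bounded_linear_right that])
    have bll: "(\<integral>t. prod (k t) a \<partial>lborel) = prod (integral\<^sup>L lborel k) a" if "integrable lborel k" for a k
      by (rule integral_bounded_linear[OF bounded_linear_left that])
    have PF: "prim f T = integral\<^sup>L lborel F" and PG: "prim g T = integral\<^sup>L lborel G"
      by (simp_all add: prim_def set_lebesgue_integral_def F_def[abs_def] G_def[abs_def])
    have "integral\<^sup>L (lborel \<Otimes>\<^sub>M lborel) H = (\<integral>s. (\<integral>t. prod (F s) (G t) \<partial>lborel) \<partial>lborel)"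
      using lborel_pair.integral_fst[of "\<lambda>s t. prod (F s) (G t)"] H by (simp add: H_def)
    also have "\<dots> = prod (prim f T) (prim g T)"
      by (simp add: blr[OF G] bll[OF F] PF PG)
    finally have e0: "integral\<^sup>L (lborel \<Otimes>\<^sub>M lborel) H = prod (prim f T) (prim g T)" .
    have i1: "(\<integral>t. indicator {t. t \<le> s} t *\<^sub>R prod (F s) (G t) \<partial>lborel) = indicator {0..T} s *\<^sub>R prod (f s) (prim g s)" for s
    proof -
      have "(\<integral>t. indicator {t. t \<le> s} t *\<^sub>R prod (F s) (G t) \<partial>lborel) = (\<integral>t. prod (F s) (indicator {t. t \<le> s} t *\<^sub>R G t) \<partial>lborel)"
        by (simp add: scaleR_right)
      also have "\<dots> = prod (F s) (\<integral>t. indicator {t. t \<le> s} t *\<^sub>R G t \<partial>lborel)"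
        by (rule blr) (use G in \<open>auto intro!: integrable_mult_indicator\<close>)
      also have "\<dots> = indicator {0..T} s *\<^sub>R prod (f s) (prim g s)"
      proof (cases "s \<in> {0..T}")
        case True
        then have "indicator {t. t \<le> s} t *\<^sub>R G t = indicator {0..s} t *\<^sub>R g t" for t
          by (auto simp: G_def indicator_def)
        then show ?thesis using True by (simp add: F_def prim_def set_lebesgue_integral_def)
      qed (simp add: F_def zero_left)
      finally show ?thesis .
    qed
    have i2: "(\<integral>s. indicator {s. s < t} s *\<^sub>R prod (F s) (G t) \<partial>lborel) = indicator {0..T} t *\<^sub>R prod (prim f t) (g t)" for t
    proof -
      have "(\<integral>s. indicator {s. s < t} s *\<^sub>R prod (F s) (G t) \<partial>lborel) = (\<integral>s. prod (indicator {s. s < t} s *\<^sub>R F s) (G t) \<partial>lborel)"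
        by (simp add: scaleR_left)
      also have "\<dots> = prod (\<integral>s. indicator {s. s < t} s *\<^sub>R F s \<partial>lborel) (G t)"
        by (rule bll) (use F in \<open>auto intro!: integrable_mult_indicator\<close>)
      also have "\<dots> = indicator {0..T} t *\<^sub>R prod (prim f t) (g t)"
      proof (cases "t \<in> {0..T}")
        case True
        have "(\<integral>s. indicator {s. s < t} s *\<^sub>R F s \<partial>lborel) = (\<integral>s. indicator {0..t} s *\<^sub>R F s \<partial>lborel)"
        proof (rule integral_cong_AE)
          show "AE s in lborel. indicator {s. s < t} s *\<^sub>R F s = indicator {0..t} s *\<^sub>R F s"
            using AE_lborel_singleton[of t] by eventually_elim (auto simp: indicator_def F_def)
        qed auto
        moreover have "indicator {0..t} s *\<^sub>R F s = indicator {0..t} s *\<^sub>R f s" for s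
          using True by (auto simp: F_def indicator_def)
        ultimately show ?thesis using True by (simp add: G_def prim_def set_lebesgue_integral_def)
      qed (simp add: G_def zero_right)
      finally show ?thesis .
    qed
    have I1: "integrable lborel (\<lambda>s. indicator {0..T} s *\<^sub>R prod (f s) (prim g s))"
      using lborel_pair.integrable_fst[of "\<lambda>s t. H1 (s, t)"] H1 by (simp add: H1_def i1)
    have I2: "integrable lborel (\<lambda>t. indicator {0..T} t *\<^sub>R prod (prim f t) (g t))"
      using lborel_pair.integrable_snd[of "\<lambda>s t. H2 (s, t)"] H2 by (simp add: H2_def i2)
    have "integral\<^sup>L (lborel \<Otimes>\<^sub>M lborel) H1 = prim (\<lambda>s. prod (f s) (prim g s)) T"
      using lborel_pair.integral_fst[of "\<lambda>s t. H1 (s, t)"] H1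
      by (simp add: H1_def i1 prim_def set_lebesgue_integral_def)
    moreover have "integral\<^sup>L (lborel \<Otimes>\<^sub>M lborel) H2 = prim (\<lambda>s. prod (prim f s) (g s)) T"
      using lborel_pair.integral_snd[of "\<lambda>s t. H2 (s, t)"] H2
      by (simp add: H2_def i2 prim_def set_lebesgue_integral_def)
    moreover have "integral\<^sup>L (lborel \<Otimes>\<^sub>M lborel) H = integral\<^sup>L (lborel \<Otimes>\<^sub>M lborel) H1 + integral\<^sup>L (lborel \<Otimes>\<^sub>M lborel) H2"
      unfolding sum by (rule Bochner_Integration.integral_add[OF H1 H2])
    ultimately show ?thesis using I1 I2 e0 by (simp add: set_integrable_def)
  qed
  show ?A ?B using main by (auto simp: locint_def)
  show ?C using main by blast
qed

section \<open>The fundamental lemma of the calculus of variations and weak derivatives of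
  primitives\<close>

lemma AE_zero_intervals:
  fixes f :: "real \<Rightarrow> 'b::{banach, second_countable_topology}"
  assumes f: "integrable lborel f" and z: "\<And>c d. (LINT t:{c<..<d}|lborel. f t) = 0"
  shows "AE t in lborel. f t = 0"
proof (rule sigma_finite_measure.density_zero[OF lborel.sigma_finite_measure_axioms f])
  fix A assume "A \<in> sets (lborel :: real measure)"
  then have A: "A \<in> sigma_sets UNIV (range (\<lambda>(a, b). box a b :: real set))"
    by (simp add: borel_eq_box)
  have fi: "set_integrable lborel B f" if "B \<in> sets borel" for B
    using f that by (auto simp: set_integrable_def intro!: integrable_mult_indicator)
  \<comment> \<open>The total integral serves the complement step of the Dynkin induction over the
    intersection stable family of open intervals.\<close>
  have U: "(LINT t:UNIV|lborel. f t) = 0"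
  proof -
    have "(\<lambda>n. LINT t:{- real n<..<real n}|lborel. f t) \<longlonglongrightarrow> (LINT t:(\<Union>n. {- real n<..<real n})|lborel. f t)"
      by (intro set_integral_cont_up) (auto simp: incseq_def intro!: fi)
    moreover have "(\<Union>n. {- real n<..<real n}) = UNIV"
    proof safe
      fix x :: real
      obtain n where "\<bar>x\<bar> < real n" using reals_Archimedean2 by blast
      then show "x \<in> (\<Union>n. {- real n<..<real n})" by (auto intro!: exI[of _ n])
    qed auto
    ultimately show ?thesis using z by (simp add: LIMSEQ_const_iff)
  qed
  have "Int_stable (range (\<lambda>(a, b). box a b :: real set))"
    by (auto simp: Int_stable_def box_Int_box)
  moreover have "range (\<lambda>(a, b). box a b :: real set) \<subseteq> Pow UNIV" by auto
  ultimately show "(LINT t:A|lborel. f t) = 0" using A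
  proof (induction A rule: sigma_sets_induct_disjoint)
    case (basic A) then show ?case using z by (auto simp: box_real)
  next
    case empty then show ?case by (simp add: set_lebesgue_integral_def)
  next
    case (compl A)
    then have Ab: "A \<in> sets borel" by (simp add: borel_eq_box)
    have "(LINT t:(UNIV - A) \<union> A|lborel. f t) = (LINT t:UNIV - A|lborel. f t) + (LINT t:A|lborel. f t)"
      by (rule set_integral_Un) (use Ab in \<open>auto intro!: fi\<close>)
    then show ?case using U compl by simp
  next
    case (union A)
    then have Ab: "A i \<in> sets borel" for i by (auto simp: borel_eq_box)
    have "(LINT t:(\<Union>i. A i)|lborel. f t) = (\<Sum>i. LINT t:A i|lborel. f t)"
      by (rule lebesgue_integral_countable_add)
         (use union(1) Ab in \<open>auto intro!: fi simp: disjoint_family_on_def\<close>)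
    then show ?case using union by simp
  qed
qed

lemma test_fun_on_props:
  assumes "test_fun_on I \<phi>"
  shows "(\<phi> has_real_derivative deriv \<phi> x) (at x)" "continuous_on A \<phi>" "continuous_on A (deriv \<phi>)"
    "test_fun_on I (deriv \<phi>)" "\<phi> \<in> borel_measurable borel" "deriv \<phi> \<in> borel_measurable borel"
proof -
  have s: "smooth \<phi>" using assms by (simp add: test_fun_on_def)
  show "(\<phi> has_real_derivative deriv \<phi> x) (at x)" using s by (rule smooth_deriv)
  have c: "continuous_on A \<phi>" "continuous_on A (deriv \<phi>)" for A
    by (rule smooth_continuous[OF s], rule smooth_continuous[OF smooth_deriv(2)[OF s]])
  show "continuous_on A \<phi>" "continuous_on A (deriv \<phi>)" by (rule c)+
  show "\<phi> \<in> borel_measurable borel" "deriv \<phi> \<in> borel_measurable borel"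
    by (rule borel_measurable_continuous_onI[OF c(1)], rule borel_measurable_continuous_onI[OF c(2)])
  obtain K where K: "compact K" "K \<subseteq> I" "\<And>x. x \<notin> K \<Longrightarrow> \<phi> x = 0"
    using assms by (auto simp: test_fun_on_def)
  have "deriv \<phi> x = 0" if "x \<notin> K" for x
  proof -
    have "(\<phi> has_real_derivative 0) (at x)"
      by (rule has_field_derivative_transform_within_open[of "\<lambda>x. 0" _ _ "- K"])
         (use that K compact_imp_closed[OF K(1)] in auto)
    then show ?thesis by (rule DERIV_imp_deriv)
  qed
  then show "test_fun_on I (deriv \<phi>)" unfolding test_fun_on_def using K smooth_deriv(2)[OF s] by blast
qed

lemma test_fun_set_integrable:
  fixes f :: "real \<Rightarrow> 'b::{banach, second_countable_topology}"
  assumes t: "test_fun_on I \<phi>" and f: "loc_integrable_on I f"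
  shows "set_integrable lborel I (\<lambda>t. \<phi> t *\<^sub>R f t)"
proof -
  obtain K where K: "compact K" "K \<subseteq> I" "\<And>x. x \<notin> K \<Longrightarrow> \<phi> x = 0"
    using t by (auto simp: test_fun_on_def)
  have [measurable]: "\<phi> \<in> borel_measurable borel" using t by (rule test_fun_on_props)
  have "compact (\<phi> ` K)" using K test_fun_on_props(2)[OF t] by (intro compact_continuous_image) auto
  then have "bounded (\<phi> ` K)" by (rule compact_imp_bounded)
  then obtain B where "\<forall>y\<in>\<phi> ` K. norm y \<le> B" unfolding bounded_iff by blast
  then have B: "\<And>x. x \<in> K \<Longrightarrow> norm (\<phi> x) \<le> B" by blast
  have i: "integrable lborel (\<lambda>t. indicator K t *\<^sub>R f t)"
    using f K(1,2) unfolding loc_integrable_on_def set_integrable_def by blast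
  have "integrable lborel (\<lambda>t. \<phi> t *\<^sub>R (indicator K t *\<^sub>R f t))"
  proof (rule Bochner_Integration.integrable_bound)
    show "integrable lborel (\<lambda>t. B *\<^sub>R indicator K t *\<^sub>R f t)"
      by (intro integrable_scaleR_right i)
    have "(\<lambda>t. indicator K t *\<^sub>R f t) \<in> borel_measurable borel"
      using borel_measurable_integrable[OF i] by simp
    then show "(\<lambda>t. \<phi> t *\<^sub>R indicator K t *\<^sub>R f t) \<in> borel_measurable lborel"
      by measurable
    show "AE t in lborel. norm (\<phi> t *\<^sub>R indicator K t *\<^sub>R f t) \<le> norm (B *\<^sub>R indicator K t *\<^sub>R f t)"
    proof (rule AE_I2)
      fix t show "norm (\<phi> t *\<^sub>R indicator K t *\<^sub>R f t) \<le> norm (B *\<^sub>R indicator K t *\<^sub>R f t)"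
      proof (cases "t \<in> K")
        case True
        then have "\<bar>\<phi> t\<bar> \<le> \<bar>B\<bar>" using B[of t] by simp
        then show ?thesis using True by (simp add: mult_right_mono)
      qed simp
    qed
  qed
  moreover have "\<phi> t *\<^sub>R indicator K t *\<^sub>R f t = indicator I t *\<^sub>R \<phi> t *\<^sub>R f t" for t
    using K by (cases "t \<in> K") (auto simp: indicator_def)
  ultimately show ?thesis by (simp only: set_integrable_def)
qed

text \<open>Bump functions tend to indicators, so all integrals of \<open>f\<close> over
  subintervals of a compact interval in \<open>I\<close> vanish and \<open>f\<close> is zero almost
  everywhere there. Countably many intervals with rational endpoints cover \<open>I\<close>.\<close>

lemma fundamental_lemma:
  fixes f :: "real \<Rightarrow> 'b::{banach, second_countable_topology}"
  assumes I: "open I" and f: "loc_integrable_on I f"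
    and z: "\<And>\<phi>. test_fun_on I \<phi> \<Longrightarrow> (LINT t:I|lborel. \<phi> t *\<^sub>R f t) = 0"
  shows "AE t in lborel. t \<in> I \<longrightarrow> f t = 0"
proof -
  have *: "AE t in lborel. t \<in> {a..b} \<longrightarrow> f t = 0" if ab: "{a..b} \<subseteq> I" for a b
  proof -
    let ?F = "\<lambda>t. indicator {a..b} t *\<^sub>R f t"
    have F: "integrable lborel ?F"
      using f ab compact_Icc[of a b] unfolding loc_integrable_on_def set_integrable_def by blast
    then have [measurable]: "?F \<in> borel_measurable borel" by auto
    have "(LINT t:{c<..<d}|lborel. ?F t) = 0" for c d
    proof -
      \<comment> \<open>Clipping to \<open>[a, b]\<close> keeps the supports of the bumps inside
        \<open>I\<close>. Since \<open>?F\<close> vanishes outside \<open>[a, b]\<close>, the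
        integrand changes at most at the points \<open>a\<close> and \<open>b\<close>.\<close>
      let ?c = "max a c" and ?d = "min b d"
      have sub: "{?c..?d} \<subseteq> I" using ab by auto
      have eq: "bump ?c ?d n t *\<^sub>R ?F t = indicator I t *\<^sub>R (bump ?c ?d n t *\<^sub>R f t)" for n t
      proof (cases "t \<in> {?c<..<?d}")
        case True
        then have "t \<in> {a..b}" by auto
        then show ?thesis using ab by auto
      next
        case False
        then have "bump ?c ?d n t = 0" by (simp only: bump_eq_0_iff not_False_eq_True)
        then show ?thesis by simp
      qed
      have "(\<lambda>n. \<integral>t. bump ?c ?d n t *\<^sub>R ?F t \<partial>lborel) \<longlonglongrightarrow> (\<integral>t. indicator {?c<..<?d} t *\<^sub>R ?F t \<partial>lborel)"
      proof (rule integral_dominated_convergence)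
        show "integrable lborel (\<lambda>t. norm (?F t))" using F by (rule integrable_norm)
        show "AE t in lborel. (\<lambda>n. bump ?c ?d n t *\<^sub>R ?F t) \<longlonglongrightarrow> indicator {?c<..<?d} t *\<^sub>R ?F t"
          by (intro AE_I2 tendsto_intros bump_tendsto)
        show "AE t in lborel. norm (bump ?c ?d n t *\<^sub>R ?F t) \<le> norm (?F t)" for n
        proof (rule AE_I2)
          fix t
          have "bump ?c ?d n t * norm (?F t) \<le> norm (?F t)"
            by (rule mult_left_le_one_le) (simp_all only: bump_nonneg bump_le_1 norm_ge_zero)
          then show "norm (bump ?c ?d n t *\<^sub>R ?F t) \<le> norm (?F t)"
            by (simp only: norm_scaleR[of "bump ?c ?d n t"] abs_of_nonneg[OF bump_nonneg])
        qed
      qed measurable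
      moreover have "(\<integral>t. bump ?c ?d n t *\<^sub>R ?F t \<partial>lborel) = 0" for n
        unfolding eq using z[OF test_fun_bump[OF sub]] by (simp add: set_lebesgue_integral_def)
      ultimately have "(\<integral>t. indicator {?c<..<?d} t *\<^sub>R ?F t \<partial>lborel) = 0" by (simp add: LIMSEQ_const_iff)
      moreover have "(\<integral>t. indicator {?c<..<?d} t *\<^sub>R ?F t \<partial>lborel) = (\<integral>t. indicator {c<..<d} t *\<^sub>R ?F t \<partial>lborel)"
      proof (rule integral_cong_AE)
        show "AE t in lborel. indicator {?c<..<?d} t *\<^sub>R ?F t = indicator {c<..<d} t *\<^sub>R ?F t"
          using AE_lborel_singleton[of a] AE_lborel_singleton[of b]
          by eventually_elim (auto simp: indicator_def)
      qed measurable
      ultimately show ?thesis by (simp add: set_lebesgue_integral_def)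
    qed
    from AE_zero_intervals[OF F this] show ?thesis
      by eventually_elim (auto simp: indicator_def split: if_splits)
  qed
  let ?P = "{(a, b). a \<in> \<rat> \<and> b \<in> \<rat> \<and> {a..b} \<subseteq> I} :: (real \<times> real) set"
  have "countable ?P"
    by (rule countable_subset[of _ "\<rat> \<times> \<rat>"]) (auto intro: countable_rat)
  then have "AE t in lborel. \<forall>p\<in>?P. t \<in> {fst p..snd p} \<longrightarrow> f t = 0"
    using * by (subst AE_ball_countable) auto
  then show ?thesis
  proof eventually_elim
    case (elim t)
    show ?case
    proof
      assume "t \<in> I"
      then obtain e where e: "e > 0" "ball t e \<subseteq> I" using I by (auto simp: open_contains_ball)
      obtain a b where ab: "a \<in> \<rat>" "t - e < a" "a < t" "b \<in> \<rat>" "t < b" "b < t + e"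
        using Rats_dense_in_real[of "t - e" t] Rats_dense_in_real[of t "t + e"] e(1) by auto
      then have "{a..b} \<subseteq> ball t e" by (auto simp: dist_real_def)
      then have "(a, b) \<in> ?P" using ab e by auto
      then show "f t = 0" using elim ab by fastforce
    qed
  qed
qed

lemma loc_integrable_on_diff:
  "loc_integrable_on I f \<Longrightarrow> loc_integrable_on I g \<Longrightarrow> loc_integrable_on I (\<lambda>t. f t - g t)"
  by (simp add: loc_integrable_on_def set_integral_diff)

lemma loc_integrable_on_const: "loc_integrable_on I (\<lambda>t. c)"
  unfolding loc_integrable_on_def set_integrable_def
proof (intro allI impI)
  fix K :: "real set" assume "compact K \<and> K \<subseteq> I"
  then have "K \<in> sets lborel" "emeasure lborel K < \<infinity>"
    using emeasure_compact_finite[of K] by (auto intro: borel_compact)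
  then show "integrable lborel (\<lambda>x. indicat_real K x *\<^sub>R c)"
    by (rule integrable_scaleR_left[OF integrable_real_indicator])
qed

lemma weak_deriv_unique:
  assumes I: "open I" and v: "weak_deriv_on I u v" "weak_deriv_on I u v'"
  shows "AE t in lborel. t \<in> I \<longrightarrow> v t = v' t"
proof -
  have li: "loc_integrable_on I v" "loc_integrable_on I v'" using v by (auto simp: weak_deriv_on_def)
  have "AE t in lborel. t \<in> I \<longrightarrow> v t - v' t = 0"
  proof (rule fundamental_lemma[OF I loc_integrable_on_diff[OF li]])
    fix \<phi> assume t: "test_fun_on I \<phi>"
    have "(LINT t:I|lborel. \<phi> t *\<^sub>R v t) = (LINT t:I|lborel. \<phi> t *\<^sub>R v' t)"
        using v[unfolded weak_deriv_on_def] t by simp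
    then show "(LINT t:I|lborel. \<phi> t *\<^sub>R (v t - v' t)) = 0"
      using test_fun_set_integrable[OF t li(1)] test_fun_set_integrable[OF t li(2)]
      by (simp add: scaleR_diff_right set_integral_diff)
  qed
  then show ?thesis by eventually_elim auto
qed

lemma test_fun_on_support:
  assumes "test_fun_on I \<phi>"
  obtains a b where "a < b" "\<And>x. x \<notin> {a..b} \<Longrightarrow> \<phi> x = 0" "\<And>x. x \<notin> {a..b} \<Longrightarrow> deriv \<phi> x = 0"
proof -
  obtain K K' where K: "compact K" "\<And>x. x \<notin> K \<Longrightarrow> \<phi> x = 0" "compact K'" "\<And>x. x \<notin> K' \<Longrightarrow> deriv \<phi> x = 0"
    using assms test_fun_on_props(4)[OF assms] unfolding test_fun_on_def by blast
  have "bounded (K \<union> K')" using K by (simp add: compact_imp_bounded)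
  then obtain a where "\<forall>x\<in>K \<union> K'. norm x \<le> a" unfolding bounded_iff by blast
  then have a: "\<And>x. x \<in> K \<union> K' \<Longrightarrow> \<bar>x\<bar> \<le> a" by simp
  show ?thesis
  proof (rule that[of "- \<bar>a\<bar> - 1" "\<bar>a\<bar> + 1"])
    show "\<phi> x = 0" if "x \<notin> {- \<bar>a\<bar> - 1..\<bar>a\<bar> + 1}" for x
      using that a[of x] K(2)[of x] by (cases "x \<in> K") auto
    show "deriv \<phi> x = 0" if "x \<notin> {- \<bar>a\<bar> - 1..\<bar>a\<bar> + 1}" for x
      using that a[of x] K(4)[of x] by (cases "x \<in> K'") auto
  qed auto
qed

lemma prim_deriv:
  assumes "\<And>x. x \<in> {0..t} \<Longrightarrow> (f has_real_derivative f' x) (at x)" "continuous_on {0..t} f'" "0 \<le> t"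
  shows "prim f' t = f t - f (0::real)"
proof -
  have "(f has_vector_derivative f' x) (at x within {0..t})" if "0 \<le> x" "x \<le> t" for x
    using assms(1)[of x] that
    by (simp add: has_vector_derivative_at_within has_real_derivative_iff_has_vector_derivative)
  from integral_FTC_atLeastAtMost[OF assms(3) this assms(2)]
  show ?thesis by (simp add: prim_def set_lebesgue_integral_def)
qed

text \<open>A test function on \<open>I\<close> vanishes at \<open>0\<close>, which lies outside
  \<open>I\<close>, and is therefore the primitive of its derivative. Integration by parts of this
  derivative against \<open>f\<close> has no boundary term once the endpoint is beyond the
  support.\<close>

lemma weak_deriv_prim:
  fixes f :: "real \<Rightarrow> 'b::{banach, second_countable_topology}"
  assumes f: "locint f" and I: "I \<subseteq> {0<..}" and u: "\<And>t. t \<in> I \<Longrightarrow> u t = c + prim f t"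
  shows "weak_deriv_on I u f"
  unfolding weak_deriv_on_def
proof (intro conjI allI impI)
  have sub: "\<exists>T. K \<subseteq> {0..T}" if "compact K" "K \<subseteq> I" for K
  proof -
    have "bounded K" using that(1) by (rule compact_imp_bounded)
    then obtain T where "\<forall>x\<in>K. norm x \<le> T" unfolding bounded_iff by blast
    then have "K \<subseteq> {0..T}" using that(2) I by (auto simp: abs_le_iff)
    then show ?thesis by blast
  qed
  show "loc_integrable_on I f" unfolding loc_integrable_on_def
  proof (intro allI impI)
    fix K assume K: "compact K \<and> K \<subseteq> I"
    then obtain T where "K \<subseteq> {0..T}" using sub by blast
    then show "set_integrable lborel K f" using locint_subset[OF f, of K T] K by (auto intro: borel_compact)
  qed
  show "loc_integrable_on I u" unfolding loc_integrable_on_def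
  proof (intro allI impI)
    fix K assume K: "compact K \<and> K \<subseteq> I"
    have "set_integrable lborel K (\<lambda>t. c + prim f t)" unfolding set_integrable_def
      using K by (intro borel_integrable_compact continuous_intros continuous_prim f) auto
    moreover have "set_integrable lborel K (\<lambda>t. c + prim f t) \<longleftrightarrow> set_integrable lborel K u"
      by (rule set_integrable_cong) (use K u in auto)
    ultimately show "set_integrable lborel K u" by simp
  qed
  fix \<phi> assume t: "test_fun_on I \<phi>"
  obtain a T where T: "a < T" "\<And>x. x \<notin> {a..T} \<Longrightarrow> \<phi> x = 0" "\<And>x. x \<notin> {a..T} \<Longrightarrow> deriv \<phi> x = 0"
    using test_fun_on_support[OF t] by blast
  have zI: "\<phi> x = 0" "deriv \<phi> x = 0" if "x \<notin> I" for x
    using t test_fun_on_props(4)[OF t] that unfolding test_fun_on_def by blast+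
  \<comment> \<open>A positive time beyond the support, from which on \<open>\<phi>\<close> and its
    derivative vanish.\<close>
  define R where "R = max T 0 + 1"
  have R: "\<phi> x = 0" "deriv \<phi> x = 0" if "x \<ge> R" for x
  proof -
    have "T < x" using that by (simp add: R_def)
    then have "x \<notin> {a..T}" by simp
    then show "\<phi> x = 0" "deriv \<phi> x = 0" by (rule T(2), rule T(3))
  qed
  have R0: "R > 0" by (simp add: R_def)
  have d: "locint (deriv \<phi>)" by (rule locint_continuous[OF test_fun_on_props(3)[OF t]])
  have p: "prim (deriv \<phi>) s = \<phi> s" if "s \<ge> 0" for s
    using prim_deriv[of s \<phi> "deriv \<phi>"] test_fun_on_props[OF t] zI(1)[of 0] I that by auto
  have eq: "(LINT t:I|lborel. \<psi> t *\<^sub>R k t) = prim (\<lambda>t. \<psi> t *\<^sub>R k t) R"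
    if "\<And>x. x \<notin> I \<Longrightarrow> \<psi> x = 0" "\<And>x. x \<ge> R \<Longrightarrow> \<psi> x = (0::real)" for \<psi> and k :: "real \<Rightarrow> 'b"
    unfolding prim_def set_lebesgue_integral_def
  proof (rule Bochner_Integration.integral_cong[OF refl])
    fix x show "indicator I x *\<^sub>R \<psi> x *\<^sub>R k x = indicator {0..R} x *\<^sub>R \<psi> x *\<^sub>R k x"
      using that[of x] I by (auto simp: indicator_def not_le)
  qed
  note bp = prim_by_parts[OF bounded_bilinear_scaleR d f]
  have l1: "locint (\<lambda>s. deriv \<phi> s *\<^sub>R c)"
    by (rule locint_continuous) (intro continuous_intros test_fun_on_props(3)[OF t])
  have "(LINT t:I|lborel. deriv \<phi> t *\<^sub>R u t) = (LINT t:I|lborel. deriv \<phi> t *\<^sub>R (c + prim f t))"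
    unfolding set_lebesgue_integral_def
    by (rule Bochner_Integration.integral_cong[OF refl]) (auto simp: indicator_def u)
  also have "\<dots> = prim (\<lambda>t. deriv \<phi> t *\<^sub>R (c + prim f t)) R" by (rule eq) (use zI R in auto)
  also have "\<dots> = prim (\<lambda>t. deriv \<phi> t *\<^sub>R c) R + prim (\<lambda>t. deriv \<phi> t *\<^sub>R prim f t) R"
    by (subst prim_add[symmetric, OF l1 bp(1)]) (simp add: scaleR_add_right)
  also have "prim (\<lambda>t. deriv \<phi> t *\<^sub>R c) R = prim (deriv \<phi>) R *\<^sub>R c"
    by (rule prim_bounded_linear[OF bounded_linear_scaleR_left d])
  also have "\<dots> = 0" using p[of R] R R0 by simp
  also have "prim (\<lambda>t. deriv \<phi> t *\<^sub>R prim f t) R = - prim (\<lambda>t. prim (deriv \<phi>) t *\<^sub>R f t) R"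
    using bp(3)[of R] p[of R] R R0 by (simp add: eq_neg_iff_add_eq_0)
  also have "prim (\<lambda>t. prim (deriv \<phi>) t *\<^sub>R f t) R = prim (\<lambda>t. \<phi> t *\<^sub>R f t) R"
    by (rule prim_cong) (simp add: p)
  also have "\<dots> = (LINT t:I|lborel. \<phi> t *\<^sub>R f t)" by (rule eq[symmetric]) (use zI R in auto)
  finally show "(LINT t:I|lborel. deriv \<phi> t *\<^sub>R u t) = - (LINT t:I|lborel. \<phi> t *\<^sub>R f t)" by simp
qed

text \<open>A test function with integral zero is the derivative of a
  test function.\<close>

lemma du_Bois_Reymond:
  fixes f :: "real \<Rightarrow> 'b::{banach, second_countable_topology}"
  assumes ab: "a < b" and f: "loc_integrable_on {a<..<b} f"
    and z: "\<And>\<phi>. test_fun_on {a<..<b} \<phi> \<Longrightarrow> (LINT t:{a<..<b}|lborel. deriv \<phi> t *\<^sub>R f t) = 0"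
  obtains c where "AE t in lborel. t \<in> {a<..<b} \<longrightarrow> f t = c"
proof -
  let ?I = "{a<..<b}"
  obtain l r where lr: "a < l" "l < r" "r < b" using ab by (metis dense)
  define e where "e = bump l r 0"
  have e: "test_fun_on ?I e" unfolding e_def by (rule test_fun_bump) (use lr in auto)
  have ei: "integrable lborel \<psi>" if "test_fun_on ?I \<psi>" for \<psi> :: "real \<Rightarrow> real"
  proof -
    have "set_integrable lborel ?I (\<lambda>t. \<psi> t *\<^sub>R (1::real))"
      by (rule test_fun_set_integrable[OF that loc_integrable_on_const])
    moreover have "indicator ?I t *\<^sub>R \<psi> t *\<^sub>R 1 = \<psi> t" for t
      using that by (auto simp: test_fun_on_def indicator_def)
    ultimately show ?thesis by (simp only: set_integrable_def)
  qed
  define m where "m = integral\<^sup>L lborel e"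
  have "m \<noteq> 0"
  proof
    assume "m = 0"
    then have "AE t in lborel. e t = 0"
      using integral_nonneg_eq_0_iff_AE[OF ei[OF e]] bump_nonneg by (auto simp: m_def e_def)
    then have "AE t in lborel. t \<notin> {l<..<r}"
      by eventually_elim (simp only: e_def bump_eq_0_iff not_False_eq_True)
    then have "emeasure lborel {l<..<r} = 0"
      by (subst (asm) AE_iff_measurable[of "{l<..<r}"]) auto
    then show False using lr by simp
  qed
  define c where "c = (1 / m) *\<^sub>R (LINT t:?I|lborel. e t *\<^sub>R f t)"
  have "AE t in lborel. t \<in> ?I \<longrightarrow> f t - c = 0"
  proof (rule fundamental_lemma)
    show "loc_integrable_on ?I (\<lambda>t. f t - c)" by (intro loc_integrable_on_diff f loc_integrable_on_const)
    fix \<psi> assume p: "test_fun_on ?I \<psi>"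
    \<comment> \<open>Subtracting this multiple of the fixed bump \<open>e\<close> makes the
      integral of \<open>\<rho>\<close> zero, so that its primitive \<open>\<phi>\<close> has
      compact support and may be used in the assumption on derivatives of test functions.\<close>
    define k where "k = integral\<^sup>L lborel \<psi> / m"
    define \<rho> where "\<rho> t = \<psi> t + (- k) * e t" for t
    have sr: "smooth \<rho>" unfolding \<rho>_def
      using p e by (intro smooth_add smooth_cmult) (auto simp: test_fun_on_def)
    have cr: "continuous_on A \<rho>" for A by (rule smooth_continuous[OF sr])
    obtain K K' where K: "compact K" "K \<subseteq> ?I" "\<And>x. x \<notin> K \<Longrightarrow> \<psi> x = 0"
      "compact K'" "K' \<subseteq> ?I" "\<And>x. x \<notin> K' \<Longrightarrow> e x = 0"
      using p e unfolding test_fun_on_def by blast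
    \<comment> \<open>The midpoint is inserted to make the set nonempty, so that its minimum and
      maximum exist.\<close>
    let ?K = "insert ((a + b) / 2) (K \<union> K')"
    have KI: "compact ?K" "?K \<subseteq> ?I" "?K \<noteq> {}"
    proof -
      show "compact ?K" by (intro compact_insert compact_Un K)
      show "?K \<subseteq> ?I" using K(2,5) ab by simp
    qed simp
    obtain \<alpha> where al: "\<alpha> \<in> ?K" "\<And>x. x \<in> ?K \<Longrightarrow> \<alpha> \<le> x"
      using compact_attains_inf[OF KI(1,3)] by blast
    obtain \<beta> where be: "\<beta> \<in> ?K" "\<And>x. x \<in> ?K \<Longrightarrow> x \<le> \<beta>"
      using compact_attains_sup[OF KI(1,3)] by blast
    have ab': "a < \<alpha>" "\<alpha> \<le> \<beta>" "\<beta> < b"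
      using al(1) be(1) al(2)[OF be(1)] KI(2) by auto
    have zr: "\<rho> x = 0" if "x \<notin> {\<alpha>..\<beta>}" for x
    proof -
      have "x \<notin> ?K"
      proof
        assume "x \<in> ?K"
        from al(2)[OF this] be(2)[OF this] that show False by simp
      qed
      then have "x \<notin> K" "x \<notin> K'" by blast+
      from K(3)[OF this(1)] K(6)[OF this(2)] show ?thesis by (simp add: \<rho>_def)
    qed
    define \<phi> where "\<phi> x = (LBINT y=\<alpha>..x. \<rho> y)" for x :: real
    have d: "(\<phi> has_real_derivative \<rho> x) (at x)" for x
    proof -
      define A B where "A = min x \<alpha> - 1" and "B = max x \<alpha> + 1"
      have "((\<lambda>u. LBINT y=\<alpha>..u. \<rho> y) has_vector_derivative \<rho> x) (at x within {A..B})"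
      proof (rule interval_integral_FTC2)
        show "A \<le> \<alpha>" "\<alpha> \<le> B" "A \<le> x" "x \<le> B" by (simp_all add: A_def B_def)
      qed (rule cr)
      moreover have "at x within {A..B} = at x"
        by (rule at_within_interior) (auto simp: A_def B_def min_def max_def)
      ultimately show ?thesis
        unfolding \<phi>_def[abs_def] has_real_derivative_iff_has_vector_derivative by (simp only:)
    qed
    have sphi: "smooth \<phi>" by (rule smooth_antiderivative[OF sr d])
    have ip: "integrable lborel \<psi>" and ie: "integrable lborel (\<lambda>t. (- k) * e t)"
      using ei[OF p] ei[OF e] by simp_all
    have ir: "integrable lborel \<rho>" unfolding \<rho>_def[abs_def]
      by (rule Bochner_Integration.integrable_add[OF ip ie])
    have "integral\<^sup>L lborel \<rho> = integral\<^sup>L lborel \<psi> + (\<integral>t. (- k) * e t \<partial>lborel)"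
      unfolding \<rho>_def[abs_def] by (rule Bochner_Integration.integral_add[OF ip ie])
    also have "(\<integral>t. (- k) * e t \<partial>lborel) = (- k) * m" unfolding m_def by (rule integral_mult_right_zero)
    finally have tot: "integral\<^sup>L lborel \<rho> = 0" using \<open>m \<noteq> 0\<close> by (simp add: k_def)
    have zphi: "\<phi> x = 0" if "x \<notin> {\<alpha>..\<beta>}" for x
    proof (cases "x < \<alpha>")
      case True
      then have "\<phi> x = - (LBINT y=x..\<alpha>. \<rho> y)"
        unfolding \<phi>_def by (subst interval_integral_endpoints_reverse) simp
      also have "(LBINT y=x..\<alpha>. \<rho> y) = (LINT y:{x<..<\<alpha>}|lborel. \<rho> y)"
        using True by (simp add: interval_lebesgue_integral_def einterval_eq)
      also have "\<dots> = 0" unfolding set_lebesgue_integral_def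
        by (rule integral_eq_zero_AE) (auto simp: indicator_def zr)
      finally show ?thesis by simp
    next
      case False
      with that have x: "x > \<beta>" "\<alpha> \<le> \<beta>" using ab' by auto
      have "\<phi> x = (LINT y:{\<alpha><..<x}|lborel. \<rho> y)"
        unfolding \<phi>_def using x by (simp add: interval_lebesgue_integral_def einterval_eq)
      also have "\<dots> = integral\<^sup>L lborel \<rho>" unfolding set_lebesgue_integral_def
      proof (rule integral_cong_AE)
        show "AE t in lborel. indicator {\<alpha><..<x} t *\<^sub>R \<rho> t = \<rho> t"
          using AE_lborel_singleton[of \<alpha>] AE_lborel_singleton[of x]
        proof eventually_elim
          case (elim t)
          then have "t \<in> {\<alpha>..\<beta>} \<Longrightarrow> t \<in> {\<alpha><..<x}" using x by auto
          then show ?case using zr[of t] by (cases "t \<in> {\<alpha>..\<beta>}") auto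
        qed
      qed (use ir in auto)
      finally show ?thesis using tot by simp
    qed
    have "test_fun_on ?I \<phi>" unfolding test_fun_on_def
      by (intro conjI sphi exI[of _ "{\<alpha>..\<beta>}"]) (use zphi ab' in auto)
    moreover have "deriv \<phi> = \<rho>" using d by (auto intro!: DERIV_imp_deriv)
    ultimately have "(LINT t:?I|lborel. \<rho> t *\<^sub>R f t) = 0" using z[of \<phi>] by simp
    note i = test_fun_set_integrable[OF p f] test_fun_set_integrable[OF e f]
      test_fun_set_integrable[OF p loc_integrable_on_const, of c]
    have "(LINT t:?I|lborel. \<rho> t *\<^sub>R f t) = (LINT t:?I|lborel. \<psi> t *\<^sub>R f t - k *\<^sub>R e t *\<^sub>R f t)"
      by (simp add: \<rho>_def scaleR_diff_left)
    also have "\<dots> = (LINT t:?I|lborel. \<psi> t *\<^sub>R f t) - k *\<^sub>R (LINT t:?I|lborel. e t *\<^sub>R f t)"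
      using i by (subst set_integral_diff) (auto simp del: scaleR_scaleR)
    also have "k *\<^sub>R (LINT t:?I|lborel. e t *\<^sub>R f t) = integral\<^sup>L lborel \<psi> *\<^sub>R c"
      by (simp add: k_def c_def)
    also have "\<dots> = (\<integral>t. \<psi> t *\<^sub>R c \<partial>lborel)"
      using integral_scaleR_left[of c lborel \<psi>] ei[OF p] by simp
    also have "\<dots> = (LINT t:?I|lborel. \<psi> t *\<^sub>R c)"
    proof -
      have "indicator ?I t *\<^sub>R \<psi> t *\<^sub>R c = \<psi> t *\<^sub>R c" for t
        using p by (auto simp: test_fun_on_def indicator_def)
      then show ?thesis by (simp only: set_lebesgue_integral_def)
    qed
    finally have "(LINT t:?I|lborel. \<psi> t *\<^sub>R f t) - (LINT t:?I|lborel. \<psi> t *\<^sub>R c) = 0"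
      using \<open>(LINT t:?I|lborel. \<rho> t *\<^sub>R f t) = 0\<close> by simp
    then show "(LINT t:?I|lborel. \<psi> t *\<^sub>R (f t - c)) = 0"
      using i by (simp add: scaleR_diff_right set_integral_diff)
  qed auto
  then have "AE t in lborel. t \<in> ?I \<longrightarrow> f t = c" by eventually_elim auto
  then show ?thesis by (rule that)
qed

text \<open>The difference of \<open>u\<close> and a primitive of \<open>v\<close> has weak
  derivative zero and is constant by \<open>du_Bois_Reymond\<close>. The function \<open>v'\<close>
  extends \<open>v\<close> beyond the interval, because \<open>prim\<close> and
  \<open>locint\<close> refer to the closed half line.\<close>

lemma weak_deriv_primitive:
  fixes u v :: "real \<Rightarrow> 'b::{banach, second_countable_topology}"
  assumes T: "0 < T" and uv: "weak_deriv_on {0<..<T} u v" and v': "locint v'" "\<And>t. t \<in> {0<..<T} \<Longrightarrow> v' t = v t"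
  obtains c where "AE t in lborel. t \<in> {0<..<T} \<longrightarrow> u t = c + prim v' t"
proof -
  let ?I = "{0<..<T}"
  have w: "weak_deriv_on ?I (prim v') v'" by (rule weak_deriv_prim[OF v'(1), where c = 0]) auto
  have li: "loc_integrable_on ?I u" "loc_integrable_on ?I (prim v')"
    using uv w by (auto simp: weak_deriv_on_def)
  obtain c where "AE t in lborel. t \<in> ?I \<longrightarrow> u t - prim v' t = c"
  proof (rule du_Bois_Reymond[OF T loc_integrable_on_diff[OF li]])
    fix \<phi> assume t: "test_fun_on ?I \<phi>"
    have "(LINT t:?I|lborel. \<phi> t *\<^sub>R v' t) = (LINT t:?I|lborel. \<phi> t *\<^sub>R v t)"
      by (rule set_lebesgue_integral_cong) (use v' in auto)
    then have "(LINT t:?I|lborel. deriv \<phi> t *\<^sub>R u t) = (LINT t:?I|lborel. deriv \<phi> t *\<^sub>R prim v' t)"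
      using uv w t by (simp add: weak_deriv_on_def)
    then show "(LINT t:?I|lborel. deriv \<phi> t *\<^sub>R (u t - prim v' t)) = 0"
      using test_fun_set_integrable[OF test_fun_on_props(4)[OF t] li(1)]
        test_fun_set_integrable[OF test_fun_on_props(4)[OF t] li(2)]
      by (simp add: scaleR_diff_right set_integral_diff)
  qed
  then have "AE t in lborel. t \<in> ?I \<longrightarrow> u t = c + prim v' t" by eventually_elim (auto simp: algebra_simps)
  then show ?thesis by (rule that)
qed

section \<open>Paths with square integrable acceleration\<close>

definition locL2 :: "(real \<Rightarrow> 'b::{banach, second_countable_topology}) \<Rightarrow> bool" where
  "locL2 z \<longleftrightarrow> z \<in> borel_measurable borel \<and> (\<forall>T. (\<integral>\<^sup>+t\<in>{0..T}. ennreal ((norm (z t))\<^sup>2) \<partial>lborel) < \<infinity>)"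

text \<open>Paths are parametrised by their acceleration \<open>z\<close> together with the initial
  position and velocity. The initial conditions then hold by construction, and the minimization runs
  over the vector space of all \<open>locL2\<close> functions, where variations are free.\<close>

definition vel :: "'b \<Rightarrow> (real \<Rightarrow> 'b) \<Rightarrow> real \<Rightarrow> 'b::{banach, second_countable_topology}" where
  "vel u1 z t = u1 + prim z t"

definition pth :: "'b \<Rightarrow> 'b \<Rightarrow> (real \<Rightarrow> 'b) \<Rightarrow> real \<Rightarrow> 'b::{banach, second_countable_topology}" where
  "pth u0 u1 z t = u0 + prim (vel u1 z) t"

lemma locL2_measurable [measurable_dest]: "locL2 z \<Longrightarrow> z \<in> borel_measurable borel"
  by (simp add: locL2_def)

lemma locL2_sq:
  assumes "locL2 z" shows "locint (\<lambda>t. (norm (z t))\<^sup>2)"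
  unfolding locint_def set_integrable_def
proof
  fix T
  have [measurable]: "z \<in> borel_measurable borel" using assms by (rule locL2_measurable)
  show "integrable lborel (\<lambda>x. indicat_real {0..T} x *\<^sub>R (norm (z x))\<^sup>2)"
  proof (rule integrableI_nonneg)
    have "(\<integral>\<^sup>+ x. ennreal (indicat_real {0..T} x *\<^sub>R (norm (z x))\<^sup>2) \<partial>lborel)
      = (\<integral>\<^sup>+t\<in>{0..T}. ennreal ((norm (z t))\<^sup>2) \<partial>lborel)"
      by (rule nn_integral_cong) (simp add: indicator_def)
    then show "(\<integral>\<^sup>+ x. ennreal (indicat_real {0..T} x *\<^sub>R (norm (z x))\<^sup>2) \<partial>lborel) < \<infinity>"
      using assms by (simp add: locL2_def)
  qed (simp_all add: indicator_def)
qed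

lemma locL2I:
  assumes [measurable]: "z \<in> borel_measurable borel" and "locint (\<lambda>t. (norm (z t))\<^sup>2)"
  shows "locL2 z"
  unfolding locL2_def
proof (intro conjI allI)
  fix T
  have "integrable lborel (\<lambda>t. indicator {0..T} t *\<^sub>R (norm (z t))\<^sup>2)"
    using assms(2) by (rule locint_integrable)
  then have "(\<integral>\<^sup>+ t. ennreal (norm (indicator {0..T} t *\<^sub>R (norm (z t))\<^sup>2)) \<partial>lborel) < \<infinity>"
    by (simp only: integrable_iff_bounded)
  then show "(\<integral>\<^sup>+t\<in>{0..T}. ennreal ((norm (z t))\<^sup>2) \<partial>lborel) < \<infinity>"
    by (rule le_less_trans[rotated]) (rule nn_integral_mono, simp add: indicator_def)
qed (rule assms(1))

lemma locint_bound:
  fixes f :: "real \<Rightarrow> 'b::{banach, second_countable_topology}"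
  assumes "locint g" and f: "f \<in> borel_measurable borel" and b: "\<And>t. 0 \<le> t \<Longrightarrow> norm (f t) \<le> norm (g t)"
  shows "locint f"
  unfolding locint_def set_integrable_def
proof
  fix T
  show "integrable lborel (\<lambda>x. indicat_real {0..T} x *\<^sub>R f x)"
    by (rule Bochner_Integration.integrable_bound[OF locint_integrable[OF assms(1), of T]])
       (use f b in \<open>simp_all add: indicator_def\<close>)
qed

lemma locL2_locint: 
  assumes "locL2 z" shows "locint z"
proof (rule locint_bound)
  show "locint (\<lambda>t. 1 + (norm (z t))\<^sup>2)"
    by (intro locint_add locL2_sq assms locint_continuous continuous_on_const)
  show "norm (z t) \<le> norm (1 + (norm (z t))\<^sup>2)" for t
    using sum_power2_ge_zero[of "norm (z t) - 1" 0] by (simp add: power2_diff) (smt (verit) zero_le_power2 norm_ge_zero)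
qed (use assms in \<open>simp add: locL2_def\<close>)

lemma continuous_vel: "locint z \<Longrightarrow> continuous_on A (vel u1 z)"
  unfolding vel_def[abs_def] by (intro continuous_intros continuous_prim)

lemma locint_vel: "locint z \<Longrightarrow> locint (vel u1 z)"
  by (rule locint_continuous[OF continuous_vel])

lemma continuous_pth: "locint z \<Longrightarrow> continuous_on A (pth u0 u1 z)"
  unfolding pth_def[abs_def] by (intro continuous_intros continuous_prim locint_vel)

lemma measurable_vel: "locint z \<Longrightarrow> vel u1 z \<in> borel_measurable borel"
  and measurable_pth: "locint z \<Longrightarrow> pth u0 u1 z \<in> borel_measurable borel"
  by (intro borel_measurable_continuous_onI continuous_vel continuous_pth; assumption)+

lemma vel_0 [simp]: "vel u1 z 0 = u1" and pth_0 [simp]: "pth u0 u1 z 0 = u0"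
  by (simp_all add: vel_def pth_def)

text \<open>The set of agreement is relatively closed and its complement in \<open>I\<close> is
  null. A nonempty open set is never null, so the set contains \<open>I\<close> and then its
  closure.\<close>

lemma eq_on_closure_AE:
  fixes f g :: "real \<Rightarrow> 'b::real_normed_vector"
  assumes I: "open I" and c: "continuous_on (closure I) f" "continuous_on (closure I) g"
    and ae: "AE t in lborel. t \<in> I \<longrightarrow> f t = g t" and t: "t \<in> closure I"
  shows "f t = g t"
proof -
  let ?C = "{t \<in> closure I. f t = g t}"
  have "closed {t \<in> closure I. f t - g t = 0}"
    by (intro continuous_closed_preimage_constant continuous_on_diff c) simp
  then have cl: "closed ?C" by simp
  have "AE t \<in> I in lebesgue. t \<in> ?C"
    using AE_completion[OF ae] closure_subset[of I] by (auto elim!: eventually_mono)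
  then have "I \<subseteq> ?C" using mem_closed_if_AE_lebesgue_open[OF I cl] by blast
  then have "closure I \<subseteq> ?C" using cl by (rule closure_minimal)
  then show ?thesis using t by blast
qed

section \<open>The derivative selected by \<open>wderiv\<close>\<close>

lemma wderiv_weak_deriv:
  assumes "weak_deriv_on I u v" shows "weak_deriv_on I u (wderiv I u)"
proof (cases "\<exists>v. weak_deriv_on I u v \<and> continuous_on (closure I) v")
  case True
  then show ?thesis using someI_ex[OF True] by (simp add: wderiv_def)
next
  case False
  then show ?thesis using someI[of "weak_deriv_on I u" v, OF assms]
    by (simp only: wderiv_def if_not_P[OF False] if_False)
qed

lemma wderiv_AE:
  assumes "open I" "weak_deriv_on I u v"
  shows "AE t in lborel. t \<in> I \<longrightarrow> wderiv I u t = v t"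
  by (rule weak_deriv_unique[OF assms(1) wderiv_weak_deriv[OF assms(2)] assms(2)])

lemma wderiv_eq:
  assumes I: "open I" and v: "weak_deriv_on I u v" and c: "continuous_on (closure I) v" and t: "t \<in> closure I"
  shows "wderiv I u t = v t"
proof -
  have "weak_deriv_on I u (wderiv I u) \<and> continuous_on (closure I) (wderiv I u)"
  proof -
    have ex: "\<exists>v. weak_deriv_on I u v \<and> continuous_on (closure I) v" using v c by blast
    show ?thesis using someI_ex[OF ex] ex by (simp add: wderiv_def)
  qed
  then show ?thesis
    by (intro eq_on_closure_AE[OF I _ c wderiv_AE[OF I v] t]) simp
qed

lemma set_integrable_cong_on:
  "(\<And>t. t \<in> K \<Longrightarrow> u t = u' t) \<Longrightarrow> set_integrable lborel K u = set_integrable lborel K u'"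
  by (rule set_integrable_cong) simp_all

lemma weak_deriv_on_cong:
  assumes u: "\<And>t. t \<in> I \<Longrightarrow> u t = u' t" and v: "\<And>t. t \<in> I \<Longrightarrow> v t = v' t"
  shows "weak_deriv_on I u v = weak_deriv_on I u' v'"
proof -
  have li: "loc_integrable_on I a = loc_integrable_on I b" if "\<And>t. t \<in> I \<Longrightarrow> a t = b t" for a b :: "real \<Rightarrow> 'a"
    unfolding loc_integrable_on_def
    by (intro all_cong1 imp_cong refl set_integrable_cong_on) (use that in blast)
  have "(LINT t:I|lborel. \<phi> t *\<^sub>R a t) = (LINT t:I|lborel. \<phi> t *\<^sub>R b t)"
    if "\<And>t. t \<in> I \<Longrightarrow> a t = b t" for a b :: "real \<Rightarrow> 'a" and \<phi> :: "real \<Rightarrow> real"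
    unfolding set_lebesgue_integral_def
    by (rule Bochner_Integration.integral_cong[OF refl]) (simp add: indicator_def that)
  then have "(LINT t:I|lborel. \<phi> t *\<^sub>R u t) = (LINT t:I|lborel. \<phi> t *\<^sub>R u' t)"
    "(LINT t:I|lborel. \<phi> t *\<^sub>R v t) = (LINT t:I|lborel. \<phi> t *\<^sub>R v' t)" for \<phi> :: "real \<Rightarrow> real"
    using u v by blast+
  moreover have "loc_integrable_on I u = loc_integrable_on I u'" "loc_integrable_on I v = loc_integrable_on I v'"
    using li u v by blast+
  ultimately show ?thesis unfolding weak_deriv_on_def by simp
qed

text \<open>\<open>wderiv\<close> picks by \<open>SOME\<close> from a predicate that sees only the
  values of \<open>u\<close> on \<open>I\<close>. Equal predicates give the same choice, so this is
  an equality of functions at all times, which may be used below a second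
  \<open>wderiv\<close>.\<close>

lemma wderiv_cong:
  assumes "\<And>t. t \<in> I \<Longrightarrow> u t = u' t" shows "wderiv I u = wderiv I u'"
proof -
  have "weak_deriv_on I u v = weak_deriv_on I u' v" for v
    by (rule weak_deriv_on_cong) (simp_all add: assms)
  then have "weak_deriv_on I u = weak_deriv_on I u'" by (rule ext)
  then show ?thesis by (simp only: wderiv_def)
qed

lemma weak_deriv_on_AE_cong:
  fixes u :: "real \<Rightarrow> 'b::{banach, second_countable_topology}"
  assumes uv: "weak_deriv_on I u v" and u': "loc_integrable_on I u'" and ae: "AE t in lborel. t \<in> I \<longrightarrow> u t = u' t"
  shows "weak_deriv_on I u' v"
  unfolding weak_deriv_on_def
proof (intro conjI allI impI)
  show "loc_integrable_on I v" using uv by (simp add: weak_deriv_on_def)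
  fix \<phi> assume t: "test_fun_on I \<phi>"
  have i: "set_integrable lborel I (\<lambda>t. deriv \<phi> t *\<^sub>R u t)" "set_integrable lborel I (\<lambda>t. deriv \<phi> t *\<^sub>R u' t)"
    using test_fun_set_integrable[OF test_fun_on_props(4)[OF t]] uv u' by (auto simp: weak_deriv_on_def)
  have "(LINT t:I|lborel. deriv \<phi> t *\<^sub>R u t) = (LINT t:I|lborel. deriv \<phi> t *\<^sub>R u' t)"
    unfolding set_lebesgue_integral_def
  proof (rule integral_cong_AE)
    show "AE t in lborel. indicator I t *\<^sub>R deriv \<phi> t *\<^sub>R u t = indicator I t *\<^sub>R deriv \<phi> t *\<^sub>R u' t"
      using ae by eventually_elim (simp add: indicator_def)
  qed (use set_integrable_measurable[OF i(1)] set_integrable_measurable[OF i(2)] in simp_all)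
  then show "(LINT t:I|lborel. deriv \<phi> t *\<^sub>R u' t) = - (LINT t:I|lborel. \<phi> t *\<^sub>R v t)"
    using uv t by (simp add: weak_deriv_on_def)
qed (rule u')

lemma weak_deriv_pth:
  assumes z: "locint z" and w: "\<And>t. t \<in> I \<Longrightarrow> w t = pth u0 u1 z t" and I: "I \<subseteq> {0<..}"
  shows "weak_deriv_on I w (vel u1 z)"
  by (rule weak_deriv_prim[OF locint_vel[OF z] I, where c = u0]) (simp add: w pth_def)

lemma weak_deriv_vel:
  assumes z: "locint z" and I: "I \<subseteq> {0<..}"
  shows "weak_deriv_on I (vel u1 z) z"
  by (rule weak_deriv_prim[OF z I, where c = u1]) (simp add: vel_def)

text \<open>The velocity is continuous up to time \<open>0\<close>, so the continuous representative
  selected by \<open>wderiv\<close> coincides with it at every nonnegative time. The acceleration is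
  identified almost everywhere only.\<close>

lemma wderiv_pth:
  assumes z: "locint z" and w: "\<And>t. t \<ge> 0 \<Longrightarrow> w t = pth u0 u1 z t"
  shows "t \<ge> 0 \<Longrightarrow> wderiv {0<..} w t = vel u1 z t"
    and "AE t in lborel. 0 < t \<longrightarrow> wderiv {0<..} (wderiv {0<..} w) t = z t"
    and "wderiv {0<..} w = wderiv {0<..} (pth u0 u1 z)"
proof -
  have 1: "wderiv {0<..} w t = vel u1 z t" if "t \<ge> 0" for t
    by (rule wderiv_eq[OF _ weak_deriv_pth[OF z]]) (use that w in \<open>auto intro: continuous_vel[OF z]\<close>)
  then show "t \<ge> 0 \<Longrightarrow> wderiv {0<..} w t = vel u1 z t" .
  have "weak_deriv_on {0<..} (wderiv {0<..} w) z"
    using weak_deriv_vel[OF z, of "{0<..}" u1] weak_deriv_on_cong[of "{0<..}" "wderiv {0<..} w" "vel u1 z" z z] 1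
    by auto
  from wderiv_AE[OF _ this] show "AE t in lborel. 0 < t \<longrightarrow> wderiv {0<..} (wderiv {0<..} w) t = z t"
    by simp
  show "wderiv {0<..} w = wderiv {0<..} (pth u0 u1 z)" by (rule wderiv_cong) (simp add: w)
qed

lemma L2_on_continuous:
  fixes f :: "real \<Rightarrow> 'b::{banach, second_countable_topology}"
  assumes "continuous_on UNIV f" shows "L2_on {0<..<T} f"
  unfolding L2_on_def
proof
  have [measurable]: "f \<in> borel_measurable borel" using assms by (rule borel_measurable_continuous_onI)
  show "set_borel_measurable lborel {0<..<T} f" unfolding set_borel_measurable_def by measurable
  have "locL2 f"
    by (rule locL2I) (auto intro!: locint_continuous continuous_intros continuous_on_subset[OF assms])
  then have "(\<integral>\<^sup>+t\<in>{0..T}. ennreal ((norm (f t))\<^sup>2) \<partial>lborel) < \<infinity>" by (simp add: locL2_def)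
  then show "(\<integral>\<^sup>+t\<in>{0<..<T}. ennreal ((norm (f t))\<^sup>2) \<partial>lborel) < \<infinity>"
    by (rule le_less_trans[rotated]) (rule nn_set_integral_set_mono, auto)
qed

lemma L2_on_locL2: "locL2 z \<Longrightarrow> L2_on {0<..<T} z"
  unfolding L2_on_def
proof
  assume z: "locL2 z"
  then have [measurable]: "z \<in> borel_measurable borel" by (rule locL2_measurable)
  show "set_borel_measurable lborel {0<..<T} z" unfolding set_borel_measurable_def by measurable
  have "(\<integral>\<^sup>+t\<in>{0..T}. ennreal ((norm (z t))\<^sup>2) \<partial>lborel) < \<infinity>" using z by (simp add: locL2_def)
  then show "(\<integral>\<^sup>+t\<in>{0<..<T}. ennreal ((norm (z t))\<^sup>2) \<partial>lborel) < \<infinity>"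
    by (rule le_less_trans[rotated]) (rule nn_set_integral_set_mono, auto)
qed

section \<open>Representation of paths by their accelerations\<close>

lemma H2_loc_pth: "locL2 z \<Longrightarrow> H2_loc (pth u0 u1 z)"
  unfolding H2_loc_def H2_on_def H1_on_def
proof (intro allI impI conjI exI)
  fix T :: real assume z: "locL2 z"
  note zi = locL2_locint[OF z]
  show "L2_on {0<..<T} (pth u0 u1 z)" "L2_on {0<..<T} (vel u1 z)"
    by (intro L2_on_continuous continuous_pth continuous_vel zi)+
  show "weak_deriv_on {0<..<T} (pth u0 u1 z) (vel u1 z)" by (rule weak_deriv_pth[OF zi]) auto
  show "weak_deriv_on {0<..<T} (vel u1 z) z" by (rule weak_deriv_vel[OF zi]) auto
  show "L2_on {0<..<T} z" by (rule L2_on_locL2[OF z])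
qed

lemma L2_on_extend:
  fixes u :: "real \<Rightarrow> 'b::{banach, second_countable_topology}"
  assumes "L2_on {0<..<T} u"
  shows "locL2 (\<lambda>t. indicator {0<..<T} t *\<^sub>R u t)"
  unfolding locL2_def
proof (intro conjI allI)
  show "(\<lambda>t. indicat_real {0<..<T} t *\<^sub>R u t) \<in> borel_measurable borel"
    using assms by (simp add: L2_on_def set_borel_measurable_def)
  fix S
  have "(\<integral>\<^sup>+ t\<in>{0..S}. ennreal ((norm (indicat_real {0<..<T} t *\<^sub>R u t))\<^sup>2) \<partial>lborel)
      \<le> (\<integral>\<^sup>+t\<in>{0<..<T}. ennreal ((norm (u t))\<^sup>2) \<partial>lborel)"
    by (rule nn_integral_mono) (simp add: indicator_def)
  also have "\<dots> < \<infinity>" using assms by (simp add: L2_on_def)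
  finally show "(\<integral>\<^sup>+ t\<in>{0..S}. ennreal ((norm (indicat_real {0<..<T} t *\<^sub>R u t))\<^sup>2) \<partial>lborel) < \<infinity>" .
qed

text \<open>The weak derivatives are extended by zero and integrated back twice, each time up to a
  constant. Continuity of \<open>w\<close> upgrades equality almost everywhere to the closed
  interval and identifies the outer constant as \<open>w 0\<close>.\<close>

lemma H2_on_rep:
  fixes w :: "real \<Rightarrow> 'b::{banach, second_countable_topology}"
  assumes T: "0 < T" and w: "H2_on {0<..<T} w" "continuous_on {0..} w"
  obtains d z where "locL2 z" "\<And>t. t \<in> {0..T} \<Longrightarrow> w t = pth (w 0) d z t"
proof -
  let ?I = "{0<..<T}"
  obtain v z where v: "weak_deriv_on ?I w v" "L2_on ?I v" and z: "weak_deriv_on ?I v z" "L2_on ?I z"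
    using w unfolding H2_on_def H1_on_def by blast
  define v' z' where "v' t = indicator ?I t *\<^sub>R v t" and "z' t = indicator ?I t *\<^sub>R z t" for t
  have v': "locL2 v'" and z': "locL2 z'"
    unfolding v'_def[abs_def] z'_def[abs_def] by (intro L2_on_extend v z)+
  note v'i = locL2_locint[OF v'] and z'i = locL2_locint[OF z']
  obtain d where d: "AE t in lborel. t \<in> ?I \<longrightarrow> v t = d + prim z' t"
    by (rule weak_deriv_primitive[OF T z(1) z'i]) (auto simp: z'_def)
  obtain c where c: "AE t in lborel. t \<in> ?I \<longrightarrow> w t = c + prim v' t"
    by (rule weak_deriv_primitive[OF T v(1) v'i]) (auto simp: v'_def)
  have pv: "prim v' t = prim (vel d z') t" if "t \<in> ?I" for t
  proof (rule prim_cong_AE[OF v'i locint_vel[OF z'i]])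
    show "AE s in lborel. 0 < s \<and> s < t \<longrightarrow> v' s = vel d z' s"
      using d by eventually_elim (use that in \<open>auto simp: v'_def vel_def\<close>)
  qed
  have "AE t in lborel. t \<in> ?I \<longrightarrow> w t = pth c d z' t"
    using c by eventually_elim (auto simp: pth_def pv)
  then have eq: "w t = pth c d z' t" if "t \<in> {0..T}" for t
    by (rule eq_on_closure_AE[of ?I w "pth c d z'" t, rotated 3])
       (use T that in \<open>auto intro: continuous_on_subset[OF w(2)] continuous_pth[OF z'i]\<close>)
  then have "c = w 0" using T by simp
  then show ?thesis using eq z' that by blast
qed

lemma pth_unique:
  assumes T: "0 < T" and z: "locint z" "locint z'" and eq: "\<And>t. t \<in> {0..T} \<Longrightarrow> pth c d z t = pth c' d' z' t"
  shows "d = d'" "AE t in lborel. t \<in> {0<..<T} \<longrightarrow> z t = z' t"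
proof -
  let ?I = "{0<..<T}"
  have "weak_deriv_on ?I (pth c d z) (vel d z)" by (rule weak_deriv_pth[OF z(1)]) auto
  moreover have "weak_deriv_on ?I (pth c d z) (vel d' z')"
    by (rule weak_deriv_pth[OF z(2)]) (use eq in auto)
  ultimately have ae: "AE t in lborel. t \<in> ?I \<longrightarrow> vel d z t = vel d' z' t"
    by (intro weak_deriv_unique) auto
  have v: "vel d z t = vel d' z' t" if "t \<in> {0..T}" for t
    by (rule eq_on_closure_AE[OF _ _ _ ae]) (use T that in \<open>auto intro: continuous_vel[OF z(1)] continuous_vel[OF z(2)]\<close>)
  from this[of 0] show "d = d'" using T by simp
  have "weak_deriv_on ?I (vel d z) z" by (rule weak_deriv_vel[OF z(1)]) auto
  moreover have "weak_deriv_on ?I (vel d' z') z'" by (rule weak_deriv_vel[OF z(2)]) auto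
  moreover have "weak_deriv_on ?I (vel d z) z' = weak_deriv_on ?I (vel d' z') z'"
    by (rule weak_deriv_on_cong) (use v in auto)
  ultimately have "weak_deriv_on ?I (vel d z) z" "weak_deriv_on ?I (vel d z) z'" by blast+
  then show "AE t in lborel. t \<in> ?I \<longrightarrow> z t = z' t"
    by (rule weak_deriv_unique[OF open_greaterThanLessThan])
qed

text \<open>Representations on the intervals of length \<open>Suc n\<close> are glued. By
  \<open>pth_unique\<close> they have the same initial velocity, and their accelerations agree
  almost everywhere on the shorter of two intervals.\<close>

lemma H2_loc_rep:
  fixes w :: "real \<Rightarrow> 'b::{banach, second_countable_topology}"
  assumes w: "H2_loc w" "continuous_on {0..} w"
  obtains d z where "locL2 z" "\<And>t. t \<ge> 0 \<Longrightarrow> w t = pth (w 0) d z t"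
proof -
  have "\<exists>p. locL2 (snd p) \<and> (\<forall>t\<in>{0..real (Suc n)}. w t = pth (w 0) (fst p) (snd p) t)" for n
  proof -
    have a: "0 < real (Suc n)" by simp
    then have b: "H2_on {0<..<real (Suc n)} w" using w(1)[unfolded H2_loc_def, rule_format] by blast
    show ?thesis
    proof (rule H2_on_rep[OF a b w(2)])
      fix d z assume "locL2 z" "\<And>t. t \<in> {0..real (Suc n)} \<Longrightarrow> w t = pth (w 0) d z t"
      then show ?thesis
        by (intro exI[of _ "(d, z)"] conjI ballI) (simp_all only: fst_conv snd_conv)
    qed
  qed
  then have "\<exists>p. \<forall>n. locL2 (snd (p n)) \<and> (\<forall>t\<in>{0..real (Suc n)}. w t = pth (w 0) (fst (p n)) (snd (p n)) t)"
    by (intro choice allI)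
  then obtain p where "\<forall>n. locL2 (snd (p n)) \<and> (\<forall>t\<in>{0..real (Suc n)}. w t = pth (w 0) (fst (p n)) (snd (p n)) t)" ..
  then have p: "\<And>n. locL2 (snd (p n))" "\<And>n t. t \<in> {0..real (Suc n)} \<Longrightarrow> w t = pth (w 0) (fst (p n)) (snd (p n)) t"
    by blast+
  define d where "d = fst (p 0)"
  define zs where "zs n = snd (p n)" for n
  have zs: "locL2 (zs n)" "locint (zs n)" for n using p(1) by (auto simp: zs_def intro: locL2_locint)
  have [measurable]: "zs n \<in> borel_measurable borel" for n using zs(1) by (rule locL2_measurable)
  have u: "fst (p n) = fst (p m)" "AE t in lborel. t \<in> {0<..<real (Suc n)} \<longrightarrow> zs n t = zs m t" if "n \<le> m" for n m
  proof -
    have "pth (w 0) (fst (p n)) (zs n) t = pth (w 0) (fst (p m)) (zs m) t" if "t \<in> {0..real (Suc n)}" for t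
    proof -
      have "t \<in> {0..real (Suc m)}" using that \<open>n \<le> m\<close> by auto
      then show ?thesis using p(2)[of t n] p(2)[of t m] that unfolding zs_def by metis
    qed
    note pth_unique[OF _ zs(2) zs(2), of "real (Suc n)", OF _ this]
    then show "fst (p n) = fst (p m)" "AE t in lborel. t \<in> {0<..<real (Suc n)} \<longrightarrow> zs n t = zs m t"
      by simp_all
  qed
  have fd: "fst (p n) = d" for n using u(1)[of 0 n] by (simp add: d_def)
  \<comment> \<open>For positive \<open>t\<close> this takes the first interval that contains
    \<open>t\<close> in its interior. A choice among countably many measurable functions by a
    measurable index is measurable.\<close>
  define z where "z t = zs (nat \<lfloor>t\<rfloor>) t" for t
  have zm [measurable]: "z \<in> borel_measurable borel"
    unfolding z_def[abs_def] by (rule measurable_compose_countable) measurable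
  have zz: "AE t in lborel. t \<in> {0<..<real (Suc n)} \<longrightarrow> z t = zs n t" for n
  proof -
    have "AE t in lborel. \<forall>m\<in>{..n}. t \<in> {0<..<real (Suc m)} \<longrightarrow> zs m t = zs n t"
      by (subst AE_ball_countable) (use u(2) in auto)
    then show ?thesis
    proof eventually_elim
      case (elim t)
      show ?case
      proof
        assume t: "t \<in> {0<..<real (Suc n)}"
        then have f: "\<lfloor>t\<rfloor> \<ge> 0" "\<lfloor>t\<rfloor> < int (Suc n)" by (auto simp: floor_less_iff)
        have "t < real_of_int \<lfloor>t\<rfloor> + 1" by linarith
        moreover have "real (Suc (nat \<lfloor>t\<rfloor>)) = real_of_int \<lfloor>t\<rfloor> + 1" using f by simp
        ultimately have tn: "t \<in> {0<..<real (Suc (nat \<lfloor>t\<rfloor>))}" using t by (simp del: of_nat_Suc)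
        have "nat \<lfloor>t\<rfloor> \<in> {..n}" using f by simp
        then show "z t = zs n t" unfolding z_def using elim tn by blast
      qed
    qed
  qed
  have lz: "locL2 z" unfolding locL2_def
  proof (intro conjI allI zm)
    fix T :: real
    obtain n where n: "T < real n" using reals_Archimedean2 by blast
    have "(\<integral>\<^sup>+t\<in>{0..T}. ennreal ((norm (z t))\<^sup>2) \<partial>lborel) = (\<integral>\<^sup>+t\<in>{0..T}. ennreal ((norm (zs n t))\<^sup>2) \<partial>lborel)"
    proof (rule nn_integral_cong_AE)
      show "AE t in lborel. ennreal ((norm (z t))\<^sup>2) * indicator {0..T} t = ennreal ((norm (zs n t))\<^sup>2) * indicator {0..T} t"
        using zz[of n] AE_lborel_singleton[of 0] by eventually_elim (use n in \<open>auto simp: indicator_def\<close>)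
    qed
    also have "\<dots> < \<infinity>" using zs(1) by (simp add: locL2_def)
    finally show "(\<integral>\<^sup>+t\<in>{0..T}. ennreal ((norm (z t))\<^sup>2) \<partial>lborel) < \<infinity>" .
  qed
  have "w t = pth (w 0) d z t" if "t \<ge> 0" for t
  proof -
    obtain n where n: "t < real n" using reals_Archimedean2 by blast
    have "prim (zs n) s = prim z s" if "s \<le> t" for s
    proof (rule prim_cong_AE[OF zs(2) locL2_locint[OF lz]])
      show "AE r in lborel. 0 < r \<and> r < s \<longrightarrow> zs n r = z r"
        using zz[of n] by eventually_elim (use n that in auto)
    qed
    then have "prim (vel d (zs n)) t = prim (vel d z) t"
      by (intro prim_cong) (simp add: vel_def)
    then show ?thesis using p(2)[of t n] n that fd[of n] by (simp add: zs_def pth_def)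
  qed
  with lz show ?thesis by (rule that)
qed

section \<open>The functional in terms of the acceleration\<close>

definition wfun :: "('b::{banach, second_countable_topology} \<Rightarrow> ennreal) \<Rightarrow> 'b \<Rightarrow> 'b \<Rightarrow> real \<Rightarrow> (real \<Rightarrow> 'b) \<Rightarrow> ennreal" where
  "wfun \<W> u0 u1 \<epsilon> z = ennreal (\<epsilon>\<^sup>2 / 2) * (\<integral>\<^sup>+t\<in>{0..}. ennreal (exp (- t / \<epsilon>) * (norm (z t))\<^sup>2) \<partial>lborel)
     + (\<integral>\<^sup>+t\<in>{0..}. ennreal (exp (- t / \<epsilon>)) * \<W> (pth u0 u1 z t) \<partial>lborel)"

lemma weighted_functional_pth:
  assumes z: "locL2 z" and w: "\<And>t. t \<ge> 0 \<Longrightarrow> w t = pth u0 u1 z t"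
  shows "weighted_functional \<W> \<epsilon> w = wfun \<W> u0 u1 \<epsilon> z"
proof -
  have "(\<integral>\<^sup>+t\<in>{0..}. ennreal (exp (- t / \<epsilon>) * (norm (wderiv {0<..} (wderiv {0<..} w) t))\<^sup>2) \<partial>lborel)
    = (\<integral>\<^sup>+t\<in>{0..}. ennreal (exp (- t / \<epsilon>) * (norm (z t))\<^sup>2) \<partial>lborel)"
  proof (rule nn_integral_cong_AE)
    show "AE t in lborel. ennreal (exp (- t / \<epsilon>) * (norm (wderiv {0<..} (wderiv {0<..} w) t))\<^sup>2) * indicator {0..} t =
      ennreal (exp (- t / \<epsilon>) * (norm (z t))\<^sup>2) * indicator {0..} t"
      using wderiv_pth(2)[OF locL2_locint[OF z], of w u0 u1, OF w, simplified] AE_lborel_singleton[of 0]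
      by eventually_elim (simp add: indicator_def)
  qed
  moreover have "(\<integral>\<^sup>+t\<in>{0..}. ennreal (exp (- t / \<epsilon>)) * \<W> (w t) \<partial>lborel)
     = (\<integral>\<^sup>+t\<in>{0..}. ennreal (exp (- t / \<epsilon>)) * \<W> (pth u0 u1 z t) \<partial>lborel)"
    by (rule nn_integral_cong) (simp add: indicator_def w)
  ultimately show ?thesis by (simp only: weighted_functional_def wfun_def)
qed

lemma competitor_pth:
  assumes z: "locL2 z" shows "competitor J w0 w1 (pth (J w0) (J w1) z)"
proof -
  note zi = locL2_locint[OF z]
  have "wderiv {0<..} (pth (J w0) (J w1) z) 0 = vel (J w1) z 0"
    by (rule wderiv_pth(1)[OF zi refl]) simp_all
  then show ?thesis
    unfolding competitor_def by (simp add: H2_loc_pth[OF z] continuous_pth[OF zi])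
qed

lemma competitor_rep:
  assumes "competitor J w0 w1 w"
  obtains z where "locL2 z" "\<And>t. t \<ge> 0 \<Longrightarrow> w t = pth (J w0) (J w1) z t"
proof -
  have w: "H2_loc w" "continuous_on {0..} w" "w 0 = J w0" "wderiv {0<..} w 0 = J w1"
    using assms by (auto simp: competitor_def)
  obtain d z where z: "locL2 z" "\<And>t. t \<ge> 0 \<Longrightarrow> w t = pth (w 0) d z t"
    using H2_loc_rep[OF w(1,2)] by blast
  from wderiv_pth(1)[OF locL2_locint[OF z(1)] z(2), of 0] w(4) have "d = J w1" by simp
  with z w(3) show ?thesis using that by simp
qed

text \<open>Comparison with all competitors becomes comparison with all \<open>locL2\<close>
  accelerations. The minimizer itself is known only on nonnegative times, which is all that the
  functional sees.\<close>

lemma minimizer_rep: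
  assumes "minimizer J \<W> w0 w1 \<epsilon> w"
  obtains z where "locL2 z" "\<And>t. t \<ge> 0 \<Longrightarrow> w t = pth (J w0) (J w1) z t"
    "\<And>z'. locL2 z' \<Longrightarrow> wfun \<W> (J w0) (J w1) \<epsilon> z \<le> wfun \<W> (J w0) (J w1) \<epsilon> z'"
proof -
  have w: "competitor J w0 w1 w"
    and min: "\<And>u. competitor J w0 w1 u \<Longrightarrow> weighted_functional \<W> \<epsilon> w \<le> weighted_functional \<W> \<epsilon> u"
    using assms by (auto simp: minimizer_def)
  obtain z where z: "locL2 z" "\<And>t. t \<ge> 0 \<Longrightarrow> w t = pth (J w0) (J w1) z t"
    using competitor_rep[OF w] by blast
  have "wfun \<W> (J w0) (J w1) \<epsilon> z \<le> wfun \<W> (J w0) (J w1) \<epsilon> z'" if z': "locL2 z'" for z'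
    using min[OF competitor_pth[OF z']] weighted_functional_pth[OF z', of "pth (J w0) (J w1) z'" "J w0" "J w1" \<W> \<epsilon>]
      weighted_functional_pth[OF z(1), of w "J w0" "J w1" \<W> \<epsilon>, OF z(2)] by simp
  with z show ?thesis by (rule that)
qed

lemma minimizerI:
  assumes z: "locL2 z" and min: "\<And>z'. locL2 z' \<Longrightarrow> wfun \<W> (J w0) (J w1) \<epsilon> z \<le> wfun \<W> (J w0) (J w1) \<epsilon> z'"
  shows "minimizer J \<W> w0 w1 \<epsilon> (pth (J w0) (J w1) z)"
  unfolding minimizer_def
proof (intro conjI allI impI competitor_pth z)
  fix u assume "competitor J w0 w1 u"
  then obtain z' where z': "locL2 z'" "\<And>t. t \<ge> 0 \<Longrightarrow> u t = pth (J w0) (J w1) z' t"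
    using competitor_rep by metis
  show "weighted_functional \<W> \<epsilon> (pth (J w0) (J w1) z) \<le> weighted_functional \<W> \<epsilon> u"
    using min[OF z'(1)] weighted_functional_pth[OF z, of "pth (J w0) (J w1) z" "J w0" "J w1" \<W> \<epsilon>]
      weighted_functional_pth[OF z'(1), of u "J w0" "J w1" \<W> \<epsilon>, OF z'(2)] by simp
qed

section \<open>Forward convex combinations\<close>

text \<open>Finitely supported coefficients that form a convex combination of terms with index at least
  \<open>n\<close>. In a Hilbert space, nearly norm minimizing forward convex combinations of a bounded sequence
  converge by the parallelogram law. This replaces weak compactness and the Riesz theorem.\<close>

definition comb :: "(nat \<Rightarrow> real) \<Rightarrow> (nat \<Rightarrow> 'b::real_vector) \<Rightarrow> 'b" where
  "comb c f = (\<Sum>i | c i \<noteq> 0. c i *\<^sub>R f i)"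

definition fwd :: "nat \<Rightarrow> (nat \<Rightarrow> real) set" where
  "fwd n = {c. finite {i. c i \<noteq> 0} \<and> (\<forall>i. 0 \<le> c i) \<and> (\<forall>i<n. c i = 0) \<and> comb c (\<lambda>i. 1 :: real) = 1}"

definition unit_coeff :: "nat \<Rightarrow> nat \<Rightarrow> real" where
  "unit_coeff k i = (if i = k then 1 else 0)"

lemma comb_superset: "finite A \<Longrightarrow> {i. c i \<noteq> 0} \<subseteq> A \<Longrightarrow> comb c f = (\<Sum>i\<in>A. c i *\<^sub>R f i)"
  unfolding comb_def by (rule sum.mono_neutral_left) auto

lemma comb_unit [simp]: "comb (unit_coeff k) f = f k"
  by (subst comb_superset[of "{k}"]) (auto simp: unit_coeff_def)

lemma finite_unit [simp]: "finite {i. unit_coeff k i \<noteq> 0}"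
  by (rule finite_subset[of _ "{k}"]) (auto simp: unit_coeff_def)

lemma comb_diff:
  assumes "finite {i. c i \<noteq> 0}" "finite {i. d i \<noteq> 0}"
  shows "finite {i. c i - d i \<noteq> 0}" "comb (\<lambda>i. c i - d i) f = comb c f - comb d f"
proof -
  let ?A = "{i. c i \<noteq> 0} \<union> {i. d i \<noteq> 0}"
  have s: "finite ?A" "{i. c i - d i \<noteq> 0} \<subseteq> ?A" "{i. c i \<noteq> 0} \<subseteq> ?A" "{i. d i \<noteq> 0} \<subseteq> ?A"
    using assms by auto
  show "finite {i. c i - d i \<noteq> 0}" by (rule finite_subset[OF s(2,1)])
  show "comb (\<lambda>i. c i - d i) f = comb c f - comb d f"
    unfolding comb_superset[OF s(1,2)] comb_superset[OF s(1,3)] comb_superset[OF s(1,4)]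
    by (simp add: scaleR_diff_left sum_subtractf)
qed

lemma comb_mid:
  assumes "finite {i. c i \<noteq> 0}" "finite {i. d i \<noteq> 0}"
  shows "finite {i. (c i + d i) / 2 \<noteq> 0}" "comb (\<lambda>i. (c i + d i) / 2) f = (1 / 2) *\<^sub>R (comb c f + comb d f)"
proof -
  let ?A = "{i. c i \<noteq> 0} \<union> {i. d i \<noteq> 0}"
  have s: "finite ?A" "{i. (c i + d i) / 2 \<noteq> 0} \<subseteq> ?A" "{i. c i \<noteq> 0} \<subseteq> ?A" "{i. d i \<noteq> 0} \<subseteq> ?A"
    using assms by auto
  show "finite {i. (c i + d i) / 2 \<noteq> 0}" by (rule finite_subset[OF s(2,1)])
  have e: "((c i + d i) / 2) *\<^sub>R f i = (1 / 2) *\<^sub>R (c i *\<^sub>R f i + d i *\<^sub>R f i)" for i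
    by (simp only: scaleR_add_left[symmetric] scaleR_scaleR times_divide_eq_left mult_1)
  show "comb (\<lambda>i. (c i + d i) / 2) f = (1 / 2) *\<^sub>R (comb c f + comb d f)"
    unfolding comb_superset[OF s(1,2)] comb_superset[OF s(1,3)] comb_superset[OF s(1,4)]
    by (simp only: e scaleR_sum_right[symmetric] sum.distrib)
qed

lemma fwd_finite: "c \<in> fwd n \<Longrightarrow> finite {i. c i \<noteq> 0}"
  by (simp add: fwd_def)

lemma fwd_unit: "n \<le> k \<Longrightarrow> unit_coeff k \<in> fwd n"
  by (auto simp: fwd_def) (auto simp: unit_coeff_def)

lemma fwd_mono: "n \<le> m \<Longrightarrow> c \<in> fwd m \<Longrightarrow> c \<in> fwd n"
  by (auto simp: fwd_def)

lemma fwd_mid: "c \<in> fwd n \<Longrightarrow> d \<in> fwd n \<Longrightarrow> (\<lambda>i. (c i + d i) / 2) \<in> fwd n"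
proof -
  assume c: "c \<in> fwd n" and d: "d \<in> fwd n"
  note f = fwd_finite[OF c] fwd_finite[OF d]
  show "(\<lambda>i. (c i + d i) / 2) \<in> fwd n"
    unfolding fwd_def mem_Collect_eq comb_mid(2)[OF f]
    by (intro conjI comb_mid(1)[OF f]) (use c d in \<open>auto simp: fwd_def\<close>)
qed

lemma comb_linear: "linear L \<Longrightarrow> L (comb c f) = comb c (\<lambda>i. L (f i))"
  by (simp add: comb_def linear_sum linear_scale)

lemma comb_le:
  assumes "c \<in> fwd n" "\<And>k. n \<le> k \<Longrightarrow> a k \<le> (b k :: real)"
  shows "comb c a \<le> comb c b"
  unfolding comb_def
proof (rule sum_mono)
  fix i assume "i \<in> {i. c i \<noteq> 0}"
  then have "n \<le> i" "0 \<le> c i" using assms(1) by (auto simp: fwd_def) (meson not_le)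
  then show "c i *\<^sub>R a i \<le> c i *\<^sub>R b i" using assms(2) by (simp add: mult_left_mono)
qed

lemma comb_const: "c \<in> fwd n \<Longrightarrow> comb c (\<lambda>i. x) = x"
proof -
  assume c: "c \<in> fwd n"
  have "comb c (\<lambda>i. x) = comb c (\<lambda>i. 1 :: real) *\<^sub>R x"
    by (simp add: comb_def scaleR_sum_left)
  then show ?thesis using c by (simp add: fwd_def)
qed

lemma comb_diff_const: "c \<in> fwd n \<Longrightarrow> comb c (\<lambda>i. f i - x) = comb c f - x"
proof -
  assume c: "c \<in> fwd n"
  have "comb c (\<lambda>i. f i - x) = comb c f - comb c (\<lambda>i. x)"
    by (simp add: comb_def scaleR_diff_right sum_subtractf)
  then show ?thesis by (simp add: comb_const[OF c])
qed

lemma comb_norm: "c \<in> fwd n \<Longrightarrow> norm (comb c f) \<le> comb c (\<lambda>i. norm (f i))"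
  unfolding comb_def by (rule sum_norm_le) (simp add: fwd_def)

lemma comb_norm_le:
  assumes c: "c \<in> fwd n" and "\<And>k. n \<le> k \<Longrightarrow> norm (f k) \<le> B"
  shows "norm (comb c f) \<le> B"
  using comb_norm[OF c, of f] comb_le[OF c, of "\<lambda>k. norm (f k)" "\<lambda>k. B"] assms(2) comb_const[OF c, of B] by simp

lemma fwd_tendsto:
  fixes a :: "nat \<Rightarrow> 'b::real_normed_vector"
  assumes c: "\<And>n. c n \<in> fwd n" and a: "a \<longlonglongrightarrow> l"
  shows "(\<lambda>n. comb (c n) a) \<longlonglongrightarrow> l"
proof (rule LIMSEQ_I)
  fix e :: real assume "0 < e"
  then obtain N where N: "\<And>n. N \<le> n \<Longrightarrow> norm (a n - l) < e / 2" using LIMSEQ_D[OF a, of "e / 2"] by auto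
  have "norm (comb (c n) a - l) < e" if "N \<le> n" for n
  proof -
    have "norm (comb (c n) (\<lambda>i. a i - l)) \<le> e / 2"
      by (rule comb_norm_le[OF c]) (use N that in \<open>auto intro: less_imp_le\<close>)
    then show ?thesis using \<open>0 < e\<close> by (simp add: comb_diff_const[OF c])
  qed
  then show "\<exists>N. \<forall>n\<ge>N. norm (comb (c n) a - l) < e" by blast
qed

text \<open>If convergence failed, infinitely many terms would lie above \<open>l + e\<close> or
  infinitely many below \<open>l - e\<close>. Along such a subsequence every forward convex
  combination keeps the one-sided bound and cannot tend to \<open>l\<close>. This is how strong
  convergence of convex combinations is turned into convergence of scalars along the original
  sequence.\<close>

lemma fwd_criterion:
  fixes a :: "nat \<Rightarrow> real"
  assumes *: "\<And>s. strict_mono s \<Longrightarrow> \<exists>c. (\<forall>n. c n \<in> fwd n) \<and> (\<lambda>n. comb (c n) (\<lambda>k. a (s k))) \<longlonglongrightarrow> l"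
  shows "a \<longlonglongrightarrow> l"
proof (rule ccontr)
  assume "\<not> a \<longlonglongrightarrow> l"
  then obtain e where e: "e > 0" "\<And>N. \<exists>n\<ge>N. e \<le> \<bar>a n - l\<bar>"
    unfolding lim_sequentially dist_real_def by (meson not_le)
  have inf: "infinite {n. e \<le> \<bar>a n - l\<bar>}"
    unfolding infinite_nat_iff_unbounded_le using e(2) by blast
  have "{n. e \<le> \<bar>a n - l\<bar>} \<subseteq> {n. a n \<ge> l + e} \<union> {n. a n \<le> l - e}" by auto
  then have "infinite {n. a n \<ge> l + e} \<or> infinite {n. a n \<le> l - e}"
    using inf by (meson finite_Un finite_subset)
  then show False
  proof
    assume i: "infinite {n. a n \<ge> l + e}"
    let ?s = "enumerate {n. a n \<ge> l + e}"
    have s: "strict_mono ?s" "\<And>k. a (?s k) \<ge> l + e"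
      using i enumerate_in_set[OF i] by (auto intro: strict_mono_enumerate)
    obtain c where c: "\<And>n. c n \<in> fwd n" "(\<lambda>n. comb (c n) (\<lambda>k. a (?s k))) \<longlonglongrightarrow> l"
      using *[OF s(1)] by blast
    have "l + e \<le> comb (c n) (\<lambda>k. a (?s k))" for n
      using comb_le[OF c(1), of n "\<lambda>k. l + e" "\<lambda>k. a (?s k)", OF s(2)]
      by (simp only: comb_const[OF c(1)])
    then have "l + e \<le> l" by (intro LIMSEQ_le_const[OF c(2)]) blast
    then show False using e by simp
  next
    assume i: "infinite {n. a n \<le> l - e}"
    let ?s = "enumerate {n. a n \<le> l - e}"
    have s: "strict_mono ?s" "\<And>k. a (?s k) \<le> l - e"
      using i enumerate_in_set[OF i] by (auto intro: strict_mono_enumerate)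
    obtain c where c: "\<And>n. c n \<in> fwd n" "(\<lambda>n. comb (c n) (\<lambda>k. a (?s k))) \<longlonglongrightarrow> l"
      using *[OF s(1)] by blast
    have "comb (c n) (\<lambda>k. a (?s k)) \<le> l - e" for n
      using comb_le[OF c(1), of n "\<lambda>k. a (?s k)" "\<lambda>k. l - e", OF s(2)]
      by (simp only: comb_const[OF c(1)])
    then have "l \<le> l - e" by (intro LIMSEQ_le_const2[OF c(2)]) blast
    then show False using e by simp
  qed
qed

text \<open>The quadratic form is a function of the coefficients, so that one argument covers
  vectors of a Hilbert space as well as square integrable functions. The infima \<open>m n\<close>
  over forward combinations increase and are bounded by \<open>B\<close>, hence converge, and near
  minimizers are then Cauchy.\<close>

lemma fwd_cauchy:
  fixes q :: "(nat \<Rightarrow> real) \<Rightarrow> real"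
  assumes q0: "\<And>c. 0 \<le> q c"
    and par: "\<And>c d. finite {i. c i \<noteq> 0} \<Longrightarrow> finite {i. d i \<noteq> 0} \<Longrightarrow>
        4 * q (\<lambda>i. (c i + d i) / 2) + q (\<lambda>i. c i - d i) = 2 * q c + 2 * q d"
    and bd: "\<And>k. q (unit_coeff k) \<le> B"
  obtains c where "\<And>n. c n \<in> fwd n" "\<And>n k. n \<le> k \<Longrightarrow> q (c n) \<le> q (unit_coeff k) + 1 / real (Suc n)"
    "\<And>e. 0 < e \<Longrightarrow> \<exists>N. \<forall>m\<ge>N. \<forall>n\<ge>N. q (\<lambda>i. c m i - c n i) < e"
proof -
  define m where "m n = Inf (q ` fwd n)" for n
  have bb: "bdd_below (q ` A)" for A using q0 by (intro bdd_belowI2[of _ 0]) auto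
  have ne: "fwd n \<noteq> {}" for n using fwd_unit[OF order_refl] by blast
  have mle: "m n \<le> q c" if "c \<in> fwd n" for n c
    unfolding m_def by (rule cInf_lower[OF _ bb]) (use that in blast)
  have "\<exists>c\<in>fwd n. q c < m n + 1 / real (Suc n)" for n
  proof -
    have "Inf (q ` fwd n) < m n + 1 / real (Suc n)" unfolding m_def by simp
    then have "\<exists>y\<in>q ` fwd n. y < m n + 1 / real (Suc n)"
      using cInf_lessD[of "q ` fwd n" "m n + 1 / real (Suc n)"] ne[of n] by simp
    then show ?thesis by simp
  qed
  then have "\<exists>c. \<forall>n. c n \<in> fwd n \<and> q (c n) < m n + 1 / real (Suc n)"
    by (intro choice allI) blast
  then obtain c where c: "\<And>n. c n \<in> fwd n" "\<And>n. q (c n) < m n + 1 / real (Suc n)" by blast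
  have "incseq m" unfolding m_def incseq_def
    by (intro allI impI cInf_superset_mono bb image_mono) (use ne fwd_mono in blast)+
  moreover have "m n \<le> B" for n using mle[OF fwd_unit[OF order_refl]] bd by (meson order_trans)
  ultimately obtain l where l: "m \<longlonglongrightarrow> l" using incseq_convergent by metis
  define al where "al k = 1 / real (Suc k)" for k
  note c2 = c(2)[folded al_def]
  \<comment> \<open>The midpoint is a forward combination for the smaller of the two indices, so its
    value is at least the infimum there. The parallelogram law turns this lower bound into an upper
    bound for the difference.\<close>
  have main: "q (\<lambda>i. c p i - c r i) \<le> 2 * \<bar>m p - m r\<bar> + 2 * al p + 2 * al r" for p r
  proof -
    have "m p \<le> q (\<lambda>i. (c p i + c r i) / 2) \<or> m r \<le> q (\<lambda>i. (c p i + c r i) / 2)"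
    proof (cases "p \<le> r")
      case True
      then show ?thesis using mle[OF fwd_mid[OF c(1) fwd_mono[OF True c(1)]]] by simp
    next
      case False
      then have "r \<le> p" by simp
      then show ?thesis using mle[OF fwd_mid[OF fwd_mono[OF _ c(1)] c(1)]] by simp
    qed
    then have "m p + m r - \<bar>m p - m r\<bar> \<le> 2 * q (\<lambda>i. (c p i + c r i) / 2)" by linarith
    moreover define X Y where "X = q (\<lambda>i. (c p i + c r i) / 2)" and "Y = \<bar>m p - m r\<bar>"
    ultimately have "m p + m r - Y \<le> 2 * X" by simp
    moreover have "4 * X + q (\<lambda>i. c p i - c r i) = 2 * q (c p) + 2 * q (c r)"
      unfolding X_def by (rule par[OF fwd_finite[OF c(1)] fwd_finite[OF c(1)]])
    ultimately show ?thesis unfolding Y_def[symmetric] using c2[of p] c2[of r] by linarith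
  qed
  show ?thesis
  proof
    show "c n \<in> fwd n" for n by (rule c)
    show "q (c n) \<le> q (unit_coeff k) + 1 / real (Suc n)" if "n \<le> k" for n k
      using c(2)[of n] mle[OF fwd_unit[OF that]] by simp
    fix e :: real assume e: "0 < e"
    have "\<forall>\<^sub>F n in sequentially. \<bar>m n - l\<bar> < e / 16"
      using tendstoD[OF l, of "e / 16"] e by (simp add: dist_real_def)
    moreover have "\<forall>\<^sub>F n in sequentially. 1 / real (Suc n) < e / 16"
      using order_tendstoD(2)[OF LIMSEQ_inverse_real_of_nat, of "e / 16"] e by (simp add: inverse_eq_divide)
    ultimately obtain N where N: "\<And>n. n \<ge> N \<Longrightarrow> \<bar>m n - l\<bar> < e / 16 \<and> 1 / real (Suc n) < e / 16"
      unfolding eventually_sequentially by (meson le_trans nat_le_linear)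
    show "\<exists>N. \<forall>m\<ge>N. \<forall>n\<ge>N. q (\<lambda>i. c m i - c n i) < e"
    proof (intro exI[of _ N] allI impI)
      fix p r assume "N \<le> p" "N \<le> r"
      then have 1: "\<bar>m p - l\<bar> < e / 16" "\<bar>m r - l\<bar> < e / 16" "al p < e / 16" "al r < e / 16"
        using N unfolding al_def by blast+
      moreover have "\<bar>m p - m r\<bar> \<le> \<bar>m p - l\<bar> + \<bar>m r - l\<bar>"
        using abs_triangle_ineq4[of "m p - l" "m r - l"] by simp
      ultimately have "2 * \<bar>m p - m r\<bar> < e / 4" by simp
      then show "q (\<lambda>i. c p i - c r i) < e" using main[of p r] 1 e by linarith
    qed
  qed
qed

section \<open>Weak limits in a Hilbert space\<close>

lemma convergent_approx:
  fixes a :: "nat \<Rightarrow> real"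
  assumes "\<And>e. 0 < e \<Longrightarrow> \<exists>b. convergent b \<and> (\<forall>k. \<bar>a k - b k\<bar> \<le> e)"
  shows "convergent a"
proof (rule real_Cauchy_convergent, rule CauchyI)
  fix e :: real assume "0 < e"
  then obtain b where b: "convergent b" "\<And>k. \<bar>a k - b k\<bar> \<le> e / 4" using assms[of "e / 4"] by auto
  then have "Cauchy b" by (simp add: Cauchy_convergent_iff)
  then obtain N where N: "\<And>m n. m \<ge> N \<Longrightarrow> n \<ge> N \<Longrightarrow> \<bar>b m - b n\<bar> < e / 4"
    using CauchyD[of b "e / 4"] \<open>0 < e\<close> by (auto simp: real_norm_def)
  have "\<bar>a m - a n\<bar> < e" if "m \<ge> N" "n \<ge> N" for m n
    using N[OF that] b(2)[of m] b(2)[of n] \<open>0 < e\<close> by linarith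
  then show "\<exists>M. \<forall>m\<ge>M. \<forall>n\<ge>M. norm (a m - a n) < e" by auto
qed

lemma parallelogram_half:
  fixes a b :: "'b::real_inner"
  shows "4 * (norm ((1 / 2) *\<^sub>R (a + b)))\<^sup>2 + (norm (a - b))\<^sup>2 = 2 * (norm a)\<^sup>2 + 2 * (norm b)\<^sup>2"
proof -
  have "(norm ((1 / 2) *\<^sub>R (a + b)))\<^sup>2 = (norm (a + b))\<^sup>2 / 4" by (simp add: power_divide)
  moreover have "(norm (a + b))\<^sup>2 + (norm (a - b))\<^sup>2 = 2 * (norm a)\<^sup>2 + 2 * (norm b)\<^sup>2"
    by (simp add: power2_norm_eq_inner inner_diff_left inner_diff_right inner_add_left inner_add_right
      inner_commute[of b a])
  ultimately show ?thesis by linarith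
qed

lemma fwd_hilbert:
  fixes x :: "nat \<Rightarrow> 'b::{real_inner, banach}"
  assumes b: "\<And>k. norm (x k) \<le> B"
  obtains c y where "\<And>n. c n \<in> fwd n" "(\<lambda>n. comb (c n) x) \<longlonglongrightarrow> y"
proof -
  have B: "0 \<le> B" using b[of 0] norm_ge_zero order_trans by blast
  obtain c where c: "\<And>n. c n \<in> fwd n"
    "\<And>e. 0 < e \<Longrightarrow> \<exists>N. \<forall>m\<ge>N. \<forall>n\<ge>N. (norm (comb (\<lambda>i. c m i - c n i) x))\<^sup>2 < e"
  proof (rule fwd_cauchy[of "\<lambda>c. (norm (comb c x))\<^sup>2" "B\<^sup>2"])
    show "4 * (norm (comb (\<lambda>i. (c i + d i) / 2) x))\<^sup>2 + (norm (comb (\<lambda>i. c i - d i) x))\<^sup>2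
        = 2 * (norm (comb c x))\<^sup>2 + 2 * (norm (comb d x))\<^sup>2"
      if "finite {i. c i \<noteq> 0}" "finite {i. d i \<noteq> 0}" for c d
      unfolding comb_mid(2)[OF that] comb_diff(2)[OF that] by (rule parallelogram_half)
    show "(norm (comb (unit_coeff k) x))\<^sup>2 \<le> B\<^sup>2" for k using b[of k] by (simp add: power_mono)
  qed auto
  have "Cauchy (\<lambda>n. comb (c n) x)"
  proof (rule CauchyI)
    fix e :: real assume e: "0 < e"
    then obtain N where N: "\<And>m n. m \<ge> N \<Longrightarrow> n \<ge> N \<Longrightarrow> (norm (comb (\<lambda>i. c m i - c n i) x))\<^sup>2 < e\<^sup>2"
      using c(2)[of "e\<^sup>2"] by auto
    have "norm (comb (c m) x - comb (c n) x) < e" if "m \<ge> N" "n \<ge> N" for m n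
      using N[OF that] e comb_diff(2)[OF fwd_finite[OF c(1)[of m]] fwd_finite[OF c(1)[of n]], of x]
      by (auto intro: power2_less_imp_less)
    then show "\<exists>M. \<forall>m\<ge>M. \<forall>n\<ge>M. norm (comb (c m) x - comb (c n) x) < e" by blast
  qed
  then obtain y where "(\<lambda>n. comb (c n) x) \<longlonglongrightarrow> y" by (auto simp: Cauchy_convergent_iff convergent_def)
  with c(1) show ?thesis by (rule that)
qed

text \<open>Density and boundedness extend the convergence of pairings to all vectors. The limit is
  represented by the strong limit of forward convex combinations, since forward combinations of a
  convergent scalar sequence have the same limit.\<close>

lemma weak_limit_dense:
  fixes x :: "nat \<Rightarrow> 'b::{real_inner, banach}"
  assumes b: "\<And>k. norm (x k) \<le> B" and D: "closure D = UNIV"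
    and conv: "\<And>d. d \<in> D \<Longrightarrow> convergent (\<lambda>k. inner (x k) d)"
  obtains y where "norm y \<le> B" "\<And>h. (\<lambda>k. inner (x k) h) \<longlonglongrightarrow> inner y h"
proof -
  have B: "0 \<le> B" using b[of 0] norm_ge_zero order_trans by blast
  have conv': "convergent (\<lambda>k. inner (x k) h)" for h
  proof (rule convergent_approx)
    fix e :: real assume "0 < e"
    have "h \<in> closure D" using D by simp
    moreover have "0 < e / (B + 1)" using B \<open>0 < e\<close> by simp
    ultimately obtain d where d: "d \<in> D" "dist d h < e / (B + 1)"
      unfolding closure_approachable by blast
    have "\<bar>inner (x k) h - inner (x k) d\<bar> \<le> e" for k
    proof -
      have "\<bar>inner (x k) (h - d)\<bar> \<le> norm (x k) * norm (h - d)" by (rule Cauchy_Schwarz_ineq2)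
      also have "\<dots> \<le> (B + 1) * (e / (B + 1))"
        by (rule mult_mono) (use b[of k] d B in \<open>auto simp: dist_norm norm_minus_commute\<close>)
      finally show ?thesis using B by (simp add: inner_diff_right)
    qed
    then show "\<exists>b. convergent b \<and> (\<forall>k. \<bar>inner (x k) h - b k\<bar> \<le> e)" using conv[OF d(1)] by blast
  qed
  obtain c y where c: "\<And>n. c n \<in> fwd n" "(\<lambda>n. comb (c n) x) \<longlonglongrightarrow> y"
    using fwd_hilbert[of x B] b by blast
  have "(\<lambda>k. inner (x k) h) \<longlonglongrightarrow> inner y h" for h
  proof -
    obtain l where l: "(\<lambda>k. inner (x k) h) \<longlonglongrightarrow> l" using conv'[of h] by (auto simp: convergent_def)
    have "(\<lambda>n. inner (comb (c n) x) h) \<longlonglongrightarrow> l"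
      using fwd_tendsto[OF c(1) l] comb_linear[of "\<lambda>v. inner v h" _ x]
      by (simp add: bounded_linear.linear[OF bounded_linear_inner_left])
    moreover have "(\<lambda>n. inner (comb (c n) x) h) \<longlonglongrightarrow> inner y h"
      by (intro tendsto_inner c(2) tendsto_const)
    ultimately show ?thesis using l LIMSEQ_unique by blast
  qed
  moreover have "norm y \<le> B"
    by (rule LIMSEQ_le_const2[OF tendsto_norm[OF c(2)]]) (use comb_norm_le[OF c(1)] b in blast)
  ultimately show ?thesis using that by blast
qed

text \<open>From any subsequence forward combinations converge strongly, and pairings identify the
  limit as \<open>y\<close>. A bounded functional is linear and continuous, so its values on these
  combinations converge as well, and \<open>fwd_criterion\<close> applies. This connects lower
  semicontinuity, which is stated for all functionals, with convergence of inner products.\<close>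

lemma weak_conv_inner:
  fixes x :: "nat \<Rightarrow> 'b::{real_inner, banach}"
  assumes b: "\<And>k. norm (x k) \<le> B" and w: "\<And>h. (\<lambda>k. inner (x k) h) \<longlonglongrightarrow> inner y h"
  shows "weak_conv x y"
  unfolding weak_conv_def
proof (intro allI fwd_criterion)
  fix L :: "'b \<Rightarrow>\<^sub>L real" and s :: "nat \<Rightarrow> nat" assume s: "strict_mono s"
  obtain c y' where c: "\<And>n. c n \<in> fwd n" "(\<lambda>n. comb (c n) (\<lambda>k. x (s k))) \<longlonglongrightarrow> y'"
    using fwd_hilbert[of "\<lambda>k. x (s k)" B] b by blast
  have "inner y' h = inner y h" for h
  proof -
    have "(\<lambda>k. inner (x (s k)) h) \<longlonglongrightarrow> inner y h"
      using LIMSEQ_subseq_LIMSEQ[OF w s] by (simp add: o_def)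
    from fwd_tendsto[OF c(1) this]
    have "(\<lambda>n. inner (comb (c n) (\<lambda>k. x (s k))) h) \<longlonglongrightarrow> inner y h"
      using comb_linear[of "\<lambda>v. inner v h" _ "\<lambda>k. x (s k)"]
      by (simp add: bounded_linear.linear[OF bounded_linear_inner_left])
    moreover have "(\<lambda>n. inner (comb (c n) (\<lambda>k. x (s k))) h) \<longlonglongrightarrow> inner y' h"
      by (intro tendsto_inner c(2) tendsto_const)
    ultimately show ?thesis using LIMSEQ_unique by blast
  qed
  then have "y' = y" by (rule vector_eq_rdot[THEN iffD1, OF allI])
  have "(\<lambda>n. blinfun_apply L (comb (c n) (\<lambda>k. x (s k)))) \<longlonglongrightarrow> blinfun_apply L y"
    using c(2) unfolding \<open>y' = y\<close> by (intro tendsto_intros)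
  then have "(\<lambda>n. comb (c n) (\<lambda>k. blinfun_apply L (x (s k)))) \<longlonglongrightarrow> blinfun_apply L y"
    by (subst (asm) comb_linear) (simp_all add: bounded_linear.linear[OF blinfun.bounded_linear_right])
  with c(1) show "\<exists>c. (\<forall>n. c n \<in> fwd n) \<and> (\<lambda>n. comb (c n) (\<lambda>k. blinfun_apply L (x (s k)))) \<longlonglongrightarrow> blinfun_apply L y"
    by blast
qed

text \<open>A diagonal argument of Arzela-Ascoli type.\<close>

lemma weak_subsequence:
  fixes v :: "nat \<Rightarrow> real \<Rightarrow> 'b::{real_inner, banach}"
  assumes b: "\<And>k t. 0 \<le> t \<Longrightarrow> norm (v k t) \<le> Bd t" and D: "countable D" "closure D = UNIV"
    and eq: "\<And>d t e. d \<in> D \<Longrightarrow> 0 \<le> t \<Longrightarrow> 0 < e \<Longrightarrow>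
      \<exists>\<delta>>0. \<forall>k. \<forall>s\<ge>0. \<bar>s - t\<bar> < \<delta> \<longrightarrow> \<bar>inner (v k s - v k t) d\<bar> < e"
  obtains r y where "strict_mono (r :: nat \<Rightarrow> nat)" "\<And>t. 0 \<le> t \<Longrightarrow> norm (y t) \<le> Bd t"
    "\<And>t h. 0 \<le> t \<Longrightarrow> (\<lambda>k. inner (v (r k) t) h) \<longlonglongrightarrow> inner (y t) h"
proof -
  let ?S = "{q \<in> \<rat>. 0 \<le> q} \<times> D"
  have B0: "0 \<le> Bd t" if "0 \<le> t" for t using b[OF that] norm_ge_zero order_trans by blast
  \<comment> \<open>Division by \<open>1 + Bd q * norm d\<close> makes all pairings bounded by one,
    because \<open>function_convergent_subsequence\<close> asks for a single bound.\<close>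
  let ?f = "\<lambda>n (q, d). inner (v n q) d / (1 + Bd q * norm d)"
  have "countable ?S" by (intro countable_SIGMA countable_subset[OF _ countable_rat] D) auto
  moreover have "norm (?f n p) \<le> 1" if p: "p \<in> ?S" for n p
  proof -
    obtain q d where q: "p = (q, d)" "0 \<le> q" using p by auto
    have "\<bar>inner (v n q) d\<bar> \<le> norm (v n q) * norm d" by (rule Cauchy_Schwarz_ineq2)
    also have "\<dots> \<le> Bd q * norm d" by (rule mult_right_mono[OF b[OF q(2)]]) simp
    finally have "\<bar>inner (v n q) d\<bar> \<le> 1 + Bd q * norm d" by simp
    moreover have "0 < 1 + Bd q * norm d" using B0[OF q(2)] by (simp add: add_pos_nonneg)
    ultimately show ?thesis using q(1) by (simp add: abs_divide)
  qed
  ultimately obtain r where r: "strict_mono (r :: nat \<Rightarrow> nat)" "\<And>p. p \<in> ?S \<Longrightarrow> \<exists>l. (\<lambda>n. ?f (r n) p) \<longlonglongrightarrow> l"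
    using function_convergent_subsequence[of ?S ?f 1] by blast
  have cq: "convergent (\<lambda>n. inner (v (r n) q) d)" if "q \<in> \<rat>" "0 \<le> q" "d \<in> D" for q d
  proof -
    have pos: "0 < 1 + Bd q * norm d" using B0[OF that(2)] by (simp add: add_pos_nonneg)
    have "(q, d) \<in> ?S" using that by simp
    from r(2)[OF this] obtain l where "(\<lambda>n. inner (v (r n) q) d / (1 + Bd q * norm d)) \<longlonglongrightarrow> l"
      by auto
    then have "(\<lambda>n. (1 + Bd q * norm d) * (inner (v (r n) q) d / (1 + Bd q * norm d))) \<longlonglongrightarrow> (1 + Bd q * norm d) * l"
      by (rule tendsto_mult_left)
    then show ?thesis using pos by (auto simp: convergent_def)
  qed
  have ct: "convergent (\<lambda>n. inner (v (r n) t) d)" if td: "0 \<le> t" "d \<in> D" for t d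
  proof (rule convergent_approx)
    fix e :: real assume "0 < e"
    then obtain \<delta> where de: "\<delta> > 0" "\<And>k s. s \<ge> 0 \<Longrightarrow> \<bar>s - t\<bar> < \<delta> \<Longrightarrow> \<bar>inner (v k s - v k t) d\<bar> < e"
      using eq[OF td(2,1)] by blast
    obtain q where q: "q \<in> \<rat>" "t < q" "q < t + \<delta>" using Rats_dense_in_real[of t "t + \<delta>"] de by auto
    then have "\<bar>inner (v (r k) t) d - inner (v (r k) q) d\<bar> \<le> e" for k
      using de(2)[of q "r k"] td by (simp add: inner_diff_left abs_minus_commute)
    then show "\<exists>b. convergent b \<and> (\<forall>k. \<bar>inner (v (r k) t) d - b k\<bar> \<le> e)"
      using cq[of q d] q td by (intro exI[of _ "\<lambda>k. inner (v (r k) q) d"]) auto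
  qed
  have "\<exists>y. 0 \<le> t \<longrightarrow> norm y \<le> Bd t \<and> (\<forall>h. (\<lambda>k. inner (v (r k) t) h) \<longlonglongrightarrow> inner y h)" for t
  proof (cases "0 \<le> t")
    case True
    obtain y where "norm y \<le> Bd t" "\<And>h. (\<lambda>k. inner (v (r k) t) h) \<longlonglongrightarrow> inner y h"
      by (rule weak_limit_dense[of "\<lambda>k. v (r k) t" "Bd t" D]) (use b[OF True] D ct[OF True] in auto)
    then show ?thesis by blast
  qed simp
  then have "\<exists>y. \<forall>t. 0 \<le> t \<longrightarrow> norm (y t) \<le> Bd t \<and> (\<forall>h. (\<lambda>k. inner (v (r k) t) h) \<longlonglongrightarrow> inner (y t) h)"
    by (intro choice allI)
  then obtain y where "\<forall>t. 0 \<le> t \<longrightarrow> norm (y t) \<le> Bd t \<and> (\<forall>h. (\<lambda>k. inner (v (r k) t) h) \<longlonglongrightarrow> inner (y t) h)" ..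
  then show ?thesis using r(1) that by blast
qed

section \<open>Forward convex combinations of square integrable functions\<close>

definition sqint :: "'a measure \<Rightarrow> ('a \<Rightarrow> 'b::{real_inner, banach, second_countable_topology}) \<Rightarrow> bool" where
  "sqint M f \<longleftrightarrow> f \<in> borel_measurable M \<and> integrable M (\<lambda>x. (norm (f x))\<^sup>2)"

lemma norm_add_sq_le: "(norm (a + b))\<^sup>2 \<le> 2 * (norm a)\<^sup>2 + 2 * (norm (b :: 'b::real_inner))\<^sup>2"
proof -
  have "(norm (a + b))\<^sup>2 + (norm (a - b))\<^sup>2 = 2 * (norm a)\<^sup>2 + 2 * (norm b)\<^sup>2"
    by (simp add: power2_norm_eq_inner inner_diff_left inner_diff_right inner_add_left inner_add_right
      inner_commute[of b a])
  then show ?thesis using zero_le_power2[of "norm (a - b)"] by linarith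
qed

lemma sqint_add:
  assumes "sqint M f" "sqint M g" shows "sqint M (\<lambda>x. f x + g x)"
  unfolding sqint_def
proof
  have [measurable]: "f \<in> borel_measurable M" "g \<in> borel_measurable M" using assms by (auto simp: sqint_def)
  show "(\<lambda>x. f x + g x) \<in> borel_measurable M" by measurable
  show "integrable M (\<lambda>x. (norm (f x + g x))\<^sup>2)"
  proof (rule Bochner_Integration.integrable_bound)
    show "integrable M (\<lambda>x. 2 * (norm (f x))\<^sup>2 + 2 * (norm (g x))\<^sup>2)"
      using assms by (simp add: sqint_def)
    show "AE x in M. norm ((norm (f x + g x))\<^sup>2) \<le> norm (2 * (norm (f x))\<^sup>2 + 2 * (norm (g x))\<^sup>2)"
      using norm_add_sq_le by (intro AE_I2) simp
  qed measurable
qed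

lemma sqint_scale: "sqint M f \<Longrightarrow> sqint M (\<lambda>x. c *\<^sub>R f x)"
  unfolding sqint_def by (auto simp: power_mult_distrib)

lemma sqint_diff: "sqint M f \<Longrightarrow> sqint M g \<Longrightarrow> sqint M (\<lambda>x. f x - g x)"
  using sqint_add[of M f "\<lambda>x. (-1) *\<^sub>R g x"] sqint_scale[of M g "-1"] by simp

lemma sqint_0: "sqint M (\<lambda>x. 0)"
  by (simp add: sqint_def)

lemma sqint_comb: "(\<And>k. sqint M (f k)) \<Longrightarrow> sqint M (\<lambda>x. comb c (\<lambda>k. f k x))"
proof -
  assume f: "\<And>k. sqint M (f k)"
  have "finite A \<Longrightarrow> sqint M (\<lambda>x. \<Sum>i\<in>A. c i *\<^sub>R f i x)" for A
    by (induction A rule: finite_induct) (simp_all add: sqint_0 sqint_add sqint_scale f)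
  then show ?thesis unfolding comb_def
    by (cases "finite {i. c i \<noteq> 0}") (simp_all add: sqint_0)
qed

lemma sqint_nn: "sqint M f \<Longrightarrow> (\<integral>\<^sup>+x. ennreal ((norm (f x))\<^sup>2) \<partial>M) = ennreal (\<integral>x. (norm (f x))\<^sup>2 \<partial>M)"
  by (rule nn_integral_eq_integral) (auto simp: sqint_def)

lemma sqint_nnI:
  assumes "f \<in> borel_measurable M" "(\<integral>\<^sup>+x. ennreal ((norm (f x))\<^sup>2) \<partial>M) < \<infinity>" shows "sqint M f"
  using assms by (auto simp: sqint_def intro!: integrableI_nonneg)

text \<open>With the weights \<open>4 ^ k\<close> the integrals still sum like
  \<open>(1/2) ^ k\<close>. Almost everywhere the weighted squares therefore have a finite sum
  \<open>S\<close>, the increments are at most \<open>sqrt S * (1/2) ^ k\<close>, and the sequence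
  converges.\<close>

lemma sqint_AE_convergent:
  assumes f: "\<And>k. sqint M (f k)" and d: "\<And>k. (\<integral>x. (norm (f (Suc k) x - f k x))\<^sup>2 \<partial>M) \<le> (1/8)^k"
  shows "AE x in M. convergent (\<lambda>k. f k x)"
proof -
  have [measurable]: "f k \<in> borel_measurable M" for k using f by (simp add: sqint_def)
  let ?d = "\<lambda>k x. 4^k * (norm (f (Suc k) x - f k x))\<^sup>2"
  have "(\<integral>\<^sup>+x. (\<Sum>k. ennreal (?d k x)) \<partial>M) = (\<Sum>k. \<integral>\<^sup>+x. ennreal (?d k x) \<partial>M)"
    by (rule nn_integral_suminf) measurable
  also have "\<dots> \<le> (\<Sum>k. ennreal ((1/2)^k))"
  proof (rule suminf_le)
    fix k
    have i: "integrable M (\<lambda>x. (norm (f (Suc k) x - f k x))\<^sup>2)"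
      using sqint_diff[OF f f] by (simp add: sqint_def)
    have "(\<integral>\<^sup>+x. ennreal (?d k x) \<partial>M) = ennreal (\<integral>x. ?d k x \<partial>M)"
      by (rule nn_integral_eq_integral) (use i in auto)
    also have "\<dots> = ennreal (4^k * (\<integral>x. (norm (f (Suc k) x - f k x))\<^sup>2 \<partial>M))" by simp
    also have "\<dots> \<le> ennreal (4^k * (1/8)^k)" by (intro ennreal_leI mult_left_mono d) simp
    also have "(4::real)^k * (1/8)^k = (1/2)^k" unfolding power_mult_distrib[symmetric] by simp
    finally show "(\<integral>\<^sup>+x. ennreal (?d k x) \<partial>M) \<le> ennreal ((1/2)^k)" .
  qed auto
  also have "\<dots> = ennreal (\<Sum>k. (1/2)^k)"
    by (rule suminf_ennreal2) (auto simp: summable_geometric)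
  also have "\<dots> < \<infinity>" by simp
  finally have fin: "(\<integral>\<^sup>+x. (\<Sum>k. ennreal (?d k x)) \<partial>M) \<noteq> \<infinity>" by (rule less_imp_neq)
  have "AE x in M. (\<Sum>k. ennreal (?d k x)) \<noteq> \<infinity>"
    by (rule nn_integral_PInf_AE[OF _ fin]) measurable
  then show ?thesis
  proof (rule eventually_mono)
    fix x assume ninf: "(\<Sum>k. ennreal (?d k x)) \<noteq> \<infinity>"
    define S where "S = enn2real (\<Sum>k. ennreal (?d k x))"
    have le: "?d k x \<le> S" for k
    proof -
      have "(\<Sum>k\<in>{k}. ennreal (?d k x)) \<le> (\<Sum>k. ennreal (?d k x))"
        by (rule sum_le_suminf) (rule summableI, simp, rule zero_le)
      then have "ennreal (?d k x) \<le> (\<Sum>k. ennreal (?d k x))" by (simp only: sum.insert finite.intros empty_iff not_False_eq_True sum.empty add_0_right)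
      also have "\<dots> = ennreal S" unfolding S_def using ninf by (intro ennreal_enn2real[symmetric]) (simp only: less_top infinity_ennreal_def)
      finally show ?thesis by (rule ennreal_le_iff[THEN iffD1, rotated]) (simp only: S_def enn2real_nonneg)
    qed
    have S: "0 \<le> S" unfolding S_def by (rule enn2real_nonneg)
    have b: "norm (f (Suc k) x - f k x) \<le> sqrt S * (1/2)^k" for k
    proof (rule power2_le_imp_le)
      have "(1/4)^k * ?d k x \<le> (1/4)^k * S" by (intro mult_left_mono le) auto
      also have "(1/4)^k * ?d k x = (norm (f (Suc k) x - f k x))\<^sup>2"
        unfolding mult.assoc[symmetric] power_mult_distrib[symmetric] by simp
      finally have "(norm (f (Suc k) x - f k x))\<^sup>2 \<le> (1/4)^k * S" .
      moreover have "((1/2::real)^k)\<^sup>2 = (1/4)^k"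
        unfolding power2_eq_square power_mult_distrib[symmetric] by simp
      ultimately show "(norm (f (Suc k) x - f k x))\<^sup>2 \<le> (sqrt S * (1/2)^k)\<^sup>2"
        using S by (simp add: power_mult_distrib mult.commute)
    qed (use S in auto)
    have "summable (\<lambda>k. sqrt S * (1/2)^k)" by (rule summable_mult, rule summable_geometric) simp
    then have "summable (\<lambda>k. f (Suc k) x - f k x)"
      by (rule summable_comparison_test'[where N = 0]) (simp only: b)
    then have "convergent (\<lambda>n. \<Sum>k<n. f (Suc k) x - f k x)" by (simp add: summable_iff_convergent)
    then have "convergent (\<lambda>n. (\<Sum>k<n. f (Suc k) x - f k x) + f 0 x)"
      by (intro convergent_add convergent_const)
    moreover have "(\<Sum>k<n. f (Suc k) x - f k x) + f 0 x = f n x" for n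
      using sum_lessThan_telescope[of "\<lambda>k. f k x" n] by simp
    ultimately show "convergent (\<lambda>k. f k x)" by (simp only:)
  qed
qed

text \<open>The argument of \<open>fwd_hilbert\<close> carried out on representatives. A sparse
  subsequence of the near minimizers converges almost everywhere as well as in mean square; Fatou's
  lemma gives integrability of the limit. The last conclusion is weak lower semicontinuity of the
  norm: a bound that holds for infinitely many \<open>k\<close> passes to \<open>g\<close>.\<close>

lemma fwd_L2:
  fixes f :: "nat \<Rightarrow> 'a \<Rightarrow> 'b::{real_inner, banach, second_countable_topology}"
  assumes f: "\<And>k. sqint M (f k)" and B: "\<And>k. (\<integral>x. (norm (f k x))\<^sup>2 \<partial>M) \<le> B"
  obtains c g where "\<And>n. c n \<in> fwd n" "sqint M g"
    "AE x in M. (\<lambda>n. comb (c n) (\<lambda>k. f k x)) \<longlonglongrightarrow> g x"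
    "(\<lambda>n. \<integral>x. (norm (comb (c n) (\<lambda>k. f k x) - g x))\<^sup>2 \<partial>M) \<longlonglongrightarrow> 0"
    "\<And>b. (\<And>N. \<exists>k\<ge>N. (\<integral>x. (norm (f k x))\<^sup>2 \<partial>M) \<le> b) \<Longrightarrow> (\<integral>x. (norm (g x))\<^sup>2 \<partial>M) \<le> b"
proof -
  let ?q = "\<lambda>c. \<integral>x. (norm (comb c (\<lambda>k. f k x)))\<^sup>2 \<partial>M"
  have sc: "sqint M (\<lambda>x. comb c (\<lambda>k. f k x))" for c by (rule sqint_comb[OF f])
  have ic: "integrable M (\<lambda>x. (norm (comb c (\<lambda>k. f k x)))\<^sup>2)" for c using sc by (simp add: sqint_def)
  obtain c where c: "\<And>n. c n \<in> fwd n" "\<And>n k. n \<le> k \<Longrightarrow> ?q (c n) \<le> ?q (unit_coeff k) + 1 / real (Suc n)"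
    "\<And>e. 0 < e \<Longrightarrow> \<exists>N. \<forall>m\<ge>N. \<forall>n\<ge>N. ?q (\<lambda>i. c m i - c n i) < e"
  proof (rule fwd_cauchy[of ?q B])
    fix c d :: "nat \<Rightarrow> real" assume cd: "finite {i. c i \<noteq> 0}" "finite {i. d i \<noteq> 0}"
    have "(\<integral>x. 4 * (norm (comb (\<lambda>i. (c i + d i) / 2) (\<lambda>k. f k x)))\<^sup>2 + (norm (comb (\<lambda>i. c i - d i) (\<lambda>k. f k x)))\<^sup>2 \<partial>M)
      = (\<integral>x. 2 * (norm (comb c (\<lambda>k. f k x)))\<^sup>2 + 2 * (norm (comb d (\<lambda>k. f k x)))\<^sup>2 \<partial>M)"
      unfolding comb_mid(2)[OF cd] comb_diff(2)[OF cd] parallelogram_half ..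
    then show "4 * ?q (\<lambda>i. (c i + d i) / 2) + ?q (\<lambda>i. c i - d i) = 2 * ?q c + 2 * ?q d"
      by (subst (asm) (1 2) Bochner_Integration.integral_add) (auto intro!: integrable_mult_right ic)
  qed (use B in auto)
  define y where "y n x = comb (c n) (\<lambda>k. f k x)" for n x
  have ys: "sqint M (y n)" for n unfolding y_def by (rule sc)
  have yd: "?q (\<lambda>i. c m i - c n i) = (\<integral>x. (norm (y m x - y n x))\<^sup>2 \<partial>M)" for m n
    unfolding y_def comb_diff(2)[OF fwd_finite[OF c(1)] fwd_finite[OF c(1)]] ..
  have "\<exists>r. \<forall>k. (\<forall>m\<ge>r k. \<forall>n\<ge>r k. (\<integral>x. (norm (y m x - y n x))\<^sup>2 \<partial>M) < (1/8)^k) \<and> r k < r (Suc k)"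
  proof (rule dependent_nat_choice)
    show "\<exists>N. \<forall>m\<ge>N. \<forall>n\<ge>N. (\<integral>x. (norm (y m x - y n x))\<^sup>2 \<partial>M) < (1/8)^0"
      using c(3)[of "(1/8)^0"] unfolding yd by simp
    fix M' k
    obtain N where "\<forall>m\<ge>N. \<forall>n\<ge>N. (\<integral>x. (norm (y m x - y n x))\<^sup>2 \<partial>M) < (1/8)^(Suc k)"
      using c(3)[of "(1/8)^(Suc k)"] unfolding yd by auto
    then show "\<exists>N. (\<forall>m\<ge>N. \<forall>n\<ge>N. (\<integral>x. (norm (y m x - y n x))\<^sup>2 \<partial>M) < (1/8)^(Suc k)) \<and> M' < N"
      by (intro exI[of _ "max N (Suc M')"]) auto
  qed
  then obtain r where r: "strict_mono (r :: nat \<Rightarrow> nat)"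
    "\<And>k m n. m \<ge> r k \<Longrightarrow> n \<ge> r k \<Longrightarrow> (\<integral>x. (norm (y m x - y n x))\<^sup>2 \<partial>M) < (1/8)^k"
    by (auto simp: strict_mono_Suc_iff)
  have [measurable]: "y n \<in> borel_measurable M" for n using ys by (simp add: sqint_def)
  define g where "g x = lim (\<lambda>k. y (r k) x)" for x
  have gm [measurable]: "g \<in> borel_measurable M" unfolding g_def[abs_def] by measurable
  have "AE x in M. convergent (\<lambda>k. y (r k) x)"
  proof (rule sqint_AE_convergent)
    show "(\<integral>x. (norm (y (r (Suc k)) x - y (r k) x))\<^sup>2 \<partial>M) \<le> (1/8)^k" for k
    proof -
      have "r k \<le> r (Suc k)" using r(1) by (simp add: strict_mono_less_eq)
      then show ?thesis using r(2)[of k "r (Suc k)" "r k"] by simp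
    qed
  qed (rule ys)
  then have conv: "AE x in M. (\<lambda>k. y (r k) x) \<longlonglongrightarrow> g x"
    by eventually_elim (simp add: g_def convergent_LIMSEQ_iff)
  have fat: "(\<integral>\<^sup>+x. ennreal ((norm (h x - g x))\<^sup>2) \<partial>M) \<le> ennreal b"
    if h: "sqint M h" and ev: "\<forall>\<^sub>F n in sequentially. (\<integral>x. (norm (h x - y (r n) x))\<^sup>2 \<partial>M) \<le> b" for h b
  proof -
    have [measurable]: "h \<in> borel_measurable M" using h by (simp add: sqint_def)
    have "(\<integral>\<^sup>+x. ennreal ((norm (h x - g x))\<^sup>2) \<partial>M) = (\<integral>\<^sup>+x. liminf (\<lambda>n. ennreal ((norm (h x - y (r n) x))\<^sup>2)) \<partial>M)"
    proof (rule nn_integral_cong_AE)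
      show "AE x in M. ennreal ((norm (h x - g x))\<^sup>2) = liminf (\<lambda>n. ennreal ((norm (h x - y (r n) x))\<^sup>2))"
        using conv
      proof eventually_elim
        case (elim x)
        have "(\<lambda>n. ennreal ((norm (h x - y (r n) x))\<^sup>2)) \<longlonglongrightarrow> ennreal ((norm (h x - g x))\<^sup>2)"
          by (intro tendsto_ennrealI tendsto_intros elim)
        then show ?case by (intro lim_imp_Liminf[symmetric]) auto
      qed
    qed
    also have "\<dots> \<le> liminf (\<lambda>n. \<integral>\<^sup>+x. ennreal ((norm (h x - y (r n) x))\<^sup>2) \<partial>M)"
      by (rule nn_integral_liminf) measurable
    also have "\<dots> \<le> liminf (\<lambda>n. ennreal b)"
    proof (rule Liminf_mono)
      show "\<forall>\<^sub>F n in sequentially. (\<integral>\<^sup>+x. ennreal ((norm (h x - y (r n) x))\<^sup>2) \<partial>M) \<le> ennreal b"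
        using ev by eventually_elim (simp add: sqint_nn[OF sqint_diff[OF h ys]] ennreal_leI)
    qed
    also have "\<dots> = ennreal b" by (simp add: Liminf_const)
    finally show ?thesis .
  qed
  have near: "(\<integral>\<^sup>+x. ennreal ((norm (y n x - g x))\<^sup>2) \<partial>M) \<le> ennreal ((1/8)^k)" if "n \<ge> r k" for n k
  proof (rule fat[OF ys])
    show "\<forall>\<^sub>F m in sequentially. (\<integral>x. (norm (y n x - y (r m) x))\<^sup>2 \<partial>M) \<le> (1/8)^k"
      using eventually_ge_at_top[of k]
    proof eventually_elim
      case (elim m)
      then have "r k \<le> r m" using r(1) by (simp add: strict_mono_less_eq)
      from r(2)[OF that this] show ?case by simp
    qed
  qed
  have "sqint M (\<lambda>x. y (r 0) x - g x)"
    by (rule sqint_nnI) (measurable, rule le_less_trans[OF near[OF order_refl]], simp)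
  from sqint_diff[OF ys[of "r 0"] this] have gs: "sqint M g" by simp
  show ?thesis
  proof (rule that[of "\<lambda>k. c (r k)" g])
    show "c (r k) \<in> fwd k" for k by (rule fwd_mono[OF strict_mono_imp_increasing[OF r(1)] c(1)])
    show "sqint M g" by (rule gs)
    show "AE x in M. (\<lambda>n. comb (c (r n)) (\<lambda>k. f k x)) \<longlonglongrightarrow> g x" using conv by (simp add: y_def)
    have "(\<integral>x. (norm (y (r k) x - g x))\<^sup>2 \<partial>M) \<le> (1/8)^k" for k
      using near[OF order_refl, of k] by (simp add: sqint_nn[OF sqint_diff[OF ys gs]])
    then show "(\<lambda>n. \<integral>x. (norm (comb (c (r n)) (\<lambda>k. f k x) - g x))\<^sup>2 \<partial>M) \<longlonglongrightarrow> 0"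
      unfolding y_def[symmetric]
      by (intro tendsto_sandwich[OF _ _ tendsto_const LIMSEQ_power_zero[of "1/8"]]) auto
    fix b assume b: "\<And>N. \<exists>k\<ge>N. (\<integral>x. (norm (f k x))\<^sup>2 \<partial>M) \<le> b"
    obtain k where "(\<integral>x. (norm (f k x))\<^sup>2 \<partial>M) \<le> b" using b[of 0] by blast
    moreover have "0 \<le> (\<integral>x. (norm (f k x))\<^sup>2 \<partial>M)" by (intro integral_nonneg_AE AE_I2) simp
    ultimately have b0: "0 \<le> b" by linarith
    have yb: "(\<integral>x. (norm (y n x))\<^sup>2 \<partial>M) \<le> b + 1 / real (Suc n)" for n
    proof -
      obtain k where "n \<le> k" "(\<integral>x. (norm (f k x))\<^sup>2 \<partial>M) \<le> b" using b[of n] by blast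
      then show ?thesis using c(2)[of n k] by (simp add: y_def)
    qed
    have "(\<integral>x. (norm (g x))\<^sup>2 \<partial>M) \<le> b + e" if "0 < e" for e
    proof -
      have "(\<integral>\<^sup>+x. ennreal ((norm (0 - g x))\<^sup>2) \<partial>M) \<le> ennreal (b + e)"
      proof (rule fat[OF sqint_0])
        have "\<forall>\<^sub>F n in sequentially. 1 / real (Suc n) < e"
          using order_tendstoD(2)[OF LIMSEQ_inverse_real_of_nat that] by (simp add: inverse_eq_divide)
        then have "\<forall>\<^sub>F n in sequentially. 1 / real (Suc (r n)) < e"
          by (rule eventually_subseq[OF r(1)])
        then show "\<forall>\<^sub>F n in sequentially. (\<integral>x. (norm (0 - y (r n) x))\<^sup>2 \<partial>M) \<le> b + e"
        proof eventually_elim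
          case (elim n) then show ?case using yb[of "r n"] by simp
        qed
      qed
      then have "ennreal (\<integral>x. (norm (g x))\<^sup>2 \<partial>M) \<le> ennreal (b + e)"
        by (simp add: sqint_nn[OF gs] del: ennreal_plus)
      then show ?thesis using b0 that by (simp add: ennreal_le_iff del: ennreal_plus)
    qed
    then show "(\<integral>x. (norm (g x))\<^sup>2 \<partial>M) \<le> b" by (rule field_le_epsilon)
  qed
qed

section \<open>Admissible potentials\<close>

lemma iter_pd_zero:
  fixes \<phi> :: "'a::euclidean_space \<Rightarrow> real"
  assumes K: "closed K" and z: "\<And>x. x \<notin> K \<Longrightarrow> \<phi> x = 0"
  shows "x \<notin> K \<Longrightarrow> iter_pd bs \<phi> x = 0"
proof (induction bs arbitrary: x)
  case Nil then show ?case using z by simp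
next
  case (Cons b bs)
  have "((\<lambda>y. 0) has_derivative (\<lambda>h. 0)) (at x)" by simp
  then have "(iter_pd bs \<phi> has_derivative (\<lambda>h. 0)) (at x)"
    by (rule has_derivative_transform_within_open[of _ _ _ _ "- K"]) (use K Cons in auto)
  then have "frechet_derivative (iter_pd bs \<phi>) (at x) = (\<lambda>h. 0)" by (rule frechet_derivative_at[symmetric])
  then show ?case by simp
qed

text \<open>Test functions with support in a fixed ball are classified up to small errors in finitely many
  derivatives by countably many codes: a modulus of continuity and rounded values on a finite net.\<close>

lemma test_fun_separable:
  "\<exists>X :: ('a::euclidean_space \<Rightarrow> real) set. countable X \<and> (\<forall>\<phi>\<in>X. test_fun_on UNIV \<phi>) \<and>
     (\<forall>\<phi>. test_fun_on UNIV \<phi> \<longrightarrow> (\<exists>\<phi>s. (\<forall>k. \<phi>s k \<in> X) \<and> test_conv \<phi>s \<phi>))"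
proof -
  define TF :: "nat \<Rightarrow> ('a \<Rightarrow> real) set" where
    "TF R = {\<phi>. test_fun_on UNIV \<phi> \<and> (\<forall>x. x \<notin> cball 0 (real R) \<longrightarrow> \<phi> x = 0)}" for R
  define e where "e m = 1 / real (Suc m)" for m
  have e0: "0 < e m" for m by (simp add: e_def)
  define bsn :: "nat \<Rightarrow> 'a list" where "bsn = from_nat_into (lists Basis)"
  have cl: "countable (lists (Basis :: 'a set))" by (intro countable_lists countable_finite) simp
  have bsn: "bsn i \<in> lists Basis" for i unfolding bsn_def by (rule from_nat_into) auto
  have bsn_surj: "\<exists>i. bs = bsn i" if "bs \<in> lists Basis" for bs
    unfolding bsn_def using from_nat_into_surj[OF cl that] by metis
  have "\<exists>xs. set xs \<subseteq> cball (0::'a) (real R) \<and> cball 0 (real R) \<subseteq> (\<Union>x\<in>set xs. ball x (e N))" for R N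
  proof -
    show ?thesis
    proof (rule compactE_image[OF compact_cball[of "0::'a" "real R"], of "cball 0 (real R)" "\<lambda>x. ball x (e N)"])
      show "cball (0::'a) (real R) \<subseteq> (\<Union>x\<in>cball 0 (real R). ball x (e N))"
        using e0[of N] by (auto intro!: bexI)
      fix k assume "k \<subseteq> cball (0::'a) (real R)" "finite k" "cball 0 (real R) \<subseteq> (\<Union>x\<in>k. ball x (e N))"
      moreover obtain xs where "set xs = k" using finite_list[OF \<open>finite k\<close>] ..
      ultimately show ?thesis by (intro exI[of _ xs]) simp
    qed (rule open_ball)
  qed
  then have "\<exists>P. \<forall>p. set (P p) \<subseteq> cball (0::'a) (real (fst p)) \<and> cball 0 (real (fst p)) \<subseteq> (\<Union>x\<in>set (P p). ball x (e (snd p)))"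
    by (intro choice allI)
  then obtain P where *: "\<forall>p. set (P p) \<subseteq> cball (0::'a) (real (fst p)) \<and> cball 0 (real (fst p)) \<subseteq> (\<Union>x\<in>set (P p). ball x (e (snd p)))" ..
  have P: "set (P (R, N)) \<subseteq> cball (0::'a) (real R)" "cball 0 (real R) \<subseteq> (\<Union>x\<in>set (P (R, N)). ball x (e N))" for R N
    using *[rule_format, of "(R, N)"] by simp_all
  define md where "md R m i \<phi> N \<longleftrightarrow> (\<forall>x\<in>cball 0 (real R). \<forall>y\<in>cball 0 (real R). dist x y < e N \<longrightarrow>
     \<bar>iter_pd (bsn i) \<phi> x - iter_pd (bsn i) \<phi> y\<bar> < e m)" for R m i \<phi> N
  have ex_md: "\<exists>N. md R m i \<phi> N" if "\<phi> \<in> TF R" for R m i \<phi>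
  proof -
    have "iter_pd (bsn i) \<phi> differentiable (at x)" for x
      using that bsn[of i] by (auto simp: TF_def test_fun_on_def smooth_def)
    then have "continuous_on (cball 0 (real R)) (iter_pd (bsn i) \<phi>)"
      by (simp add: continuous_at_imp_continuous_on differentiable_imp_continuous_within)
    then have "uniformly_continuous_on (cball 0 (real R)) (iter_pd (bsn i) \<phi>)"
      by (rule compact_uniformly_continuous) simp
    then obtain d where d: "d > 0" "\<And>x y. x \<in> cball 0 (real R) \<Longrightarrow> y \<in> cball 0 (real R) \<Longrightarrow> dist x y < d \<Longrightarrow>
        dist (iter_pd (bsn i) \<phi> x) (iter_pd (bsn i) \<phi> y) < e m"
      using e0[of m] unfolding uniformly_continuous_on_def by (metis dist_commute)
    obtain N where "e N < d" using nat_approx_posE[OF d(1)] unfolding e_def by metis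
    then have "md R m i \<phi> N" unfolding md_def using d(2) by (auto simp: dist_real_def)
    then show ?thesis ..
  qed
  define N0 where "N0 R m i \<phi> = (SOME N. md R m i \<phi> N)" for R m i \<phi>
  have N0: "md R m i \<phi> (N0 R m i \<phi>)" if "\<phi> \<in> TF R" for R m i \<phi>
    unfolding N0_def using ex_md[OF that] by (rule someI_ex)
  define code where "code R m i \<phi> = (N0 R m i \<phi>, map (\<lambda>p. \<lfloor>iter_pd (bsn i) \<phi> p / e m\<rfloor>) (P (R, N0 R m i \<phi>)))" for R m i \<phi>
  define CODE where "CODE R m \<phi> = map (\<lambda>i. code R m i \<phi>) [0..<m]" for R m \<phi>
  \<comment> \<open>Equal codes mean equal moduli and equal roundings on the net. Going from
    \<open>x\<close> to a net point costs \<open>e m\<close> for each of the two functions, and the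
    rounding at the net point costs \<open>e m\<close> once more.\<close>
  have close: "\<bar>iter_pd (bsn i) \<phi> x - iter_pd (bsn i) \<eta> x\<bar> \<le> 3 * e m"
    if phi: "\<phi> \<in> TF R" "\<eta> \<in> TF R" and c: "code R m i \<phi> = code R m i \<eta>" for R m i \<phi> \<eta> x
  proof (cases "x \<in> cball 0 (real R)")
    case False
    then have "iter_pd (bsn i) \<phi> x = 0" "iter_pd (bsn i) \<eta> x = 0"
      using iter_pd_zero[OF closed_cball _ False] phi unfolding TF_def by blast+
    then show ?thesis using e0[of m] by simp
  next
    case True
    let ?N = "N0 R m i \<phi>"
    have N: "N0 R m i \<eta> = ?N" using c by (simp add: code_def)
    obtain p where p: "p \<in> set (P (R, ?N))" "dist p x < e ?N" using P(2)[of R ?N] True by auto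
    have pc: "p \<in> cball 0 (real R)" using p P(1) by blast
    have 1: "\<bar>iter_pd (bsn i) \<phi> p - iter_pd (bsn i) \<phi> x\<bar> < e m"
      using N0[OF phi(1), of m i] True pc p(2) unfolding md_def by blast
    have 2: "\<bar>iter_pd (bsn i) \<eta> p - iter_pd (bsn i) \<eta> x\<bar> < e m"
      using N0[OF phi(2), of m i] True pc p(2) unfolding md_def N by blast
    have "map (\<lambda>p. \<lfloor>iter_pd (bsn i) \<phi> p / e m\<rfloor>) (P (R, ?N)) = map (\<lambda>p. \<lfloor>iter_pd (bsn i) \<eta> p / e m\<rfloor>) (P (R, ?N))"
      using c N by (simp only: code_def prod.inject)
    then have "\<lfloor>iter_pd (bsn i) \<phi> p / e m\<rfloor> = \<lfloor>iter_pd (bsn i) \<eta> p / e m\<rfloor>" using p(1) by simp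
    then have "\<bar>iter_pd (bsn i) \<phi> p / e m - iter_pd (bsn i) \<eta> p / e m\<bar> < 1" by linarith
    then have "\<bar>(iter_pd (bsn i) \<phi> p - iter_pd (bsn i) \<eta> p) / e m\<bar> < 1" by (simp add: diff_divide_distrib)
    then have 3: "\<bar>iter_pd (bsn i) \<phi> p - iter_pd (bsn i) \<eta> p\<bar> < e m" using e0[of m] by (simp add: abs_divide)
    show ?thesis using 1 2 3 by linarith
  qed
  \<comment> \<open>One function is chosen for each code. Codes are finite data over countable
    types, so countably many functions suffice; for codes that do not occur the choice is arbitrary,
    which is why \<open>X\<close> is intersected with the test functions.\<close>
  define pick where "pick R m c = (SOME \<phi>. \<phi> \<in> TF R \<and> CODE R m \<phi> = c)" for R m c
  have pick: "pick R m (CODE R m \<phi>) \<in> TF R \<and> CODE R m (pick R m (CODE R m \<phi>)) = CODE R m \<phi>" if "\<phi> \<in> TF R" for R m \<phi>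
    unfolding pick_def by (rule someI[of _ \<phi>]) (simp add: that)
  define X where "X = (\<lambda>(R, m, c). pick R m c) ` UNIV \<inter> {\<phi>. test_fun_on UNIV \<phi>}"
  have "countable X" unfolding X_def by (intro countable_Int1 countable_image) simp
  moreover have "\<forall>\<phi>\<in>X. test_fun_on UNIV \<phi>" by (simp add: X_def)
  moreover have "\<exists>\<phi>s. (\<forall>k. \<phi>s k \<in> X) \<and> test_conv \<phi>s \<phi>" if phi: "test_fun_on UNIV \<phi>" for \<phi>
  proof -
    obtain K where K: "compact K" "\<And>x. x \<notin> K \<Longrightarrow> \<phi> x = 0" using phi by (auto simp: test_fun_on_def)
    obtain B where B: "\<And>x. x \<in> K \<Longrightarrow> norm x \<le> B" using compact_imp_bounded[OF K(1)] unfolding bounded_iff by blast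
    obtain R :: nat where R: "B < real R" using reals_Archimedean2 by blast
    have TFR: "\<phi> \<in> TF R" unfolding TF_def
    proof (intro CollectI conjI allI impI phi)
      fix x :: 'a assume "x \<notin> cball 0 (real R)"
      then have "x \<notin> K" using B[of x] R by auto
      then show "\<phi> x = 0" by (rule K)
    qed
    define \<phi>s where "\<phi>s m = pick R m (CODE R m \<phi>)" for m
    have s: "\<phi>s m \<in> TF R" "CODE R m (\<phi>s m) = CODE R m \<phi>" for m using pick[OF TFR] by (simp_all add: \<phi>s_def)
    have t: "test_fun_on UNIV (\<phi>s m)" for m using s(1) by (simp add: TF_def)
    have "\<phi>s m \<in> X" for m unfolding X_def using t[of m]
      by (auto simp: \<phi>s_def intro!: image_eqI[of _ _ "(R, m, CODE R m \<phi>)"])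
    moreover have "test_conv \<phi>s \<phi>" unfolding test_conv_def
    proof (intro conjI allI ballI t phi)
      show "\<exists>K. compact K \<and> (\<forall>k x. x \<notin> K \<longrightarrow> \<phi>s k x = 0)"
        using s(1) by (intro exI[of _ "cball 0 (real R)"]) (simp add: TF_def)
      fix bs :: "'a list" assume "bs \<in> lists Basis"
      then obtain i where i: "bs = bsn i" using bsn_surj by blast
      show "uniform_limit UNIV (\<lambda>k. iter_pd bs (\<phi>s k)) (iter_pd bs \<phi>) sequentially"
        unfolding uniform_limit_iff
      proof (intro allI impI)
        fix d :: real assume "0 < d"
        then have "0 < d / 3" by simp
        then obtain n where n: "e n < d / 3" using nat_approx_posE unfolding e_def by metis
        show "\<forall>\<^sub>F k in sequentially. \<forall>x\<in>UNIV. dist (iter_pd bs (\<phi>s k) x) (iter_pd bs \<phi> x) < d"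
          using eventually_ge_at_top[of "max n (Suc i)"]
        proof eventually_elim
          case (elim k)
          then have "i < k" "n \<le> k" by auto
          have cc: "code R k i (\<phi>s k) = code R k i \<phi>"
            using arg_cong[OF s(2)[of k], of "\<lambda>l. l ! i"] \<open>i < k\<close> by (simp add: CODE_def)
          have "e k \<le> e n" using \<open>n \<le> k\<close> by (simp add: e_def frac_le)
          then have "\<bar>iter_pd bs (\<phi>s k) x - iter_pd bs \<phi> x\<bar> < d" for x
            using close[OF s(1) TFR cc, of x] n by (simp add: i)
          then show ?case by (simp add: dist_real_def)
        qed
      qed
    qed
    ultimately show ?thesis by blast
  qed
  ultimately show ?thesis by blast
qed

text \<open>Test functions are dense in \<open>W\<close>, and continuity of their inclusion into
  \<open>W\<close> carries the countable approximation over. Separability allows statements for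
  almost every time to be tested against countably many directions.\<close>

lemma admissible_separable:
  assumes "admissible_space (J :: 'w::banach \<Rightarrow> 'a::euclidean_space L2)"
  shows "\<exists>D :: 'w set. countable D \<and> closure D = UNIV"
proof -
  obtain X :: "('a \<Rightarrow> real) set" where X: "countable X" "\<And>\<phi>. \<phi> \<in> X \<Longrightarrow> test_fun_on UNIV \<phi>"
    "\<And>\<phi>. test_fun_on UNIV \<phi> \<Longrightarrow> \<exists>\<phi>s. (\<forall>k. \<phi>s k \<in> X) \<and> test_conv \<phi>s \<phi>"
    using test_fun_separable by blast
  let ?D = "(\<lambda>\<phi>. inv J (to_L2 \<phi>)) ` X"
  let ?V = "{v. \<exists>\<phi>. test_fun_on UNIV \<phi> \<and> J v = to_L2 \<phi>}"
  have J: "inj J" "closure ?V = UNIV"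
    "\<And>\<phi>s \<phi>. test_conv \<phi>s \<phi> \<Longrightarrow> (\<lambda>k. inv J (to_L2 (\<phi>s k))) \<longlonglongrightarrow> inv J (to_L2 \<phi>)"
    using assms unfolding admissible_space_def by blast+
  have "?V \<subseteq> closure ?D"
  proof
    fix v assume "v \<in> ?V"
    then obtain \<phi> where phi: "test_fun_on UNIV \<phi>" "J v = to_L2 \<phi>" by blast
    then obtain \<phi>s where "\<forall>k. \<phi>s k \<in> X" "test_conv \<phi>s \<phi>" using X(3) by blast
    moreover have "inv J (to_L2 \<phi>) = v" using phi(2) inv_f_f[OF J(1), of v] by simp
    ultimately show "v \<in> closure ?D" using J(3)[of \<phi>s \<phi>] unfolding closure_sequential by (intro exI) auto
  qed
  then have "closure ?V \<subseteq> closure ?D" by (simp add: closure_minimal)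
  then have "closure ?D = UNIV" using J(2) by auto
  then show ?thesis using X(1) by blast
qed

text \<open>The argument \<open>y + l * a\<close> is the convex combination of \<open>y\<close> and
  \<open>y + a\<close> with weight \<open>l\<close>, so this is convexity of the power. The
  induction absorbs the quadratic term by \<open>l * l \<le> l\<close>.\<close>

lemma power_convex_bound:
  fixes y a l :: real
  assumes "0 \<le> y" "0 \<le> a" "0 \<le> l" "l \<le> 1"
  shows "(y + l * a) ^ n \<le> y ^ n + l * ((y + a) ^ n - y ^ n)"
proof (induction n)
  case (Suc n)
  let ?D = "(y + a) ^ n - y ^ n"
  have D: "0 \<le> ?D" using assms by (simp add: power_mono)
  have "(y + l * a) * (y + l * a) ^ n \<le> (y + l * a) * (y ^ n + l * ?D)"
    by (rule mult_left_mono[OF Suc]) (use assms in simp)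
  also have "\<dots> = y * y ^ n + l * (y * ?D + a * y ^ n) + (l * l) * (a * ?D)" by (simp add: algebra_simps)
  also have "\<dots> \<le> y * y ^ n + l * (y * ?D + a * y ^ n) + l * (a * ?D)"
  proof -
    have "l * l \<le> l" using assms by (simp add: mult_left_le)
    then have "(l * l) * (a * ?D) \<le> l * (a * ?D)" using D assms by (intro mult_right_mono) auto
    then show ?thesis by simp
  qed
  also have "\<dots> = y ^ Suc n + l * ((y + a) ^ Suc n - y ^ Suc n)" by (simp add: algebra_simps)
  finally show ?case by simp
qed simp

lemma power_add_bound:
  fixes y a :: real
  assumes "0 \<le> y" "0 \<le> a"
  shows "(y + a) ^ n \<le> 2 ^ n * (y ^ n + a ^ n)"
proof -
  have "(y + a) ^ n \<le> (2 * max y a) ^ n" using assms by (intro power_mono) auto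
  also have "\<dots> = 2 ^ n * (max y a) ^ n" by (simp add: power_mult_distrib)
  also have "(max y a) ^ n \<le> y ^ n + a ^ n" using assms by (simp add: max_def)
  finally show ?thesis by simp
qed

text \<open>Condition (iii) says that \<open>(1 + \<W>) powr (1 / n)\<close> is Lipschitz continuous on \<open>W\<close> when
  \<open>1 / n \<le> 1 - \<theta>\<close>; by convexity of the \<open>n\<close>-th power this yields the only growth property that is used.\<close>

lemma gradient_growth:
  fixes J :: "'w::banach \<Rightarrow> 'h::real_normed_vector"
  assumes J: "bounded_linear J" and G: "gateaux_gradient (\<lambda>v. enn2real (\<W> (J v))) G" and C: "0 \<le> C"
    and th: "0 < \<theta>" "\<theta> < 1" and b: "\<And>v. norm (G v) \<le> C * (1 + enn2real (\<W> (J v)) powr \<theta>)"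
    and fin: "\<And>v. \<W> v < \<infinity> \<longleftrightarrow> v \<in> range J"
  obtains K and n :: nat where "0 \<le> K"
    "\<And>x h l. 0 \<le> l \<Longrightarrow> l \<le> 1 \<Longrightarrow> \<W> (x + l *\<^sub>R J h) \<le> \<W> x + ennreal (l * K) * (1 + \<W> x + ennreal (norm h ^ n))"
proof -
  obtain n0 where n0: "1 / real (Suc n0) < 1 - \<theta>" using nat_approx_posE[of "1 - \<theta>"] th by auto
  define n where "n = Suc n0"
  have n: "0 < n" "\<theta> \<le> 1 - 1 / real n" using n0 by (simp_all add: n_def)
  define K where "K = 2 ^ n * (1 + (2 * C) ^ n)"
  have K0: "0 \<le> K" using C by (simp add: K_def)
  define P where "P v = enn2real (\<W> (J v))" for v
  have P0: "0 \<le> P v" for v by (simp add: P_def)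
  have WP: "\<W> (J v) = ennreal (P v)" for v
    unfolding P_def using fin[of "J v"] by (intro ennreal_enn2real[symmetric]) (simp add: less_top[symmetric])
  have main: "P (v + l *\<^sub>R h) \<le> P v + l * K * (1 + P v + norm h ^ n)" if l: "0 \<le> l" "l \<le> 1" for v h l
  proof -
    define f where "f s = P (v + s *\<^sub>R h)" for s
    define D where "D s = blinfun_apply (G (v + s *\<^sub>R h)) h" for s
    have f: "(f has_real_derivative D s) (at s)" for s
    proof -
      have "((\<lambda>r. P ((v + s *\<^sub>R h) + r *\<^sub>R h)) has_real_derivative D s) (at 0)"
        using G unfolding gateaux_gradient_def P_def D_def by blast
      then have "((\<lambda>r. f (r + s)) has_real_derivative D s) (at 0)"
        by (simp add: f_def scaleR_add_left add_ac)
      then show ?thesis using DERIV_shift[of f "D s" 0 s] by simp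
    qed
    have f0: "0 \<le> f s" for s by (simp add: f_def P0)
    \<comment> \<open>Differentiating this root multiplies the gradient by
      \<open>(1 + f s) powr (1 / n - 1)\<close>, which compensates the growth
      \<open>(1 + f s) powr (1 - 1 / n)\<close> allowed by the choice of \<open>n\<close>. What
      remains is the Lipschitz constant \<open>A\<close>; its factor \<open>2\<close> comes from
      \<open>1 + f s powr \<theta> \<le> 2 * (1 + f s) powr (1 - 1 / n)\<close>.\<close>
    define Y where "Y s = (1 + f s) powr (1 / real n)" for s
    have Yn: "Y s ^ n = 1 + f s" for s
      using f0[of s] n by (simp add: Y_def powr_realpow[symmetric] powr_powr)
    have Y0: "0 \<le> Y s" for s by (simp add: Y_def)
    define A where "A = 2 * C * norm h"
    have A0: "0 \<le> A" using C by (simp add: A_def)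
    define Y' where "Y' s = (1 / real n) * (1 + f s) powr (1 / real n - 1) * D s" for s
    have Yd: "(Y has_real_derivative Y' s) (at s)" for s
      unfolding Y_def[abs_def] Y'_def using f0[of s]
      by (auto intro!: derivative_eq_intros DERIV_fun_powr[THEN DERIV_cong] f simp: add_pos_nonneg)
    have Yb: "norm (Y' s) \<le> A" for s
    proof -
      have pos: "1 \<le> 1 + f s" using f0[of s] by simp
      have "\<bar>D s\<bar> \<le> norm (G (v + s *\<^sub>R h)) * norm h" unfolding D_def using norm_blinfun[of "G (v + s *\<^sub>R h)" h] by simp
      also have "\<dots> \<le> C * (1 + f s powr \<theta>) * norm h"
        using b[of "v + s *\<^sub>R h"] by (intro mult_right_mono) (simp_all add: f_def P_def)
      also have "\<dots> \<le> C * (2 * (1 + f s) powr (1 - 1 / real n)) * norm h"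
      proof (intro mult_right_mono mult_left_mono C norm_ge_zero)
        have "f s powr \<theta> \<le> (1 + f s) powr \<theta>" using f0[of s] th by (intro powr_mono2) auto
        also have "\<dots> \<le> (1 + f s) powr (1 - 1 / real n)" by (rule powr_mono[OF n(2) pos])
        finally have 1: "f s powr \<theta> \<le> (1 + f s) powr (1 - 1 / real n)" .
        have "(1 + f s) powr 0 \<le> (1 + f s) powr (1 - 1 / real n)"
          by (rule powr_mono[OF _ pos]) (use n th in simp)
        then have "1 \<le> (1 + f s) powr (1 - 1 / real n)" using pos by simp
        with 1 show "1 + f s powr \<theta> \<le> 2 * (1 + f s) powr (1 - 1 / real n)" by simp
      qed
      finally have D: "\<bar>D s\<bar> \<le> A * (1 + f s) powr (1 - 1 / real n)" by (simp add: A_def mult_ac)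
      have "norm (Y' s) = (1 / real n) * (1 + f s) powr (1 / real n - 1) * \<bar>D s\<bar>"
        by (simp add: Y'_def abs_mult)
      also have "\<dots> \<le> 1 * (1 + f s) powr (1 / real n - 1) * (A * (1 + f s) powr (1 - 1 / real n))"
        using n by (intro mult_mono D) auto
      also have "\<dots> = A * ((1 + f s) powr (1 / real n - 1) * (1 + f s) powr (1 - 1 / real n))" by simp
      also have "(1 + f s) powr (1 / real n - 1) * (1 + f s) powr (1 - 1 / real n) = 1"
        using pos by (simp add: powr_add[symmetric])
      finally show ?thesis by simp
    qed
    have "norm (Y l - Y 0) \<le> A * norm (l - 0)"
      by (rule field_differentiable_bound[of UNIV Y Y' A l 0])
         (use Yd Yb in \<open>auto intro: has_field_derivative_at_within\<close>)
    then have "Y l \<le> Y 0 + l * A" using l by (simp add: mult.commute)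
    then have "Y l ^ n \<le> (Y 0 + l * A) ^ n" by (rule power_mono[OF _ Y0])
    also have "\<dots> \<le> Y 0 ^ n + l * ((Y 0 + A) ^ n - Y 0 ^ n)" by (rule power_convex_bound[OF Y0 A0 l])
    also have "\<dots> \<le> Y 0 ^ n + l * (K * (1 + f 0 + norm h ^ n))"
    proof (intro add_left_mono mult_left_mono l)
      have "(Y 0 + A) ^ n - Y 0 ^ n \<le> (Y 0 + A) ^ n" using Y0 by simp
      also have "\<dots> \<le> 2 ^ n * (Y 0 ^ n + A ^ n)" by (rule power_add_bound[OF Y0 A0])
      also have "\<dots> = 2 ^ n * ((1 + f 0) + (2 * C) ^ n * norm h ^ n)" by (simp add: Yn A_def power_mult_distrib)
      also have "\<dots> \<le> 2 ^ n * ((1 + (2 * C) ^ n) * (1 + f 0) + (1 + (2 * C) ^ n) * norm h ^ n)"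
        using C f0[of 0] by (intro mult_left_mono add_mono) (simp_all add: algebra_simps)
      also have "\<dots> = K * (1 + f 0 + norm h ^ n)" by (simp add: K_def algebra_simps)
      finally show "(Y 0 + A) ^ n - Y 0 ^ n \<le> K * (1 + f 0 + norm h ^ n)" .
    qed
    finally show ?thesis by (simp add: Yn) (simp add: f_def mult.assoc)
  qed
  show ?thesis
  proof (rule that[OF K0, of n])
    fix x h and l :: real assume l: "0 \<le> l" "l \<le> 1"
    show "\<W> (x + l *\<^sub>R J h) \<le> \<W> x + ennreal (l * K) * (1 + \<W> x + ennreal (norm h ^ n))"
    proof (cases "\<W> x < \<infinity>")
      case False
      then show ?thesis by (simp add: less_top[symmetric])
    next
      case True
      then obtain v where v: "x = J v" using fin by blast
      have "x + l *\<^sub>R J h = J (v + l *\<^sub>R h)" using J by (simp add: v linear_simps)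
      then have "\<W> (x + l *\<^sub>R J h) = ennreal (P (v + l *\<^sub>R h))" by (simp only: WP)
      also have "\<dots> \<le> ennreal (P v + (l * K) * (1 + P v + norm h ^ n))" by (rule ennreal_leI[OF main[OF l]])
      also have "\<dots> = \<W> x + ennreal (l * K) * (1 + \<W> x + ennreal (norm h ^ n))"
      proof -
        have nn: "0 \<le> l * K" "0 \<le> norm h ^ n" using l K0 by simp_all
        have "ennreal ((l * K) * (1 + P v + norm h ^ n)) = ennreal (l * K) * (1 + ennreal (P v) + ennreal (norm h ^ n))"
          using P0[of v] nn by (simp add: ennreal_mult'[OF nn(1)])
        then show ?thesis using P0[of v] nn by (simp add: v WP ennreal_plus[OF P0 mult_nonneg_nonneg])
      qed
      finally show ?thesis .
    qed
  qed
qed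

text \<open>The consequences of admissibility on which the rest relies. Lower semicontinuity is
  stated for bounded sequences tested by inner products, the gradient condition is replaced by its
  growth inequality, and \<open>D\<close> is a countable dense set of directions. The state space
  may be any separable Hilbert space.\<close>

locale potential =
  fixes J :: "'w::banach \<Rightarrow> 'h::{real_inner, banach, second_countable_topology}"
    and \<W> :: "'h \<Rightarrow> ennreal" and K :: real and n :: nat and D :: "'w set"
  assumes lsc: "\<And>x y B. (\<And>k. norm (x k) \<le> B) \<Longrightarrow> (\<And>h. (\<lambda>k. inner (x k) h) \<longlonglongrightarrow> inner y h) \<Longrightarrow>
      \<W> y \<le> liminf (\<lambda>k. \<W> (x k))"
    and J: "bounded_linear J" and dense: "closure (range J) = UNIV"
    and fin: "\<And>v. \<W> (J v) < \<infinity>" and K0: "0 \<le> K"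
    and growth: "\<And>x h l. 0 \<le> l \<Longrightarrow> l \<le> 1 \<Longrightarrow>
      \<W> (x + l *\<^sub>R J h) \<le> \<W> x + ennreal (l * K) * (1 + \<W> x + ennreal (norm h ^ n))"
    and D: "countable D" "closure D = UNIV"

lemma admissible_potential:
  assumes "admissible_potential (J :: 'w::banach \<Rightarrow> 'a::euclidean_space L2) \<W>"
  obtains K n D where "potential J \<W> K n D"
proof -
  obtain G C \<theta> where G: "gateaux_gradient (\<lambda>v. enn2real (\<W> (J v))) G" "0 \<le> C" "0 < \<theta>" "\<theta> < 1"
    "\<And>v. norm (G v) \<le> C * (1 + enn2real (\<W> (J v)) powr \<theta>)"
    using assms unfolding admissible_potential_def by blast
  have sp: "admissible_space J" and fin: "\<And>v. \<W> v < \<infinity> \<longleftrightarrow> v \<in> range J"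
    and lsc: "\<And>vs v. weak_conv vs v \<Longrightarrow> \<W> v \<le> liminf (\<lambda>k. \<W> (vs k))"
    using assms unfolding admissible_potential_def by blast+
  have J: "bounded_linear J" "closure (range J) = UNIV" using sp unfolding admissible_space_def by blast+
  obtain D :: "'w set" where D: "countable D" "closure D = UNIV" using admissible_separable[OF sp] by blast
  show ?thesis
  proof (rule gradient_growth[OF J(1) G(1-5) fin])
    fix K and n :: nat assume K: "0 \<le> K" and
      g: "\<And>x h l. 0 \<le> l \<Longrightarrow> l \<le> 1 \<Longrightarrow> \<W> (x + l *\<^sub>R J h) \<le> \<W> x + ennreal (l * K) * (1 + \<W> x + ennreal (norm h ^ n))"
    have "potential J \<W> K n D"
    proof (rule potential.intro)
      show "\<W> y \<le> liminf (\<lambda>k. \<W> (x k))"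
        if "\<And>k. norm (x k) \<le> B" "\<And>h. (\<lambda>k. inner (x k) h) \<longlonglongrightarrow> inner y h" for x y B
        by (rule lsc[OF weak_conv_inner[OF that]])
      show "\<W> (J v) < \<infinity>" for v using fin by blast
    qed (rule J D K g; assumption)+
    then show ?thesis by (rule that)
  qed
qed

context potential
begin

lemma lsc_tendsto:
  assumes "x \<longlonglongrightarrow> y" shows "\<W> y \<le> liminf (\<lambda>k. \<W> (x k))"
proof -
  obtain B where B: "\<And>k. norm (x k) \<le> B"
    using convergent_imp_Bseq[of x] assms by (auto simp: convergent_def Bseq_def)
  show ?thesis by (rule lsc[OF B]) (intro tendsto_inner assms tendsto_const)
qed

text \<open>Strong convergence implies weak convergence, so sublevel sets are closed.\<close>

lemma borel_W [measurable]: "\<W> \<in> borel_measurable borel"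
proof (rule borel_measurableI_le)
  fix c
  have "closed {x. \<W> x \<le> c}"
    unfolding closed_sequential_limits
  proof (intro allI impI, elim conjE)
    fix x y assume x: "\<forall>k. x k \<in> {x. \<W> x \<le> c}" and "x \<longlonglongrightarrow> y"
    then have "\<W> y \<le> liminf (\<lambda>k. \<W> (x k))" by (intro lsc_tendsto)
    also have "\<dots> \<le> c" using Liminf_le[of sequentially "\<lambda>k. \<W> (x k)" c] x by simp
    finally show "y \<in> {x. \<W> x \<le> c}" by simp
  qed
  then show "{x \<in> space borel. \<W> x \<le> c} \<in> sets borel" by (simp add: borel_closed)
qed

end

section \<open>Existence of minimizers\<close>

lemma nn_integral_exp_power:
  assumes e: "0 < (\<epsilon>::real)"
  shows "(\<integral>\<^sup>+t\<in>{0..}. ennreal (exp (- t / \<epsilon>) * (t / \<epsilon>) ^ k) \<partial>lborel) = ennreal (\<epsilon> * fact k)"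
proof -
  have "(\<integral>\<^sup>+t\<in>{0..}. ennreal (exp (- t / \<epsilon>) * (t / \<epsilon>) ^ k) \<partial>lborel)
    = ennreal \<bar>\<epsilon>\<bar> * (\<integral>\<^sup>+t. ennreal (exp (- (0 + \<epsilon> * t) / \<epsilon>) * ((0 + \<epsilon> * t) / \<epsilon>) ^ k) * indicator {0..} (0 + \<epsilon> * t) \<partial>lborel)"
    by (rule nn_integral_real_affine) (use e in auto)
  also have "(\<integral>\<^sup>+t. ennreal (exp (- (0 + \<epsilon> * t) / \<epsilon>) * ((0 + \<epsilon> * t) / \<epsilon>) ^ k) * indicator {0..} (0 + \<epsilon> * t) \<partial>lborel)
    = (\<integral>\<^sup>+t. ennreal (t ^ k * exp (- t)) * indicator {0..} t \<partial>lborel)"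
  proof (rule nn_integral_cong)
    fix t
    have "indicator {0..} (0 + \<epsilon> * t) = (indicator {0..} t :: ennreal)"
      using e by (simp add: indicator_def zero_le_mult_iff)
    then show "ennreal (exp (- (0 + \<epsilon> * t) / \<epsilon>) * ((0 + \<epsilon> * t) / \<epsilon>) ^ k) * indicator {0..} (0 + \<epsilon> * t)
      = ennreal (t ^ k * exp (- t)) * indicator {0..} t"
      using e by (simp add: mult.commute)
  qed
  also have "\<dots> = ennreal (fact k)" by (subst nn_intergal_power_times_exp_Ici) (simp add: ennreal_of_nat_eq_real_of_nat)
  finally show ?thesis using e by (simp add: ennreal_mult')
qed

text \<open>Multiplication by the square root of the weight and restriction to nonnegative times.
  The weighted quadratic term becomes a squared norm on the whole line, to which
  \<open>fwd_L2\<close> applies.\<close>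

definition damp :: "real \<Rightarrow> (real \<Rightarrow> 'b::real_vector) \<Rightarrow> real \<Rightarrow> 'b" where
  "damp \<epsilon> z t = indicator {0..} t *\<^sub>R (exp (- t / (2 * \<epsilon>)) *\<^sub>R z t)"

lemma exp_half_sq: "\<epsilon> \<noteq> 0 \<Longrightarrow> (exp (- (t / (2 * \<epsilon>))))\<^sup>2 = exp (- (t / (\<epsilon>::real)))"
  by (simp add: power2_eq_square exp_add[symmetric])

lemma integrable_indicator_const: "integrable lborel (\<lambda>s. indicator {a..b::real} s * (c::real))"
  by (intro integrable_mult_left integrable_real_indicator) (auto simp: emeasure_lborel_Icc_eq)

lemma norm_damp: "\<epsilon> \<noteq> 0 \<Longrightarrow> (norm (damp \<epsilon> z t))\<^sup>2 = indicator {0..} t * (exp (- t / \<epsilon>) * (norm (z t))\<^sup>2)"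
  by (simp add: damp_def power_mult_distrib exp_half_sq indicator_def)

lemma damp_measurable [measurable]:
  "z \<in> borel_measurable borel \<Longrightarrow> damp \<epsilon> (z :: real \<Rightarrow> 'b::{banach, second_countable_topology}) \<in> borel_measurable borel"
  unfolding damp_def[abs_def] by measurable

lemma damp_nn:
  assumes "\<epsilon> \<noteq> 0"
  shows "(\<integral>\<^sup>+t\<in>{0..}. ennreal (exp (- t / \<epsilon>) * (norm (z t))\<^sup>2) \<partial>lborel) = (\<integral>\<^sup>+t. ennreal ((norm (damp \<epsilon> z t))\<^sup>2) \<partial>lborel)"
  by (rule nn_integral_cong) (simp add: norm_damp[OF assms] indicator_def)

text \<open>The inverse of damping: up to time \<open>t\<close> the factor
  \<open>exp (s / \<epsilon>)\<close> is at most \<open>exp (t / \<epsilon>)\<close>, so a global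
  weighted bound gives local square integrability with an explicit constant.\<close>

lemma locL2_exp_bound:
  assumes f: "sqint lborel f" and z: "z \<in> borel_measurable borel" and e: "0 < \<epsilon>"
    and b: "\<And>t. 0 \<le> t \<Longrightarrow> (norm (z t))\<^sup>2 \<le> exp (t / \<epsilon>) * (norm (f t))\<^sup>2"
  shows "locL2 z" and "prim (\<lambda>s. (norm (z s))\<^sup>2) t \<le> exp (t / \<epsilon>) * (\<integral>s. (norm (f s))\<^sup>2 \<partial>lborel)"
proof -
  note [measurable] = z
  have fi: "integrable lborel (\<lambda>s. (norm (f s))\<^sup>2)" using f by (simp add: sqint_def)
  have b': "indicator {0..T} s * (norm (z s))\<^sup>2 \<le> exp (T / \<epsilon>) * (norm (f s))\<^sup>2" for s T
  proof (cases "s \<in> {0..T}")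
    case True
    then have "exp (s / \<epsilon>) \<le> exp (T / \<epsilon>)" using e by (simp add: divide_right_mono)
    then have "exp (s / \<epsilon>) * (norm (f s))\<^sup>2 \<le> exp (T / \<epsilon>) * (norm (f s))\<^sup>2" by (rule mult_right_mono) simp
    then show ?thesis using b[of s] True by simp
  qed simp
  have i: "integrable lborel (\<lambda>s. indicator {0..T} s * (norm (z s))\<^sup>2)" for T
    by (rule Bochner_Integration.integrable_bound[OF integrable_mult_right[of "exp (T / \<epsilon>)", OF fi]])
       (use b' in \<open>auto simp: abs_mult\<close>)
  then show "locL2 z" by (intro locL2I z) (simp add: locint_def set_integrable_def)
  have "prim (\<lambda>s. (norm (z s))\<^sup>2) t \<le> (\<integral>s. exp (t / \<epsilon>) * (norm (f s))\<^sup>2 \<partial>lborel)"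
    unfolding prim_def set_lebesgue_integral_def
    by (rule integral_mono) (use i[of t] fi b' in simp_all)
  then show "prim (\<lambda>s. (norm (z s))\<^sup>2) t \<le> exp (t / \<epsilon>) * (\<integral>s. (norm (f s))\<^sup>2 \<partial>lborel)" by simp
qed

lemma norm_le_sq: "0 < a \<Longrightarrow> norm x \<le> a / 2 + (norm x)\<^sup>2 / (2 * a)"
proof -
  assume a: "0 < a"
  have "0 \<le> (norm x - a)\<^sup>2 / (2 * a)" using a by simp
  then show ?thesis using a by (simp add: power2_diff field_simps power2_eq_square)
qed

text \<open>Schwarz' inequality in Young's form with a free parameter. A large \<open>a\<close>
  makes the integral term small, and afterwards a short interval makes the other term small; this is
  the source of equicontinuity of velocities.\<close>

lemma prim_L2_bound:
  fixes z :: "real \<Rightarrow> 'b::{banach, second_countable_topology}"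
  assumes z: "locL2 z" and st: "0 \<le> s" "s \<le> t" and a: "0 < a"
  shows "norm (prim z t - prim z s) \<le> a / 2 * (t - s) + prim (\<lambda>s. (norm (z s))\<^sup>2) t / (2 * a)"
proof -
  note zi = locL2_locint[OF z]
  have si: "set_integrable lborel {s..t} z" using st by (intro locint_subset[OF zi, of _ t]) auto
  have si2: "set_integrable lborel {s..t} (\<lambda>r. (norm (z r))\<^sup>2)" using st by (intro locint_subset[OF locL2_sq[OF z], of _ t]) auto
  have i2: "integrable lborel (\<lambda>r. indicator {s..t} r * (a / 2) + indicator {s..t} r * (norm (z r))\<^sup>2 / (2 * a))"
    using si2 unfolding set_integrable_def
    by (intro Bochner_Integration.integrable_add integrable_divide integrable_indicator_const) simp
  have "norm (prim z t - prim z s) = norm (\<integral>r. indicator {s..t} r *\<^sub>R z r \<partial>lborel)"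
    by (simp add: prim_diff_interval[OF zi st] set_lebesgue_integral_def)
  also have "\<dots> \<le> (\<integral>r. indicator {s..t} r * (a / 2) + indicator {s..t} r * (norm (z r))\<^sup>2 / (2 * a) \<partial>lborel)"
  proof (rule Bochner_Integration.integral_norm_bound_integral)
    show "integrable lborel (\<lambda>r. indicat_real {s..t} r *\<^sub>R z r)" using si by (simp add: set_integrable_def)
    show "norm (indicat_real {s..t} r *\<^sub>R z r) \<le> indicator {s..t} r * (a / 2) + indicator {s..t} r * (norm (z r))\<^sup>2 / (2 * a)" for r
      using norm_le_sq[OF a, of "z r"] by (simp add: indicator_def)
  qed (rule i2)
  also have "\<dots> = a / 2 * (t - s) + (\<integral>r. indicator {s..t} r * (norm (z r))\<^sup>2 \<partial>lborel) / (2 * a)"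
    using si2 st unfolding set_integrable_def
    by (subst Bochner_Integration.integral_add) (simp_all add: integrable_indicator_const)
  also have "(\<integral>r. indicator {s..t} r * (norm (z r))\<^sup>2 \<partial>lborel) \<le> prim (\<lambda>s. (norm (z s))\<^sup>2) t"
    unfolding prim_def set_lebesgue_integral_def
    by (rule integral_mono)
       (use si2 locint_integrable[OF locL2_sq[OF z], of t] st in \<open>simp_all add: set_integrable_def indicator_def\<close>)
  finally show ?thesis using a by (simp add: divide_right_mono)
qed

lemma prim_comb:
  assumes "\<And>k. locint (f k)"
  shows "locint (\<lambda>s. comb c (\<lambda>k. f k s))" "prim (\<lambda>s. comb c (\<lambda>k. f k s)) t = comb c (\<lambda>k. prim (f k) t)"
proof -
  have "finite A \<Longrightarrow> locint (\<lambda>s. \<Sum>i\<in>A. c i *\<^sub>R f i s) \<and> prim (\<lambda>s. \<Sum>i\<in>A. c i *\<^sub>R f i s) t = (\<Sum>i\<in>A. c i *\<^sub>R prim (f i) t)" for A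
  proof (induction A rule: finite_induct)
    case empty then show ?case by (simp add: locint_continuous)
  next
    case (insert i A)
    have "locint (\<lambda>s. c i *\<^sub>R f i s)" by (rule locint_bounded_linear[OF bounded_linear_scaleR_right assms])
    moreover have "prim (\<lambda>s. c i *\<^sub>R f i s) t = c i *\<^sub>R prim (f i) t"
      by (rule prim_bounded_linear[OF bounded_linear_scaleR_right assms])
    ultimately show ?case using insert by (simp add: locint_add prim_add)
  qed
  then have "locint (\<lambda>s. comb c (\<lambda>k. f k s)) \<and> prim (\<lambda>s. comb c (\<lambda>k. f k s)) t = comb c (\<lambda>k. prim (f k) t)"
    unfolding comb_def by (cases "finite {i. c i \<noteq> 0}") (simp_all add: locint_continuous)
  then show "locint (\<lambda>s. comb c (\<lambda>k. f k s))" "prim (\<lambda>s. comb c (\<lambda>k. f k s)) t = comb c (\<lambda>k. prim (f k) t)"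
    by blast+
qed

lemma locint_inner: "locint f \<Longrightarrow> locint (\<lambda>s. inner (f s) (h::'b::{real_inner, banach, second_countable_topology}))"
  and prim_inner: "locint f \<Longrightarrow> prim (\<lambda>s. inner (f s) h) t = inner (prim f t) h"
  by (rule locint_bounded_linear[OF bounded_linear_inner_left], assumption)
     (rule prim_bounded_linear[OF bounded_linear_inner_left])

lemma inner_prim_tendsto:
  fixes v :: "nat \<Rightarrow> real \<Rightarrow> 'b::{real_inner, banach, second_countable_topology}"
  assumes v: "\<And>k. locint (v k)" and y: "locint y" and B: "\<And>k s. 0 \<le> s \<Longrightarrow> s \<le> t \<Longrightarrow> norm (v k s) \<le> B"
    and c: "AE s in lborel. 0 < s \<longrightarrow> (\<lambda>k. inner (v k s) h) \<longlonglongrightarrow> inner (y s) h"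
  shows "(\<lambda>k. inner (prim (v k) t) h) \<longlonglongrightarrow> inner (prim y t) h"
  unfolding prim_inner[OF v, symmetric] prim_inner[OF y, symmetric] unfolding prim_def set_lebesgue_integral_def
proof (rule integral_dominated_convergence)
  show "integrable lborel (\<lambda>s. indicator {0..t} s * (B * norm h))" by (rule integrable_indicator_const)
  show "AE s in lborel. (\<lambda>k. indicat_real {0..t} s *\<^sub>R inner (v k s) h) \<longlonglongrightarrow> indicat_real {0..t} s *\<^sub>R inner (y s) h"
    using c AE_lborel_singleton[of 0] by eventually_elim (auto simp: indicator_def)
  show "AE s in lborel. norm (indicat_real {0..t} s *\<^sub>R inner (v k s) h) \<le> indicator {0..t} s * (B * norm h)" for k
  proof (rule AE_I2)
    fix s
    have "\<bar>inner (v k s) h\<bar> \<le> B * norm h" if "0 \<le> s" "s \<le> t"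
      using Cauchy_Schwarz_ineq2[of "v k s" h] mult_right_mono[OF B[OF that] norm_ge_zero[of h], of k] by linarith
    then show "norm (indicat_real {0..t} s *\<^sub>R inner (v k s) h) \<le> indicator {0..t} s * (B * norm h)"
      by (simp add: indicator_def)
  qed
  show "(\<lambda>s. indicat_real {0..t} s *\<^sub>R inner (v k s) h) \<in> borel_measurable lborel" for k
    using locint_integrable[OF locint_inner[OF v]] by (rule borel_measurable_integrable)
  show "(\<lambda>s. indicat_real {0..t} s *\<^sub>R inner (y s) h) \<in> borel_measurable lborel"
    using locint_integrable[OF locint_inner[OF y]] by (rule borel_measurable_integrable)
qed

lemma liminf_cmult_ennreal:
  fixes f :: "nat \<Rightarrow> ennreal"
  assumes "c < top" shows "liminf (\<lambda>k. c * f k) = c * liminf f"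
proof (rule Liminf_compose_continuous_mono)
  show "continuous_on UNIV (\<lambda>x. c * x)"
    unfolding continuous_on_def by (intro ballI ennreal_tendsto_cmult assms tendsto_ident_at)
  show "mono (\<lambda>x. c * x)" by (intro monoI mult_left_mono) simp_all
qed simp

context potential
begin

lemma W_measurable_pth [measurable]:
  "locint z \<Longrightarrow> (\<lambda>t. \<W> (pth u0 u1 z t)) \<in> borel_measurable borel"
  by (rule measurable_compose[OF measurable_pth borel_W])

lemma wfun_damp:
  assumes "\<epsilon> \<noteq> 0"
  shows "wfun \<W> u0 u1 \<epsilon> z = ennreal (\<epsilon>\<^sup>2 / 2) * (\<integral>\<^sup>+t. ennreal ((norm (damp \<epsilon> z t))\<^sup>2) \<partial>lborel)
     + (\<integral>\<^sup>+t\<in>{0..}. ennreal (exp (- t / \<epsilon>)) * \<W> (pth u0 u1 z t) \<partial>lborel)"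
  unfolding wfun_def damp_nn[OF assms] ..

lemma wfun_sqint:
  assumes e: "0 < \<epsilon>" and z: "locL2 z" and b: "wfun \<W> u0 u1 \<epsilon> z \<le> ennreal m" and m: "0 \<le> m"
  shows "sqint lborel (damp \<epsilon> z)" "\<epsilon>\<^sup>2 / 2 * (\<integral>t. (norm (damp \<epsilon> z t))\<^sup>2 \<partial>lborel) \<le> m"
    "ennreal (\<epsilon>\<^sup>2 / 2 * (\<integral>t. (norm (damp \<epsilon> z t))\<^sup>2 \<partial>lborel)) + (\<integral>\<^sup>+t\<in>{0..}. ennreal (exp (- t / \<epsilon>)) * \<W> (pth u0 u1 z t) \<partial>lborel) \<le> ennreal m"
proof -
  have [measurable]: "z \<in> borel_measurable borel" using z by (rule locL2_measurable)
  let ?A = "\<integral>\<^sup>+t. ennreal ((norm (damp \<epsilon> z t))\<^sup>2) \<partial>lborel"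
  have e': "\<epsilon> \<noteq> 0" using e by simp
  have "ennreal (\<epsilon>\<^sup>2 / 2) * ?A \<le> wfun \<W> u0 u1 \<epsilon> z" unfolding wfun_damp[OF e'] by simp
  also note b
  finally have le: "ennreal (\<epsilon>\<^sup>2 / 2) * ?A \<le> ennreal m" .
  have "?A < \<infinity>"
  proof (rule ccontr)
    assume "\<not> ?A < \<infinity>"
    then have "?A = \<infinity>" by (simp add: less_top[symmetric])
    then have "ennreal (\<epsilon>\<^sup>2 / 2) * ?A = \<infinity>" using e by (simp add: ennreal_mult_top)
    then show False using le by (simp add: top_unique)
  qed
  then show s: "sqint lborel (damp \<epsilon> z)" by (intro sqint_nnI) auto
  have eq: "ennreal (\<epsilon>\<^sup>2 / 2) * ?A = ennreal (\<epsilon>\<^sup>2 / 2 * (\<integral>t. (norm (damp \<epsilon> z t))\<^sup>2 \<partial>lborel))"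
    unfolding sqint_nn[OF s] by (rule ennreal_mult'[symmetric]) simp
  show "\<epsilon>\<^sup>2 / 2 * (\<integral>t. (norm (damp \<epsilon> z t))\<^sup>2 \<partial>lborel) \<le> m"
    using le m unfolding eq by (simp add: ennreal_le_iff)
  show "ennreal (\<epsilon>\<^sup>2 / 2 * (\<integral>t. (norm (damp \<epsilon> z t))\<^sup>2 \<partial>lborel)) + (\<integral>\<^sup>+t\<in>{0..}. ennreal (exp (- t / \<epsilon>)) * \<W> (pth u0 u1 z t) \<partial>lborel) \<le> ennreal m"
    using b unfolding wfun_damp[OF e'] eq .
qed

definition W0 :: "'w \<Rightarrow> real" where "W0 w0 = enn2real (\<W> (J w0))"
text \<open>The weighted potential of the straight path exceeds \<open>\<epsilon> * W0 w0\<close> by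
  at most \<open>\<epsilon>\<^sup>2 * C0 w0 w1\<close>. The factorial is the integral of
  \<open>t ^ n * exp (- t)\<close>.\<close>

definition C0 :: "'w \<Rightarrow> 'w \<Rightarrow> real" where "C0 w0 w1 = K * (1 + W0 w0 + norm w1 ^ n * fact n)"

lemma W0: "\<W> (J w0) = ennreal (W0 w0)" and W0_nonneg: "0 \<le> W0 w0"
  using fin[of w0] by (simp_all add: W0_def less_top[symmetric])

lemma C0_nonneg: "0 \<le> C0 w0 w1"
  unfolding C0_def using K0 W0_nonneg by simp

text \<open>Zero acceleration gives the straight path. Its displacement
  \<open>t *\<^sub>R J w1\<close> is written as
  \<open>\<epsilon> *\<^sub>R J ((t / \<epsilon>) *\<^sub>R w1)\<close>, so that
  \<open>growth\<close> applies with factor \<open>\<epsilon>\<close> and the excess is one order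
  smaller than the leading term; the remaining power of \<open>t / \<epsilon>\<close> is harmless
  against the weight.\<close>

lemma level:
  assumes e: "0 < \<epsilon>" "\<epsilon> < 1"
  shows "wfun \<W> (J w0) (J w1) \<epsilon> (\<lambda>t. 0) \<le> ennreal (\<epsilon> * (W0 w0 + \<epsilon> * C0 w0 w1))"
proof -
  have p: "pth (J w0) (J w1) (\<lambda>t. 0) t = J w0 + \<epsilon> *\<^sub>R J ((t / \<epsilon>) *\<^sub>R w1)" if "t \<ge> 0" for t
  proof -
    have "vel (J w1) (\<lambda>t. 0) = (\<lambda>t. J w1)" by (simp add: vel_def fun_eq_iff)
    then show ?thesis using that e J by (simp add: pth_def prim_const linear_simps)
  qed
  let ?a = "W0 w0 + \<epsilon> * K * (1 + W0 w0)" and ?b = "\<epsilon> * K * norm w1 ^ n"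
  have W: "\<W> (pth (J w0) (J w1) (\<lambda>t. 0) t) \<le> ennreal (?a + ?b * (t / \<epsilon>) ^ n)" if "t \<ge> 0" for t
  proof -
    have "\<W> (pth (J w0) (J w1) (\<lambda>t. 0) t) \<le> \<W> (J w0) + ennreal (\<epsilon> * K) * (1 + \<W> (J w0) + ennreal (norm ((t / \<epsilon>) *\<^sub>R w1) ^ n))"
      unfolding p[OF that] using growth[of \<epsilon> "J w0" "(t / \<epsilon>) *\<^sub>R w1"] e by (simp only: less_imp_le)
    also have "norm ((t / \<epsilon>) *\<^sub>R w1) ^ n = (t / \<epsilon>) ^ n * norm w1 ^ n"
      using that e by (simp add: power_mult_distrib power_divide)
    also have "\<W> (J w0) + ennreal (\<epsilon> * K) * (1 + \<W> (J w0) + ennreal ((t / \<epsilon>) ^ n * norm w1 ^ n))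
       = ennreal (W0 w0 + (\<epsilon> * K) * (1 + W0 w0 + (t / \<epsilon>) ^ n * norm w1 ^ n))"
    proof -
      have nn: "0 \<le> \<epsilon> * K" "0 \<le> (t / \<epsilon>) ^ n * norm w1 ^ n" using e K0 that by simp_all
      have "ennreal ((\<epsilon> * K) * (1 + W0 w0 + (t / \<epsilon>) ^ n * norm w1 ^ n))
         = ennreal (\<epsilon> * K) * (1 + ennreal (W0 w0) + ennreal ((t / \<epsilon>) ^ n * norm w1 ^ n))"
        using nn W0_nonneg[of w0] by (simp add: ennreal_mult'[OF nn(1)])
      then show ?thesis using nn W0_nonneg[of w0] by (simp add: W0 ennreal_plus[OF W0_nonneg mult_nonneg_nonneg])
    qed
    finally show ?thesis by (simp add: algebra_simps)
  qed
  have "wfun \<W> (J w0) (J w1) \<epsilon> (\<lambda>t. 0) = (\<integral>\<^sup>+t\<in>{0..}. ennreal (exp (- t / \<epsilon>)) * \<W> (pth (J w0) (J w1) (\<lambda>t. 0) t) \<partial>lborel)"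
    by (simp add: wfun_def)
  also have "\<dots> \<le> (\<integral>\<^sup>+t\<in>{0..}. ennreal ?a * ennreal (exp (- t / \<epsilon>) * (t / \<epsilon>) ^ 0) + ennreal ?b * ennreal (exp (- t / \<epsilon>) * (t / \<epsilon>) ^ n) \<partial>lborel)"
  proof (rule nn_integral_mono)
    fix t
    show "ennreal (exp (- t / \<epsilon>)) * \<W> (pth (J w0) (J w1) (\<lambda>t. 0) t) * indicator {0..} t
      \<le> (ennreal ?a * ennreal (exp (- t / \<epsilon>) * (t / \<epsilon>) ^ 0) + ennreal ?b * ennreal (exp (- t / \<epsilon>) * (t / \<epsilon>) ^ n)) * indicator {0..} t"
    proof (cases "0 \<le> t")
      case True
      have nn: "0 \<le> ?a" "0 \<le> ?b" "0 \<le> (t / \<epsilon>) ^ n" using e K0 True W0_nonneg[of w0] by simp_all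
      have "ennreal (exp (- t / \<epsilon>)) * \<W> (pth (J w0) (J w1) (\<lambda>t. 0) t) \<le> ennreal (exp (- t / \<epsilon>)) * ennreal (?a + ?b * (t / \<epsilon>) ^ n)"
        by (rule mult_left_mono[OF W[OF True]]) simp
      also have "\<dots> = ennreal (?a * (exp (- t / \<epsilon>) * (t / \<epsilon>) ^ 0) + ?b * (exp (- t / \<epsilon>) * (t / \<epsilon>) ^ n))"
        by (subst ennreal_mult'[symmetric]) (simp_all add: algebra_simps)
      also have "\<dots> = ennreal ?a * ennreal (exp (- t / \<epsilon>) * (t / \<epsilon>) ^ 0) + ennreal ?b * ennreal (exp (- t / \<epsilon>) * (t / \<epsilon>) ^ n)"
        using nn by (simp only: ennreal_plus[OF mult_nonneg_nonneg mult_nonneg_nonneg] ennreal_mult' exp_ge_zero mult_nonneg_nonneg power_0 mult_1_right)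
      finally show ?thesis using True by simp
    qed simp
  qed
  also have "\<dots> = ennreal ?a * ennreal (\<epsilon> * fact 0) + ennreal ?b * ennreal (\<epsilon> * fact n)"
    unfolding nn_integral_exp_power[OF e(1), symmetric]
    by (subst (1 2) nn_integral_cmult[symmetric], measurable, subst nn_integral_add[symmetric]) (simp_all add: distrib_right mult.assoc)
  also have "\<dots> = ennreal (?a * (\<epsilon> * fact 0) + ?b * (\<epsilon> * fact n))"
    using e K0 W0_nonneg[of w0] by (subst ennreal_plus) (simp_all add: ennreal_mult')
  also have "?a * (\<epsilon> * fact 0) + ?b * (\<epsilon> * fact n) = \<epsilon> * (W0 w0 + \<epsilon> * C0 w0 w1)"
    by (simp add: C0_def algebra_simps)
  finally show ?thesis .
qed

text \<open>The direct method. The potential term is treated along a subsequence of the minimizing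
  sequence itself: velocities, and hence paths, converge weakly at every time, and lower
  semicontinuity combines with Fatou's lemma. Forward convex combinations of the damped
  accelerations converge strongly to \<open>g\<close>; this supplies the acceleration
  \<open>zl\<close> of the limit and the lower bound for the quadratic term.\<close>

lemma exists_minimizer:
  assumes e: "0 < \<epsilon>" "\<epsilon> < 1"
  obtains z where "locL2 z" "\<And>z'. locL2 z' \<Longrightarrow> wfun \<W> (J w0) (J w1) \<epsilon> z \<le> wfun \<W> (J w0) (J w1) \<epsilon> z'"
proof -
  let ?F = "wfun \<W> (J w0) (J w1) \<epsilon>"
  let ?p = "pth (J w0) (J w1)"
  have e': "\<epsilon> \<noteq> 0" using e by simp
  define m where "m = (INF z\<in>{z. locL2 z}. ?F z)"
  have lz: "locL2 (\<lambda>t. 0 :: 'h)" by (simp add: locL2_def)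
  have "m \<le> ?F (\<lambda>t. 0)" unfolding m_def by (rule INF_lower) (simp add: lz)
  also have "\<dots> < \<infinity>" using level[OF e, of w0 w1] by (simp add: le_less_trans[OF _ ennreal_less_top])
  finally have "m < \<infinity>" .
  then obtain \<mu> where mu: "m = ennreal \<mu>" "0 \<le> \<mu>" by (cases m) (auto simp: less_top[symmetric])
  have "\<exists>z. locL2 z \<and> ?F z \<le> ennreal (\<mu> + 1 / real (Suc k))" for k
  proof -
    have "m < ennreal (\<mu> + 1 / real (Suc k))" unfolding mu using mu by (simp add: ennreal_less_iff del: ennreal_plus of_nat_Suc)
    then show ?thesis unfolding m_def INF_less_iff by (auto intro: less_imp_le)
  qed
  then have "\<exists>z. \<forall>k. locL2 (z k) \<and> ?F (z k) \<le> ennreal (\<mu> + 1 / real (Suc k))" by (intro choice allI)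
  then obtain z where z: "\<And>k. locL2 (z k)" and Fz: "\<And>k. ?F (z k) \<le> ennreal (\<mu> + 1 / real (Suc k))" by blast
  have nn: "0 \<le> \<mu> + 1 / real (Suc k)" for k using mu by simp
  note zi = locL2_locint[OF z]
  note zm = locL2_measurable[OF z]
  define f where "f k = damp \<epsilon> (z k)" for k
  have fs: "sqint lborel (f k)" for k unfolding f_def by (rule wfun_sqint(1)[OF e(1) z Fz nn])
  define a where "a k = (\<integral>t. (norm (f k t))\<^sup>2 \<partial>lborel)" for k
  have a0: "0 \<le> a k" for k unfolding a_def by (intro integral_nonneg_AE AE_I2) simp
  have am: "\<epsilon>\<^sup>2 / 2 * a k \<le> \<mu> + 1 / real (Suc k)" for k
    using wfun_sqint(2)[OF e(1) z Fz nn] by (simp add: a_def f_def)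
  define A where "A = (\<mu> + 1) / (\<epsilon>\<^sup>2 / 2)"
  have aA: "a k \<le> A" for k
  proof -
    have "\<epsilon>\<^sup>2 / 2 * a k \<le> \<mu> + 1" by (rule order_trans[OF am]) (simp add: divide_le_eq)
    then show ?thesis unfolding A_def using e by (simp add: pos_le_divide_eq mult.commute)
  qed
  have A0: "0 \<le> A" using a0 aA order_trans by blast
  have zf: "(norm (z k t))\<^sup>2 \<le> exp (t / \<epsilon>) * (norm (f k t))\<^sup>2" if "0 \<le> t" for k t
    using that by (simp add: f_def norm_damp[OF e'] exp_minus field_simps)
  have pz: "prim (\<lambda>s. (norm (z k s))\<^sup>2) t \<le> exp (t / \<epsilon>) * A" for k t
    by (rule order_trans[OF locL2_exp_bound(2)[OF fs[of k] zm e(1) zf]])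
       (use aA[of k] in \<open>auto simp: a_def intro!: mult_left_mono\<close>)
  define v where "v k = vel (J w1) (z k)" for k
  define Bd where "Bd t = norm (J w1) + (1 / 2 * t + exp (t / \<epsilon>) * A / 2)" for t
  have Bd_mono: "Bd s \<le> Bd t" if "s \<le> t" for s t
    using that e A0 by (auto simp: Bd_def intro!: add_mono mult_right_mono divide_right_mono)
  have vb: "norm (v k t) \<le> Bd t" if "0 \<le> t" for k t
  proof -
    have "norm (prim (z k) t - prim (z k) 0) \<le> 1 / 2 * (t - 0) + prim (\<lambda>s. (norm (z k s))\<^sup>2) t / (2 * 1)"
      by (rule prim_L2_bound[OF z]) (use that in simp_all)
    also have "\<dots> \<le> 1 / 2 * t + exp (t / \<epsilon>) * A / 2" using pz[of k t] by simp
    finally show ?thesis using norm_triangle_ineq[of "J w1" "prim (z k) t"] by (simp add: v_def vel_def Bd_def)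
  qed
  obtain Dh :: "'h set" where Dh: "countable Dh" "closure Dh = UNIV"
  proof -
    obtain X :: "'h set" where X: "countable X" "\<And>U. open U \<Longrightarrow> U \<noteq> {} \<Longrightarrow> \<exists>d\<in>X. d \<in> U"
      using countable_dense_exists by blast
    have "closure X = UNIV"
    proof (rule ccontr)
      assume "closure X \<noteq> UNIV"
      then have "- closure X \<noteq> {}" by auto
      then obtain d where "d \<in> X" "d \<in> - closure X" using X(2)[of "- closure X"] by blast
      then show False using closure_subset by blast
    qed
    with X(1) show ?thesis by (rule that)
  qed
  have eqc: "\<exists>\<delta>>0. \<forall>k. \<forall>s\<ge>0. \<bar>s - t\<bar> < \<delta> \<longrightarrow> \<bar>inner (v k s - v k t) d\<bar> < c"
    if t: "0 \<le> t" and c: "0 < c" for d t c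
  proof -
    \<comment> \<open>\<open>E\<close> bounds the integrals of the squared accelerations up to time
      \<open>t + 1\<close> for all \<open>k\<close>. The parameter \<open>al\<close> brings the term
      with \<open>E\<close> below \<open>b\<close>, and \<open>\<delta>\<close> then brings the term
      proportional to time below \<open>b\<close>; the value of \<open>b\<close> leaves room for the
      factor \<open>norm d\<close>.\<close>
    define E where "E = exp ((t + 1) / \<epsilon>) * A"
    have E0: "0 \<le> E" by (simp add: E_def A0)
    define b where "b = c / (4 * (norm d + 1))"
    have nd: "0 < norm d + 1" using norm_ge_zero[of d] by linarith
    have b: "0 < b" using c nd by (simp add: b_def)
    define al where "al = (E + 1) / (2 * b)"
    have al: "0 < al" using E0 b by (simp add: al_def)
    define \<delta> where "\<delta> = min 1 (2 * b / al)"
    have de: "0 < \<delta>" using b al by (simp add: \<delta>_def)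
    have key: "norm (prim (z k) s' - prim (z k) s) \<le> 2 * b"
      if s: "0 \<le> s" "s \<le> s'" "s' - s < \<delta>" "s' \<le> t + 1" for k s s'
    proof -
      have "norm (prim (z k) s' - prim (z k) s) \<le> al / 2 * (s' - s) + prim (\<lambda>s. (norm (z k s))\<^sup>2) s' / (2 * al)"
        by (rule prim_L2_bound[OF z s(1,2) al])
      also have "prim (\<lambda>s. (norm (z k s))\<^sup>2) s' \<le> E"
      proof (rule order_trans[OF pz])
        show "exp (s' / \<epsilon>) * A \<le> E" unfolding E_def
          using s(4) e by (intro mult_right_mono A0) (simp add: divide_right_mono)
      qed
      also have "al / 2 * (s' - s) \<le> al / 2 * (2 * b / al)"
        using s(3) al by (intro mult_left_mono) (simp_all add: \<delta>_def)
      also have "al / 2 * (2 * b / al) = b" using al by simp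
      also have "E / (2 * al) \<le> b"
      proof -
        have "E + 1 \<noteq> 0" using E0 by simp
        then have "E / (2 * al) = b * (E / (E + 1))" using b E0 by (simp add: al_def divide_simps)
        also have "\<dots> \<le> b * 1" using b E0 by (intro mult_left_mono) simp_all
        finally show ?thesis by simp
      qed
      finally show ?thesis using al by (simp add: divide_right_mono)
    qed
    show ?thesis
    proof (intro exI[of _ \<delta>] conjI de allI impI)
      fix k s assume s: "0 \<le> s" "\<bar>s - t\<bar> < \<delta>"
      have "\<delta> \<le> 1" by (simp add: \<delta>_def)
      then have s1: "s \<le> t + 1" using s(2) by linarith
      have "norm (prim (z k) s - prim (z k) t) \<le> 2 * b"
      proof (cases "s \<le> t")
        case True then show ?thesis using key[of s t k] s by (simp add: norm_minus_commute)
      next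
        case False then show ?thesis using key[of t s k] s s1 t by simp
      qed
      then have "norm (v k s - v k t) \<le> 2 * b" by (simp add: v_def vel_def)
      then have *: "norm (v k s - v k t) * norm d \<le> 2 * b * (norm d + 1)" using b by (intro mult_mono) auto
      have "b * (4 * (norm d + 1)) = c"
        using nd b_def nonzero_eq_divide_eq[of "4 * (norm d + 1)" b c] by simp
      then have "2 * b * (norm d + 1) = c / 2" by (simp add: algebra_simps)
      then show "\<bar>inner (v k s - v k t) d\<bar> < c"
        using * Cauchy_Schwarz_ineq2[of "v k s - v k t" d] c by linarith
    qed
  qed
  obtain r y where r: "strict_mono (r :: nat \<Rightarrow> nat)" and y: "\<And>t. 0 \<le> t \<Longrightarrow> norm (y t) \<le> Bd t"
    and vy: "\<And>t h. 0 \<le> t \<Longrightarrow> (\<lambda>k. inner (v (r k) t) h) \<longlonglongrightarrow> inner (y t) h"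
  proof (rule weak_subsequence[OF vb Dh eqc])
    fix r y assume a: "strict_mono (r :: nat \<Rightarrow> nat)" "\<And>t. 0 \<le> t \<Longrightarrow> norm (y t) \<le> Bd t"
      "\<And>t h. 0 \<le> t \<Longrightarrow> (\<lambda>k. inner (v (r k) t) h) \<longlonglongrightarrow> inner (y t) h"
    show thesis by (rule that[OF a])
  qed
  obtain c g where c: "\<And>i. c i \<in> fwd i" and g: "sqint lborel g"
    and conv: "(\<lambda>i. \<integral>t. (norm (comb (c i) (\<lambda>k. f (r k) t) - g t))\<^sup>2 \<partial>lborel) \<longlonglongrightarrow> 0"
    and gb: "\<And>b. (\<And>N. \<exists>k\<ge>N. (\<integral>t. (norm (f (r k) t))\<^sup>2 \<partial>lborel) \<le> b) \<Longrightarrow> (\<integral>t. (norm (g t))\<^sup>2 \<partial>lborel) \<le> b"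
  proof (rule fwd_L2[of lborel "\<lambda>k. f (r k)" A])
    show "sqint lborel (f (r k))" "(\<integral>t. (norm (f (r k) t))\<^sup>2 \<partial>lborel) \<le> A" for k
      using fs aA by (simp_all add: a_def)
    fix c g assume a: "\<And>i. c i \<in> fwd i" "sqint lborel g"
      "(\<lambda>i. \<integral>t. (norm (comb (c i) (\<lambda>k. f (r k) t) - g t))\<^sup>2 \<partial>lborel) \<longlonglongrightarrow> 0"
      "\<And>b. (\<And>N. \<exists>k\<ge>N. (\<integral>t. (norm (f (r k) t))\<^sup>2 \<partial>lborel) \<le> b) \<Longrightarrow> (\<integral>t. (norm (g t))\<^sup>2 \<partial>lborel) \<le> b"
    show thesis by (rule that[OF a])
  qed
  define zl where "zl t = exp (t / (2 * \<epsilon>)) *\<^sub>R g t" for t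
  have gm [measurable]: "g \<in> borel_measurable borel" using g by (simp add: sqint_def)
  have zlm [measurable]: "zl \<in> borel_measurable borel" unfolding zl_def[abs_def] by measurable
  have sq: "(exp (t / (2 * \<epsilon>)))\<^sup>2 = exp (t / \<epsilon>)" for t using e' by (simp add: power2_eq_square exp_add[symmetric])
  have zl: "locL2 zl"
    by (rule locL2_exp_bound(1)[OF g zlm e(1)]) (simp add: zl_def power_mult_distrib sq)
  note zli = locL2_locint[OF zl]
  have pl: "(\<lambda>i. comb (c i) (\<lambda>k. prim (z (r k)) t)) \<longlonglongrightarrow> prim zl t" if t: "0 \<le> t" for t
  proof -
    define d where "d i s = comb (c i) (\<lambda>k. z (r k) s) - zl s" for i s
    define df where "df i s = comb (c i) (\<lambda>k. f (r k) s) - g s" for i s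
    have dfs: "sqint lborel (df i)" for i unfolding df_def by (intro sqint_diff sqint_comb fs g)
    have cz: "(\<lambda>s. comb (c i) (\<lambda>k. z (r k) s)) \<in> borel_measurable borel" for i
      unfolding comb_def using zm by measurable
    have dm: "d i \<in> borel_measurable borel" for i unfolding d_def[abs_def] using cz by measurable
    have db: "(norm (d i s))\<^sup>2 \<le> exp (s / \<epsilon>) * (norm (df i s))\<^sup>2" if "0 \<le> s" for i s
    proof -
      have "f k s = exp (- s / (2 * \<epsilon>)) *\<^sub>R z k s" for k using that by (simp add: f_def damp_def)
      then have "comb (c i) (\<lambda>k. f (r k) s) = exp (- s / (2 * \<epsilon>)) *\<^sub>R comb (c i) (\<lambda>k. z (r k) s)"
        by (simp add: comb_def scaleR_sum_right mult.commute)
      then have "d i s = exp (s / (2 * \<epsilon>)) *\<^sub>R df i s"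
        by (simp add: d_def df_def zl_def scaleR_diff_right exp_add[symmetric])
      then show ?thesis by (simp add: power_mult_distrib sq)
    qed
    have dl: "locL2 (d i)" for i by (rule locL2_exp_bound(1)[OF dfs dm e(1) db])
    have pd: "comb (c i) (\<lambda>k. prim (z (r k)) t) - prim zl t = prim (d i) t" for i
      unfolding d_def prim_comb(2)[OF zi, symmetric] by (rule prim_diff[OF prim_comb(1)[OF zi] zli, symmetric])
    have nb: "norm (prim (d i) t) \<le> al / 2 * t + exp (t / \<epsilon>) * (\<integral>s. (norm (df i s))\<^sup>2 \<partial>lborel) / (2 * al)" if al: "0 < al" for i al
    proof -
      have "norm (prim (d i) t - prim (d i) 0) \<le> al / 2 * (t - 0) + prim (\<lambda>s. (norm (d i s))\<^sup>2) t / (2 * al)"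
        by (rule prim_L2_bound[OF dl order_refl t al])
      also have "\<dots> \<le> al / 2 * (t - 0) + exp (t / \<epsilon>) * (\<integral>s. (norm (df i s))\<^sup>2 \<partial>lborel) / (2 * al)"
        using locL2_exp_bound(2)[OF dfs dm e(1) db, of i t] al by (simp add: divide_right_mono)
      finally show ?thesis by simp
    qed
    have "(\<lambda>i. prim (d i) t) \<longlonglongrightarrow> 0"
    proof (rule LIMSEQ_I)
      fix b :: real assume b: "0 < b"
      define al where "al = b / (t + 1)"
      have al: "0 < al" using b t by (simp add: al_def)
      have "al / 2 * t = (b / 2) * (t / (t + 1))" by (simp add: al_def)
      also have "\<dots> \<le> (b / 2) * 1" using b t by (intro mult_left_mono) simp_all
      finally have 1: "al / 2 * t \<le> b / 2" by simp
      have "(\<lambda>i. exp (t / \<epsilon>) * (\<integral>s. (norm (df i s))\<^sup>2 \<partial>lborel) / (2 * al)) \<longlonglongrightarrow> exp (t / \<epsilon>) * 0 / (2 * al)"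
        unfolding df_def using al by (intro tendsto_intros conv) simp
      then have "\<forall>\<^sub>F i in sequentially. exp (t / \<epsilon>) * (\<integral>s. (norm (df i s))\<^sup>2 \<partial>lborel) / (2 * al) < b / 2"
        by (rule order_tendstoD) (use b in simp)
      then obtain N where N: "\<And>i. i \<ge> N \<Longrightarrow> exp (t / \<epsilon>) * (\<integral>s. (norm (df i s))\<^sup>2 \<partial>lborel) / (2 * al) < b / 2"
        unfolding eventually_sequentially by blast
      show "\<exists>N. \<forall>i\<ge>N. norm (prim (d i) t - 0) < b"
      proof (intro exI[of _ N] allI impI)
        fix i assume "N \<le> i"
        then show "norm (prim (d i) t - 0) < b" using nb[OF al, of i] N[of i] 1 by simp
      qed
    qed
    then show ?thesis unfolding pd[symmetric] by (rule LIM_zero_cancel)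
  qed
  \<comment> \<open>The same combinations applied to the velocities converge strongly, which
    identifies the weak limit \<open>y\<close> as the velocity of \<open>zl\<close>.\<close>
  have yv: "y t = vel (J w1) zl t" if t: "0 \<le> t" for t
  proof -
    have "inner (y t) h = inner (vel (J w1) zl t) h" for h
    proof -
      have "(\<lambda>i. comb (c i) (\<lambda>k. inner (v (r k) t) h)) \<longlonglongrightarrow> inner (y t) h" by (rule fwd_tendsto[OF c vy[OF t]])
      moreover have "comb (c i) (\<lambda>k. inner (v (r k) t) h) = inner (J w1 + comb (c i) (\<lambda>k. prim (z (r k)) t)) h" for i
      proof -
        have "comb (c i) (\<lambda>k. v (r k) t) - J w1 = comb (c i) (\<lambda>k. v (r k) t - J w1)" by (rule comb_diff_const[OF c, symmetric])
        also have "\<dots> = comb (c i) (\<lambda>k. prim (z (r k)) t)" by (simp add: v_def vel_def)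
        finally have "comb (c i) (\<lambda>k. v (r k) t) = J w1 + comb (c i) (\<lambda>k. prim (z (r k)) t)" by (simp add: algebra_simps)
        then show ?thesis
          using comb_linear[OF bounded_linear.linear[OF bounded_linear_inner_left[of h]], of "c i" "\<lambda>k. v (r k) t"] by simp
      qed
      moreover have "(\<lambda>i. inner (J w1 + comb (c i) (\<lambda>k. prim (z (r k)) t)) h) \<longlonglongrightarrow> inner (J w1 + prim zl t) h"
        by (intro tendsto_intros pl t)
      ultimately show ?thesis unfolding vel_def by (simp add: LIMSEQ_unique)
    qed
    then have "\<forall>h. inner (y t) h = inner (vel (J w1) zl t) h" ..
    then show ?thesis by (rule vector_eq_rdot[THEN iffD1])
  qed
  have Wl: "\<W> (?p zl t) \<le> liminf (\<lambda>k. \<W> (?p (z (r k)) t))" if t: "0 \<le> t" for t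
  proof (rule lsc)
    note vi = locint_vel[OF zi, of "J w1"]
    have vb': "norm (vel (J w1) (z k) s) \<le> Bd t" if "0 \<le> s" "s \<le> t" for k s
      using vb[OF that(1), of k] Bd_mono[OF that(2)] by (simp add: v_def)
    show "norm (?p (z (r k)) t) \<le> norm (J w0) + t * Bd t" for k
    proof -
      have "norm (prim (vel (J w1) (z (r k))) t) \<le> prim (\<lambda>s. norm (vel (J w1) (z (r k)) s)) t" by (rule prim_norm_le)
      also have "\<dots> \<le> prim (\<lambda>s. Bd t) t"
        unfolding prim_def
      proof (rule set_integral_mono)
        show "set_integrable lborel {0..t} (\<lambda>s. norm (vel (J w1) (z (r k)) s))"
          using locintD[OF vi] by (rule set_integrable_norm)
        show "set_integrable lborel {0..t} (\<lambda>s. Bd t)" by (rule locintD, rule locint_continuous) simp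
      qed (use vb' in simp)
      also have "\<dots> = t * Bd t" using t by (simp add: prim_const)
      finally show ?thesis using norm_triangle_ineq[of "J w0" "prim (vel (J w1) (z (r k))) t"] by (simp add: pth_def)
    qed
    fix h
    have "(\<lambda>k. inner (prim (vel (J w1) (z (r k))) t) h) \<longlonglongrightarrow> inner (prim (vel (J w1) zl) t) h"
    proof (rule inner_prim_tendsto[OF vi locint_vel[OF zli] vb'])
      show "AE s in lborel. 0 < s \<longrightarrow> (\<lambda>k. inner (vel (J w1) (z (r k)) s) h) \<longlonglongrightarrow> inner (vel (J w1) zl s) h"
        using vy yv by (intro AE_I2) (simp add: v_def)
    qed
    then show "(\<lambda>k. inner (?p (z (r k)) t) h) \<longlonglongrightarrow> inner (?p zl t) h"
      unfolding pth_def inner_add_left by (rule tendsto_add[OF tendsto_const])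
  qed
  define P where "P x = (\<integral>\<^sup>+t\<in>{0..}. ennreal (exp (- t / \<epsilon>)) * \<W> (?p x t) \<partial>lborel)" for x
  have Wm: "(\<lambda>t. \<W> (?p (z k) t)) \<in> borel_measurable borel" for k by (rule W_measurable_pth[OF zi])
  have fat: "P zl \<le> liminf (\<lambda>k. P (z (r k)))"
  proof -
    have "P zl \<le> (\<integral>\<^sup>+t. liminf (\<lambda>k. ennreal (exp (- t / \<epsilon>)) * \<W> (?p (z (r k)) t) * indicator {0..} t) \<partial>lborel)"
      unfolding P_def
    proof (rule nn_integral_mono)
      fix t
      show "ennreal (exp (- t / \<epsilon>)) * \<W> (?p zl t) * indicator {0..} t \<le> liminf (\<lambda>k. ennreal (exp (- t / \<epsilon>)) * \<W> (?p (z (r k)) t) * indicator {0..} t)"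
      proof (cases "0 \<le> t")
        case True
        have "ennreal (exp (- t / \<epsilon>)) * \<W> (?p zl t) \<le> ennreal (exp (- t / \<epsilon>)) * liminf (\<lambda>k. \<W> (?p (z (r k)) t))"
          by (rule mult_left_mono[OF Wl[OF True]]) simp
        also have "\<dots> \<le> liminf (\<lambda>k. ennreal (exp (- t / \<epsilon>)) * \<W> (?p (z (r k)) t))"
          by (simp add: liminf_cmult_ennreal)
        finally show ?thesis using True by simp
      qed simp
    qed
    also have "\<dots> \<le> liminf (\<lambda>k. \<integral>\<^sup>+t. ennreal (exp (- t / \<epsilon>)) * \<W> (?p (z (r k)) t) * indicator {0..} t \<partial>lborel)"
      by (rule nn_integral_liminf) (use Wm in measurable)
    finally show ?thesis by (simp only: P_def)
  qed
  define G where "G = (\<integral>t. (norm (g t))\<^sup>2 \<partial>lborel)"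
  \<comment> \<open>The limes inferior of the quadratic parts is at least \<open>G\<close>:
    otherwise infinitely many of them would be at most \<open>G - b\<close>, and \<open>gb\<close>
    would give \<open>G \<le> G - b\<close>.\<close>
  have ev: "\<forall>\<^sub>F k in sequentially. G - b \<le> a (r k)" if b: "0 < b" for b
  proof (rule ccontr)
    assume "\<not> ?thesis"
    then have "\<exists>k\<ge>N. a (r k) \<le> G - b" for N
      unfolding eventually_sequentially by (meson less_imp_le not_le)
    then have "G \<le> G - b" unfolding G_def[symmetric] a_def by (intro gb[folded G_def]) blast
    then show False using b by simp
  qed
  \<comment> \<open>The total is at most nearly \<open>\<mu>\<close> and the quadratic part at least
    nearly \<open>\<epsilon>\<^sup>2 / 2 * G\<close>; the potential term is left with the
    difference.\<close>
  have main: "P zl \<le> ennreal (\<mu> - \<epsilon>\<^sup>2 / 2 * G + b)" if b: "0 < b" for b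
  proof -
    define b2 where "b2 = b / 2 / (\<epsilon>\<^sup>2 / 2)"
    have b2: "0 < b2" "\<epsilon>\<^sup>2 / 2 * b2 = b / 2" using b e by (simp_all add: b2_def)
    have "\<forall>\<^sub>F k in sequentially. 1 / real (Suc k) < b / 2"
      using order_tendstoD(2)[OF LIMSEQ_inverse_real_of_nat, of "b / 2"] b by (simp add: inverse_eq_divide)
    then have "\<forall>\<^sub>F k in sequentially. 1 / real (Suc (r k)) < b / 2" by (rule eventually_subseq[OF r])
    with ev[OF b2(1)] have "\<forall>\<^sub>F k in sequentially. P (z (r k)) \<le> ennreal (\<mu> - \<epsilon>\<^sup>2 / 2 * G + b)"
    proof eventually_elim
      case (elim k)
      have *: "ennreal (\<epsilon>\<^sup>2 / 2 * a (r k)) + P (z (r k)) \<le> ennreal (\<mu> + 1 / real (Suc (r k)))"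
        using wfun_sqint(3)[OF e(1) z Fz nn, of "r k"] by (simp add: P_def a_def f_def)
      have "P (z (r k)) \<le> ennreal (\<epsilon>\<^sup>2 / 2 * a (r k)) + P (z (r k))" by (rule add_increasing) simp_all
      from order_trans[OF this *] have "P (z (r k)) < \<infinity>" by (simp add: le_less_trans[OF _ ennreal_less_top])
      then obtain p where p: "P (z (r k)) = ennreal p" "0 \<le> p" by (cases "P (z (r k))") (auto simp: less_top[symmetric])
      have "ennreal (\<epsilon>\<^sup>2 / 2 * a (r k) + p) \<le> ennreal (\<mu> + 1 / real (Suc (r k)))"
        using * a0 by (simp only: p ennreal_plus mult_nonneg_nonneg p(2) zero_le_power2 divide_nonneg_nonneg zero_le_numeral)
      then have "\<epsilon>\<^sup>2 / 2 * a (r k) + p \<le> \<mu> + 1 / real (Suc (r k))" using nn by (simp only: ennreal_le_iff)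
      moreover have "\<epsilon>\<^sup>2 / 2 * (G - b2) \<le> \<epsilon>\<^sup>2 / 2 * a (r k)" by (rule mult_left_mono[OF elim(1)]) simp
      ultimately have "p \<le> \<mu> - \<epsilon>\<^sup>2 / 2 * G + b" using elim(2) b2(2) by (simp only: right_diff_distrib)
      then show ?case unfolding p by (rule ennreal_leI)
    qed
    then have "liminf (\<lambda>k. P (z (r k))) \<le> liminf (\<lambda>k. ennreal (\<mu> - \<epsilon>\<^sup>2 / 2 * G + b))" by (rule Liminf_mono)
    also have "\<dots> = ennreal (\<mu> - \<epsilon>\<^sup>2 / 2 * G + b)" by (simp add: Liminf_const)
    finally show ?thesis using fat by (rule order_trans[rotated])
  qed
  have Gm: "\<epsilon>\<^sup>2 / 2 * G \<le> \<mu> + b" if b: "0 < b" for b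
  proof -
    define b2 where "b2 = b / 2 / (\<epsilon>\<^sup>2 / 2)"
    have b2: "0 < b2" "\<epsilon>\<^sup>2 / 2 * b2 = b / 2" using b e by (simp_all add: b2_def)
    have "\<forall>\<^sub>F k in sequentially. 1 / real (Suc k) < b / 2"
      using order_tendstoD(2)[OF LIMSEQ_inverse_real_of_nat, of "b / 2"] b by (simp add: inverse_eq_divide)
    then have "\<forall>\<^sub>F k in sequentially. 1 / real (Suc (r k)) < b / 2" by (rule eventually_subseq[OF r])
    then have "\<forall>\<^sub>F k in sequentially. \<epsilon>\<^sup>2 / 2 * G \<le> \<mu> + b" using ev[OF b2(1)]
    proof eventually_elim
      case (elim k)
      have "\<epsilon>\<^sup>2 / 2 * (G - b2) \<le> \<epsilon>\<^sup>2 / 2 * a (r k)" by (rule mult_left_mono[OF elim(2)]) simp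
      then have "\<epsilon>\<^sup>2 / 2 * G - \<epsilon>\<^sup>2 / 2 * b2 \<le> \<mu> + 1 / real (Suc (r k))"
        using am[of "r k"] by (simp only: right_diff_distrib)
      then show ?case using elim(1) b2(2) by linarith
    qed
    then show ?thesis by (simp add: eventually_const)
  qed
  then have Gm': "\<epsilon>\<^sup>2 / 2 * G \<le> \<mu>" by (rule field_le_epsilon)
  have "P zl \<le> ennreal (\<mu> - \<epsilon>\<^sup>2 / 2 * G)"
  proof -
    have "P zl < \<infinity>" using main[of 1] by (simp add: le_less_trans[OF _ ennreal_less_top])
    then obtain p where p: "P zl = ennreal p" "0 \<le> p" by (cases "P zl") (auto simp: less_top[symmetric])
    have "p \<le> \<mu> - \<epsilon>\<^sup>2 / 2 * G + b" if "0 < b" for b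
    proof -
      have "ennreal p \<le> ennreal (\<mu> - \<epsilon>\<^sup>2 / 2 * G + b)" using main[OF that] by (simp only: p(1))
      moreover have "0 \<le> \<mu> - \<epsilon>\<^sup>2 / 2 * G + b" using Gm' that by linarith
      ultimately show ?thesis by (simp only: ennreal_le_iff)
    qed
    then have "p \<le> \<mu> - \<epsilon>\<^sup>2 / 2 * G" by (rule field_le_epsilon)
    then show ?thesis unfolding p(1) by (rule ennreal_leI)
  qed
  moreover have "(\<integral>\<^sup>+t. ennreal ((norm (damp \<epsilon> zl t))\<^sup>2) \<partial>lborel) \<le> ennreal G"
  proof -
    have "(\<integral>\<^sup>+t. ennreal ((norm (damp \<epsilon> zl t))\<^sup>2) \<partial>lborel) \<le> (\<integral>\<^sup>+t. ennreal ((norm (g t))\<^sup>2) \<partial>lborel)"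
    proof (intro nn_integral_mono ennreal_leI)
      fix t
      have "damp \<epsilon> zl t = indicator {0..} t *\<^sub>R g t"
        by (simp add: damp_def zl_def exp_add[symmetric])
      then show "(norm (damp \<epsilon> zl t))\<^sup>2 \<le> (norm (g t))\<^sup>2" by (simp add: indicator_def)
    qed
    then show ?thesis unfolding sqint_nn[OF g] G_def .
  qed
  ultimately have "?F zl \<le> ennreal (\<epsilon>\<^sup>2 / 2) * ennreal G + ennreal (\<mu> - \<epsilon>\<^sup>2 / 2 * G)"
    unfolding wfun_damp[OF e'] P_def by (intro add_mono mult_left_mono) simp_all
  also have "\<dots> = ennreal \<mu>"
  proof -
    have "0 \<le> G" unfolding G_def by (intro integral_nonneg_AE AE_I2) simp
    then have nn: "0 \<le> \<epsilon>\<^sup>2 / 2 * G" "0 \<le> \<mu> - \<epsilon>\<^sup>2 / 2 * G" using Gm' by simp_all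
    have "ennreal (\<epsilon>\<^sup>2 / 2) * ennreal G = ennreal (\<epsilon>\<^sup>2 / 2 * G)" by (rule ennreal_mult'[symmetric]) simp
    then show ?thesis using ennreal_plus[OF nn] by (simp only:) simp
  qed
  finally have "?F zl \<le> m" by (simp only: mu)
  moreover have "m \<le> ?F z'" if "locL2 z'" for z' unfolding m_def by (rule INF_lower) (simp add: that)
  ultimately show ?thesis by (intro that[OF zl]) (rule order_trans)
qed

end

section \<open>Change of variables in time\<close>

lemma prim_product_rule:
  fixes prod :: "'b::{banach, second_countable_topology} \<Rightarrow> 'c::{banach, second_countable_topology} \<Rightarrow> 'd::{banach, second_countable_topology}"
  assumes pr: "bounded_bilinear prod" and f: "locint f" and g: "locint g"
  shows "locint (\<lambda>s. prod (f s) (c + prim g s))" "locint (\<lambda>s. prod (a + prim f s) (g s))"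
    and "0 \<le> t \<Longrightarrow> prod (a + prim f t) (c + prim g t)
      = prod a c + (prim (\<lambda>s. prod (f s) (c + prim g s)) t + prim (\<lambda>s. prod (a + prim f s) (g s)) t)"
proof -
  interpret bounded_bilinear prod by (rule pr)
  note bp = prim_by_parts[OF pr f g]
  have l1: "locint (\<lambda>s. prod (f s) c)" by (rule locint_bounded_linear[OF bounded_linear_left f])
  have l2: "locint (\<lambda>s. prod a (g s))" by (rule locint_bounded_linear[OF bounded_linear_right g])
  show "locint (\<lambda>s. prod (f s) (c + prim g s))" "locint (\<lambda>s. prod (a + prim f s) (g s))"
    unfolding add_left add_right by (rule locint_add[OF l1 bp(1)], rule locint_add[OF l2 bp(2)])
  assume "0 \<le> t"
  have "prim (\<lambda>s. prod (f s) (c + prim g s)) t = prod (prim f t) c + prim (\<lambda>s. prod (f s) (prim g s)) t"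
    unfolding add_right prim_add[OF l1 bp(1)] prim_bounded_linear[OF bounded_linear_left f] ..
  moreover have "prim (\<lambda>s. prod (a + prim f s) (g s)) t = prod a (prim g t) + prim (\<lambda>s. prod (prim f s) (g s)) t"
    unfolding add_left prim_add[OF l2 bp(2)] prim_bounded_linear[OF bounded_linear_right g] ..
  ultimately show "prod (a + prim f t) (c + prim g t)
      = prod a c + (prim (\<lambda>s. prod (f s) (c + prim g s)) t + prim (\<lambda>s. prod (a + prim f s) (g s)) t)"
    using bp(3)[of t] by (simp add: add_left add_right add_ac)
qed

lemma norm_vel_sq:
  fixes z :: "real \<Rightarrow> 'b::{real_inner, banach, second_countable_topology}"
  assumes z: "locint z" and t: "0 \<le> t"
  shows "locint (\<lambda>s. inner (z s) (vel u z s))" "(norm (vel u z t))\<^sup>2 = (norm u)\<^sup>2 + 2 * prim (\<lambda>s. inner (z s) (vel u z s)) t"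
proof -
  show "locint (\<lambda>s. inner (z s) (vel u z s))"
    unfolding vel_def by (rule prim_product_rule(1)[OF bounded_bilinear_inner z z])
  have "prim (\<lambda>s. inner (u + prim z s) (z s)) t = prim (\<lambda>s. inner (z s) (u + prim z s)) t"
    by (simp add: inner_commute)
  with prim_product_rule(3)[OF bounded_bilinear_inner z z t, of u u] show "(norm (vel u z t))\<^sup>2 = (norm u)\<^sup>2 + 2 * prim (\<lambda>s. inner (z s) (vel u z s)) t"
    unfolding power2_norm_eq_inner vel_def by linarith
qed

locale time_change =
  fixes m :: "real \<Rightarrow> real"
  assumes cont: "continuous_on UNIV m" and ge1: "\<And>t. 1 \<le> m t"
begin

text \<open>In contrast to \<open>prim\<close>, the oriented integral keeps increasing on negative
  times. Hence \<open>psi\<close> is a bijection of the whole line, and \<open>phi\<close> is its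
  genuine inverse.\<close>

definition psi :: "real \<Rightarrow> real" where "psi t = (LBINT y=ereal 0..ereal t. m y)"
definition phi :: "real \<Rightarrow> real" where "phi = inv psi"

lemma psi_deriv: "(psi has_real_derivative m t) (at t)"
proof -
  define A B where "A = min t 0 - 1" and "B = max t 0 + 1"
  have "((\<lambda>u. LBINT y=ereal 0..ereal u. m y) has_vector_derivative m t) (at t within {A..B})"
  proof (rule interval_integral_FTC2)
    show "A \<le> 0" "0 \<le> B" "A \<le> t" "t \<le> B" by (simp_all add: A_def B_def)
    show "continuous_on {A..B} m" using cont by (rule continuous_on_subset) simp
  qed
  moreover have "at t within {A..B} = at t"
    by (rule at_within_interior) (auto simp: A_def B_def min_def max_def)
  ultimately show ?thesis
    unfolding psi_def[abs_def] has_real_derivative_iff_has_vector_derivative by (simp only:)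
qed

lemma psi_prim: "0 \<le> t \<Longrightarrow> psi t = prim m t"
  unfolding psi_def prim_def by (rule interval_integral_Icc)

lemma psi_0 [simp]: "psi 0 = 0"
  by (simp add: psi_prim)

lemma psi_cont: "continuous_on A psi"
  by (meson DERIV_isCont continuous_at_imp_continuous_on psi_deriv)

lemma psi_increase: "s \<le> t \<Longrightarrow> t - s \<le> psi t - psi s"
proof -
  assume "s \<le> t"
  then have "psi s - s \<le> psi t - t"
  proof (rule DERIV_nonneg_imp_nondecreasing)
    fix x
    show "\<exists>y. ((\<lambda>x. psi x - x) has_real_derivative y) (at x) \<and> 0 \<le> y"
      using ge1[of x] by (intro exI[of _ "m x - 1"]) (auto intro!: derivative_eq_intros psi_deriv)
  qed
  then show ?thesis by simp
qed

lemma psi_ge: "0 \<le> t \<Longrightarrow> t \<le> psi t"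
  using psi_increase[of 0 t] by simp

lemma psi_strict_mono: "strict_mono psi"
proof (rule strict_monoI)
  fix s t :: real assume "s < t"
  then show "psi s < psi t" using psi_increase[of s t] by simp
qed

lemma psi_bij: "bij psi"
proof (rule bijI)
  show "inj psi" using psi_strict_mono by (rule strict_mono_imp_inj_on)
  have "\<exists>x. s = psi x" for s
  proof -
    have "\<exists>x\<ge>- \<bar>s\<bar>. x \<le> \<bar>s\<bar> \<and> psi x = s"
    proof (rule IVT')
      show "psi (- \<bar>s\<bar>) \<le> s" using psi_increase[of "- \<bar>s\<bar>" 0] by simp
      show "s \<le> psi \<bar>s\<bar>" using psi_ge[of "\<bar>s\<bar>"] by simp
    qed (auto intro: psi_cont)
    then show ?thesis by blast
  qed
  then show "surj psi" unfolding surj_def by blast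
qed

lemma psi_phi [simp]: "psi (phi s) = s" and phi_psi [simp]: "phi (psi t) = t"
  unfolding phi_def using psi_bij by (simp_all add: bij_is_surj surj_f_inv_f bij_is_inj)

lemma psi_le_iff: "psi s \<le> psi t \<longleftrightarrow> s \<le> t"
  using psi_strict_mono by (rule strict_mono_less_eq)

lemma psi_nonneg_iff [simp]: "0 \<le> psi t \<longleftrightarrow> 0 \<le> t"
  using psi_le_iff[of 0 t] by simp

lemma phi_le_iff: "phi s \<le> t \<longleftrightarrow> s \<le> psi t"
  using psi_le_iff[of "phi s" t] by simp

lemma psi_measurable [measurable]: "psi \<in> borel_measurable borel"
  by (rule borel_measurable_continuous_onI[OF psi_cont])

lemma phi_measurable [measurable]: "phi \<in> borel_measurable borel"
  by (rule borel_measurable_mono) (simp add: mono_def phi_le_iff)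

lemma m_measurable [measurable]: "m \<in> borel_measurable borel"
  by (rule borel_measurable_continuous_onI[OF cont])

lemma m_nonneg: "0 \<le> m t"
  using ge1[of t] by simp

text \<open>Substitution is phrased as an identity of measures, checked on boxes by the fundamental
  theorem of calculus. It then serves nonnegative integrals and vector valued integrals
  alike.\<close>

lemma lborel_psi: "lborel = distr (density lborel (\<lambda>t. ennreal (m t))) borel psi"
proof (rule lborel_eqI)
  fix l u :: real assume "\<And>b. b \<in> Basis \<Longrightarrow> l \<bullet> b \<le> u \<bullet> b"
  then have lu: "l \<le> u" by simp
  have "emeasure (distr (density lborel (\<lambda>t. ennreal (m t))) borel psi) (box l u)
     = emeasure (density lborel (\<lambda>t. ennreal (m t))) (psi -` box l u)"
    by (subst emeasure_distr) (auto simp: box_real)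
  also have "\<dots> = (\<integral>\<^sup>+t. ennreal (m t) * indicator (psi -` box l u) t \<partial>lborel)"
    by (rule emeasure_density) (auto simp: box_real intro!: measurable_sets_borel[OF psi_measurable])
  also have "\<dots> = (\<integral>\<^sup>+t. ennreal (m t) * indicator {phi l..phi u} t \<partial>lborel)"
  proof (rule nn_integral_cong_AE)
    show "AE t in lborel. ennreal (m t) * indicator (psi -` box l u) t = ennreal (m t) * indicator {phi l..phi u} t"
      using AE_lborel_singleton[of "phi l"] AE_lborel_singleton[of "phi u"]
    proof eventually_elim
      case (elim t)
      have "l < psi t \<longleftrightarrow> phi l < t" "psi t < u \<longleftrightarrow> t < phi u"
        using psi_strict_mono strict_mono_less[of psi "phi l" t] strict_mono_less[of psi t "phi u"] by simp_all
      then show ?case using elim by (auto simp: indicator_def box_real)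
    qed
  qed
  also have "\<dots> = ennreal (psi (phi u) - psi (phi l))"
    by (rule nn_integral_FTC_Icc) (use lu in \<open>auto simp: phi_le_iff m_nonneg intro: psi_deriv\<close>)
  finally show "emeasure (distr (density lborel (\<lambda>t. ennreal (m t))) borel psi) (box l u) = ennreal (\<Prod>b\<in>Basis. (u - l) \<bullet> b)"
    by simp
qed simp

lemma nn_integral_psi:
  assumes [measurable]: "f \<in> borel_measurable borel"
  shows "(\<integral>\<^sup>+s\<in>{0..}. f s \<partial>lborel) = (\<integral>\<^sup>+t\<in>{0..}. ennreal (m t) * f (psi t) \<partial>lborel)"
proof -
  have "(\<integral>\<^sup>+s\<in>{0..}. f s \<partial>lborel) = (\<integral>\<^sup>+s. f s * indicator {0..} s \<partial>distr (density lborel (\<lambda>t. ennreal (m t))) borel psi)"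
    by (subst lborel_psi) (rule refl)
  also have "\<dots> = (\<integral>\<^sup>+t. f (psi t) * indicator {0..} (psi t) \<partial>density lborel (\<lambda>t. ennreal (m t)))"
    by (rule nn_integral_distr) measurable
  also have "\<dots> = (\<integral>\<^sup>+t. ennreal (m t) * (f (psi t) * indicator {0..} (psi t)) \<partial>lborel)"
    by (rule nn_integral_density) measurable
  also have "\<dots> = (\<integral>\<^sup>+t\<in>{0..}. ennreal (m t) * f (psi t) \<partial>lborel)"
    by (rule nn_integral_cong) (simp add: indicator_def)
  finally show ?thesis .
qed

lemma prim_psi:
  fixes f :: "real \<Rightarrow> 'b::{banach, second_countable_topology}"
  assumes [measurable]: "f \<in> borel_measurable borel"
  shows "prim f (psi t) = prim (\<lambda>r. m r *\<^sub>R f (psi r)) t"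
proof -
  have "prim f (psi t) = (\<integral>s. indicator {0..psi t} s *\<^sub>R f s \<partial>distr (density lborel (\<lambda>t. ennreal (m t))) borel psi)"
    unfolding prim_def set_lebesgue_integral_def by (subst lborel_psi) (rule refl)
  also have "\<dots> = (\<integral>r. indicator {0..psi t} (psi r) *\<^sub>R f (psi r) \<partial>density lborel (\<lambda>t. ennreal (m t)))"
    by (rule integral_distr) measurable
  also have "\<dots> = (\<integral>r. m r *\<^sub>R (indicator {0..psi t} (psi r) *\<^sub>R f (psi r)) \<partial>lborel)"
    by (rule integral_density) (auto simp: m_nonneg)
  also have "\<dots> = prim (\<lambda>r. m r *\<^sub>R f (psi r)) t"
    unfolding prim_def set_lebesgue_integral_def
    by (rule Bochner_Integration.integral_cong[OF refl]) (simp add: indicator_def psi_le_iff)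
  finally show ?thesis .
qed

end

lemma prim_indicator:
  fixes f :: "real \<Rightarrow> 'b::{banach, second_countable_topology}"
  shows "prim (\<lambda>s. indicator {0..b} s *\<^sub>R f s) t = prim f (min t b)"
  unfolding prim_def set_lebesgue_integral_def
  by (rule Bochner_Integration.integral_cong[OF refl]) (simp add: indicator_def)

lemma locint_indicator: "locint f \<Longrightarrow> locint (\<lambda>s. indicator {0..b} s *\<^sub>R f s)"
  unfolding locint_def set_integrable_def
proof
  fix T assume "\<forall>T. integrable lborel (\<lambda>x. indicat_real {0..T} x *\<^sub>R f x)"
  then have "integrable lborel (\<lambda>x. indicat_real {0..min T b} x *\<^sub>R f x)" ..
  moreover have "indicat_real {0..T} x *\<^sub>R (indicat_real {0..b} x *\<^sub>R f x) = indicat_real {0..min T b} x *\<^sub>R f x" for x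
    by (simp add: indicator_def)
  ultimately show "integrable lborel (\<lambda>x. indicat_real {0..T} x *\<^sub>R (indicat_real {0..b} x *\<^sub>R f x))" by (simp only:)
qed

text \<open>The generator of the time changes \<open>t + \<delta> * gen t\<close> of the inner variation. It is chosen such that
  \<open>exp (- t / \<epsilon>) * (gen' - gen / \<epsilon>)\<close> is \<open>exp (- t / \<epsilon>)\<close> up to time \<open>b\<close> and then minus the kernel
  that appears in the approximate energy at time \<open>b\<close>.\<close>

definition gen' :: "real \<Rightarrow> real \<Rightarrow> real \<Rightarrow> real" where
  "gen' \<epsilon> b t = exp (max 0 (min t b) / \<epsilon>)"

definition gen :: "real \<Rightarrow> real \<Rightarrow> real \<Rightarrow> real" where
  "gen \<epsilon> b t = prim (gen' \<epsilon> b) t"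

lemma gen'_cont: "continuous_on A (gen' \<epsilon> b)"
  unfolding gen'_def[abs_def] divide_inverse by (intro continuous_intros)

lemma gen'_bounds: "0 < \<epsilon> \<Longrightarrow> 0 \<le> b \<Longrightarrow> 1 \<le> gen' \<epsilon> b t \<and> gen' \<epsilon> b t \<le> exp (b / \<epsilon>)"
  by (auto simp: gen'_def divide_right_mono)

text \<open>Up to time \<open>b\<close> the generator is
  \<open>\<epsilon> * (exp (t / \<epsilon>) - 1)\<close>, afterwards it is affine with slope
  \<open>exp (b / \<epsilon>)\<close>. Multiplied by \<open>exp (- t / \<epsilon>)\<close>, the last
  term becomes \<open>\<epsilon>\<close> times the kernel started at \<open>b\<close>.\<close>

lemma gen_eq:
  assumes e: "0 < \<epsilon>" and b: "0 \<le> b" and t: "0 \<le> t"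
  shows "gen \<epsilon> b t / \<epsilon> + 1 = gen' \<epsilon> b t + exp (b / \<epsilon>) * max 0 (t - b) / \<epsilon>"
proof -
  have l: "locint (gen' \<epsilon> b)" by (rule locint_continuous[OF gen'_cont])
  have small: "gen \<epsilon> b t = \<epsilon> * (exp (t / \<epsilon>) - 1)" if "0 \<le> t" "t \<le> b" for t
  proof -
    have "gen \<epsilon> b t = prim (\<lambda>s. exp (s / \<epsilon>)) t"
      unfolding gen_def by (rule prim_cong) (use that in \<open>simp add: gen'_def\<close>)
    also have "\<dots> = \<epsilon> * exp (t / \<epsilon>) - \<epsilon> * exp (0 / \<epsilon>)"
      by (rule prim_deriv) (use e that in \<open>auto intro!: derivative_eq_intros continuous_intros\<close>)
    finally show ?thesis by (simp add: algebra_simps)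
  qed
  show ?thesis
  proof (cases "t \<le> b")
    case True
    then show ?thesis using small[OF t True] e t by (simp add: gen'_def)
  next
    case False
    have "gen \<epsilon> b t - gen \<epsilon> b b = (LINT r:{b..t}|lborel. gen' \<epsilon> b r)"
      unfolding gen_def by (rule prim_diff_interval[OF l b]) (use False in simp)
    also have "\<dots> = (LINT r:{b..t}|lborel. exp (b / \<epsilon>))"
      by (rule set_lebesgue_integral_cong) (use b in \<open>auto simp: gen'_def\<close>)
    also have "\<dots> = (t - b) * exp (b / \<epsilon>)" using False by (subst set_integral_const) auto
    finally have "gen \<epsilon> b t = \<epsilon> * (exp (b / \<epsilon>) - 1) + (t - b) * exp (b / \<epsilon>)" using small[OF b order_refl] by simp
    then have "gen \<epsilon> b t / \<epsilon> = exp (b / \<epsilon>) - 1 + exp (b / \<epsilon>) * (t - b) / \<epsilon>"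
      using e by (simp add: add_divide_distrib mult.commute)
    then show ?thesis using False b by (simp add: gen'_def)
  qed
qed

lemma gen_bounds:
  assumes e: "0 < \<epsilon>" and b: "0 \<le> b" and t: "0 \<le> t"
  shows "0 \<le> gen \<epsilon> b t" "gen \<epsilon> b t \<le> exp (b / \<epsilon>) * t"
proof -
  have l: "locint (gen' \<epsilon> b)" by (rule locint_continuous[OF gen'_cont])
  have c: "locint (\<lambda>s. c :: real)" for c by (rule locint_continuous) simp
  have g: "1 \<le> gen' \<epsilon> b s" "gen' \<epsilon> b s \<le> exp (b / \<epsilon>)" "0 \<le> gen' \<epsilon> b s" for s
    using gen'_bounds[OF e b, of s] by simp_all
  have "gen \<epsilon> b t \<le> prim (\<lambda>s. exp (b / \<epsilon>)) t"
    unfolding gen_def prim_def by (rule set_integral_mono[OF locintD[OF l] locintD[OF c]]) (rule g)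
  moreover have "prim (\<lambda>s. 0) t \<le> gen \<epsilon> b t"
    unfolding gen_def prim_def by (rule set_integral_mono[OF locintD[OF c] locintD[OF l]]) (rule g)
  ultimately show "0 \<le> gen \<epsilon> b t" "gen \<epsilon> b t \<le> exp (b / \<epsilon>) * t" using t by (simp_all add: prim_const mult.commute)
qed

section \<open>The energy estimate\<close>

lemma nn_integral_le_integral:
  fixes R :: "real \<Rightarrow> real"
  assumes R: "integrable lborel (\<lambda>t. indicator {0..} t * R t)"
    and f: "AE t in lborel. 0 \<le> t \<longrightarrow> f t \<le> ennreal (R t) \<and> 0 \<le> R t"
  shows "(\<integral>\<^sup>+t\<in>{0..}. f t \<partial>lborel) \<le> ennreal (\<integral>t. indicator {0..} t * R t \<partial>lborel)"
proof -
  have "(\<integral>\<^sup>+t\<in>{0..}. f t \<partial>lborel) \<le> (\<integral>\<^sup>+t. ennreal (indicator {0..} t * R t) \<partial>lborel)"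
    by (rule nn_integral_mono_AE) (use f in \<open>eventually_elim, simp add: indicator_def\<close>)
  also have "\<dots> = ennreal (\<integral>t. indicator {0..} t * R t \<partial>lborel)"
    by (rule nn_integral_eq_integral[OF R]) (use f in \<open>eventually_elim, simp add: indicator_def\<close>)
  finally show ?thesis .
qed

lemma exp_power_integral:
  assumes e: "0 < (\<epsilon>::real)"
  shows "integrable lborel (\<lambda>t. indicator {0..} t * (exp (- t / \<epsilon>) * (t / \<epsilon>) ^ k))"
    and "(\<integral>t. indicator {0..} t * (exp (- t / \<epsilon>) * (t / \<epsilon>) ^ k) \<partial>lborel) = \<epsilon> * fact k"
proof -
  have "(\<integral>\<^sup>+t. ennreal (indicator {0..} t * (exp (- t / \<epsilon>) * (t / \<epsilon>) ^ k)) \<partial>lborel) = ennreal (\<epsilon> * fact k)"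
    unfolding nn_integral_exp_power[OF e, symmetric] by (rule nn_integral_cong) (simp add: indicator_def)
  then have "integrable lborel (\<lambda>t. indicator {0..} t * (exp (- t / \<epsilon>) * (t / \<epsilon>) ^ k)) \<and>
     (\<integral>t. indicator {0..} t * (exp (- t / \<epsilon>) * (t / \<epsilon>) ^ k) \<partial>lborel) = \<epsilon> * fact k"
    by (subst (asm) nn_integral_eq_integrable) (use e in \<open>auto simp: indicator_def\<close>)
  then show "integrable lborel (\<lambda>t. indicator {0..} t * (exp (- t / \<epsilon>) * (t / \<epsilon>) ^ k))"
    "(\<integral>t. indicator {0..} t * (exp (- t / \<epsilon>) * (t / \<epsilon>) ^ k) \<partial>lborel) = \<epsilon> * fact k" by blast+
qed

text \<open>A scalar that exceeds \<open>l\<close> by a factor of at most \<open>R\<close> is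
  accommodated by scaling the direction to \<open>(c / l) *\<^sub>R h\<close>. The prefactor remains
  the small number \<open>l\<close>, while \<open>R\<close> may grow polynomially in time.\<close>

lemma (in potential) growth_le:
  assumes l: "0 \<le> l" "l \<le> 1" and c: "\<bar>c\<bar> \<le> l * R" and R: "0 \<le> R"
  shows "\<W> (x + c *\<^sub>R J h) \<le> \<W> x + ennreal (l * K) * (1 + \<W> x + ennreal ((R * norm h) ^ n))"
proof (cases "l = 0")
  case True
  then show ?thesis using c by simp
next
  case False
  then have l0: "0 < l" using l by simp
  define h' where "h' = (c / l) *\<^sub>R h"
  have "norm h' \<le> R * norm h"
    unfolding h'_def norm_scaleR using c l0
    by (intro mult_right_mono) (simp_all add: abs_divide divide_le_eq mult.commute)
  then have hn: "norm h' ^ n \<le> (R * norm h) ^ n" by (rule power_mono) simp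
  have "l *\<^sub>R J h' = c *\<^sub>R J h" using J l0 by (simp add: h'_def linear_simps)
  then have "\<W> (x + c *\<^sub>R J h) = \<W> (x + l *\<^sub>R J h')" by simp
  also have "\<dots> \<le> \<W> x + ennreal (l * K) * (1 + \<W> x + ennreal (norm h' ^ n))" by (rule growth[OF l])
  also have "\<dots> \<le> \<W> x + ennreal (l * K) * (1 + \<W> x + ennreal ((R * norm h) ^ n))"
    by (intro add_left_mono mult_left_mono ennreal_leI hn) simp
  finally show ?thesis .
qed

section \<open>Integrals along a minimal path\<close>

locale minimal_path = potential J \<W> K n D
  for J :: "'w::banach \<Rightarrow> 'h::{real_inner, banach, second_countable_topology}" and \<W> K n D +
  fixes w0 w1 :: 'w and \<epsilon> :: real and z :: "real \<Rightarrow> 'h"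
  assumes e: "0 < \<epsilon>" and e1: "\<epsilon> < 1" and z: "locL2 z"
    and minimal: "\<And>z'. locL2 z' \<Longrightarrow> wfun \<W> (J w0) (J w1) \<epsilon> z \<le> wfun \<W> (J w0) (J w1) \<epsilon> z'"
begin

abbreviation "om t \<equiv> exp (- t / \<epsilon>)"
abbreviation "u \<equiv> pth (J w0) (J w1) z"
abbreviation "v \<equiv> vel (J w1) z"
text \<open>On a null set of times \<open>\<W> (u t)\<close> may be infinite, and there
  \<open>enn2real\<close> gives \<open>0\<close>; at almost every nonnegative time the two
  agree.\<close>

definition "p t = enn2real (\<W> (u t))"
definition "Iz = (\<integral>t. (norm (damp \<epsilon> z t))\<^sup>2 \<partial>lborel)"
definition "IW = (\<integral>t. indicator {0..} t * (om t * p t) \<partial>lborel)"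

lemmas zi = locL2_locint[OF z]
lemmas zm [measurable] = locL2_measurable[OF z]

lemma e_nz: "\<epsilon> \<noteq> 0" using e by simp

lemma vm [measurable]: "v \<in> borel_measurable borel" and um [measurable]: "u \<in> borel_measurable borel"
  using measurable_vel[OF zi] measurable_pth[OF zi] by auto

lemma pm [measurable]: "p \<in> borel_measurable borel"
  unfolding p_def[abs_def] by measurable

lemma p0: "0 \<le> p t" by (simp add: p_def)

lemma m_le: "wfun \<W> (J w0) (J w1) \<epsilon> z \<le> ennreal (\<epsilon> * (W0 w0 + \<epsilon> * C0 w0 w1))"
  by (rule order_trans[OF minimal level[OF e e1]]) (simp add: locL2_def)

lemma m0: "0 \<le> \<epsilon> * (W0 w0 + \<epsilon> * C0 w0 w1)"
  using e W0_nonneg[of w0] C0_nonneg[of w0 w1] by simp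

lemmas sq = wfun_sqint(1)[OF e z m_le m0]

lemma W_fin: "(\<integral>\<^sup>+t\<in>{0..}. ennreal (om t) * \<W> (u t) \<partial>lborel) < \<infinity>"
proof -
  have "(\<integral>\<^sup>+t\<in>{0..}. ennreal (om t) * \<W> (u t) \<partial>lborel) \<le> wfun \<W> (J w0) (J w1) \<epsilon> z"
    unfolding wfun_def by (rule add_increasing) simp_all
  also note m_le
  finally show ?thesis by (simp add: le_less_trans[OF _ ennreal_less_top])
qed

lemma W_p: "AE t in lborel. 0 \<le> t \<longrightarrow> \<W> (u t) = ennreal (p t)"
proof -
  have "AE t in lborel. ennreal (om t) * \<W> (u t) * indicator {0..} t \<noteq> \<infinity>"
    by (rule nn_integral_PInf_AE) (use W_fin in auto)
  then show ?thesis
  proof eventually_elim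
    case (elim t)
    show ?case
    proof
      assume "0 \<le> t"
      then have "\<W> (u t) \<noteq> top" using elim by (auto simp: ennreal_mult_top)
      then show "\<W> (u t) = ennreal (p t)" by (simp add: p_def less_top)
    qed
  qed
qed

lemma ip: "integrable lborel (\<lambda>t. indicator {0..} t * (om t * p t))"
  and IW: "(\<integral>\<^sup>+t\<in>{0..}. ennreal (om t) * \<W> (u t) \<partial>lborel) = ennreal IW"
proof -
  have eq: "(\<integral>\<^sup>+t\<in>{0..}. ennreal (om t) * \<W> (u t) \<partial>lborel) = (\<integral>\<^sup>+t. ennreal (indicator {0..} t * (om t * p t)) \<partial>lborel)"
    by (rule nn_integral_cong_AE) (use W_p in \<open>eventually_elim, simp add: indicator_def ennreal_mult'\<close>)
  show i: "integrable lborel (\<lambda>t. indicator {0..} t * (om t * p t))"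
    by (rule integrableI_nonneg) (use W_fin eq p0 in auto)
  show "(\<integral>\<^sup>+t\<in>{0..}. ennreal (om t) * \<W> (u t) \<partial>lborel) = ennreal IW"
    unfolding eq IW_def by (rule nn_integral_eq_integral[OF i]) (simp add: p0)
qed

lemma Iz0: "0 \<le> Iz" and IW0: "0 \<le> IW"
  unfolding Iz_def IW_def by (intro integral_nonneg_AE AE_I2; simp add: p0)+

lemma wfun_z: "wfun \<W> (J w0) (J w1) \<epsilon> z = ennreal (\<epsilon>\<^sup>2 / 2 * Iz + IW)"
proof -
  have "ennreal (\<epsilon>\<^sup>2 / 2) * ennreal Iz = ennreal (\<epsilon>\<^sup>2 / 2 * Iz)" by (rule ennreal_mult'[symmetric]) simp
  moreover have "0 \<le> \<epsilon>\<^sup>2 / 2 * Iz" using Iz0 by simp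
  ultimately show ?thesis
    unfolding wfun_damp[OF e_nz] sqint_nn[OF sq] IW Iz_def[symmetric] using ennreal_plus[OF _ IW0] by (simp only:)
qed

lemma IW_le: "IW \<le> \<epsilon> * (W0 w0 + \<epsilon> * C0 w0 w1)"
proof -
  have "\<epsilon>\<^sup>2 / 2 * Iz + IW \<le> \<epsilon> * (W0 w0 + \<epsilon> * C0 w0 w1)"
    using m_le m0 unfolding wfun_z by (simp only: ennreal_le_iff)
  moreover have "0 \<le> \<epsilon>\<^sup>2 / 2 * Iz" using Iz0 by simp
  ultimately show ?thesis by linarith
qed

lemma compare:
  assumes z': "locL2 z'" and a: "(\<integral>\<^sup>+t\<in>{0..}. ennreal (om t * (norm (z' t))\<^sup>2) \<partial>lborel) \<le> ennreal a" "0 \<le> a"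
    and b: "(\<integral>\<^sup>+t\<in>{0..}. ennreal (om t) * \<W> (pth (J w0) (J w1) z' t) \<partial>lborel) \<le> ennreal b" "0 \<le> b"
  shows "\<epsilon>\<^sup>2 / 2 * Iz + IW \<le> \<epsilon>\<^sup>2 / 2 * a + b"
proof -
  have "ennreal (\<epsilon>\<^sup>2 / 2 * Iz + IW) \<le> wfun \<W> (J w0) (J w1) \<epsilon> z'"
    unfolding wfun_z[symmetric] by (rule minimal[OF z'])
  also have "\<dots> \<le> ennreal (\<epsilon>\<^sup>2 / 2) * ennreal a + ennreal b"
    unfolding wfun_def by (intro add_mono mult_left_mono a b) simp
  also have "\<dots> = ennreal (\<epsilon>\<^sup>2 / 2 * a + b)"
  proof -
    have "ennreal (\<epsilon>\<^sup>2 / 2) * ennreal a = ennreal (\<epsilon>\<^sup>2 / 2 * a)" by (rule ennreal_mult'[symmetric]) simp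
    moreover have "0 \<le> \<epsilon>\<^sup>2 / 2 * a" using a by simp
    ultimately show ?thesis using ennreal_plus[OF _ b(2)] by (simp only:)
  qed
  finally show ?thesis using a(2) b(2) by (subst (asm) ennreal_le_iff) simp_all
qed

lemma integrable_damp: "integrable lborel (\<lambda>t. indicator {0..} t * (om t * (norm (z t))\<^sup>2))"
  and integral_damp: "(\<integral>t. indicator {0..} t * (om t * (norm (z t))\<^sup>2) \<partial>lborel) = Iz"
  using sq unfolding sqint_def Iz_def norm_damp[OF e_nz] by simp_all

section \<open>The inner variation\<close>

definition "MM b = exp (b / \<epsilon>)"
text \<open>Half the increment of the squared velocity from time \<open>0\<close> to time
  \<open>b\<close>.\<close>

definition "S1 b = prim (\<lambda>s. inner (z s) (v s)) b"
text \<open>Coefficient of the errors of second order in \<open>\<delta>\<close> that stem from the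
  acceleration. It may be large when \<open>\<epsilon>\<close> is small, but it disappears when
  \<open>\<delta>\<close> tends to zero at fixed \<open>\<epsilon>\<close>.\<close>

definition "QQ b = (10 * MM b / \<epsilon>) * prim (\<lambda>s. \<bar>inner (z s) (v s)\<bar>) b + (MM b / \<epsilon>\<^sup>2) * prim (\<lambda>s. (norm (v s))\<^sup>2) b"
text \<open>The integral of \<open>om t * (1 + p t + (t / \<epsilon> * norm w1) ^ n)\<close> over
  the half line, that is the growth term for displacements in the direction
  \<open>w1\<close>.\<close>

definition "SS = \<epsilon> + IW + \<epsilon> * (norm w1 ^ n * fact n)"

text \<open>The competitor is \<open>u\<close> transported by the time change
  \<open>t + \<delta> * gen \<epsilon> b t\<close>, plus \<open>\<kappa> * s\<close> times
  \<open>J w1\<close> at the new time \<open>s\<close>, which restores the initial velocity. All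
  integrals are pulled back to the old time. The factor of the potential is kept exactly, the cross
  term \<open>inner z v\<close> to first order in \<open>\<delta>\<close>, and the factor of the
  squared acceleration is at most one. The second condition on \<open>\<delta>\<close> keeps the
  growth factor \<open>l\<close> below one.\<close>

lemma inner_variation:
  assumes b: "0 \<le> b" and d: "0 < \<delta>" "\<delta> * (1 + \<delta> * MM b) \<le> 1"
  shows "integrable lborel (\<lambda>t. indicator {0..} t * (om t * p t * (exp (- \<delta> * gen \<epsilon> b t / \<epsilon>) * (1 + \<delta> * gen' \<epsilon> b t))))"
    and "IW \<le> (\<integral>t. indicator {0..} t * (om t * p t * (exp (- \<delta> * gen \<epsilon> b t / \<epsilon>) * (1 + \<delta> * gen' \<epsilon> b t))) \<partial>lborel)
       - \<delta> * \<epsilon> * S1 b + \<delta>\<^sup>2 * (\<epsilon>\<^sup>2 / 2 * QQ b) + (1 + \<delta> * MM b)\<^sup>2 * \<delta> * \<epsilon> * K * SS"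
proof -
  define m where "m t = 1 + \<delta> * gen' \<epsilon> b t" for t
  have g1: "1 \<le> gen' \<epsilon> b t" "gen' \<epsilon> b t \<le> MM b" for t using gen'_bounds[OF e b] by (simp_all add: MM_def)
  have M1: "1 \<le> MM b" using g1[of 0] by linarith
  have dM: "0 \<le> \<delta> * MM b" using d M1 by simp
  interpret tc: time_change m
  proof
    show "continuous_on UNIV m" unfolding m_def[abs_def] by (intro continuous_intros gen'_cont)
    show "1 \<le> m t" for t using g1[of t] d by (simp add: m_def)
  qed
  have m_le: "m t \<le> 1 + \<delta> * MM b" for t using g1[of t] d by (simp add: m_def)
  have m_pos: "0 < m t" for t using tc.ge1[of t] by linarith
  have lg: "locint (gen' \<epsilon> b)" by (rule locint_continuous[OF gen'_cont])
  have lm: "locint m" by (rule locint_continuous[OF continuous_on_subset[OF tc.cont]]) simp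
  have psi: "tc.psi t = t + \<delta> * gen \<epsilon> b t" if "0 \<le> t" for t
  proof -
    have "prim m t = prim (\<lambda>s. 1) t + prim (\<lambda>s. \<delta> * gen' \<epsilon> b s) t"
      unfolding m_def[abs_def] by (intro prim_add locint_continuous continuous_intros gen'_cont)
    also have "prim (\<lambda>s. \<delta> * gen' \<epsilon> b s) t = \<delta> * gen \<epsilon> b t"
      unfolding gen_def by (rule prim_bounded_linear[OF bounded_linear_mult_right lg])
    finally show ?thesis using that by (simp add: tc.psi_prim prim_const)
  qed
  \<comment> \<open>The derivative of the inverse time change, expressed at the old time: the factor
    by which velocities are multiplied.\<close>
  define q where "q t = 1 / m t" for t
  have q0: "0 < q t" and q1: "q t \<le> 1" and mq: "m t * q t = 1" for t
    using m_pos[of t] tc.ge1[of t] by (simp_all add: q_def)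
  have qm [measurable]: "q \<in> borel_measurable borel" unfolding q_def[abs_def] by measurable
  \<comment> \<open>The derivative of \<open>q\<close> before time \<open>b\<close>. Afterwards
    \<open>gen'\<close> is constant, so \<open>k\<close> is cut off there and the cross term
    disappears.\<close>
  define k' where "k' t = - (\<delta> / \<epsilon>) * exp (t / \<epsilon>) / (1 + \<delta> * exp (t / \<epsilon>))\<^sup>2" for t
  define k where "k t = indicator {0..b} t *\<^sub>R k' t" for t
  have dpos: "0 < 1 + \<delta> * exp (t / \<epsilon>)" for t using d by (simp add: add_pos_pos)
  have k'c: "continuous_on A k'" for A unfolding k'_def[abs_def] divide_inverse[of _ \<epsilon>]
    by (intro continuous_intros) (use dpos in \<open>simp add: divide_inverse less_imp_neq[symmetric]\<close>)
  have k'l: "locint k'" by (rule locint_continuous[OF k'c])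
  have kl: "locint k" unfolding k_def[abs_def] by (rule locint_indicator[OF k'l])
  have km [measurable]: "k \<in> borel_measurable borel"
    unfolding k_def[abs_def] using borel_measurable_continuous_onI[OF k'c] by measurable
  have qk: "q t = q 0 + prim k t" if t: "0 \<le> t" for t
  proof -
    have "prim k t = prim k' (min t b)" unfolding k_def[abs_def] by (rule prim_indicator)
    also have "\<dots> = 1 / (1 + \<delta> * exp (min t b / \<epsilon>)) - 1 / (1 + \<delta> * exp (0 / \<epsilon>))"
    proof (rule prim_deriv)
      fix x
      show "((\<lambda>x. 1 / (1 + \<delta> * exp (x / \<epsilon>))) has_real_derivative k' x) (at x)"
        unfolding k'_def using dpos[of x] e
        by (auto intro!: derivative_eq_intros simp: power2_eq_square)
    qed (use k'c t b in auto)
    finally show ?thesis using t b by (simp add: q_def m_def gen'_def)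
  qed
  \<comment> \<open>The part of the initial velocity lost by the time change; it equals
    \<open>\<delta> / (1 + \<delta>)\<close>.\<close>
  define \<kappa> where "\<kappa> = 1 - q 0"
  have ka: "0 \<le> \<kappa>" "\<kappa> \<le> \<delta>"
  proof -
    have "q 0 = 1 / (1 + \<delta>)" using b by (simp add: q_def m_def gen'_def)
    then have "\<kappa> = \<delta> / (1 + \<delta>)" using d by (simp add: \<kappa>_def field_simps)
    then show "0 \<le> \<kappa>" "\<kappa> \<le> \<delta>" using d by (simp_all add: divide_le_eq)
  qed
  \<comment> \<open>Acceleration of the competitor at the old time: the product rule for
    \<open>q t *\<^sub>R v t\<close> gives the bracket, and passing to the derivative in the new
    time gives the outer factor \<open>q t\<close>.\<close>
  define zh where "zh t = q t *\<^sub>R (q t *\<^sub>R z t + k t *\<^sub>R v t)" for t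
  have zhm [measurable]: "zh \<in> borel_measurable borel" unfolding zh_def[abs_def] by measurable
  define Z where "Z s = zh (tc.phi s)" for s
  have Zm [measurable]: "Z \<in> borel_measurable borel" unfolding Z_def[abs_def] by measurable
  have kb: "\<bar>k t\<bar> \<le> \<delta> * MM b / \<epsilon>" for t
  proof (cases "t \<in> {0..b}")
    case True
    have 1: "1 \<le> (1 + \<delta> * exp (t / \<epsilon>))\<^sup>2" using d by (intro one_le_power) simp
    have E: "exp (t / \<epsilon>) \<le> MM b" unfolding MM_def using True e by (simp add: divide_right_mono)
    have "\<bar>k' t\<bar> = (\<delta> / \<epsilon>) * exp (t / \<epsilon>) / (1 + \<delta> * exp (t / \<epsilon>))\<^sup>2"
      unfolding k'_def using d e by (simp add: abs_mult abs_divide)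
    also have "\<dots> \<le> (\<delta> / \<epsilon>) * exp (t / \<epsilon>) / 1" using 1 d e less_imp_neq[OF dpos[of t]]
      by (intro divide_left_mono) simp_all
    also have "\<dots> = (\<delta> / \<epsilon>) * exp (t / \<epsilon>)" by simp
    also have "\<dots> \<le> (\<delta> / \<epsilon>) * MM b" using d e by (intro mult_left_mono E) simp
    finally show ?thesis using True by (simp add: k_def)
  next
    case False
    then show ?thesis using dM e by (simp add: k_def)
  qed
  have vs: "locint (\<lambda>s. (norm (v s))\<^sup>2)" by (intro locint_continuous continuous_intros continuous_vel zi)
  have zhl: "locL2 zh"
  proof (rule locL2I[OF zhm], rule locint_bound)
    show "locint (\<lambda>s. 2 * (norm (z s))\<^sup>2 + 2 * ((\<delta> * MM b / \<epsilon>)\<^sup>2 * (norm (v s))\<^sup>2))"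
      by (intro locint_add locint_bounded_linear[OF bounded_linear_mult_right] locL2_sq[OF z] vs)
    show "(\<lambda>s. (norm (zh s))\<^sup>2) \<in> borel_measurable borel" by measurable
    fix t :: real
    have "(norm (zh t))\<^sup>2 = (q t)\<^sup>2 * (norm (q t *\<^sub>R z t + k t *\<^sub>R v t))\<^sup>2" by (simp add: zh_def power_mult_distrib)
    also have "\<dots> \<le> 1 * (norm (q t *\<^sub>R z t + k t *\<^sub>R v t))\<^sup>2"
      using q0[of t] q1[of t] by (intro mult_right_mono) (simp_all add: power_le_one)
    also have "\<dots> \<le> 2 * (norm (q t *\<^sub>R z t))\<^sup>2 + 2 * (norm (k t *\<^sub>R v t))\<^sup>2" unfolding mult_1 by (rule norm_add_sq_le)
    also have "\<dots> = 2 * ((q t)\<^sup>2 * (norm (z t))\<^sup>2) + 2 * ((k t)\<^sup>2 * (norm (v t))\<^sup>2)" by (simp add: power_mult_distrib)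
    also have "\<dots> \<le> 2 * (1 * (norm (z t))\<^sup>2) + 2 * ((\<delta> * MM b / \<epsilon>)\<^sup>2 * (norm (v t))\<^sup>2)"
    proof (intro add_mono mult_left_mono mult_right_mono)
      show "(q t)\<^sup>2 \<le> 1" using q0[of t] q1[of t] by (simp add: power_le_one)
      show "(k t)\<^sup>2 \<le> (\<delta> * MM b / \<epsilon>)\<^sup>2" using power_mono[OF kb[of t], of 2] by simp
    qed simp_all
    finally show "norm ((norm (zh t))\<^sup>2) \<le> norm (2 * (norm (z t))\<^sup>2 + 2 * ((\<delta> * MM b / \<epsilon>)\<^sup>2 * (norm (v t))\<^sup>2))"
      by simp
  qed
  have Zl: "locL2 Z" unfolding locL2_def
  proof (intro conjI allI Zm)
    fix T :: real
    have "(\<integral>\<^sup>+t\<in>{0..T}. ennreal ((norm (Z t))\<^sup>2) \<partial>lborel) = (\<integral>\<^sup>+t\<in>{0..}. (ennreal ((norm (Z t))\<^sup>2) * indicator {..T} t) \<partial>lborel)"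
      by (rule nn_integral_cong) (simp add: indicator_def)
    also have "\<dots> = (\<integral>\<^sup>+t\<in>{0..}. ennreal (m t) * (ennreal ((norm (Z (tc.psi t)))\<^sup>2) * indicator {..T} (tc.psi t)) \<partial>lborel)"
      by (rule tc.nn_integral_psi) measurable
    also have "\<dots> \<le> (\<integral>\<^sup>+t. ennreal (1 + \<delta> * MM b) * (ennreal ((norm (zh t))\<^sup>2) * indicator {0..T} t) \<partial>lborel)"
    proof (rule nn_integral_mono)
      fix t
      show "ennreal (m t) * (ennreal ((norm (Z (tc.psi t)))\<^sup>2) * indicator {..T} (tc.psi t)) * indicator {0..} t
        \<le> ennreal (1 + \<delta> * MM b) * (ennreal ((norm (zh t))\<^sup>2) * indicator {0..T} t)"
      proof (cases "0 \<le> t \<and> tc.psi t \<le> T")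
        case True
        then have "t \<le> T" using tc.psi_ge[of t] by linarith
        then show ?thesis using True by (simp add: Z_def mult_right_mono ennreal_leI[OF m_le] del: ennreal_plus)
      qed (auto simp: indicator_def)
    qed
    also have "\<dots> = ennreal (1 + \<delta> * MM b) * (\<integral>\<^sup>+t\<in>{0..T}. ennreal ((norm (zh t))\<^sup>2) \<partial>lborel)"
      by (rule nn_integral_cmult) measurable
    also have "\<dots> < \<infinity>" using zhl by (simp add: locL2_def ennreal_mult_less_top)
    finally show "(\<integral>\<^sup>+t\<in>{0..T}. ennreal ((norm (Z t))\<^sup>2) \<partial>lborel) < \<infinity>" .
  qed
  note pr = prim_product_rule[OF bounded_bilinear_scaleR kl zi]
  have velZ: "vel (J w1) Z (tc.psi t) = q t *\<^sub>R v t + \<kappa> *\<^sub>R J w1" if t: "0 \<le> t" for t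
  proof -
    have l1: "locint (\<lambda>s. k s *\<^sub>R v s)" using pr(1)[of "J w1"] by (simp add: vel_def)
    have l2: "locint (\<lambda>s. (q 0 + prim k s) *\<^sub>R z s)" by (rule pr(2))
    have "prim Z (tc.psi t) = prim (\<lambda>r. m r *\<^sub>R Z (tc.psi r)) t" by (rule tc.prim_psi[OF Zm])
    also have "\<dots> = prim (\<lambda>s. k s *\<^sub>R v s + (q 0 + prim k s) *\<^sub>R z s) t"
    proof (rule prim_cong)
      fix s :: real assume "0 \<le> s"
      then show "m s *\<^sub>R Z (tc.psi s) = k s *\<^sub>R v s + (q 0 + prim k s) *\<^sub>R z s"
        by (simp add: Z_def zh_def mq qk[symmetric] add.commute)
    qed
    also have "\<dots> = prim (\<lambda>s. k s *\<^sub>R v s) t + prim (\<lambda>s. (q 0 + prim k s) *\<^sub>R z s) t" by (rule prim_add[OF l1 l2])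
    also have "\<dots> = q t *\<^sub>R v t - q 0 *\<^sub>R J w1"
      using pr(3)[OF t, of "q 0" "J w1"] qk[OF t] by (simp add: vel_def)
    finally show ?thesis by (simp add: vel_def[of "J w1" Z] \<kappa>_def scaleR_diff_left)
  qed
  have pthZ: "pth (J w0) (J w1) Z (tc.psi t) = u t + (\<kappa> * tc.psi t) *\<^sub>R J w1" if t: "0 \<le> t" for t
  proof -
    have lv: "locint v" by (rule locint_vel[OF zi])
    have lk: "locint (\<lambda>s. m s *\<^sub>R (\<kappa> *\<^sub>R J w1))" by (rule locint_bounded_linear[OF bounded_linear_scaleR_left lm])
    have "prim (vel (J w1) Z) (tc.psi t) = prim (\<lambda>r. m r *\<^sub>R vel (J w1) Z (tc.psi r)) t"
      by (rule tc.prim_psi[OF measurable_vel[OF locL2_locint[OF Zl]]])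
    also have "\<dots> = prim (\<lambda>s. v s + m s *\<^sub>R (\<kappa> *\<^sub>R J w1)) t"
    proof (rule prim_cong)
      fix s :: real assume "0 \<le> s"
      then show "m s *\<^sub>R vel (J w1) Z (tc.psi s) = v s + m s *\<^sub>R (\<kappa> *\<^sub>R J w1)"
        unfolding velZ[OF \<open>0 \<le> s\<close>] scaleR_add_right scaleR_scaleR mq by simp
    qed
    also have "\<dots> = prim v t + prim (\<lambda>s. m s *\<^sub>R (\<kappa> *\<^sub>R J w1)) t" by (rule prim_add[OF lv lk])
    also have "prim (\<lambda>s. m s *\<^sub>R (\<kappa> *\<^sub>R J w1)) t = prim m t *\<^sub>R (\<kappa> *\<^sub>R J w1)"
      by (rule prim_bounded_linear[OF bounded_linear_scaleR_left lm])
    finally show ?thesis using t by (simp add: pth_def tc.psi_prim mult.commute add.assoc)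
  qed
  \<comment> \<open>Majorant of the squared acceleration after pulling back. In the cross term the
    weight cancels the factor \<open>exp (t / \<epsilon>)\<close> of \<open>k\<close>, which leaves
    the constant \<open>2 * \<delta> / \<epsilon>\<close>; the other two terms on
    \<open>[0, b]\<close> are of order \<open>\<delta>\<^sup>2\<close>.\<close>
  define R where "R t = om t * (norm (z t))\<^sup>2 + indicator {0..b} t * (- (2 * \<delta> / \<epsilon>) * inner (z t) (v t)
      + 10 * \<delta>\<^sup>2 * MM b / \<epsilon> * \<bar>inner (z t) (v t)\<bar> + \<delta>\<^sup>2 * MM b / \<epsilon>\<^sup>2 * (norm (v t))\<^sup>2)" for t
  have ptw: "exp (- tc.psi t / \<epsilon>) * m t * (norm (zh t))\<^sup>2 \<le> R t" if t: "0 \<le> t" for t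
  proof -
    define x where "x = \<delta> * gen \<epsilon> b t / \<epsilon>"
    have x0: "0 \<le> x" using gen_bounds(1)[OF e b t] d e by (simp add: x_def)
    have om': "exp (- tc.psi t / \<epsilon>) = om t * exp (- x)"
      by (simp add: psi[OF t] x_def add_divide_distrib diff_divide_distrib exp_add[symmetric])
    define a s c where "a = (norm (z t))\<^sup>2" and "s = inner (z t) (v t)" and "c = (norm (v t))\<^sup>2"
    have a0: "0 \<le> a" "0 \<le> c" by (simp_all add: a_def c_def)
    have ex: "0 < exp (- x)" "exp (- x) \<le> 1" using x0 by simp_all
    have qp: "0 \<le> q t ^ j" "q t ^ j \<le> 1" for j using q0[of t] q1[of t] by (simp_all add: power_le_one)
    show ?thesis
    proof (cases "t \<le> b")
      case False
      then have zht: "zh t = (q t)\<^sup>2 *\<^sub>R z t" by (simp add: zh_def k_def power2_eq_square)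
      have "exp (- tc.psi t / \<epsilon>) * m t * (norm (zh t))\<^sup>2 = om t * (exp (- x) * q t ^ 3) * (m t * q t) * a"
        unfolding zht om' a_def by (simp add: power_mult_distrib power2_eq_square power3_eq_cube)
      also have "\<dots> \<le> om t * 1 * 1 * a"
        unfolding mq using a0 ex qp[of 3] mult_le_one[OF ex(2) qp(1) qp(2), of 3] by (intro mult_right_mono mult_left_mono) simp_all
      finally show ?thesis using False by (simp add: R_def a_def)
    next
      case True
      define E where "E = exp (t / \<epsilon>)"
      have E: "om t * E = 1" by (simp add: E_def exp_add[symmetric])
      have E0: "0 < E" by (simp add: E_def)
      have mE: "m t = 1 + \<delta> * E" using t True by (simp add: m_def gen'_def E_def)
      have EM: "E \<le> MM b" using g1(2)[of t] t True by (simp add: gen'_def E_def)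
      define y where "y = \<delta> * E / \<epsilon>"
      have y0: "0 \<le> y" using d E0 e by (simp add: y_def)
      have kt: "k t = - y * (q t)\<^sup>2"
        using t True by (simp add: k_def k'_def y_def q_def mE E_def[symmetric] power_divide)
      have zht: "zh t = (q t)\<^sup>2 *\<^sub>R (z t - (y * q t) *\<^sub>R v t)"
        unfolding zh_def kt by (simp add: scaleR_diff_right scaleR_add_right power2_eq_square mult_ac)
      have nz: "(norm (z t - (y * q t) *\<^sub>R v t))\<^sup>2 = a - 2 * (y * q t) * s + (y * q t)\<^sup>2 * c"
        unfolding power2_norm_eq_inner a_def s_def c_def
        by (simp add: inner_diff_left inner_diff_right inner_commute power2_eq_square algebra_simps)
      define c' where "c' = exp (- x) * q t ^ 3"
      have c'0: "0 \<le> c'" "c' \<le> 1" using ex qp[of 3] mult_le_one[OF ex(2) qp(1) qp(2), of 3] by (simp_all add: c'_def)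
      have cq: "c' * q t \<le> 1" "0 \<le> c' * q t" using c'0 q0[of t] q1[of t] mult_le_one[of c' "q t"] by simp_all
      have lhs: "exp (- tc.psi t / \<epsilon>) * m t * (norm (zh t))\<^sup>2 = om t * c' * (a - 2 * (y * q t) * s + (y * q t)\<^sup>2 * c)"
      proof -
        have "exp (- tc.psi t / \<epsilon>) * m t * (norm (zh t))\<^sup>2 = om t * c' * (m t * q t) * (norm (z t - (y * q t) *\<^sub>R v t))\<^sup>2"
          unfolding zht om' c'_def by (simp add: power_mult_distrib power2_eq_square power3_eq_cube)
        then show ?thesis unfolding mq nz by simp
      qed
      have omy: "om t * y = \<delta> / \<epsilon>"
        using E by (simp add: y_def mult.left_commute[of _ \<delta>])
      have T1: "om t * c' * a \<le> om t * a"
      proof -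
        have "om t * c' * a \<le> om t * 1 * a" using c'0 a0 by (intro mult_right_mono mult_left_mono) simp_all
        then show ?thesis by simp
      qed
      have xle: "x \<le> \<delta> * MM b"
      proof -
        have "gen \<epsilon> b t / \<epsilon> \<le> MM b"
          using gen_eq[OF e b t] True t EM by (simp add: gen'_def E_def)
        then have "\<delta> * (gen \<epsilon> b t / \<epsilon>) \<le> \<delta> * MM b" using d by (intro mult_left_mono) simp_all
        then show ?thesis by (simp add: x_def)
      qed
      \<comment> \<open>The cross term carries the factor \<open>exp (- x) * q t ^ 4\<close>. From
        \<open>m t \<le> exp (\<delta> * E)\<close> follows
        \<open>q t \<ge> exp (- (\<delta> * E))\<close>, and \<open>1 + y \<le> exp y\<close> bounds
        the distance of the factor to one by \<open>x + 4 * (\<delta> * E)\<close>. Both parts are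
        controlled by \<open>\<delta> * MM b\<close>, whence the \<open>5\<close>.\<close>
      have cql: "1 - c' * q t \<le> 5 * \<delta> * MM b"
      proof -
        have dE: "\<delta> * E \<le> \<delta> * MM b" using EM d by simp
        have "m t \<le> exp (\<delta> * E)" unfolding mE by (rule exp_ge_add_one_self)
        then have "exp (- (\<delta> * E)) \<le> q t"
          unfolding q_def exp_minus inverse_eq_divide using m_pos[of t] by (intro divide_left_mono) simp_all
        then have "exp (- (\<delta> * E)) ^ 4 \<le> q t ^ 4" by (rule power_mono) simp
        then have "exp (- (4 * (\<delta> * E))) \<le> q t ^ 4" by (simp add: exp_of_nat_mult[symmetric])
        then have "exp (- x) * exp (- (4 * (\<delta> * E))) \<le> exp (- x) * q t ^ 4" by (intro mult_left_mono) simp_all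
        moreover have "exp (- x) * exp (- (4 * (\<delta> * E))) = exp (- x - 4 * (\<delta> * E))" by (simp add: exp_add[symmetric])
        moreover have "1 + (- x - 4 * (\<delta> * E)) \<le> exp (- x - 4 * (\<delta> * E))" by (rule exp_ge_add_one_self)
        moreover have "c' * q t = exp (- x) * q t ^ 4" by (simp add: c'_def power3_eq_cube power4_eq_xxxx)
        ultimately have "1 - c' * q t \<le> x + 4 * (\<delta> * E)" by linarith
        then show ?thesis using xle dE by linarith
      qed
      have T2: "- 2 * (\<delta> / \<epsilon>) * (c' * q t) * s \<le> - (2 * \<delta> / \<epsilon>) * s + 10 * \<delta>\<^sup>2 * MM b / \<epsilon> * \<bar>s\<bar>"
      proof -
        have de: "0 \<le> 2 * (\<delta> / \<epsilon>)" using d e by simp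
        have "(1 - c' * q t) * s \<le> (1 - c' * q t) * \<bar>s\<bar>" using cq by (intro mult_left_mono) simp_all
        also have "\<dots> \<le> 5 * \<delta> * MM b * \<bar>s\<bar>" by (rule mult_right_mono[OF cql]) simp
        finally have "2 * (\<delta> / \<epsilon>) * ((1 - c' * q t) * s) \<le> 2 * (\<delta> / \<epsilon>) * (5 * \<delta> * MM b * \<bar>s\<bar>)" by (rule mult_left_mono[OF _ de])
        then show ?thesis by (simp add: algebra_simps power2_eq_square)
      qed
      have T3: "om t * c' * ((y * q t)\<^sup>2 * c) \<le> \<delta>\<^sup>2 * MM b / \<epsilon>\<^sup>2 * c"
      proof -
        have "om t * c' * ((y * q t)\<^sup>2 * c) = (om t * y) * y * (c' * (q t)\<^sup>2) * c"
          by (simp add: power_mult_distrib power2_eq_square)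
        also have "\<dots> \<le> (om t * y) * y * 1 * c"
          using c'0 qp[of 2] a0 y0 mult_le_one[of c' "(q t)\<^sup>2"] by (intro mult_right_mono mult_left_mono) simp_all
        also have "\<dots> = \<delta>\<^sup>2 * E / \<epsilon>\<^sup>2 * c" unfolding omy by (simp add: y_def power2_eq_square)
        also have "\<dots> \<le> \<delta>\<^sup>2 * MM b / \<epsilon>\<^sup>2 * c"
          using EM a0 by (intro mult_right_mono divide_right_mono mult_left_mono) simp_all
        finally show ?thesis .
      qed
      have "om t * c' * (a - 2 * (y * q t) * s + (y * q t)\<^sup>2 * c)
         = om t * c' * a + (- 2 * (om t * y) * (c' * q t) * s) + om t * c' * ((y * q t)\<^sup>2 * c)" by (simp add: algebra_simps)
      also have "\<dots> \<le> om t * a + (- (2 * \<delta> / \<epsilon>) * s + 10 * \<delta>\<^sup>2 * MM b / \<epsilon> * \<bar>s\<bar>) + \<delta>\<^sup>2 * MM b / \<epsilon>\<^sup>2 * c"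
        unfolding omy by (intro add_mono T1 T2 T3)
      also have "\<dots> = R t" using t True by (simp add: R_def a_def s_def c_def)
      finally show ?thesis unfolding lhs .
    qed
  qed
  note zv = norm_vel_sq(1)[OF zi b, where u = "J w1"]
  have zv': "locint (\<lambda>s. \<bar>inner (z s) (v s)\<bar>)"
    by (rule locint_bound[OF zv], rule borel_measurable_abs, rule borel_measurable_inner, rule zm, rule vm, simp)
  have ind: "indicator {0..} t * (indicator {0..b} t * f t) = indicator {0..b} t *\<^sub>R (f t :: real)" for t f
    using b by (simp add: indicator_def)
  have Rint: "integrable lborel (\<lambda>t. indicator {0..} t * R t)"
    and RI: "(\<integral>t. indicator {0..} t * R t \<partial>lborel) = Iz - (2 * \<delta> / \<epsilon>) * S1 b + \<delta>\<^sup>2 * QQ b"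
  proof -
    let ?r = "\<lambda>t. indicator {0..} t * (om t * (norm (z t))\<^sup>2) + (- (2 * \<delta> / \<epsilon>) * (indicator {0..b} t *\<^sub>R inner (z t) (v t))
      + (10 * \<delta>\<^sup>2 * MM b / \<epsilon> * (indicator {0..b} t *\<^sub>R \<bar>inner (z t) (v t)\<bar>) + \<delta>\<^sup>2 * MM b / \<epsilon>\<^sup>2 * (indicator {0..b} t *\<^sub>R (norm (v t))\<^sup>2)))"
    have req: "indicator {0..} t * R t = ?r t" for t
      using b by (simp add: R_def indicator_def algebra_simps)
    note i = integrable_damp locint_integrable[OF zv, of b] locint_integrable[OF zv', of b] locint_integrable[OF vs, of b]
    have i': "integrable lborel (\<lambda>t. - (2 * \<delta> / \<epsilon>) * (indicator {0..b} t *\<^sub>R inner (z t) (v t)))"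
      "integrable lborel (\<lambda>t. 10 * \<delta>\<^sup>2 * MM b / \<epsilon> * (indicator {0..b} t *\<^sub>R \<bar>inner (z t) (v t)\<bar>))"
      "integrable lborel (\<lambda>t. \<delta>\<^sup>2 * MM b / \<epsilon>\<^sup>2 * (indicator {0..b} t *\<^sub>R (norm (v t))\<^sup>2))"
      using i by (intro integrable_mult_right; simp)+
    show "integrable lborel (\<lambda>t. indicator {0..} t * R t)" unfolding req
      by (intro Bochner_Integration.integrable_add i(1) i')
    have "(\<integral>t. indicator {0..} t * R t \<partial>lborel) = Iz + (- (2 * \<delta> / \<epsilon>) * S1 b + (10 * \<delta>\<^sup>2 * MM b / \<epsilon> * prim (\<lambda>s. \<bar>inner (z s) (v s)\<bar>) b
       + \<delta>\<^sup>2 * MM b / \<epsilon>\<^sup>2 * prim (\<lambda>s. (norm (v s))\<^sup>2) b))"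
      unfolding req S1_def prim_def set_lebesgue_integral_def integral_damp[symmetric]
      by (subst Bochner_Integration.integral_add Bochner_Integration.integral_add[OF i'(2,3)] Bochner_Integration.integral_add[OF i'(1) Bochner_Integration.integrable_add[OF i'(2,3)]];
        (intro i(1) i' Bochner_Integration.integrable_add)?)+ (simp only: integral_mult_right_zero)
    then show "(\<integral>t. indicator {0..} t * R t \<partial>lborel) = Iz - (2 * \<delta> / \<epsilon>) * S1 b + \<delta>\<^sup>2 * QQ b"
      by (simp add: QQ_def algebra_simps)
  qed
  have R0: "0 \<le> R t" if "0 \<le> t" for t
    by (rule order_trans[OF _ ptw[OF that]]) (simp add: m_pos less_imp_le)
  have partA: "(\<integral>\<^sup>+s\<in>{0..}. ennreal (om s * (norm (Z s))\<^sup>2) \<partial>lborel) \<le> ennreal (Iz - (2 * \<delta> / \<epsilon>) * S1 b + \<delta>\<^sup>2 * QQ b)"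
  proof -
    have "(\<integral>\<^sup>+s\<in>{0..}. ennreal (om s * (norm (Z s))\<^sup>2) \<partial>lborel)
       = (\<integral>\<^sup>+t\<in>{0..}. ennreal (m t) * ennreal (om (tc.psi t) * (norm (Z (tc.psi t)))\<^sup>2) \<partial>lborel)"
      by (rule tc.nn_integral_psi) measurable
    also have "\<dots> \<le> ennreal (\<integral>t. indicator {0..} t * R t \<partial>lborel)"
    proof (rule nn_integral_le_integral[OF Rint], rule AE_I2, intro impI conjI)
      fix t :: real assume t: "0 \<le> t"
      have "ennreal (m t) * ennreal (om (tc.psi t) * (norm (Z (tc.psi t)))\<^sup>2) = ennreal (exp (- tc.psi t / \<epsilon>) * m t * (norm (zh t))\<^sup>2)"
        using m_pos[of t] by (simp add: Z_def ennreal_mult'[symmetric] mult_ac)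
      also have "\<dots> \<le> ennreal (R t)" by (rule ennreal_leI[OF ptw[OF t]])
      finally show "ennreal (m t) * ennreal (om (tc.psi t) * (norm (Z (tc.psi t)))\<^sup>2) \<le> ennreal (R t)" .
    qed (rule R0)
    finally show ?thesis unfolding RI .
  qed
  have A0: "0 \<le> Iz - (2 * \<delta> / \<epsilon>) * S1 b + \<delta>\<^sup>2 * QQ b"
    unfolding RI[symmetric] by (intro integral_nonneg_AE AE_I2) (simp add: indicator_def R0)
  \<comment> \<open>From \<open>\<kappa> \<le> \<delta>\<close> and
    \<open>psi t \<le> (1 + \<delta> * MM b) * t\<close> the correction
    \<open>\<kappa> * psi t\<close> is at most \<open>l * (t / \<epsilon>)\<close>, the form
    required by \<open>growth_le\<close>.\<close>
  define l where "l = \<delta> * (1 + \<delta> * MM b) * \<epsilon>"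
  have l: "0 \<le> l" "l \<le> 1"
  proof -
    show "0 \<le> l" using d dM e by (simp add: l_def)
    have "\<delta> * (1 + \<delta> * MM b) * \<epsilon> \<le> 1 * 1" using d(2) e e1 d(1) dM by (intro mult_mono) simp_all
    then show "l \<le> 1" by (simp add: l_def)
  qed
  define ex where "ex t = exp (- \<delta> * gen \<epsilon> b t / \<epsilon>) * m t" for t
  have ex0: "0 \<le> ex t" for t using m_pos[of t] by (simp add: ex_def)
  have genm [measurable]: "gen \<epsilon> b \<in> borel_measurable borel"
    unfolding gen_def[abs_def] using lg by measurable
  have exm [measurable]: "ex \<in> borel_measurable borel" unfolding ex_def[abs_def] by measurable
  have ex_le: "ex t \<le> 1 + \<delta> * MM b" if "0 \<le> t" for t
  proof -
    have "exp (- \<delta> * gen \<epsilon> b t / \<epsilon>) \<le> 1" using gen_bounds(1)[OF e b that] d e by simp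
    then have "ex t \<le> 1 * m t" unfolding ex_def using m_pos[of t] by (intro mult_right_mono) simp_all
    then show ?thesis using m_le[of t] by simp
  qed
  define T where "T t = om t * p t * ex t + (1 + \<delta> * MM b) * (l * K) * (om t * (1 + p t + (t / \<epsilon> * norm w1) ^ n))" for t
  have iex: "integrable lborel (\<lambda>t. indicator {0..} t * (om t * p t * ex t))"
  proof (rule Bochner_Integration.integrable_bound)
    show "integrable lborel (\<lambda>t. (1 + \<delta> * MM b) * (indicator {0..} t * (om t * p t)))"
      by (rule integrable_mult_right[OF ip])
    show "AE t in lborel. norm (indicator {0..} t * (om t * p t * ex t)) \<le> norm ((1 + \<delta> * MM b) * (indicator {0..} t * (om t * p t)))"
    proof (rule AE_I2)
      fix t
      show "norm (indicator {0..} t * (om t * p t * ex t)) \<le> norm ((1 + \<delta> * MM b) * (indicator {0..} t * (om t * p t)))"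
      proof (cases "0 \<le> t")
        case True
        have "om t * p t * ex t \<le> om t * p t * (1 + \<delta> * MM b)"
          by (rule mult_left_mono[OF ex_le[OF True]]) (simp add: p0)
        then show ?thesis using True p0[of t] ex0[of t] dM by (simp add: abs_mult mult_ac)
      qed simp
    qed
  qed measurable
  note ex0i = exp_power_integral[OF e, of 0] and exni = exp_power_integral[OF e, of n]
  have Teq: "indicator {0..} t * T t = indicator {0..} t * (om t * p t * ex t) + (1 + \<delta> * MM b) * (l * K) * (indicator {0..} t * (om t * (t / \<epsilon>) ^ 0)
     + (indicator {0..} t * (om t * p t) + norm w1 ^ n * (indicator {0..} t * (om t * (t / \<epsilon>) ^ n))))" for t
    
  proof -
    have "(t / \<epsilon> * norm w1) ^ n = norm w1 ^ n * (t / \<epsilon>) ^ n" by (simp only: power_mult_distrib mult.commute)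
    then show ?thesis by (simp add: T_def indicator_def algebra_simps)
  qed
  have i3: "integrable lborel (\<lambda>t. indicator {0..} t * (om t * p t) + norm w1 ^ n * (indicator {0..} t * (om t * (t / \<epsilon>) ^ n)))"
    by (intro Bochner_Integration.integrable_add ip integrable_mult_right exni)
  have i4: "integrable lborel (\<lambda>t. indicator {0..} t * (om t * (t / \<epsilon>) ^ 0) + (indicator {0..} t * (om t * p t) + norm w1 ^ n * (indicator {0..} t * (om t * (t / \<epsilon>) ^ n))))"
    by (intro Bochner_Integration.integrable_add[OF ex0i(1) i3])
  have Tint: "integrable lborel (\<lambda>t. indicator {0..} t * T t)" unfolding Teq
    by (intro Bochner_Integration.integrable_add[OF iex integrable_mult_right[OF i4]])
  have TI: "(\<integral>t. indicator {0..} t * T t \<partial>lborel) = (\<integral>t. indicator {0..} t * (om t * p t * ex t) \<partial>lborel) + (1 + \<delta> * MM b) * (l * K) * SS"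
  proof -
    have "(\<integral>t. indicator {0..} t * (om t * p t) + norm w1 ^ n * (indicator {0..} t * (om t * (t / \<epsilon>) ^ n)) \<partial>lborel) = IW + norm w1 ^ n * (\<epsilon> * fact n)"
      unfolding Bochner_Integration.integral_add[OF ip integrable_mult_right[OF exni(1)]] integral_mult_right_zero exni(2) IW_def ..
    then have "(\<integral>t. indicator {0..} t * (om t * (t / \<epsilon>) ^ 0) + (indicator {0..} t * (om t * p t) + norm w1 ^ n * (indicator {0..} t * (om t * (t / \<epsilon>) ^ n))) \<partial>lborel) = SS"
      unfolding Bochner_Integration.integral_add[OF ex0i(1) i3] ex0i(2) SS_def by simp
    then show ?thesis unfolding Teq
      unfolding Bochner_Integration.integral_add[OF iex integrable_mult_right[OF i4]] integral_mult_right_zero by (simp only:)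
  qed
  have T0: "0 \<le> T t" if "0 \<le> t" for t
    unfolding T_def using that ex0[of t] p0[of t] dM l K0 e by (intro add_nonneg_nonneg[of "om t * p t * ex t"] mult_nonneg_nonneg) simp_all
  have partB: "(\<integral>\<^sup>+s\<in>{0..}. ennreal (om s) * \<W> (pth (J w0) (J w1) Z s) \<partial>lborel) \<le> ennreal (\<integral>t. indicator {0..} t * T t \<partial>lborel)"
  proof -
    have [measurable]: "(\<lambda>s. \<W> (pth (J w0) (J w1) Z s)) \<in> borel_measurable borel"
      by (rule W_measurable_pth[OF locL2_locint[OF Zl]])
    have "(\<integral>\<^sup>+s\<in>{0..}. ennreal (om s) * \<W> (pth (J w0) (J w1) Z s) \<partial>lborel)
      = (\<integral>\<^sup>+t\<in>{0..}. ennreal (m t) * (ennreal (om (tc.psi t)) * \<W> (pth (J w0) (J w1) Z (tc.psi t))) \<partial>lborel)"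
      by (rule tc.nn_integral_psi) measurable
    also have "\<dots> \<le> ennreal (\<integral>t. indicator {0..} t * T t \<partial>lborel)"
    proof (rule nn_integral_le_integral[OF Tint])
      show "AE t in lborel. 0 \<le> t \<longrightarrow> ennreal (m t) * (ennreal (om (tc.psi t)) * \<W> (pth (J w0) (J w1) Z (tc.psi t))) \<le> ennreal (T t) \<and> 0 \<le> T t"
        using W_p
      proof eventually_elim
        case (elim t)
        show ?case
        proof (intro impI conjI)
          assume t: "0 \<le> t"
          show "0 \<le> T t" by (rule T0[OF t])
          have Wp: "\<W> (u t) = ennreal (p t)" using elim t by simp
          have pc: "\<bar>\<kappa> * tc.psi t\<bar> \<le> l * (t / \<epsilon>)"
          proof -
            have ps: "0 \<le> tc.psi t" using t by simp
            have "tc.psi t \<le> (1 + \<delta> * MM b) * t"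
              unfolding psi[OF t] using mult_left_mono[OF gen_bounds(2)[OF e b t], of \<delta>] d
              by (simp add: MM_def algebra_simps)
            then have "\<kappa> * tc.psi t \<le> \<delta> * ((1 + \<delta> * MM b) * t)" using ka ps d by (intro mult_mono) simp_all
            also have "\<dots> = l * (t / \<epsilon>)" using e by (simp add: l_def)
            finally show ?thesis using ka ps by simp
          qed
          let ?r = "(t / \<epsilon> * norm w1) ^ n"
          have r0: "0 \<le> ?r" using t e by simp
          have lK: "0 \<le> l * K" using l K0 by simp
          have "\<W> (pth (J w0) (J w1) Z (tc.psi t)) \<le> \<W> (u t) + ennreal (l * K) * (1 + \<W> (u t) + ennreal ?r)"
            unfolding pthZ[OF t] by (rule growth_le[OF l pc]) (use t e in simp)
          also have "\<dots> = ennreal (p t + (l * K) * (1 + p t + ?r))"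
          proof -
            have "ennreal ((l * K) * (1 + p t + ?r)) = ennreal (l * K) * (1 + ennreal (p t) + ennreal ?r)"
              using p0[of t] r0 by (simp add: ennreal_mult'[OF lK])
            moreover have "0 \<le> (l * K) * (1 + p t + ?r)" using lK p0[of t] r0 by simp
            ultimately show ?thesis using ennreal_plus[OF p0] by (simp only: Wp)
          qed
          finally have "ennreal (m t) * (ennreal (om (tc.psi t)) * \<W> (pth (J w0) (J w1) Z (tc.psi t)))
            \<le> ennreal (m t) * (ennreal (om (tc.psi t)) * ennreal (p t + (l * K) * (1 + p t + ?r)))"
            by (intro mult_left_mono) simp_all
          also have "\<dots> = ennreal (m t * (om (tc.psi t) * (p t + (l * K) * (1 + p t + ?r))))"
            using m_pos[of t] by (simp add: ennreal_mult')
          also have "\<dots> \<le> ennreal (T t)"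
          proof (rule ennreal_leI)
            have "om (tc.psi t) = om t * exp (- \<delta> * gen \<epsilon> b t / \<epsilon>)"
              by (simp add: psi[OF t] add_divide_distrib diff_divide_distrib exp_add[symmetric])
            then have "m t * (om (tc.psi t) * (p t + (l * K) * (1 + p t + ?r))) = om t * p t * ex t + ex t * ((l * K) * (om t * (1 + p t + ?r)))"
              by (simp add: ex_def algebra_simps)
            also have "\<dots> \<le> om t * p t * ex t + (1 + \<delta> * MM b) * ((l * K) * (om t * (1 + p t + ?r)))"
              by (intro add_left_mono mult_right_mono ex_le t) (use lK p0[of t] r0 in simp)
            finally show "m t * (om (tc.psi t) * (p t + (l * K) * (1 + p t + ?r))) \<le> T t" by (simp add: T_def mult.assoc)
          qed
          finally show "ennreal (m t) * (ennreal (om (tc.psi t)) * \<W> (pth (J w0) (J w1) Z (tc.psi t))) \<le> ennreal (T t)" .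
        qed
      qed
    qed
    finally show ?thesis .
  qed
  have TIl: "(1 + \<delta> * MM b) * (l * K) * SS = (1 + \<delta> * MM b)\<^sup>2 * \<delta> * \<epsilon> * K * SS"
    by (simp add: l_def power2_eq_square)
  have B0: "0 \<le> (\<integral>t. indicator {0..} t * T t \<partial>lborel)"
    by (intro integral_nonneg_AE AE_I2) (simp add: indicator_def T0)
  have "\<epsilon>\<^sup>2 / 2 * Iz + IW \<le> \<epsilon>\<^sup>2 / 2 * (Iz - (2 * \<delta> / \<epsilon>) * S1 b + \<delta>\<^sup>2 * QQ b) + (\<integral>t. indicator {0..} t * T t \<partial>lborel)"
    by (rule compare[OF Zl partA A0 partB B0])
  moreover have "\<epsilon>\<^sup>2 / 2 * (Iz - (2 * \<delta> / \<epsilon>) * S1 b + \<delta>\<^sup>2 * QQ b) = \<epsilon>\<^sup>2 / 2 * Iz - \<delta> * \<epsilon> * S1 b + \<delta>\<^sup>2 * (\<epsilon>\<^sup>2 / 2 * QQ b)"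
    using e by (simp add: field_simps power2_eq_square)
  ultimately show "IW \<le> (\<integral>t. indicator {0..} t * (om t * p t * (exp (- \<delta> * gen \<epsilon> b t / \<epsilon>) * (1 + \<delta> * gen' \<epsilon> b t))) \<partial>lborel)
       - \<delta> * \<epsilon> * S1 b + \<delta>\<^sup>2 * (\<epsilon>\<^sup>2 / 2 * QQ b) + (1 + \<delta> * MM b)\<^sup>2 * \<delta> * \<epsilon> * K * SS"
    using TIl unfolding TI unfolding ex_def m_def by linarith
  show "integrable lborel (\<lambda>t. indicator {0..} t * (om t * p t * (exp (- \<delta> * gen \<epsilon> b t / \<epsilon>) * (1 + \<delta> * gen' \<epsilon> b t))))"
    using iex by (simp add: ex_def m_def)
qed

end

text \<open>The derivative of \<open>exp (- \<delta> * a) * (1 + \<delta> * g)\<close> at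
  \<open>0\<close> is \<open>g - a\<close>. The summand \<open>g\<close> is added because the sum is
  nonnegative in the application, as Fatou's lemma demands.\<close>

lemma difference_quotient_exp:
  fixes a g :: real
  assumes d: "d \<longlonglongrightarrow> 0" "\<And>k. d k \<noteq> 0"
  shows "(\<lambda>k. (1 - exp (- d k * a) * (1 + d k * g)) / d k + g) \<longlonglongrightarrow> a"
proof -
  have "((\<lambda>x. exp (- x * a)) has_real_derivative - a) (at 0)"
    by (auto intro!: derivative_eq_intros)
  then have "(\<lambda>h. (exp (- (0 + h) * a) - exp (- 0 * a)) / h) \<midarrow>0\<rightarrow> - a" by (rule DERIV_D)
  moreover have "filterlim d (at 0) sequentially" using d by (simp add: filterlim_at)
  ultimately have "(\<lambda>k. (exp (- (0 + d k) * a) - exp (- 0 * a)) / d k) \<longlonglongrightarrow> - a"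
    by (rule filterlim_compose)
  moreover have "(\<lambda>k. exp (- d k * a) * g) \<longlonglongrightarrow> exp (- 0 * a) * g" by (intro tendsto_intros d)
  ultimately have "(\<lambda>k. - ((exp (- (0 + d k) * a) - exp (- 0 * a)) / d k) - exp (- d k * a) * g + g) \<longlonglongrightarrow> - (- a) - exp (- 0 * a) * g + g"
    by (intro tendsto_add[OF tendsto_diff[OF tendsto_minus] tendsto_const])
  moreover have "- ((exp (- (0 + d k) * a) - exp (- 0 * a)) / d k) - exp (- d k * a) * g + g
      = (1 - exp (- d k * a) * (1 + d k * g)) / d k + g" for k
    using d(2)[of k] by (simp add: field_simps)
  ultimately show ?thesis by simp
qed

lemma exp_power_integral_shift:
  assumes e: "0 < (\<epsilon>::real)"
  shows "integrable lborel (\<lambda>t. indicator {a..} t * (exp (- (t - a) / \<epsilon>) * ((t - a) / \<epsilon>) ^ k))"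
    and "(\<integral>t. indicator {a..} t * (exp (- (t - a) / \<epsilon>) * ((t - a) / \<epsilon>) ^ k) \<partial>lborel) = \<epsilon> * fact k"
proof -
  let ?f = "\<lambda>t. indicator {a..} t * (exp (- (t - a) / \<epsilon>) * ((t - a) / \<epsilon>) ^ k)"
  have eq: "?f (a + 1 * t) = indicator {0..} t * (exp (- t / \<epsilon>) * (t / \<epsilon>) ^ k)" for t
    by (simp add: indicator_def)
  show "integrable lborel ?f"
    using exp_power_integral(1)[OF e, of k] unfolding eq[symmetric]
    by (subst (asm) lborel_integrable_real_affine_iff) simp_all
  have "integral\<^sup>L lborel ?f = \<bar>1\<bar> *\<^sub>R (\<integral>t. ?f (a + 1 * t) \<partial>lborel)"
    by (rule lborel_integral_real_affine) simp
  then show "integral\<^sup>L lborel ?f = \<epsilon> * fact k" unfolding eq exp_power_integral(2)[OF e] by simp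
qed

text \<open>Chosen such that
  \<open>IW / \<epsilon> + K * SS \<le> W0 w0 + \<epsilon> * C1 w0 w1\<close>: the coefficient of
  the error of order \<open>\<epsilon>\<close> in the approximate energy inequality.\<close>

definition (in potential) C1 :: "'w \<Rightarrow> 'w \<Rightarrow> real" where
  "C1 w0 w1 = C0 w0 w1 + K * (1 + W0 w0 + C0 w0 w1 + norm w1 ^ n * fact n)"

text \<open>A bound for the approximate energy that is valid for all
  \<open>\<epsilon> < 1\<close>.\<close>

definition (in potential) EE :: "'w \<Rightarrow> 'w \<Rightarrow> real" where
  "EE w0 w1 = (norm (J w1))\<^sup>2 / 2 + W0 w0 + C1 w0 w1"

text \<open>The bound on the acceleration in the dual of \<open>W\<close>. The term
  \<open>EE\<close> comes from the kernel average of the potential, \<open>1\<close> and the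
  factorial from integrals of powers of \<open>(t - a) / \<epsilon>\<close>, and
  \<open>2 ^ n\<close> from splitting the power of \<open>1 + (t - a) / \<epsilon>\<close>.\<close>

definition (in potential) C2 :: "'w \<Rightarrow> 'w \<Rightarrow> real" where
  "C2 w0 w1 = K * (EE w0 w1 + 1 + 2 ^ n * (1 + fact (n + 1)))"

lemma (in potential) C1_nonneg: "0 \<le> C1 w0 w1"
  unfolding C1_def using K0 C0_nonneg[of w0 w1] W0_nonneg[of w0] by simp

lemma (in potential) EE_nonneg: "0 \<le> EE w0 w1"
  unfolding EE_def using C1_nonneg[of w0 w1] W0_nonneg[of w0] by simp

lemma (in potential) C2_nonneg: "0 \<le> C2 w0 w1"
  unfolding C2_def using K0 EE_nonneg[of w0 w1] by simp

section \<open>The energy bound at a fixed time and the bound on the acceleration\<close>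

context minimal_path
begin

text \<open>The gamma density of shape two and scale \<open>\<epsilon>\<close>, started at time
  \<open>b\<close>.\<close>

definition "kern b t = indicator {b..} t * ((t - b) / \<epsilon>\<^sup>2 * exp (- (t - b) / \<epsilon>))"

lemma kern_nonneg: "0 \<le> kern b t"
  by (simp add: kern_def indicator_def)

lemma kern_measurable [measurable]: "kern b \<in> borel_measurable borel"
  unfolding kern_def[abs_def] by measurable

text \<open>\<open>inner_variation\<close> is divided by \<open>\<delta>\<close>, and
  \<open>\<delta>\<close> tends to zero. The limit integrand contains the unbounded function
  \<open>gen\<close>, and its integrability is not known beforehand; Fatou's lemma yields it
  together with the inequality.\<close>

lemma energy_real:
  assumes b: "0 \<le> b"
  shows "integrable lborel (\<lambda>t. kern b t * p t)"
    and "(norm (v b))\<^sup>2 / 2 + (\<integral>t. kern b t * p t \<partial>lborel) \<le> (norm (J w1))\<^sup>2 / 2 + IW / \<epsilon> + K * SS"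
proof -
  let ?i = "\<lambda>t. indicator {0..} t :: real"
  \<comment> \<open>The bound \<open>d k \<le> 1 / (1 + MM b)\<close> ensures the side condition of
    \<open>inner_variation\<close>.\<close>
  define d where "d k = 1 / (1 + MM b) * (1 / real (Suc k))" for k
  have M: "1 \<le> MM b" using b e by (simp add: MM_def)
  have d0: "0 < d k" for k using M by (simp add: d_def)
  have d1: "d k * (1 + d k * MM b) \<le> 1" for k
  proof -
    have s: "1 / real (Suc k) \<le> 1" by (simp add: divide_le_eq)
    have "d k \<le> 1 / (1 + MM b) * 1" unfolding d_def using M by (intro mult_left_mono s) simp
    moreover have "1 / (1 + MM b) \<le> 1" using M by (simp add: divide_le_eq)
    ultimately have dd: "d k \<le> 1 / (1 + MM b)" "d k \<le> 1" by linarith+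
    have "d k * (1 + d k * MM b) \<le> 1 / (1 + MM b) * (1 + 1 * MM b)"
      using dd M d0[of k] by (intro mult_mono add_mono mult_right_mono) simp_all
    also have "\<dots> = 1" using M by simp
    finally show ?thesis .
  qed
  have dlim: "d \<longlonglongrightarrow> 0"
  proof -
    have "(\<lambda>k. 1 / (1 + MM b) * inverse (real (Suc k))) \<longlonglongrightarrow> 1 / (1 + MM b) * 0"
      by (intro tendsto_intros LIMSEQ_inverse_real_of_nat)
    then show ?thesis by (simp add: d_def[abs_def] inverse_eq_divide)
  qed
  define ex where "ex k t = exp (- d k * gen \<epsilon> b t / \<epsilon>) * (1 + d k * gen' \<epsilon> b t)" for k t
  note iv = inner_variation[OF b d0 d1, folded ex_def]
  have g1: "1 \<le> gen' \<epsilon> b t" "gen' \<epsilon> b t \<le> MM b" for t using gen'_bounds[OF e b] by (simp_all add: MM_def)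
  have lg: "locint (gen' \<epsilon> b)" by (rule locint_continuous[OF gen'_cont])
  have [measurable]: "gen' \<epsilon> b \<in> borel_measurable borel" by (rule borel_measurable_continuous_onI[OF gen'_cont])
  have [measurable]: "gen \<epsilon> b \<in> borel_measurable borel" unfolding gen_def[abs_def] using lg by measurable
  have ig: "integrable lborel (\<lambda>t. ?i t * (om t * p t * gen' \<epsilon> b t))"
  proof (rule Bochner_Integration.integrable_bound)
    show "integrable lborel (\<lambda>t. MM b * (?i t * (om t * p t)))" by (rule integrable_mult_right[OF ip])
    show "AE t in lborel. norm (?i t * (om t * p t * gen' \<epsilon> b t)) \<le> norm (MM b * (?i t * (om t * p t)))"
    proof (rule AE_I2)
      fix t
      have "om t * p t * gen' \<epsilon> b t \<le> om t * p t * MM b" by (rule mult_left_mono[OF g1(2)]) (simp add: p0)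
      then show "norm (?i t * (om t * p t * gen' \<epsilon> b t)) \<le> norm (MM b * (?i t * (om t * p t)))"
        using p0[of t] g1(1)[of t] M by (simp add: indicator_def abs_mult mult_ac)
    qed
  qed measurable
  define G where "G = (\<integral>t. ?i t * (om t * p t * gen' \<epsilon> b t) \<partial>lborel)"
  \<comment> \<open>The function \<open>gen'\<close> is bounded, so its weighted integral
    \<open>G\<close> is finite and may be added on both sides. Since
    \<open>exp (- d k * gen / \<epsilon>) \<le> 1\<close>, the integrands become
    nonnegative.\<close>
  define F where "F k t = ?i t * (om t * p t * ((1 - ex k t) / d k + gen' \<epsilon> b t))" for k t
  have Feq: "F k t = (1 / d k) * (?i t * (om t * p t)) - (1 / d k) * (?i t * (om t * p t * ex k t)) + ?i t * (om t * p t * gen' \<epsilon> b t)" for k t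
    using d0[of k] by (simp add: F_def field_simps)
  have Fi: "integrable lborel (F k)" for k
    unfolding Feq[abs_def] by (intro Bochner_Integration.integrable_add Bochner_Integration.integrable_diff integrable_mult_right ip ig iv(1))
  define Bk where "Bk k = G - \<epsilon> * S1 b + d k * (\<epsilon>\<^sup>2 / 2 * QQ b) + (1 + d k * MM b)\<^sup>2 * \<epsilon> * K * SS" for k
  have FI: "integral\<^sup>L lborel (F k) \<le> Bk k" for k
  proof -
    have "integral\<^sup>L lborel (F k) = (1 / d k) * IW - (1 / d k) * (\<integral>t. ?i t * (om t * p t * ex k t) \<partial>lborel) + G"
      unfolding Feq[abs_def] G_def IW_def
      by (simp only: Bochner_Integration.integral_add[OF Bochner_Integration.integrable_diff[OF integrable_mult_right[OF ip] integrable_mult_right[OF iv(1)]] ig]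
          Bochner_Integration.integral_diff[OF integrable_mult_right[OF ip] integrable_mult_right[OF iv(1)]] integral_mult_right_zero)
    also have "\<dots> = (1 / d k) * (IW - (\<integral>t. ?i t * (om t * p t * ex k t) \<partial>lborel)) + G" by (simp add: algebra_simps)
    also have "\<dots> \<le> (1 / d k) * (- d k * \<epsilon> * S1 b + (d k)\<^sup>2 * (\<epsilon>\<^sup>2 / 2 * QQ b) + (1 + d k * MM b)\<^sup>2 * d k * \<epsilon> * K * SS) + G"
      using iv(2)[of k] d0[of k] by (intro add_right_mono mult_left_mono) simp_all
    also have "\<dots> = Bk k" using d0[of k] by (simp add: Bk_def field_simps power2_eq_square)
    finally show ?thesis .
  qed
  have F0: "0 \<le> F k t" for k t
  proof (cases "0 \<le> t")
    case True
    have "exp (- d k * gen \<epsilon> b t / \<epsilon>) \<le> 1" using gen_bounds(1)[OF e b True] d0[of k] e by simp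
    then have "ex k t \<le> 1 * (1 + d k * gen' \<epsilon> b t)" unfolding ex_def
      using d0[of k] g1[of t] by (intro mult_right_mono) simp_all
    then have "0 \<le> (1 - ex k t + d k * gen' \<epsilon> b t) / d k" using d0[of k] by simp
    also have "\<dots> = (1 - ex k t) / d k + gen' \<epsilon> b t" using d0[of k] by (simp add: add_divide_distrib)
    finally show ?thesis using p0[of t] by (simp add: F_def)
  qed (simp add: F_def)
  have Flim: "(\<lambda>k. F k t) \<longlonglongrightarrow> ?i t * (om t * p t * (gen \<epsilon> b t / \<epsilon>))" for t
  proof -
    have "(\<lambda>k. (1 - exp (- d k * (gen \<epsilon> b t / \<epsilon>)) * (1 + d k * gen' \<epsilon> b t)) / d k + gen' \<epsilon> b t) \<longlonglongrightarrow> gen \<epsilon> b t / \<epsilon>"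
      by (rule difference_quotient_exp[OF dlim]) (use d0 in \<open>simp add: less_imp_neq[symmetric]\<close>)
    then have "(\<lambda>k. (1 - ex k t) / d k + gen' \<epsilon> b t) \<longlonglongrightarrow> gen \<epsilon> b t / \<epsilon>" by (simp add: ex_def)
    then show ?thesis unfolding F_def by (intro tendsto_intros)
  qed
  define B where "B = G - \<epsilon> * S1 b + \<epsilon> * K * SS"
  have Blim: "Bk \<longlonglongrightarrow> B"
  proof -
    have "(\<lambda>k. G - \<epsilon> * S1 b + d k * (\<epsilon>\<^sup>2 / 2 * QQ b) + (1 + d k * MM b)\<^sup>2 * \<epsilon> * K * SS)
       \<longlonglongrightarrow> G - \<epsilon> * S1 b + 0 * (\<epsilon>\<^sup>2 / 2 * QQ b) + (1 + 0 * MM b)\<^sup>2 * \<epsilon> * K * SS"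
      by (intro tendsto_intros dlim)
    then show ?thesis by (simp add: Bk_def[abs_def] B_def)
  qed
  have Bk0: "0 \<le> Bk k" for k
    by (rule order_trans[OF _ FI]) (intro integral_nonneg_AE AE_I2 F0)
  have B0: "0 \<le> B" by (rule LIMSEQ_le_const[OF Blim]) (use Bk0 in blast)
  let ?g = "\<lambda>t. ?i t * (om t * p t * (gen \<epsilon> b t / \<epsilon>))"
  have g0: "0 \<le> ?g t" for t
    using gen_bounds(1)[OF e b, of t] p0[of t] e by (simp add: indicator_def)
  have fat: "(\<integral>\<^sup>+t. ennreal (?g t) \<partial>lborel) \<le> ennreal B"
  proof -
    have "(\<integral>\<^sup>+t. ennreal (?g t) \<partial>lborel) = (\<integral>\<^sup>+t. liminf (\<lambda>k. ennreal (F k t)) \<partial>lborel)"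
      by (intro nn_integral_cong lim_imp_Liminf[symmetric] tendsto_ennrealI Flim) simp
    also have "\<dots> \<le> liminf (\<lambda>k. \<integral>\<^sup>+t. ennreal (F k t) \<partial>lborel)"
      by (rule nn_integral_liminf) (use Fi in measurable)
    also have "\<dots> \<le> liminf (\<lambda>k. ennreal (Bk k))"
    proof (intro Liminf_mono always_eventually allI)
      fix k
      have "(\<integral>\<^sup>+t. ennreal (F k t) \<partial>lborel) = ennreal (integral\<^sup>L lborel (F k))"
        by (rule nn_integral_eq_integral[OF Fi AE_I2[OF F0]])
      then show "(\<integral>\<^sup>+t. ennreal (F k t) \<partial>lborel) \<le> ennreal (Bk k)" using FI[of k] by (simp add: ennreal_leI)
    qed
    also have "\<dots> = ennreal B" by (intro lim_imp_Liminf tendsto_ennrealI Blim) simp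
    finally show ?thesis .
  qed
  have gi: "integrable lborel ?g"
    by (rule integrableI_nonneg) (measurable, use g0 fat in \<open>simp_all add: le_less_trans[OF _ ennreal_less_top]\<close>)
  have gI: "integral\<^sup>L lborel ?g \<le> B"
    using fat B0 unfolding nn_integral_eq_integral[OF gi AE_I2[OF g0]] by (simp only: ennreal_le_iff)
  \<comment> \<open>By \<open>gen_eq\<close> the integrands of the limit, of \<open>IW\<close> and
    of \<open>G\<close> combine to the kernel; the factor \<open>exp (b / \<epsilon>)\<close> shifts
    the origin of the weight to \<open>b\<close>.\<close>
  have keq: "kern b t * p t = (1 / \<epsilon>) * (?g t + ?i t * (om t * p t) - ?i t * (om t * p t * gen' \<epsilon> b t))" for t
  proof (cases "0 \<le> t")
    case False
    then show ?thesis using b by (simp add: kern_def)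
  next
    case True
    have "?g t + ?i t * (om t * p t) - ?i t * (om t * p t * gen' \<epsilon> b t) = om t * p t * (gen \<epsilon> b t / \<epsilon> + 1 - gen' \<epsilon> b t)"
      using True by (simp add: algebra_simps)
    also have "gen \<epsilon> b t / \<epsilon> + 1 - gen' \<epsilon> b t = exp (b / \<epsilon>) * max 0 (t - b) / \<epsilon>"
      using gen_eq[OF e b True] by simp
    also have "om t * p t * (exp (b / \<epsilon>) * max 0 (t - b) / \<epsilon>) = (om t * exp (b / \<epsilon>)) * (max 0 (t - b) / \<epsilon>) * p t" by simp
    also have "om t * exp (b / \<epsilon>) = exp (- (t - b) / \<epsilon>)" by (simp add: exp_add[symmetric] diff_divide_distrib)
    finally have *: "?g t + ?i t * (om t * p t) - ?i t * (om t * p t * gen' \<epsilon> b t) = exp (- (t - b) / \<epsilon>) * (max 0 (t - b) / \<epsilon>) * p t" .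
    show ?thesis unfolding * by (cases "b \<le> t") (simp_all add: kern_def power2_eq_square)
  qed
  show "integrable lborel (\<lambda>t. kern b t * p t)" unfolding keq
    by (intro integrable_mult_right Bochner_Integration.integrable_diff Bochner_Integration.integrable_add gi ip ig)
  have "(\<integral>t. kern b t * p t \<partial>lborel) = (1 / \<epsilon>) * (integral\<^sup>L lborel ?g + IW - G)"
    unfolding keq IW_def G_def
    by (simp only: integral_mult_right_zero Bochner_Integration.integral_diff[OF Bochner_Integration.integrable_add[OF gi ip] ig] Bochner_Integration.integral_add[OF gi ip])
  also have "\<dots> \<le> (1 / \<epsilon>) * (B + IW - G)" using gI e by (intro mult_left_mono) simp_all
  also have "\<dots> = IW / \<epsilon> - S1 b + K * SS" using e by (simp add: B_def field_simps)
  finally show "(norm (v b))\<^sup>2 / 2 + (\<integral>t. kern b t * p t \<partial>lborel) \<le> (norm (J w1))\<^sup>2 / 2 + IW / \<epsilon> + K * SS"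
    using norm_vel_sq(2)[OF zi b, where u = "J w1"] by (simp add: S1_def add_divide_distrib)
qed

lemma energy_bound: "IW / \<epsilon> + K * SS \<le> W0 w0 + \<epsilon> * C1 w0 w1"
proof -
  have 1: "IW / \<epsilon> \<le> W0 w0 + \<epsilon> * C0 w0 w1" using IW_le e by (simp add: divide_le_eq mult.commute)
  have "\<epsilon> * C0 w0 w1 \<le> 1 * C0 w0 w1" using e1 C0_nonneg by (intro mult_right_mono) simp_all
  then have "IW \<le> \<epsilon> * (W0 w0 + C0 w0 w1)" using IW_le e by (smt (verit) mult_left_mono)
  then have "SS \<le> \<epsilon> * (1 + W0 w0 + C0 w0 w1 + norm w1 ^ n * fact n)" by (simp add: SS_def algebra_simps)
  then have "K * SS \<le> K * (\<epsilon> * (1 + W0 w0 + C0 w0 w1 + norm w1 ^ n * fact n))" by (rule mult_left_mono[OF _ K0])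
  with 1 show ?thesis by (simp add: C1_def algebra_simps)
qed

lemma energy_real':
  assumes b: "0 \<le> b"
  shows "(norm (v b))\<^sup>2 / 2 + (\<integral>t. kern b t * p t \<partial>lborel) \<le> (norm (J w1))\<^sup>2 / 2 + W0 w0 + \<epsilon> * C1 w0 w1"
    and "(norm (v b))\<^sup>2 / 2 + (\<integral>t. kern b t * p t \<partial>lborel) \<le> EE w0 w1"
proof -
  show 1: "(norm (v b))\<^sup>2 / 2 + (\<integral>t. kern b t * p t \<partial>lborel) \<le> (norm (J w1))\<^sup>2 / 2 + W0 w0 + \<epsilon> * C1 w0 w1"
    using energy_real(2)[OF b] energy_bound by linarith
  have "\<epsilon> * C1 w0 w1 \<le> 1 * C1 w0 w1" using e1 C1_nonneg by (intro mult_right_mono) simp_all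
  with 1 show "(norm (v b))\<^sup>2 / 2 + (\<integral>t. kern b t * p t \<partial>lborel) \<le> EE w0 w1" by (simp add: EE_def)
qed

lemma kern_int0: "0 \<le> (\<integral>t. kern b t * p t \<partial>lborel)"
  by (intro integral_nonneg_AE AE_I2) (simp add: kern_nonneg p0)

lemma vel_bound: "0 \<le> b \<Longrightarrow> (norm (v b))\<^sup>2 \<le> 2 * EE w0 w1"
  using energy_real'(2)[of b] kern_int0[of b] by simp

lemma kern_bound: "0 \<le> b \<Longrightarrow> (\<integral>t. kern b t * p t \<partial>lborel) \<le> EE w0 w1"
  using energy_real'(2)[of b] zero_le_power2[of "norm (v b)"] by linarith

lemma energy_nn:
  assumes b: "0 \<le> b"
  shows "ennreal ((norm (v b))\<^sup>2 / 2) + (\<integral>\<^sup>+t. ennreal (kern b t) * \<W> (u t) \<partial>lborel)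
     \<le> ennreal ((norm (J w1))\<^sup>2 / 2 + W0 w0 + \<epsilon> * C1 w0 w1)"
proof -
  have "(\<integral>\<^sup>+t. ennreal (kern b t) * \<W> (u t) \<partial>lborel) = (\<integral>\<^sup>+t. ennreal (kern b t * p t) \<partial>lborel)"
  proof (rule nn_integral_cong_AE)
    show "AE t in lborel. ennreal (kern b t) * \<W> (u t) = ennreal (kern b t * p t)"
      using W_p
    proof eventually_elim
      case (elim t)
      show ?case
      proof (cases "0 \<le> t")
        case False
        then have "kern b t = 0" using b by (simp add: kern_def)
        then show ?thesis by simp
      qed (use elim in \<open>simp add: ennreal_mult'[OF kern_nonneg]\<close>)
    qed
  qed
  also have "\<dots> = ennreal (\<integral>t. kern b t * p t \<partial>lborel)"
    by (rule nn_integral_eq_integral[OF energy_real(1)[OF b]]) (simp add: kern_nonneg p0)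
  finally have "ennreal ((norm (v b))\<^sup>2 / 2) + (\<integral>\<^sup>+t. ennreal (kern b t) * \<W> (u t) \<partial>lborel)
     = ennreal ((norm (v b))\<^sup>2 / 2 + (\<integral>t. kern b t * p t \<partial>lborel))"
    using kern_int0[of b] by simp
  then show ?thesis using energy_real'(1)[OF b] by (simp only: ennreal_leI)
qed

text \<open>Subtracting \<open>d * indicator A t\<close> times \<open>J h\<close> from the
  acceleration shifts the path by \<open>- d * et t\<close> times \<open>J h\<close>, with
  \<open>et\<close> the second primitive of the indicator. To first order in \<open>d\<close> the
  quadratic term decreases by \<open>\<epsilon>\<^sup>2 * d * I1\<close>, while the potential term
  increases by at most \<open>\<epsilon>\<^sup>2 * d * \<mu> * om a * C2\<close>. The powers of
  \<open>\<epsilon>\<close> cancel, which makes the bound uniform, and the factor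
  \<open>\<mu>\<close> allows localization to small sets.\<close>

lemma accel_set:
  assumes a: "0 \<le> a" and A: "A \<in> sets borel" "A \<subseteq> {a..a + 1}" and h: "norm h \<le> 1"
  shows "integrable lborel (\<lambda>t. indicator A t * (om t * inner (z t) (J h)))"
    and "(\<integral>t. indicator A t * (om t * inner (z t) (J h)) \<partial>lborel) \<le> measure lborel A * (om a * C2 w0 w1)"
proof -
  note [measurable] = A(1)
  define \<mu> where "\<mu> = measure lborel A"
  have "emeasure lborel A \<le> 1" using emeasure_mono[OF A(2), of lborel] by simp
  then have fA: "emeasure lborel A < \<infinity>" by (rule le_less_trans) simp
  have iA: "integrable lborel (indicator A :: real \<Rightarrow> real)" using fA by (intro integrable_real_indicator) auto
  have muI: "\<mu> = integral\<^sup>L lborel (indicator A)" by (simp add: \<mu>_def)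
  have mu: "0 \<le> \<mu>" "\<mu> \<le> 1"
  proof -
    show "0 \<le> \<mu>" by (simp add: \<mu>_def)
    have "measure lborel A \<le> measure lborel {a..a + 1}" by (rule measure_mono_fmeasurable[OF A(2)]) (auto simp: fmeasurable_def)
    then show "\<mu> \<le> 1" by (simp add: \<mu>_def)
  qed
  have As: "indicator A t = (0::real)" if "t < a" for t using A(2) that by (auto simp: indicator_def)
  have A0: "0 \<le> t" if "t \<in> A" for t using A(2) a that by auto
  have zh: "locint (\<lambda>t. inner (z t) (J h))" by (rule locint_inner[OF zi])
  have i1: "integrable lborel (\<lambda>t. indicator A t * (om t * inner (z t) (J h)))"
  proof (rule Bochner_Integration.integrable_bound[OF locint_integrable[OF zh, of "a + 1"]])
    show "AE t in lborel. norm (indicator A t * (om t * inner (z t) (J h))) \<le> norm (indicator {0..a + 1} t *\<^sub>R inner (z t) (J h))"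
    proof (rule AE_I2)
      fix t
      show "norm (indicator A t * (om t * inner (z t) (J h))) \<le> norm (indicator {0..a + 1} t *\<^sub>R inner (z t) (J h))"
      proof (cases "t \<in> A")
        case True
        then have "t \<in> {0..a + 1}" "om t \<le> 1" using A(2) a e by auto
        then show ?thesis using True mult_left_le_one_le[of "\<bar>inner (z t) (J h)\<bar>" "om t"] by (simp add: abs_mult)
      qed simp
    qed
  qed measurable
  then show "integrable lborel (\<lambda>t. indicator A t * (om t * inner (z t) (J h)))" .
  have i2: "integrable lborel (\<lambda>t. indicator A t * (om t * (norm (J h))\<^sup>2))"
  proof (rule Bochner_Integration.integrable_bound[OF integrable_mult_left[of "(norm (J h))\<^sup>2", OF iA]])
    show "AE t in lborel. norm (indicator A t * (om t * (norm (J h))\<^sup>2)) \<le> norm (indicator A t * (norm (J h))\<^sup>2)"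
    proof (rule AE_I2)
      fix t
      show "norm (indicator A t * (om t * (norm (J h))\<^sup>2)) \<le> norm (indicator A t * (norm (J h))\<^sup>2)"
      proof (cases "t \<in> A")
        case True
        then have "om t \<le> 1" using A0 e by simp
        then show ?thesis using True mult_left_le_one_le[of "(norm (J h))\<^sup>2" "om t"] by (simp add: abs_mult)
      qed simp
    qed
  qed measurable
  define I1 where "I1 = (\<integral>t. indicator A t * (om t * inner (z t) (J h)) \<partial>lborel)"
  define I2 where "I2 = (\<integral>t. indicator A t * (om t * (norm (J h))\<^sup>2) \<partial>lborel)"
  have lA: "locint (indicator A :: real \<Rightarrow> real)"
    unfolding locint_def set_integrable_def by (intro allI integrable_mult_indicator iA) simp
  have pA: "0 \<le> prim (indicat_real A) s" "prim (indicat_real A) s \<le> \<mu> * indicator {a..} s" for s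
  proof -
    show "0 \<le> prim (indicat_real A) s" unfolding prim_def set_lebesgue_integral_def
      by (intro integral_nonneg_AE AE_I2) (simp add: indicator_def)
    show "prim (indicat_real A) s \<le> \<mu> * indicator {a..} s"
    proof (cases "a \<le> s")
      case True
      have "prim (indicat_real A) s \<le> \<mu>" unfolding prim_def set_lebesgue_integral_def muI
        by (rule integral_mono[OF locint_integrable[OF lA] iA]) (simp add: indicator_def)
      then show ?thesis using True by simp
    next
      case False
      have "prim (indicat_real A) s = prim (\<lambda>r. 0 :: real) s" by (rule prim_cong) (use False As in simp)
      then show ?thesis using False by simp
    qed
  qed
  have lpA: "locint (prim (indicator A :: real \<Rightarrow> real))" by (rule locint_continuous[OF continuous_prim[OF lA]])
  define et where "et t = prim (prim (indicator A :: real \<Rightarrow> real)) t" for t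
  have et: "0 \<le> et t" "et t \<le> \<mu> * max 0 (t - a)" for t
  proof -
    show "0 \<le> et t" unfolding et_def prim_def[of "prim (indicat_real A)"] set_lebesgue_integral_def
      by (intro integral_nonneg_AE AE_I2) (use pA(1) in \<open>simp add: indicator_def\<close>)
    have eq: "indicator {0..t} s * (\<mu> * indicator {a..} s) = indicator {a..t} s * \<mu>" for s
      using a by (auto simp: indicator_def)
    have "et t \<le> (\<integral>s. indicator {0..t} s * (\<mu> * indicator {a..} s) \<partial>lborel)"
      unfolding et_def prim_def[of "prim (indicat_real A)"] set_lebesgue_integral_def
    proof (rule integral_mono)
      show "integrable lborel (\<lambda>s. indicat_real {0..t} s *\<^sub>R prim (indicat_real A) s)" by (rule locint_integrable[OF lpA])
      show "integrable lborel (\<lambda>s. indicat_real {0..t} s * (\<mu> * indicator {a..} s))" unfolding eq by (rule integrable_indicator_const)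
      show "indicat_real {0..t} s *\<^sub>R prim (indicat_real A) s \<le> indicat_real {0..t} s * (\<mu> * indicator {a..} s)" for s
        using pA(2)[of s] by (simp add: indicator_def)
    qed
    also have "\<dots> = \<mu> * max 0 (t - a)" unfolding eq by (cases "a \<le> t") (simp_all add: mult.commute)
    finally show "et t \<le> \<mu> * max 0 (t - a)" .
  qed
  define r where "r t = max 0 (t - a) / \<epsilon>" for t
  have r0: "0 \<le> r t" for t using e by (simp add: r_def)
  have step: "I1 \<le> d / 2 * I2 + \<mu> * (om a * C2 w0 w1)" if d: "0 < d" "d \<le> 1" for d
  proof -
    define z' where "z' t = z t - (d * indicator A t) *\<^sub>R J h" for t
    have z'm [measurable]: "z' \<in> borel_measurable borel" unfolding z'_def[abs_def] by measurable
    have lAh: "locint (\<lambda>t. (d * indicator A t) *\<^sub>R J h)"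
      by (intro locint_bounded_linear[OF bounded_linear_scaleR_left] locint_bounded_linear[OF bounded_linear_mult_right] lA)
    have z'sq: "(norm (z' t))\<^sup>2 = (norm (z t))\<^sup>2 - 2 * d * (indicator A t * inner (z t) (J h)) + d\<^sup>2 * (indicator A t * (norm (J h))\<^sup>2)" for t
      unfolding z'_def power2_norm_eq_inner
      by (simp add: inner_diff_left inner_diff_right inner_commute indicator_def power2_eq_square algebra_simps)
    have lz': "locL2 z'"
    proof (rule locL2I[OF z'm], rule locint_bound)
      show "locint (\<lambda>t. 2 * (norm (z t))\<^sup>2 + 2 * (norm (J h))\<^sup>2)"
        by (intro locint_add locint_bounded_linear[OF bounded_linear_mult_right] locL2_sq[OF z] locint_continuous continuous_on_const)
      show "(\<lambda>t. (norm (z' t))\<^sup>2) \<in> borel_measurable borel" by measurable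
      fix t
      have "(norm (z' t))\<^sup>2 \<le> 2 * (norm (z t))\<^sup>2 + 2 * (norm (- ((d * indicator A t) *\<^sub>R J h)))\<^sup>2"
        using norm_add_sq_le[of "z t" "- ((d * indicator A t) *\<^sub>R J h)"] by (simp add: z'_def)
      also have "(norm (- ((d * indicator A t) *\<^sub>R J h)))\<^sup>2 \<le> (norm (J h))\<^sup>2"
        using d mult_left_le_one_le[of "norm (J h)" d] by (auto simp: indicator_def intro!: power_mono)
      finally show "norm ((norm (z' t))\<^sup>2) \<le> norm (2 * (norm (z t))\<^sup>2 + 2 * (norm (J h))\<^sup>2)" by simp
    qed
    have vz': "vel (J w1) z' s = v s - (d * prim (indicat_real A) s) *\<^sub>R J h" for s
    proof -
      have "prim z' s = prim z s - prim (\<lambda>t. (d * indicator A t) *\<^sub>R J h) s"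
        unfolding z'_def[abs_def] by (rule prim_diff[OF zi lAh])
      also have "prim (\<lambda>t. (d * indicator A t) *\<^sub>R J h) s = prim (\<lambda>t. d * indicator A t) s *\<^sub>R J h"
        by (intro prim_bounded_linear[OF bounded_linear_scaleR_left] locint_bounded_linear[OF bounded_linear_mult_right] lA)
      also have "prim (\<lambda>t. d * indicator A t) s = d * prim (indicat_real A) s"
        by (rule prim_bounded_linear[OF bounded_linear_mult_right lA])
      finally show ?thesis by (simp add: vel_def)
    qed
    have pz': "pth (J w0) (J w1) z' t = u t + (- (d * et t)) *\<^sub>R J h" for t
    proof -
      have l: "locint (\<lambda>s. (d * prim (indicat_real A) s) *\<^sub>R J h)"
        by (intro locint_bounded_linear[OF bounded_linear_scaleR_left] locint_bounded_linear[OF bounded_linear_mult_right] lpA)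
      have "prim (vel (J w1) z') t = prim v t - prim (\<lambda>s. (d * prim (indicat_real A) s) *\<^sub>R J h) t"
        unfolding vz'[abs_def] by (rule prim_diff[OF locint_vel[OF zi] l])
      also have "prim (\<lambda>s. (d * prim (indicat_real A) s) *\<^sub>R J h) t = prim (\<lambda>s. d * prim (indicat_real A) s) t *\<^sub>R J h"
        by (intro prim_bounded_linear[OF bounded_linear_scaleR_left] locint_bounded_linear[OF bounded_linear_mult_right] lpA)
      also have "prim (\<lambda>s. d * prim (indicat_real A) s) t = d * et t"
        unfolding et_def by (rule prim_bounded_linear[OF bounded_linear_mult_right lpA])
      finally show ?thesis by (simp add: pth_def)
    qed
    have Req: "indicator {0..} t * (om t * (norm (z' t))\<^sup>2) = indicator {0..} t * (om t * (norm (z t))\<^sup>2)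
        + ((- 2 * d) * (indicator A t * (om t * inner (z t) (J h))) + d\<^sup>2 * (indicator A t * (om t * (norm (J h))\<^sup>2)))" for t
      unfolding z'sq using A0[of t] by (auto simp: indicator_def algebra_simps)
    have i12: "integrable lborel (\<lambda>t. (- 2 * d) * (indicator A t * (om t * inner (z t) (J h))) + d\<^sup>2 * (indicator A t * (om t * (norm (J h))\<^sup>2)))"
      by (intro Bochner_Integration.integrable_add integrable_mult_right i1 i2)
    have Ri: "integrable lborel (\<lambda>t. indicator {0..} t * (om t * (norm (z' t))\<^sup>2))"
      unfolding Req by (rule Bochner_Integration.integrable_add[OF integrable_damp i12])
    have RI: "(\<integral>t. indicator {0..} t * (om t * (norm (z' t))\<^sup>2) \<partial>lborel) = Iz - 2 * d * I1 + d\<^sup>2 * I2"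
      unfolding Req Bochner_Integration.integral_add[OF integrable_damp i12] integral_damp
        Bochner_Integration.integral_add[OF integrable_mult_right[OF i1] integrable_mult_right[OF i2]] integral_mult_right_zero I1_def I2_def
      by simp
    have pA: "(\<integral>\<^sup>+t\<in>{0..}. ennreal (om t * (norm (z' t))\<^sup>2) \<partial>lborel) \<le> ennreal (Iz - 2 * d * I1 + d\<^sup>2 * I2)"
      unfolding RI[symmetric] by (rule nn_integral_le_integral[OF Ri]) simp
    have A0': "0 \<le> Iz - 2 * d * I1 + d\<^sup>2 * I2" unfolding RI[symmetric] by (intro integral_nonneg_AE AE_I2) simp
    define c where "c = d * \<mu> * \<epsilon>"
    have c: "0 \<le> c" "c \<le> 1"
    proof -
      show "0 \<le> c" using d mu e by (simp add: c_def)
      have "d * \<mu> * \<epsilon> \<le> 1 * 1 * 1" using d mu e e1 by (intro mult_mono) simp_all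
      then show "c \<le> 1" by (simp add: c_def)
    qed
    let ?e = "\<lambda>k t. indicator {a..} t * (exp (- (t - a) / \<epsilon>) * ((t - a) / \<epsilon>) ^ k)"
    define T where "T t = om t * p t + c * K * om a * (\<epsilon> * (kern a t * p t) + (?e 1 t + 2 ^ n * (?e 1 t + ?e (n + 1) t)))" for t
    have e0: "0 \<le> ?e k t" for k t using e by (simp add: indicator_def)
    have T0: "0 \<le> T t" for t
    proof -
      have h: "0 \<le> om t * p t" "0 \<le> c * K * om a" "0 \<le> \<epsilon> * (kern a t * p t)"
        using c K0 e p0[of t] kern_nonneg[of a t] by simp_all
      have h': "0 \<le> 2 ^ n * (?e 1 t + ?e (n + 1) t)" by (rule mult_nonneg_nonneg[OF _ add_nonneg_nonneg[OF e0 e0]]) simp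
      show ?thesis unfolding T_def
        by (rule add_nonneg_nonneg[OF h(1) mult_nonneg_nonneg[OF h(2) add_nonneg_nonneg[OF h(3) add_nonneg_nonneg[OF e0 h']]]])
    qed
    have Teq: "indicator {0..} t * T t = indicator {0..} t * (om t * p t) + c * K * om a * (\<epsilon> * (kern a t * p t) + (?e 1 t + 2 ^ n * (?e 1 t + ?e (n + 1) t)))" for t
      using a by (auto simp: T_def indicator_def kern_def)
    note j1 = exp_power_integral_shift[OF e, of a 1] and jn = exp_power_integral_shift[OF e, of a "n + 1"]
    note j2 = Bochner_Integration.integrable_add[OF j1(1) jn(1)]
    note j3 = Bochner_Integration.integrable_add[OF j1(1) integrable_mult_right[OF j2, of "2 ^ n"]]
    note j4 = Bochner_Integration.integrable_add[OF integrable_mult_right[OF energy_real(1)[OF a], of \<epsilon>] j3]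
    have Ti: "integrable lborel (\<lambda>t. indicator {0..} t * T t)"
      unfolding Teq by (rule Bochner_Integration.integrable_add[OF ip integrable_mult_right[OF j4]])
    have TI: "(\<integral>t. indicator {0..} t * T t \<partial>lborel) \<le> IW + c * \<epsilon> * om a * C2 w0 w1"
    proof -
      have "(\<integral>t. indicator {0..} t * T t \<partial>lborel) = IW + c * K * om a * (\<epsilon> * (\<integral>t. kern a t * p t \<partial>lborel) + (\<epsilon> * fact 1 + 2 ^ n * (\<epsilon> * fact 1 + \<epsilon> * fact (n + 1))))"
        unfolding Teq Bochner_Integration.integral_add[OF ip integrable_mult_right[OF j4]] integral_mult_right_zero
          Bochner_Integration.integral_add[OF integrable_mult_right[OF energy_real(1)[OF a], of \<epsilon>] j3]
          Bochner_Integration.integral_add[OF j1(1) integrable_mult_right[OF j2, of "2 ^ n"]]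
          Bochner_Integration.integral_add[OF j1(1) jn(1)] j1(2) jn(2) IW_def ..
      also have "\<dots> \<le> IW + c * K * om a * (\<epsilon> * EE w0 w1 + (\<epsilon> * fact 1 + 2 ^ n * (\<epsilon> * fact 1 + \<epsilon> * fact (n + 1))))"
        using c K0 e by (intro add_left_mono mult_left_mono add_right_mono kern_bound a) simp_all
      also have "\<dots> = IW + c * \<epsilon> * om a * C2 w0 w1" by (simp add: C2_def algebra_simps)
      finally show ?thesis .
    qed
    have pB: "(\<integral>\<^sup>+t\<in>{0..}. ennreal (om t) * \<W> (pth (J w0) (J w1) z' t) \<partial>lborel) \<le> ennreal (\<integral>t. indicator {0..} t * T t \<partial>lborel)"
    proof (rule nn_integral_le_integral[OF Ti])
      show "AE t in lborel. 0 \<le> t \<longrightarrow> ennreal (om t) * \<W> (pth (J w0) (J w1) z' t) \<le> ennreal (T t) \<and> 0 \<le> T t"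
        using W_p
      proof eventually_elim
        case (elim t)
        show ?case
        proof (intro impI conjI T0)
          assume t: "0 \<le> t"
          have Wp: "\<W> (u t) = ennreal (p t)" using elim t by simp
          \<comment> \<open>The shift is at most \<open>c * r t\<close>, but \<open>growth\<close>
            requires a factor of at most one and \<open>r t\<close> is unbounded. The factor
            \<open>c * min 1 (r t)\<close> is admissible, and
            \<open>r t \<le> min 1 (r t) * (1 + r t)\<close> moves the excess into the direction,
            where it costs only a polynomial. Since also \<open>l \<le> c * r t\<close>, the error
            vanishes linearly at \<open>a\<close>, and the kernel appears in front of
            \<open>p\<close>.\<close>
          define l where "l = c * min 1 (r t)"
          have l: "0 \<le> l" "l \<le> 1"
          proof -
            show "0 \<le> l" using c r0[of t] by (simp add: l_def)
            have "c * min 1 (r t) \<le> 1 * 1" using c r0[of t] by (intro mult_mono) simp_all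
            then show "l \<le> 1" by (simp add: l_def)
          qed
          have lr: "l \<le> c * r t" unfolding l_def using c by (intro mult_left_mono) simp_all
          have "\<bar>- (d * et t)\<bar> \<le> l * (1 + r t)"
          proof -
            have "d * et t \<le> d * (\<mu> * max 0 (t - a))" using d et(2)[of t] by (intro mult_left_mono) simp_all
            also have "\<dots> = c * r t" using e by (simp add: c_def r_def)
            also have "\<dots> \<le> c * (min 1 (r t) * (1 + r t))"
            proof (rule mult_left_mono[OF _ c(1)])
              show "r t \<le> min 1 (r t) * (1 + r t)" using r0[of t] by (cases "r t \<le> 1") (simp_all add: algebra_simps)
            qed
            finally show ?thesis using d et(1)[of t] by (simp add: l_def mult.assoc)
          qed
          then have "\<W> (pth (J w0) (J w1) z' t) \<le> \<W> (u t) + ennreal (l * K) * (1 + \<W> (u t) + ennreal (((1 + r t) * norm h) ^ n))"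
            unfolding pz' by (rule growth_le[OF l]) (use r0[of t] in simp)
          also have "\<dots> \<le> \<W> (u t) + ennreal (c * r t * K) * (1 + \<W> (u t) + ennreal (2 ^ n * (1 + r t ^ n)))"
          proof -
            have 1: "l * K \<le> c * r t * K" by (rule mult_right_mono[OF lr K0])
            have "((1 + r t) * norm h) ^ n \<le> (1 + r t) ^ n"
              using h r0[of t] by (intro power_mono mult_right_le_one_le) simp_all
            also have "\<dots> \<le> 2 ^ n * (1 ^ n + r t ^ n)" by (rule power_add_bound) (use r0[of t] in simp_all)
            finally have 2: "((1 + r t) * norm h) ^ n \<le> 2 ^ n * (1 + r t ^ n)" by simp
            show ?thesis
              by (rule add_left_mono[OF mult_mono[OF ennreal_leI[OF 1] add_left_mono[OF ennreal_leI[OF 2]]]]) simp_all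
          qed
          also have "\<dots> = ennreal (p t + (c * r t * K) * (1 + p t + 2 ^ n * (1 + r t ^ n)))"
          proof -
            have nn: "0 \<le> c * r t * K" "0 \<le> 2 ^ n * (1 + r t ^ n)" using c r0[of t] K0 by simp_all
            have "ennreal ((c * r t * K) * (1 + p t + 2 ^ n * (1 + r t ^ n))) = ennreal (c * r t * K) * (1 + ennreal (p t) + ennreal (2 ^ n * (1 + r t ^ n)))"
              unfolding ennreal_mult'[OF nn(1)] using ennreal_plus[OF add_nonneg_nonneg[OF zero_le_one p0] nn(2)] ennreal_plus[OF zero_le_one p0]
              by (simp only: ennreal_1)
            moreover have "0 \<le> (c * r t * K) * (1 + p t + 2 ^ n * (1 + r t ^ n))" using nn p0[of t] by simp
            ultimately show ?thesis using ennreal_plus[OF p0] by (simp only: Wp)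
          qed
          finally have "ennreal (om t) * \<W> (pth (J w0) (J w1) z' t) \<le> ennreal (om t) * ennreal (p t + (c * r t * K) * (1 + p t + 2 ^ n * (1 + r t ^ n)))"
            by (rule mult_left_mono) simp
          also have "\<dots> = ennreal (om t * (p t + (c * r t * K) * (1 + p t + 2 ^ n * (1 + r t ^ n))))"
            by (rule ennreal_mult'[symmetric]) simp
          also have "om t * (p t + (c * r t * K) * (1 + p t + 2 ^ n * (1 + r t ^ n))) = T t"
          proof (cases "a \<le> t")
            case False
            then show ?thesis by (simp add: T_def r_def kern_def)
          next
            case True
            define X where "X = exp (- (t - a) / \<epsilon>)"
            have 1: "om t = om a * X" by (simp add: X_def exp_add[symmetric] diff_divide_distrib)
            have 2: "\<epsilon> * kern a t = X * r t" using True e by (simp add: X_def kern_def r_def power2_eq_square)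
            have 3: "?e k t = X * r t ^ k" for k using True by (simp add: X_def r_def)
            have "T t = om t * p t + c * K * om a * ((\<epsilon> * kern a t) * p t + (X * r t + 2 ^ n * (X * r t + X * r t ^ (n + 1))))"
              unfolding T_def 3 by (simp only: mult.assoc power_one_right)
            then show ?thesis unfolding 2 1 by (simp add: algebra_simps)
          qed
          finally show "ennreal (om t) * \<W> (pth (J w0) (J w1) z' t) \<le> ennreal (T t)" .
        qed
      qed
    qed
    have B0: "0 \<le> (\<integral>t. indicator {0..} t * T t \<partial>lborel)" by (intro integral_nonneg_AE AE_I2) (simp add: T0)
    have "\<epsilon>\<^sup>2 / 2 * Iz + IW \<le> \<epsilon>\<^sup>2 / 2 * (Iz - 2 * d * I1 + d\<^sup>2 * I2) + (IW + c * \<epsilon> * om a * C2 w0 w1)"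
      using compare[OF lz' pA A0' pB B0] TI by linarith
    then have "(d * \<epsilon>\<^sup>2) * I1 \<le> (d * \<epsilon>\<^sup>2) * (d / 2 * I2 + \<mu> * (om a * C2 w0 w1))"
      by (simp add: c_def algebra_simps power2_eq_square)
    then show ?thesis using d e by (subst (asm) mult_le_cancel_left_pos) simp_all
  qed
  have I20: "0 \<le> I2" unfolding I2_def by (intro integral_nonneg_AE AE_I2) (simp add: indicator_def)
  have "I1 \<le> \<mu> * (om a * C2 w0 w1) + x" if x: "0 < x" for x
  proof -
    define d where "d = min 1 (x / (I2 + 1))"
    have d: "0 < d" "d \<le> 1" using x I20 by (simp_all add: d_def)
    have "d / 2 * I2 \<le> (x / (I2 + 1)) / 2 * I2" using I20 by (intro mult_right_mono divide_right_mono) (simp_all add: d_def)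
    also have "\<dots> = (x / 2) * (I2 / (I2 + 1))" by simp
    also have "\<dots> \<le> (x / 2) * 1" using x I20 by (intro mult_left_mono) simp_all
    finally show ?thesis using step[OF d] x by simp
  qed
  then show "(\<integral>t. indicator A t * (om t * inner (z t) (J h)) \<partial>lborel) \<le> measure lborel A * (om a * C2 w0 w1)"
    unfolding I1_def[symmetric] \<mu>_def[symmetric] by (rule field_le_epsilon)
qed

text \<open>\<open>accel_set\<close> is applied to the set where the claim fails. The excess is
  positive there while its integral is at most zero, so the set is null.\<close>

lemma accel_AE_unit:
  assumes a: "0 \<le> a" and h: "norm h \<le> 1"
  shows "AE t in lborel. t \<in> {a..a + 1} \<longrightarrow> om t * inner (z t) (J h) \<le> om a * C2 w0 w1"
proof -
  let ?f = "\<lambda>t. om t * inner (z t) (J h) - om a * C2 w0 w1"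
  define A where "A = {t. 0 < ?f t} \<inter> {a..a + 1}"
  have Am: "A \<in> sets borel" unfolding A_def by measurable
  have As: "A \<subseteq> {a..a + 1}" by (auto simp: A_def)
  note ac = accel_set[OF a Am As h]
  have "emeasure lborel A \<le> 1" using emeasure_mono[OF As, of lborel] by simp
  then have "emeasure lborel A < \<infinity>" by (rule le_less_trans) simp
  then have iA: "integrable lborel (indicator A :: real \<Rightarrow> real)"
    using Am by (intro integrable_real_indicator) auto
  have eq: "indicator A t * ?f t = indicator A t * (om t * inner (z t) (J h)) - indicator A t * (om a * C2 w0 w1)" for t
    by (simp add: algebra_simps)
  have i: "integrable lborel (\<lambda>t. indicator A t * ?f t)"
    unfolding eq by (rule Bochner_Integration.integrable_diff[OF ac(1) integrable_mult_left[OF iA]])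
  have "(\<integral>t. indicator A t * ?f t \<partial>lborel) = (\<integral>t. indicator A t * (om t * inner (z t) (J h)) \<partial>lborel) - measure lborel A * (om a * C2 w0 w1)"
    unfolding eq Bochner_Integration.integral_diff[OF ac(1) integrable_mult_left[OF iA]] by (simp add: integral_mult_left_zero)
  also have "\<dots> \<le> 0" using ac(2) by simp
  finally have le: "(\<integral>t. indicator A t * ?f t \<partial>lborel) \<le> 0" .
  have nn: "0 \<le> indicator A t * ?f t" for t by (simp add: indicator_def A_def)
  have "(\<integral>t. indicator A t * ?f t \<partial>lborel) = 0"
    using le integral_nonneg_AE[OF AE_I2[OF nn]] by (rule antisym)
  then have "AE t in lborel. indicator A t * ?f t = 0"
    using integral_nonneg_eq_0_iff_AE[OF i AE_I2[OF nn]] by simp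
  then show ?thesis
  proof eventually_elim
    case (elim t)
    show ?case
    proof (rule impI, rule ccontr)
      assume t: "t \<in> {a..a + 1}" and "\<not> om t * inner (z t) (J h) \<le> om a * C2 w0 w1"
      then have "t \<in> A" "0 < ?f t" by (simp_all add: A_def)
      then show False using elim by simp
    qed
  qed
qed

text \<open>Almost everywhere the unit estimate holds simultaneously for all rational starting
  times, normalised directions from \<open>D\<close> and signs. Starting times that tend to
  \<open>t\<close> from below remove the factor \<open>exp ((t - q) / \<epsilon>)\<close>, and
  density of \<open>D\<close> with continuity of \<open>J\<close> reaches all directions.\<close>

lemma accel_bound: "AE t in lborel. 0 < t \<longrightarrow> (\<forall>h. \<bar>inner (z t) (J h)\<bar> \<le> C2 w0 w1 * norm h)"
proof -
  let ?P = "{q \<in> \<rat>. 0 \<le> (q::real)} \<times> (D \<times> {1, - 1 :: real})"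
  \<comment> \<open>For \<open>d = 0\<close> the quotient by the norm is \<open>0\<close>, so all
    these directions have norm at most one.\<close>
  let ?h = "\<lambda>d s. (s / norm d) *\<^sub>R d"
  have cP: "countable ?P" by (intro countable_SIGMA countable_subset[OF _ countable_rat] D) auto
  have "AE t in lborel. \<forall>x\<in>?P. t \<in> {fst x..fst x + 1} \<longrightarrow> om t * inner (z t) (J (?h (fst (snd x)) (snd (snd x)))) \<le> om (fst x) * C2 w0 w1"
    unfolding AE_ball_countable[OF cP]
  proof
    fix x assume "x \<in> ?P"
    then have "0 \<le> fst x" "norm (?h (fst (snd x)) (snd (snd x))) \<le> 1" by auto
    then show "AE t in lborel. t \<in> {fst x..fst x + 1} \<longrightarrow> om t * inner (z t) (J (?h (fst (snd x)) (snd (snd x)))) \<le> om (fst x) * C2 w0 w1"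
      by (rule accel_AE_unit)
  qed
  then show ?thesis
  proof eventually_elim
    case (elim t)
    show ?case
    proof (intro impI allI)
      assume t: "0 < t"
      have lin: "linear J" using J by (rule bounded_linear.linear)
      have dd: "\<bar>inner (z t) (J d)\<bar> \<le> C2 w0 w1 * norm d" if d: "d \<in> D" for d
      proof (cases "d = 0")
        case True
        then show ?thesis using linear_0[OF lin] by simp
      next
        case False
        have sgn: "inner (z t) (J (?h d s)) \<le> C2 w0 w1" if s: "s \<in> {1, - 1}" for s
        proof -
          have "\<exists>q. q \<in> \<rat> \<and> max 0 (t - min 1 (1 / real (Suc k))) < q \<and> q < t" for k
            using Rats_dense_in_real[of "max 0 (t - min 1 (1 / real (Suc k)))" t] t by auto
          then have "\<exists>q. \<forall>k. q k \<in> \<rat> \<and> max 0 (t - min 1 (1 / real (Suc k))) < q k \<and> q k < t" by (intro choice allI)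
          then obtain q where q: "\<And>k. q k \<in> \<rat>" "\<And>k. max 0 (t - min 1 (1 / real (Suc k))) < q k" "\<And>k. q k < t" by blast
          have le: "inner (z t) (J (?h d s)) \<le> exp ((t - q k) / \<epsilon>) * C2 w0 w1" for k
          proof -
            have qk: "0 < q k" "t - min 1 (1 / real (Suc k)) < q k" using q(2)[of k] by simp_all
            have "min 1 (1 / real (Suc k)) \<le> 1" by (rule min.cobounded1)
            then have "t \<in> {q k..q k + 1}" using q(3)[of k] qk unfolding atLeastAtMost_iff by linarith
            moreover have "(q k, d, s) \<in> ?P" using q(1)[of k] qk d s by simp
            ultimately have *: "om t * inner (z t) (J (?h d s)) \<le> om (q k) * C2 w0 w1" using elim by fastforce
            have "exp (t / \<epsilon>) * (om t * inner (z t) (J (?h d s))) \<le> exp (t / \<epsilon>) * (om (q k) * C2 w0 w1)"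
              by (rule mult_left_mono[OF *]) simp
            moreover have "exp (t / \<epsilon>) * om t = 1" by (simp add: exp_add[symmetric])
            moreover have "exp (t / \<epsilon>) * om (q k) = exp ((t - q k) / \<epsilon>)" by (simp add: exp_add[symmetric] diff_divide_distrib)
            ultimately show ?thesis by (simp only: mult.assoc[symmetric] mult_1)
          qed
          have "q \<longlonglongrightarrow> t"
          proof (rule tendsto_sandwich)
            show "\<forall>\<^sub>F k in sequentially. t - inverse (real (Suc k)) \<le> q k"
            proof (intro always_eventually allI)
              fix k
              have "min 1 (1 / real (Suc k)) \<le> inverse (real (Suc k))" by (simp add: inverse_eq_divide)
              then show "t - inverse (real (Suc k)) \<le> q k" using q(2)[of k] by simp
            qed
            show "\<forall>\<^sub>F k in sequentially. q k \<le> t" using q(3) by (simp add: less_imp_le)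
            show "(\<lambda>k. t - inverse (real (Suc k))) \<longlonglongrightarrow> t"
              using tendsto_diff[OF tendsto_const[of t] LIMSEQ_inverse_real_of_nat] by simp
          qed simp
          then have "(\<lambda>k. exp ((t - q k) / \<epsilon>) * C2 w0 w1) \<longlonglongrightarrow> exp ((t - t) / \<epsilon>) * C2 w0 w1"
            using e_nz by (intro tendsto_intros)
          then show ?thesis using le by (intro LIMSEQ_le_const[of _ "C2 w0 w1"]) auto
        qed
        have J1: "inner (z t) (J (?h d s)) = s * (inner (z t) (J d) / norm d)" for s
          by (simp add: linear_scale[OF lin])
        have "\<bar>inner (z t) (J d) / norm d\<bar> \<le> C2 w0 w1" using sgn[of 1] sgn[of "- 1"] unfolding J1 by (simp add: abs_le_iff)
        then show ?thesis using False by (simp add: abs_divide pos_divide_le_eq)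
      qed
      fix h
      have "h \<in> closure D" using D(2) by simp
      then obtain hs where hs: "\<And>k. hs k \<in> D" "hs \<longlonglongrightarrow> h" unfolding closure_sequential by blast
      have "(\<lambda>k. J (hs k)) \<longlonglongrightarrow> J h" using hs(2) by (rule bounded_linear.tendsto[OF J])
      then have "(\<lambda>k. \<bar>inner (z t) (J (hs k))\<bar>) \<longlonglongrightarrow> \<bar>inner (z t) (J h)\<bar>" by (intro tendsto_intros)
      moreover have "(\<lambda>k. C2 w0 w1 * norm (hs k)) \<longlonglongrightarrow> C2 w0 w1 * norm h" by (intro tendsto_intros hs)
      ultimately show "\<bar>inner (z t) (J h)\<bar> \<le> C2 w0 w1 * norm h"
        by (rule LIMSEQ_le) (use dd hs(1) in blast)
    qed
  qed
qed

lemma vel_lipschitz: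
  assumes st: "0 \<le> s" "s \<le> t"
  shows "\<bar>inner (v t - v s) (J h)\<bar> \<le> C2 w0 w1 * norm h * (t - s)"
proof -
  have zh: "locint (\<lambda>r. inner (z r) (J h))" by (rule locint_inner[OF zi])
  have "inner (v t - v s) (J h) = prim (\<lambda>r. inner (z r) (J h)) t - prim (\<lambda>r. inner (z r) (J h)) s"
    unfolding prim_inner[OF zi] by (simp add: vel_def inner_diff_left)
  also have "\<dots> = (LINT r:{s..t}|lborel. inner (z r) (J h))" by (rule prim_diff_interval[OF zh st])
  finally have eq: "inner (v t - v s) (J h) = (\<integral>r. indicator {s..t} r * inner (z r) (J h) \<partial>lborel)"
    by (simp add: set_lebesgue_integral_def)
  have i: "integrable lborel (\<lambda>r. indicator {s..t} r * inner (z r) (J h))"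
    using locint_subset[OF zh, of "{s..t}" t] st by (auto simp: set_integrable_def)
  have "\<bar>\<integral>r. indicator {s..t} r * inner (z r) (J h) \<partial>lborel\<bar> \<le> (\<integral>r. \<bar>indicator {s..t} r * inner (z r) (J h)\<bar> \<partial>lborel)"
    using integral_norm_bound[of lborel "\<lambda>r. indicator {s..t} r * inner (z r) (J h)"] by simp
  also have "\<dots> \<le> (\<integral>r. indicator {s..t} r * (C2 w0 w1 * norm h) \<partial>lborel)"
  proof (rule integral_mono_AE)
    show "integrable lborel (\<lambda>r. \<bar>indicator {s..t} r * inner (z r) (J h)\<bar>)" using i by (rule integrable_abs)
    show "AE r in lborel. \<bar>indicator {s..t} r * inner (z r) (J h)\<bar> \<le> indicator {s..t} r * (C2 w0 w1 * norm h)"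
      using accel_bound AE_lborel_singleton[of 0]
      by eventually_elim (use st in \<open>auto simp: indicator_def\<close>)
  qed (rule integrable_indicator_const)
  also have "\<dots> = C2 w0 w1 * norm h * (t - s)" using st by (simp add: mult.commute)
  finally show ?thesis unfolding eq .
qed

end

text \<open>\<open>prim_L2_bound\<close> with the parameter slightly above the norm
  \<open>N\<close>, which itself may be zero. For this choice both terms are multiples of the
  parameter, \<open>T / 2\<close> and \<open>1 / 2\<close>.\<close>

lemma prim_norm_L2:
  fixes f :: "real \<Rightarrow> 'b::{banach, second_countable_topology}"
  assumes f: "locL2 f" and t: "0 \<le> t" "t \<le> T"
  shows "norm (prim f t) \<le> (T + 1) / 2 * sqrt (prim (\<lambda>s. (norm (f s))\<^sup>2) T)"
proof -
  let ?q = "prim (\<lambda>s. (norm (f s))\<^sup>2)"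
  define N where "N = sqrt (?q T)"
  have l: "locint (\<lambda>s. (norm (f s))\<^sup>2)" by (rule locL2_sq[OF f])
  have P0: "0 \<le> ?q T" unfolding prim_def set_lebesgue_integral_def by (intro integral_nonneg_AE AE_I2) simp
  have mono: "?q t \<le> ?q T"
    unfolding prim_def set_lebesgue_integral_def
    by (rule integral_mono[OF locint_integrable[OF l] locint_integrable[OF l]]) (use t in \<open>auto simp: indicator_def\<close>)
  have N: "0 \<le> N" "N * N = ?q T" using P0 by (simp_all add: N_def)
  have "norm (prim f t) \<le> (T + 1) / 2 * N + x" if x: "0 < x" for x
  proof -
    define a where "a = N + 2 * x / (T + 1)"
    have T1: "0 < T + 1" using t by simp
    have a: "0 < a" "N \<le> a" using x N T1 by (simp_all add: a_def add_nonneg_pos)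
    have "norm (prim f t - prim f 0) \<le> a / 2 * (t - 0) + ?q t / (2 * a)"
      by (rule prim_L2_bound[OF f _ t(1) a(1)]) simp
    also have "\<dots> \<le> a / 2 * T + a / 2"
    proof (rule add_mono)
      show "a / 2 * (t - 0) \<le> a / 2 * T" using a t by (intro mult_left_mono) simp_all
      have "?q t \<le> a * a" using mono N(2) mult_mono[OF a(2) a(2)] N(1) a(1) by linarith
      then show "?q t / (2 * a) \<le> a / 2" using a by (simp add: divide_le_eq)
    qed
    also have "\<dots> = (T + 1) / 2 * a" by (simp add: algebra_simps add_divide_distrib)
    also have "\<dots> = (T + 1) / 2 * N + x" using T1 by (simp add: a_def distrib_left)
    finally show ?thesis by simp
  qed
  then show ?thesis unfolding N_def[symmetric] by (rule field_le_epsilon)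
qed

lemma prim_diff_bounded:
  fixes f :: "real \<Rightarrow> 'b::{banach, second_countable_topology}"
  assumes f: "locint f" and st: "0 \<le> s" "s \<le> t" and b: "\<And>r. s \<le> r \<Longrightarrow> r \<le> t \<Longrightarrow> norm (f r) \<le> B"
  shows "norm (prim f t - prim f s) \<le> B * (t - s)"
proof -
  have i: "integrable lborel (\<lambda>r. indicator {s..t} r *\<^sub>R f r)"
    using locint_subset[OF f, of "{s..t}" t] st by (auto simp: set_integrable_def)
  have "norm (prim f t - prim f s) \<le> (\<integral>r. norm (indicator {s..t} r *\<^sub>R f r) \<partial>lborel)"
    unfolding prim_diff_interval[OF f st] set_lebesgue_integral_def by (rule integral_norm_bound)
  also have "\<dots> \<le> (\<integral>r. indicator {s..t} r * B \<partial>lborel)"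
    by (rule integral_mono[OF integrable_norm[OF i] integrable_indicator_const]) (use b in \<open>simp add: indicator_def\<close>)
  also have "\<dots> = B * (t - s)" using st by (simp add: mult.commute)
  finally show ?thesis .
qed

lemma bounded_locL2:
  fixes f :: "real \<Rightarrow> 'b::{banach, second_countable_topology}"
  assumes f: "f \<in> borel_measurable borel" and b: "\<And>t. 0 \<le> t \<Longrightarrow> norm (f t) \<le> V"
  shows "locL2 f"
proof (rule locL2I[OF f], rule locint_bound)
  show "locint (\<lambda>t. V\<^sup>2)" by (intro locint_continuous continuous_on_const)
  show "(\<lambda>t. (norm (f t))\<^sup>2) \<in> borel_measurable borel" using f by measurable
  show "norm ((norm (f t))\<^sup>2) \<le> norm (V\<^sup>2)" if "0 \<le> t" for t
    using power_mono[OF b[OF that], of 2] by simp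
qed

section \<open>Uniform bounds on potential, velocity and position\<close>

context minimal_path
begin

lemma energy_level: "(norm (J w1))\<^sup>2 / 2 + W0 w0 + \<epsilon> * C1 w0 w1 \<le> EE w0 w1"
proof -
  have "\<epsilon> * C1 w0 w1 \<le> 1 * C1 w0 w1" using e1 C1_nonneg by (intro mult_right_mono) simp_all
  then show ?thesis by (simp add: EE_def)
qed

lemma IW_EE: "IW \<le> \<epsilon> * EE w0 w1"
proof -
  have "\<epsilon> * C0 w0 w1 \<le> 1 * C0 w0 w1" using e1 C0_nonneg by (intro mult_right_mono) simp_all
  moreover have "C0 w0 w1 \<le> C1 w0 w1"
    unfolding C1_def using K0 C0_nonneg[of w0 w1] W0_nonneg[of w0] by simp
  moreover have "0 \<le> (norm (J w1))\<^sup>2 / 2" by simp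
  ultimately have "W0 w0 + \<epsilon> * C0 w0 w1 \<le> EE w0 w1" unfolding EE_def by linarith
  then have "\<epsilon> * (W0 w0 + \<epsilon> * C0 w0 w1) \<le> \<epsilon> * EE w0 w1" using e by (intro mult_left_mono) simp_all
  then show ?thesis using IW_le by linarith
qed

text \<open>The kernel started at \<open>c - \<epsilon>\<close> is at least
  \<open>exp (- 2) / \<epsilon>\<close> on the interval. If there is no room before
  \<open>c\<close>, the interval lies in \<open>[0, 2 * \<epsilon>]\<close>, where the original
  weight is at least \<open>exp (- 2)\<close> and its total \<open>IW\<close> is of order
  \<open>\<epsilon>\<close>.\<close>

lemma W_interval:
  assumes c: "0 \<le> c"
  shows "(\<integral>\<^sup>+t\<in>{c..c + \<epsilon>}. \<W> (u t) \<partial>lborel) \<le> ennreal (\<epsilon> * exp 2 * EE w0 w1)"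
proof (cases "\<epsilon> \<le> c")
  case True
  define b where "b = c - \<epsilon>"
  have b: "0 \<le> b" using True by (simp add: b_def)
  have "(\<integral>\<^sup>+t\<in>{c..c + \<epsilon>}. \<W> (u t) \<partial>lborel) \<le> (\<integral>\<^sup>+t. ennreal (\<epsilon> * exp 2) * (ennreal (kern b t) * \<W> (u t)) \<partial>lborel)"
  proof (rule nn_integral_mono)
    fix t
    show "\<W> (u t) * indicator {c..c + \<epsilon>} t \<le> ennreal (\<epsilon> * exp 2) * (ennreal (kern b t) * \<W> (u t))"
    proof (cases "t \<in> {c..c + \<epsilon>}")
      case True
      have k: "1 \<le> \<epsilon> * exp 2 * kern b t"
      proof -
        define r where "r = (t - b) / \<epsilon>"
        have r: "1 \<le> r" "r \<le> 2" using True e by (simp_all add: r_def b_def pos_le_divide_eq pos_divide_le_eq)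
        have bt: "b \<le> t" using True e by (simp add: b_def)
        have "kern b t = r * exp (- r) / \<epsilon>"

        proof -
          have "- (t - b) / \<epsilon> = - r" by (simp only: r_def minus_divide_left)
          then show ?thesis using bt unfolding kern_def by (simp only: r_def) (simp add: power2_eq_square)
        qed
        then have "\<epsilon> * exp 2 * kern b t = r * (exp 2 * exp (- r))" using e by simp
        also have "exp 2 * exp (- r) = exp (2 - r)" by (simp add: exp_add[symmetric])
        finally have "\<epsilon> * exp 2 * kern b t = r * exp (2 - r)" .
        moreover have "1 * 1 \<le> r * exp (2 - r)" using r by (intro mult_mono) simp_all
        ultimately show ?thesis by simp
      qed
      have "1 * \<W> (u t) \<le> ennreal (\<epsilon> * exp 2 * kern b t) * \<W> (u t)"
        by (rule mult_right_mono) (use ennreal_leI[OF k] in simp_all)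
      also have "ennreal (\<epsilon> * exp 2 * kern b t) = ennreal (\<epsilon> * exp 2) * ennreal (kern b t)"
        by (rule ennreal_mult') (use e in simp)
      finally show ?thesis using True by (simp add: mult.assoc)
    qed simp
  qed
  also have "\<dots> = ennreal (\<epsilon> * exp 2) * (\<integral>\<^sup>+t. ennreal (kern b t) * \<W> (u t) \<partial>lborel)"
    by (rule nn_integral_cmult) measurable
  also have "\<dots> \<le> ennreal (\<epsilon> * exp 2) * ennreal (EE w0 w1)"
  proof (rule mult_left_mono)
    have "(\<integral>\<^sup>+t. ennreal (kern b t) * \<W> (u t) \<partial>lborel) \<le> ennreal ((norm (v b))\<^sup>2 / 2) + (\<integral>\<^sup>+t. ennreal (kern b t) * \<W> (u t) \<partial>lborel)"
      by simp
    also note energy_nn[OF b]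
    also note ennreal_leI[OF energy_level]
    finally show "(\<integral>\<^sup>+t. ennreal (kern b t) * \<W> (u t) \<partial>lborel) \<le> ennreal (EE w0 w1)" .
  qed simp
  also have "\<dots> = ennreal (\<epsilon> * exp 2 * EE w0 w1)" by (rule ennreal_mult'[symmetric]) (use e in simp)
  finally show ?thesis .
next
  case False
  have "(\<integral>\<^sup>+t\<in>{c..c + \<epsilon>}. \<W> (u t) \<partial>lborel) \<le> (\<integral>\<^sup>+t. ennreal (exp 2) * (ennreal (om t) * \<W> (u t) * indicator {0..} t) \<partial>lborel)"
  proof (rule nn_integral_mono)
    fix t
    show "\<W> (u t) * indicator {c..c + \<epsilon>} t \<le> ennreal (exp 2) * (ennreal (om t) * \<W> (u t) * indicator {0..} t)"
    proof (cases "t \<in> {c..c + \<epsilon>}")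
      case True
      then have t: "0 \<le> t" "t \<le> 2 * \<epsilon>" using c False by auto
      then have "t / \<epsilon> \<le> 2" using e by (simp add: pos_divide_le_eq)
      then have "1 \<le> exp (2 - t / \<epsilon>)" by simp
      then have k: "1 \<le> exp 2 * om t" by (simp add: exp_add[symmetric])
      have "1 * \<W> (u t) \<le> ennreal (exp 2 * om t) * \<W> (u t)"
        by (rule mult_right_mono) (use ennreal_leI[OF k] in simp_all)
      also have "ennreal (exp 2 * om t) = ennreal (exp 2) * ennreal (om t)" by (rule ennreal_mult') simp
      finally show ?thesis using True t by (simp add: mult.assoc)
    qed simp
  qed
  also have "\<dots> = ennreal (exp 2) * ennreal IW"
    unfolding IW[symmetric] by (rule nn_integral_cmult) measurable
  also have "\<dots> \<le> ennreal (exp 2) * ennreal (\<epsilon> * EE w0 w1)" by (intro mult_left_mono ennreal_leI IW_EE) simp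
  also have "\<dots> = ennreal (\<epsilon> * exp 2 * EE w0 w1)" by (subst ennreal_mult'[symmetric]) (simp_all add: mult_ac)
  finally show ?thesis .
qed

lemma W_intervals:
  assumes c: "0 \<le> c"
  shows "(\<integral>\<^sup>+t\<in>{c..c + real (Suc m) * \<epsilon>}. \<W> (u t) \<partial>lborel) \<le> ennreal (real (Suc m) * (\<epsilon> * exp 2 * EE w0 w1))"
proof (induction m)
  case 0
  then show ?case using W_interval[OF c] by simp
next
  case (Suc m)
  let ?d = "c + real (Suc m) * \<epsilon>" and ?B = "\<epsilon> * exp 2 * EE w0 w1"
  have B: "0 \<le> ?B" using e EE_nonneg by simp
  have d: "0 \<le> ?d" using c e by simp
  have d': "c + real (Suc (Suc m)) * \<epsilon> = ?d + \<epsilon>" by (simp add: algebra_simps)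
  have "(\<integral>\<^sup>+t\<in>{c..?d + \<epsilon>}. \<W> (u t) \<partial>lborel)
      \<le> (\<integral>\<^sup>+t. \<W> (u t) * indicator {c..?d} t + \<W> (u t) * indicator {?d..?d + \<epsilon>} t \<partial>lborel)"
    by (rule nn_integral_mono) (auto simp: indicator_def)
  also have "\<dots> = (\<integral>\<^sup>+t\<in>{c..?d}. \<W> (u t) \<partial>lborel) + (\<integral>\<^sup>+t\<in>{?d..?d + \<epsilon>}. \<W> (u t) \<partial>lborel)"
    by (rule nn_integral_add) measurable
  also have "\<dots> \<le> ennreal (real (Suc m) * ?B) + ennreal ?B" by (rule add_mono[OF Suc.IH W_interval[OF d]])
  also have "\<dots> = ennreal (real (Suc m) * ?B + ?B)" by (rule ennreal_plus[symmetric, OF mult_nonneg_nonneg[OF of_nat_0_le_iff B] B])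
  also have "real (Suc m) * ?B + ?B = real (Suc (Suc m)) * ?B" by (simp add: algebra_simps)
  finally show ?case unfolding d' .
qed

text \<open>The interval is covered by \<open>Suc m\<close> intervals of length
  \<open>\<epsilon>\<close>, of total length at most \<open>T + \<epsilon>\<close>. This is where
  \<open>\<epsilon> \<le> T\<close> enters: the total is at most \<open>2 * T\<close>.\<close>

lemma W_estimate:
  assumes t: "0 \<le> \<tau>" and T: "\<epsilon> \<le> T"
  shows "(\<integral>\<^sup>+t\<in>{\<tau>..\<tau> + T}. \<W> (u t) \<partial>lborel) \<le> ennreal (2 * exp 2 * EE w0 w1 * T)"
proof -
  define m where "m = nat \<lfloor>T / \<epsilon>\<rfloor>"
  have "0 \<le> T / \<epsilon>" using T e by simp
  then have "real m \<le> T / \<epsilon>" "T / \<epsilon> \<le> real (Suc m)"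
    unfolding m_def by (simp_all add: of_nat_nat) linarith
  then have m: "real m * \<epsilon> \<le> T" "T \<le> real (Suc m) * \<epsilon>"
    using e by (simp_all only: pos_le_divide_eq pos_divide_le_eq)
  have "(\<integral>\<^sup>+t\<in>{\<tau>..\<tau> + T}. \<W> (u t) \<partial>lborel) \<le> (\<integral>\<^sup>+t\<in>{\<tau>..\<tau> + real (Suc m) * \<epsilon>}. \<W> (u t) \<partial>lborel)"
    using m(2) by (intro nn_set_integral_set_mono) auto
  also have "\<dots> \<le> ennreal (real (Suc m) * (\<epsilon> * exp 2 * EE w0 w1))" by (rule W_intervals[OF t])
  also have "\<dots> \<le> ennreal (2 * exp 2 * EE w0 w1 * T)"
  proof (rule ennreal_leI)
    have "real (Suc m) * \<epsilon> \<le> 2 * T" using m(1) T by (simp add: algebra_simps)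
    then have "(real (Suc m) * \<epsilon>) * (exp 2 * EE w0 w1) \<le> (2 * T) * (exp 2 * EE w0 w1)"
      using EE_nonneg by (intro mult_right_mono) simp_all
    then show "real (Suc m) * (\<epsilon> * exp 2 * EE w0 w1) \<le> 2 * exp 2 * EE w0 w1 * T" by (simp only: mult_ac)
  qed
  finally show ?thesis .
qed

lemma vel_le: "0 \<le> t \<Longrightarrow> norm (v t) \<le> sqrt (2 * EE w0 w1)"
  by (rule real_le_rsqrt[OF vel_bound])

lemma path_le:
  assumes "0 \<le> t" shows "norm (u t) \<le> norm (J w0) + sqrt (2 * EE w0 w1) * t"
proof -
  have "norm (prim v t - prim v 0) \<le> sqrt (2 * EE w0 w1) * (t - 0)"
    by (rule prim_diff_bounded[OF locint_vel[OF zi] order_refl assms]) (rule vel_le)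
  then show ?thesis using norm_triangle_ineq[of "J w0" "prim v t"] by (simp add: pth_def)
qed

lemma path_sq_le:
  assumes "0 \<le> t" shows "(norm (u t))\<^sup>2 \<le> (2 * (norm (J w0))\<^sup>2 + 4 * EE w0 w1) * (1 + t\<^sup>2)"
proof -
  have "(norm (u t))\<^sup>2 \<le> (norm (J w0) + sqrt (2 * EE w0 w1) * t)\<^sup>2"
    by (rule power_mono[OF path_le[OF assms]]) simp
  also have "\<dots> \<le> 2 * (norm (J w0))\<^sup>2 + 2 * (sqrt (2 * EE w0 w1) * t)\<^sup>2"
    using norm_add_sq_le[of "norm (J w0)" "sqrt (2 * EE w0 w1) * t"] by simp
  also have "(sqrt (2 * EE w0 w1) * t)\<^sup>2 = 2 * EE w0 w1 * t\<^sup>2" using EE_nonneg by (simp add: power_mult_distrib)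
  also have "2 * (norm (J w0))\<^sup>2 + 2 * (2 * EE w0 w1 * t\<^sup>2) \<le> (2 * (norm (J w0))\<^sup>2 + 4 * EE w0 w1) * (1 + t\<^sup>2)"
    using EE_nonneg by (simp add: algebra_simps)
  finally show ?thesis .
qed

end

section \<open>Weak convergence\<close>

text \<open>The pointwise weak limit \<open>y\<close> is not known to be measurable. Forward convex
  combinations converge strongly at almost every time to a measurable function, and pairings show
  that it agrees with \<open>y\<close> there.\<close>

lemma weak_limit_representative:
  fixes v :: "nat \<Rightarrow> real \<Rightarrow> 'b::{real_inner, banach, second_countable_topology}"
  assumes v: "\<And>k. v k \<in> borel_measurable borel" and b: "\<And>k t. 0 \<le> t \<Longrightarrow> norm (v k t) \<le> V"
    and conv: "\<And>t h. 0 \<le> t \<Longrightarrow> (\<lambda>k. inner (v k t) h) \<longlonglongrightarrow> inner (y t) h"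
  obtains c x where "\<And>n. c n \<in> fwd n" "x \<in> borel_measurable borel" "\<And>t. norm (x t) \<le> V"
    "AE t in lborel. 0 \<le> t \<longrightarrow> x t = y t \<and> (\<lambda>n. comb (c n) (\<lambda>k. v k t)) \<longlonglongrightarrow> x t"
proof -
  note [measurable] = v
  have V0: "0 \<le> V" using b[of 0 0] norm_ge_zero[of "v 0 0"] by linarith
  \<comment> \<open>Damping by \<open>exp (- t / 2)\<close> makes bounded functions square
    integrable on the half line.\<close>
  let ?f = "\<lambda>k. damp 1 (v k)"
  let ?e = "\<lambda>t. V\<^sup>2 * (indicator {0..} t * (exp (- t / 1) * (t / 1) ^ 0))"
  note ei = exp_power_integral[of 1 0, OF zero_less_one]
  have ie: "integrable lborel ?e" by (rule integrable_mult_right[OF ei(1)])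
  have le: "(norm (?f k t))\<^sup>2 \<le> ?e t" for k t
  proof (cases "0 \<le> t")
    case True
    have "exp (- t) * (norm (v k t))\<^sup>2 \<le> exp (- t) * V\<^sup>2" by (intro mult_left_mono power_mono b True) simp_all
    then show ?thesis using True by (simp add: norm_damp mult.commute)
  qed (simp add: norm_damp)
  have sf: "sqint lborel (?f k)" for k unfolding sqint_def
  proof
    show "?f k \<in> borel_measurable lborel" by measurable
    show "integrable lborel (\<lambda>t. (norm (?f k t))\<^sup>2)"
      by (rule Bochner_Integration.integrable_bound[OF ie]) (measurable, rule AE_I2, simp only: real_norm_def abs_of_nonneg[OF zero_le_power2] abs_ge_self[THEN order_trans[OF le]])
  qed
  have sb: "(\<integral>t. (norm (?f k t))\<^sup>2 \<partial>lborel) \<le> integral\<^sup>L lborel ?e" for k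
    by (rule integral_mono[OF _ ie le]) (use sf in \<open>simp add: sqint_def\<close>)
  obtain c g where c: "\<And>n. c n \<in> fwd n" and g: "sqint lborel g"
    and cg: "AE t in lborel. (\<lambda>n. comb (c n) (\<lambda>k. ?f k t)) \<longlonglongrightarrow> g t"
    by (rule fwd_L2[OF sf sb]) (rule that)
  have [measurable]: "g \<in> borel_measurable borel" using g by (simp add: sqint_def)
  define x0 where "x0 t = exp (t / 2) *\<^sub>R g t" for t
  \<comment> \<open>Truncation turns the bound for almost every time into a bound for every
    time.\<close>
  define x where "x t = (if norm (x0 t) \<le> V then x0 t else 0)" for t
  have [measurable]: "x0 \<in> borel_measurable borel" unfolding x0_def[abs_def] by measurable
  show ?thesis
  proof (rule that[OF c])
    show "x \<in> borel_measurable borel" unfolding x_def[abs_def] by measurable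
    show "norm (x t) \<le> V" for t using V0 by (simp add: x_def)
    show "AE t in lborel. 0 \<le> t \<longrightarrow> x t = y t \<and> (\<lambda>n. comb (c n) (\<lambda>k. v k t)) \<longlonglongrightarrow> x t"
      using cg
    proof eventually_elim
      case (elim t)
      show ?case
      proof
        assume t: "0 \<le> t"
        let ?c = "\<lambda>n. comb (c n) (\<lambda>k. v k t)"
        have lin: "linear (\<lambda>a :: 'b. exp (- (t / 2)) *\<^sub>R a)" by (rule bounded_linear.linear[OF bounded_linear_scaleR_right])
        have "comb (c n) (\<lambda>k. ?f k t) = exp (- (t / 2)) *\<^sub>R ?c n" for n
          unfolding comb_linear[OF lin] using t by (simp add: damp_def)
        then have "(\<lambda>n. exp (t / 2) *\<^sub>R (exp (- (t / 2)) *\<^sub>R ?c n)) \<longlonglongrightarrow> exp (t / 2) *\<^sub>R g t"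
          using elim by (intro tendsto_intros) simp
        then have lim: "?c \<longlonglongrightarrow> x0 t" by (simp add: x0_def exp_add[symmetric])
        have "norm (?c n) \<le> V" for n by (rule comb_norm_le[OF c b[OF t]])
        then have "norm (x0 t) \<le> V" by (intro LIMSEQ_le_const2[OF tendsto_norm[OF lim]]) auto
        then have x: "x t = x0 t" by (simp add: x_def)
        have "inner (x0 t) h = inner (y t) h" for h
        proof (rule LIMSEQ_unique)
          show "(\<lambda>n. inner (?c n) h) \<longlonglongrightarrow> inner (x0 t) h" by (intro tendsto_intros lim)
          have l: "linear (\<lambda>a. inner a h)" by (rule bounded_linear.linear[OF bounded_linear_inner_left])
          show "(\<lambda>n. inner (?c n) h) \<longlonglongrightarrow> inner (y t) h"
            unfolding comb_linear[OF l] by (rule fwd_tendsto[OF c conv[OF t]])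
        qed
        then have "x0 t = y t" by (rule vector_eq_rdot[THEN iffD1, rule_format])
        then show "x t = y t \<and> ?c \<longlonglongrightarrow> x t" using x lim by simp
      qed
    qed
  qed
qed

text \<open>A class of primitives inside \<open>H1_on\<close> that is closed under linear
  combinations. Functionals are evaluated on its members, so membership in \<open>H1_on\<close> need
  not be propagated through sums by hand.\<close>

definition bounded_prim :: "real set \<Rightarrow> (real \<Rightarrow> 'b::{banach, second_countable_topology}) \<Rightarrow> bool" where
  "bounded_prim I U \<longleftrightarrow> (\<exists>a f V. f \<in> borel_measurable borel \<and> (\<forall>t\<ge>0. norm (f t) \<le> V) \<and> (\<forall>t\<in>I. U t = a + prim f t))"

lemma bounded_primI:
  "f \<in> borel_measurable borel \<Longrightarrow> (\<And>t. 0 \<le> t \<Longrightarrow> norm (f t) \<le> V) \<Longrightarrow> (\<And>t. t \<in> I \<Longrightarrow> U t = a + prim f t) \<Longrightarrow> bounded_prim I U"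
  unfolding bounded_prim_def by blast

lemma bounded_prim_scale_add:
  assumes "bounded_prim I U" "bounded_prim I U'"
  shows "bounded_prim I (\<lambda>t. r *\<^sub>R U t + U' t)"
proof -
  obtain a f V where f: "f \<in> borel_measurable borel" "\<And>t. 0 \<le> t \<Longrightarrow> norm (f t) \<le> V" "\<And>t. t \<in> I \<Longrightarrow> U t = a + prim f t"
    using assms(1) unfolding bounded_prim_def by blast
  obtain a' f' V' where f': "f' \<in> borel_measurable borel" "\<And>t. 0 \<le> t \<Longrightarrow> norm (f' t) \<le> V'" "\<And>t. t \<in> I \<Longrightarrow> U' t = a' + prim f' t"
    using assms(2) unfolding bounded_prim_def by blast
  note [measurable] = f(1) f'(1)
  have l: "locint f" "locint f'" using bounded_locL2[OF f(1,2)] bounded_locL2[OF f'(1,2)] by (simp_all add: locL2_locint)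
  have lr: "locint (\<lambda>t. r *\<^sub>R f t)" by (rule locint_bounded_linear[OF bounded_linear_scaleR_right l(1)])
  show ?thesis
  proof (rule bounded_primI)
    show "(\<lambda>t. r *\<^sub>R f t + f' t) \<in> borel_measurable borel" by measurable
    fix t :: real
    show "norm (r *\<^sub>R f t + f' t) \<le> \<bar>r\<bar> * V + V'" if "0 \<le> t"
      using norm_triangle_ineq[of "r *\<^sub>R f t" "f' t"] mult_left_mono[OF f(2)[OF that], of "\<bar>r\<bar>"] f'(2)[OF that] by simp
    show "r *\<^sub>R U t + U' t = (r *\<^sub>R a + a') + prim (\<lambda>t. r *\<^sub>R f t + f' t) t" if "t \<in> I"
      unfolding prim_add[OF lr l(2)] prim_bounded_linear[OF bounded_linear_scaleR_right l(1)] f(3)[OF that] f'(3)[OF that]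
      by (simp add: algebra_simps)
  qed
qed

lemma L2_on_cong:
  assumes "\<And>t. t \<in> I \<Longrightarrow> f t = g t" shows "L2_on I f = L2_on I g"
proof -
  have "indicat_real I t *\<^sub>R f t = indicat_real I t *\<^sub>R g t"
    "ennreal ((norm (f t))\<^sup>2) * indicator I t = ennreal ((norm (g t))\<^sup>2) * indicator I t" for t
    by (cases "t \<in> I"; simp add: assms)+
  then show ?thesis by (simp only: L2_on_def set_borel_measurable_def)
qed

lemma bounded_prim_H1:
  fixes U :: "real \<Rightarrow> 'b::{banach, second_countable_topology}"
  assumes "bounded_prim {0<..<T} U" shows "H1_on {0<..<T} U"
proof -
  obtain a f V where f: "f \<in> borel_measurable borel" "\<And>t. 0 \<le> t \<Longrightarrow> norm (f t) \<le> V" "\<And>t. t \<in> {0<..<T} \<Longrightarrow> U t = a + prim f t"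
    using assms unfolding bounded_prim_def by blast
  have lf: "locL2 f" by (rule bounded_locL2[OF f(1,2)])
  have "L2_on {0<..<T} U"

  proof -
    have "L2_on {0<..<T} U = L2_on {0<..<T} (\<lambda>t. a + prim f t)" by (rule L2_on_cong[OF f(3)])
    then show ?thesis
      by (simp, intro L2_on_continuous continuous_intros continuous_prim locL2_locint lf)
  qed
  moreover have "weak_deriv_on {0<..<T} U f"
    by (rule weak_deriv_prim[OF locL2_locint[OF lf] _ f(3)]) auto
  ultimately show ?thesis unfolding H1_on_def using L2_on_locL2[OF lf] by blast
qed

section \<open>Weak convergence in \<open>H1\<close> on bounded intervals\<close>

lemma H1_functional_sum:
  assumes L: "H1_functional {0<..<T} \<Lambda>" and U: "\<And>i. bounded_prim {0<..<T} (U i)" and A: "finite A"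
  shows "bounded_prim {0<..<T} (\<lambda>t. \<Sum>i\<in>A. c i *\<^sub>R U i t) \<and> \<Lambda> (\<lambda>t. \<Sum>i\<in>A. c i *\<^sub>R U i t) = (\<Sum>i\<in>A. c i *\<^sub>R \<Lambda> (U i))"
  using A
proof induction
  have add: "\<Lambda> (\<lambda>t. u t + v t) = \<Lambda> u + \<Lambda> v" if "bounded_prim {0<..<T} u" "bounded_prim {0<..<T} v" for u v
    using L that bounded_prim_H1 unfolding H1_functional_def by blast
  have scale: "\<Lambda> (\<lambda>t. r *\<^sub>R u t) = r * \<Lambda> u" if "bounded_prim {0<..<T} u" for r u
    using L that bounded_prim_H1 unfolding H1_functional_def by blast
  have z: "bounded_prim {0<..<T} (\<lambda>t. 0 :: 'a)"
    by (rule bounded_primI[of "\<lambda>t. 0" 0 _ _ 0]) simp_all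
  {
    case empty
    show ?case using z scale[OF z, of 0] by simp
  next
    case (insert i A)
    have s: "bounded_prim {0<..<T} (\<lambda>t. c i *\<^sub>R U i t)" using bounded_prim_scale_add[OF U z, of "c i"] by simp
    show ?case using insert bounded_prim_scale_add[OF U, of _ "c i" i] add[OF s] scale[OF U] by simp
  }
qed

text \<open>Only linearity and boundedness of the functional are available. From every subsequence,
  forward convex combinations of the derivatives converge almost everywhere, hence in mean square by
  dominated convergence; the corresponding primitives converge in the norm of \<open>H1\<close>, and
  \<open>fwd_criterion\<close> returns to the original sequence.\<close>

lemma H1_weak_conv_prim:
  fixes v :: "nat \<Rightarrow> real \<Rightarrow> 'b::{real_inner, banach, second_countable_topology}"
  assumes T: "0 < T" and v: "\<And>k. v k \<in> borel_measurable borel" and b: "\<And>k t. 0 \<le> t \<Longrightarrow> norm (v k t) \<le> V"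
    and conv: "\<And>t h. 0 \<le> t \<Longrightarrow> (\<lambda>k. inner (v k t) h) \<longlonglongrightarrow> inner (y t) h"
    and x: "x \<in> borel_measurable borel" "\<And>t. norm (x t) \<le> V" "AE t in lborel. 0 \<le> t \<longrightarrow> x t = y t"
    and U: "\<And>k t. t \<in> {0<..<T} \<Longrightarrow> U k t = a + prim (v k) t" and w: "\<And>t. t \<in> {0<..<T} \<Longrightarrow> w t = a + prim x t"
  shows "H1_weak_conv {0<..<T} U w"
  unfolding H1_weak_conv_def
proof (intro conjI allI impI)
  let ?I = "{0<..<T}"
  have bU: "bounded_prim ?I (U k)" for k by (rule bounded_primI[OF v b U])
  have bw: "bounded_prim ?I w" by (rule bounded_primI[OF x(1) x(2) w])
  show "H1_on ?I (U k)" for k by (rule bounded_prim_H1[OF bU])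
  show "H1_on ?I w" by (rule bounded_prim_H1[OF bw])
  fix \<Lambda> :: "(real \<Rightarrow> 'b) \<Rightarrow> real" assume L: "H1_functional ?I \<Lambda>"
  obtain C where C: "\<And>u. bounded_prim ?I u \<Longrightarrow> \<bar>\<Lambda> u\<bar> \<le> C * H1_norm ?I u"
    using L bounded_prim_H1 unfolding H1_functional_def by blast
  show "(\<lambda>k. \<Lambda> (U k)) \<longlonglongrightarrow> \<Lambda> w"
  proof (rule fwd_criterion)
    fix s :: "nat \<Rightarrow> nat" assume s: "strict_mono s"
    have convs: "(\<lambda>k. inner (v (s k) t) h) \<longlonglongrightarrow> inner (y t) h" if "0 \<le> t" for t h
      using LIMSEQ_subseq_LIMSEQ[OF conv[OF that] s] by (simp add: comp_def)
    obtain c x' where c: "\<And>n. c n \<in> fwd n"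
      and x': "AE t in lborel. 0 \<le> t \<longrightarrow> x' t = y t \<and> (\<lambda>n. comb (c n) (\<lambda>k. v (s k) t)) \<longlonglongrightarrow> x' t"
      by (rule weak_limit_representative[of "\<lambda>k. v (s k)" V y, OF v], rule b, assumption, rule convs, assumption) (rule that)
    define E where "E n t = comb (c n) (\<lambda>k. U (s k) t) + (- 1) *\<^sub>R w t" for n t
    define D where "D n t = comb (c n) (\<lambda>k. v (s k) t) - x t" for n t
    note [measurable] = v x(1)
    have Dm [measurable]: "D n \<in> borel_measurable borel" for n unfolding D_def[abs_def] comb_def by measurable
    have Db: "norm (D n t) \<le> 2 * V" if "0 \<le> t" for n t
      using norm_triangle_ineq4[of "comb (c n) (\<lambda>k. v (s k) t)" "x t"] comb_norm_le[OF c b[OF that], of n s] x(2)[of t]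
      unfolding D_def by linarith
    have Dl: "locL2 (D n)" for n by (rule bounded_locL2[OF Dm Db])
    have lv: "locint (v k)" for k by (rule locL2_locint[OF bounded_locL2[OF v b]])
    have lx: "locint x" by (rule locL2_locint[OF bounded_locL2[OF x(1,2)]])
    have ED: "E n t = 0 + prim (D n) t" if "t \<in> ?I" for n t
    proof -
      have "comb (c n) (\<lambda>k. U (s k) t) = comb (c n) (\<lambda>k. prim (v (s k)) t - (- a))"
        by (simp add: U[OF that] add.commute)
      also have "\<dots> = prim (\<lambda>t. comb (c n) (\<lambda>k. v (s k) t)) t + a"
        unfolding comb_diff_const[OF c] prim_comb(2)[of "\<lambda>k. v (s k)", OF lv] by simp
      finally show ?thesis
        unfolding E_def D_def[abs_def] prim_diff[OF prim_comb(1)[of "\<lambda>k. v (s k)", OF lv] lx] w[OF that] by simp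
    qed
    have bE: "bounded_prim ?I (E n)" for n by (rule bounded_primI[OF Dm Db ED])
    define P where "P n = prim (\<lambda>t. (norm (D n t))\<^sup>2) T" for n
    have P: "P \<longlonglongrightarrow> 0"
    proof -
      have "(\<lambda>n. \<integral>t. indicator {0..T} t *\<^sub>R (norm (D n t))\<^sup>2 \<partial>lborel) \<longlonglongrightarrow> (\<integral>t. 0 \<partial>(lborel :: real measure))"
      proof (rule integral_dominated_convergence)
        show "integrable lborel (\<lambda>t. indicator {0..T} t * (2 * V)\<^sup>2)" by (rule integrable_indicator_const)
        show "AE t in lborel. (\<lambda>n. indicator {0..T} t *\<^sub>R (norm (D n t))\<^sup>2) \<longlonglongrightarrow> 0"
          using x' x(3)
        proof eventually_elim
          case (elim t)
          show ?case
          proof (cases "t \<in> {0..T}")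
            case True
            then have t: "0 \<le> t" by simp
            have "x' t = x t" using elim(1)[THEN mp, OF t] elim(2)[THEN mp, OF t] by simp
            then have "(\<lambda>n. comb (c n) (\<lambda>k. v (s k) t)) \<longlonglongrightarrow> x t"
              using elim(1)[THEN mp, OF t, THEN conjunct2] by (simp only:)
            then have "(\<lambda>n. (norm (D n t))\<^sup>2) \<longlonglongrightarrow> (norm (x t - x t))\<^sup>2" unfolding D_def by (intro tendsto_intros)
            then show ?thesis using True by simp
          qed simp
        qed
        show "AE t in lborel. norm (indicator {0..T} t *\<^sub>R (norm (D n t))\<^sup>2) \<le> indicator {0..T} t * (2 * V)\<^sup>2" for n

        proof (rule AE_I2)
          fix t
          show "norm (indicator {0..T} t *\<^sub>R (norm (D n t))\<^sup>2) \<le> indicator {0..T} t * (2 * V)\<^sup>2"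
          proof (cases "t \<in> {0..T}")
            case True
            then have t: "0 \<le> t" by simp
            have "(norm (D n t))\<^sup>2 \<le> (2 * V)\<^sup>2" by (rule power_mono[OF Db[OF t]]) simp
            then show ?thesis using True by simp
          qed simp
        qed
      qed measurable
      then show ?thesis by (simp add: P_def[abs_def] prim_def set_lebesgue_integral_def)
    qed
    \<comment> \<open>The first summand bounds the function by \<open>prim_norm_L2\<close> and the
      length of the interval, the second accounts for its derivative.\<close>
    let ?K = "T * ((T + 1) / 2)\<^sup>2 + 1"
    have P0: "0 \<le> P n" for n unfolding P_def prim_def set_lebesgue_integral_def by (intro integral_nonneg_AE AE_I2) simp
    have N: "H1_norm ?I (E n) \<le> sqrt (?K * P n)" for n
    proof -
      have i: "integrable lborel (\<lambda>t. indicator {0..T} t *\<^sub>R (norm (D n t))\<^sup>2)" by (rule locint_integrable[OF locL2_sq[OF Dl]])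
      have wd: "weak_deriv_on ?I (E n) (D n)" by (rule weak_deriv_prim[OF locL2_locint[OF Dl] _ ED]) auto
      have A: "(LINT t:?I|lborel. (norm (wderiv ?I (E n) t))\<^sup>2) \<le> P n"
        unfolding P_def prim_def set_lebesgue_integral_def
      proof (rule integral_mono_AE'[OF i])
        show "AE t in lborel. indicat_real ?I t *\<^sub>R (norm (wderiv ?I (E n) t))\<^sup>2 \<le> indicat_real {0..T} t *\<^sub>R (norm (D n t))\<^sup>2"
          using wderiv_AE[OF open_greaterThanLessThan wd] by eventually_elim (auto simp: indicator_def)
      qed simp
      have B: "(LINT t:?I|lborel. (norm (E n t))\<^sup>2) \<le> (\<integral>t. indicator {0..T} t * (((T + 1) / 2)\<^sup>2 * P n) \<partial>lborel)"
        unfolding set_lebesgue_integral_def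
      proof (rule integral_mono_AE'[OF integrable_indicator_const])
        show "AE t in lborel. indicat_real ?I t *\<^sub>R (norm (E n t))\<^sup>2 \<le> indicat_real {0..T} t * (((T + 1) / 2)\<^sup>2 * P n)"
        proof (rule AE_I2)
          fix t
          show "indicat_real ?I t *\<^sub>R (norm (E n t))\<^sup>2 \<le> indicat_real {0..T} t * (((T + 1) / 2)\<^sup>2 * P n)"
          proof (cases "t \<in> ?I")
            case True
            then have "norm (E n t) \<le> (T + 1) / 2 * sqrt (P n)"
              unfolding ED[OF True] P_def using prim_norm_L2[OF Dl, of t T] by simp
            then have "(norm (E n t))\<^sup>2 \<le> ((T + 1) / 2 * sqrt (P n))\<^sup>2" by (rule power_mono) simp
            moreover have "((T + 1) / 2 * sqrt (P n))\<^sup>2 = ((T + 1) / 2)\<^sup>2 * P n" using P0[of n] by (simp only: power_mult_distrib real_sqrt_pow2)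
            moreover have "t \<in> {0..T}" using True by simp
            ultimately show ?thesis using True by (simp only: indicator_simps) simp
          next
            case False
            then have "indicat_real ?I t = 0" by (rule indicator_simps(2))
            moreover have "0 \<le> indicat_real {0..T} t * (((T + 1) / 2)\<^sup>2 * P n)" using P0[of n] by simp
            ultimately show ?thesis by (simp only: scaleR_zero_left)
          qed
        qed
      qed (use P0[of n] in simp)
      have eq: "(\<integral>t. indicator {0..T} t * (((T + 1) / 2)\<^sup>2 * P n) \<partial>lborel) = T * ((T + 1) / 2)\<^sup>2 * P n" using T by simp
      have "?K * P n = T * ((T + 1) / 2)\<^sup>2 * P n + P n" by (simp add: distrib_right)
      then show ?thesis unfolding H1_norm_def using A B unfolding eq by (intro real_sqrt_le_mono) linarith
    qed
    have N0: "0 \<le> H1_norm ?I u" for u :: "real \<Rightarrow> 'b"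
      unfolding H1_norm_def set_lebesgue_integral_def
      by (intro real_sqrt_ge_zero add_nonneg_nonneg integral_nonneg_AE AE_I2) simp_all
    have "(\<lambda>n. sqrt (?K * P n)) \<longlonglongrightarrow> sqrt (?K * 0)" by (intro tendsto_intros P)
    then have "(\<lambda>n. sqrt (?K * P n)) \<longlonglongrightarrow> 0" by simp
    then have "(\<lambda>n. H1_norm ?I (E n)) \<longlonglongrightarrow> 0"
      by (intro tendsto_sandwich[OF _ _ tendsto_const[of 0], of "\<lambda>n. H1_norm ?I (E n)" sequentially "\<lambda>n. sqrt (?K * P n)"] always_eventually allI N N0)
    then have "(\<lambda>n. C * H1_norm ?I (E n)) \<longlonglongrightarrow> 0" by (rule tendsto_mult_right_zero)
    then have LE: "(\<lambda>n. \<Lambda> (E n)) \<longlonglongrightarrow> 0"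
      by (rule Lim_null_comparison[rotated]) (use C[OF bE] in simp)
    have "comb (c n) (\<lambda>k. \<Lambda> (U (s k))) = \<Lambda> (E n) + \<Lambda> w" for n
    proof -
      have "finite {i. c n i \<noteq> 0}" using c by (simp add: fwd_def)
      note sm = H1_functional_sum[OF L bU this, of "\<lambda>i. c n i" s, folded comb_def]
      have "bounded_prim ?I (\<lambda>t. (- 1) *\<^sub>R w t + 0)"
        by (rule bounded_prim_scale_add[OF bw], rule bounded_primI[of "\<lambda>t. 0" 0 _ _ 0]) simp_all
      then have "H1_on ?I (\<lambda>t. (- 1) *\<^sub>R w t)" unfolding add_0_right by (rule bounded_prim_H1)
      then have "\<Lambda> (E n) = \<Lambda> (\<lambda>t. comb (c n) (\<lambda>k. U (s k) t)) + \<Lambda> (\<lambda>t. (- 1) *\<^sub>R w t)"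
        unfolding E_def[abs_def]
        using L bounded_prim_H1[OF conjunct1[OF sm]] unfolding H1_functional_def by blast
      also have "\<Lambda> (\<lambda>t. (- 1) *\<^sub>R w t) = - 1 * \<Lambda> w"
        using L bounded_prim_H1[OF bw] unfolding H1_functional_def by blast
      finally show ?thesis using sm by simp
    qed
    then have "(\<lambda>n. comb (c n) (\<lambda>k. \<Lambda> (U (s k)))) \<longlonglongrightarrow> \<Lambda> w"
      using tendsto_add[OF LE tendsto_const[of "\<Lambda> w"]] by simp
    then show "\<exists>c. (\<forall>n. c n \<in> fwd n) \<and> (\<lambda>n. comb (c n) (\<lambda>k. \<Lambda> (U (s k)))) \<longlonglongrightarrow> \<Lambda> w" using c by blast
  qed
qed

text \<open>The integral over \<open>(0, T)\<close>, paired with a vector, is a bounded functional.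
  These functionals separate continuous limits.\<close>

lemma H1_functional_prim:
  fixes h :: "'b::{real_inner, banach, second_countable_topology}"
  assumes T: "0 < T"
  shows "H1_functional {0<..<T} (\<lambda>f. inner (prim (\<lambda>t. indicator {0<..<T} t *\<^sub>R f t) T) h)"
  unfolding H1_functional_def
proof (intro conjI allI impI)
  let ?I = "{0<..<T}"
  let ?F = "\<lambda>f t. indicator ?I t *\<^sub>R (f t :: 'b)"
  have F: "locL2 (?F u)" if "H1_on ?I u" for u using that unfolding H1_on_def by (intro L2_on_extend) blast
  fix u v :: "real \<Rightarrow> 'b" and c :: real
  show "inner (prim (?F (\<lambda>t. u t + v t)) T) h = inner (prim (?F u) T) h + inner (prim (?F v) T) h" if "H1_on ?I u \<and> H1_on ?I v"
    unfolding scaleR_add_right using F that by (simp add: prim_add locL2_locint inner_add_left)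
  show "inner (prim (?F (\<lambda>t. c *\<^sub>R u t)) T) h = c * inner (prim (?F u) T) h" if "H1_on ?I u"
  proof -
    have "?F (\<lambda>t. c *\<^sub>R u t) = (\<lambda>t. c *\<^sub>R ?F u t)" by (simp add: mult.commute)
    then show ?thesis using prim_bounded_linear[OF bounded_linear_scaleR_right locL2_locint[OF F[OF that]], of c T] by simp
  qed
  show "\<exists>C. \<forall>u. H1_on ?I u \<longrightarrow> \<bar>inner (prim (?F u) T) h\<bar> \<le> C * H1_norm ?I u"
  proof (intro exI allI impI)
    fix u :: "real \<Rightarrow> 'b" assume u: "H1_on ?I u"
    have eq: "prim (\<lambda>t. (norm (?F u t))\<^sup>2) T = (LINT t:?I|lborel. (norm (u t))\<^sup>2)"
      unfolding prim_def set_lebesgue_integral_def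
      by (rule Bochner_Integration.integral_cong) (simp_all add: indicator_def)
    have n0: "0 \<le> (LINT t:?I|lborel. (norm (wderiv ?I u t))\<^sup>2)"
      unfolding set_lebesgue_integral_def by (intro integral_nonneg_AE AE_I2) simp
    have "\<bar>inner (prim (?F u) T) h\<bar> \<le> norm (prim (?F u) T) * norm h" by (rule Cauchy_Schwarz_ineq2)
    also have "\<dots> \<le> ((T + 1) / 2 * sqrt (prim (\<lambda>t. (norm (?F u t))\<^sup>2) T)) * norm h"
      by (intro mult_right_mono prim_norm_L2 F u) (use T in simp_all)
    also have "\<dots> \<le> ((T + 1) / 2 * H1_norm ?I u) * norm h"
      unfolding eq H1_norm_def using n0 T by (intro mult_right_mono mult_left_mono real_sqrt_le_mono) simp_all
    also have "\<dots> = ((T + 1) / 2 * norm h) * H1_norm ?I u" by simp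
    finally show "\<bar>inner (prim (?F u) T) h\<bar> \<le> ((T + 1) / 2 * norm h) * H1_norm ?I u" .
  qed
qed

text \<open>Both limits have the same integral over every \<open>(0, T)\<close> and are thus weak
  derivatives of the same primitive. This identifies a limit that is given in advance with the one
  that is constructed.\<close>

lemma H1_weak_limit_unique:
  fixes w w' :: "real \<Rightarrow> 'b::{real_inner, banach, second_countable_topology}"
  assumes c: "continuous_on {0..} w" "continuous_on {0..} w'"
    and lim: "\<And>T. 0 < T \<Longrightarrow> H1_weak_conv {0<..<T} U w" "\<And>T. 0 < T \<Longrightarrow> H1_weak_conv {0<..<T} U w'"
    and t: "0 \<le> t"
  shows "w t = w' t"
proof -
  have l: "locint w" "locint w'" by (intro locint_continuous c)+
  have eq: "prim w T = prim w' T" if T: "0 < T" for T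
  proof -
    let ?F = "\<lambda>f t. indicator {0<..<T} t *\<^sub>R (f t :: 'b)"
    have "inner (prim (?F w) T) h = inner (prim (?F w') T) h" for h
      using lim[OF T] H1_functional_prim[OF T, of h] unfolding H1_weak_conv_def by (blast intro: LIMSEQ_unique)
    then have "prim (?F w) T = prim (?F w') T" by (rule vector_eq_rdot[THEN iffD1, rule_format])
    moreover have "prim f T = prim (?F f) T" if "locint f" "H1_on {0<..<T} f" for f
    proof (rule prim_cong_AE[OF that(1)])
      show "locint (?F f)" using that(2) unfolding H1_on_def by (intro locL2_locint L2_on_extend) blast
    qed simp
    ultimately show ?thesis using l lim[OF T] unfolding H1_weak_conv_def by simp
  qed
  have "weak_deriv_on {0<..} (prim w) w" by (rule weak_deriv_prim[OF l(1), where c = 0]) simp_all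
  moreover have "weak_deriv_on {0<..} (prim w) w'" by (rule weak_deriv_prim[OF l(2), where c = 0]) (simp_all add: eq)
  ultimately have "AE t in lborel. t \<in> {0<..} \<longrightarrow> w t = w' t" by (rule weak_deriv_unique[OF open_greaterThan])
  then show ?thesis
    by (intro eq_on_closure_AE[OF open_greaterThan, of 0 w w' t]) (use c t in simp_all)
qed

section \<open>The limit path\<close>

definition (in potential) dual :: "'h \<Rightarrow> ('w \<Rightarrow>\<^sub>L real)" where
  "dual a = Blinfun (\<lambda>h. inner a (J h))"

lemma (in potential) dual_apply [simp]: "blinfun_apply (dual a) h = inner a (J h)"
  unfolding dual_def
  by (subst bounded_linear_Blinfun_apply) (rule bounded_linear_compose[OF bounded_linear_inner_right J], rule refl)

lemma (in potential) dual_diff: "dual a - dual b = dual (a - b)"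
  by (rule blinfun_eqI) (simp add: blinfun.diff_left inner_diff_left)

lemma (in potential) norm_dual_le: "0 \<le> c \<Longrightarrow> (\<And>h. \<bar>inner a (J h)\<bar> \<le> c * norm h) \<Longrightarrow> norm (dual a) \<le> c"
  by (rule norm_blinfun_bound) simp_all

text \<open>The function \<open>y\<close> is the weak limit of the velocities at every nonnegative
  time, including \<open>0\<close>, with values in the state space. The limit path is rebuilt from a
  measurable version of it.\<close>

locale limit_path = potential J \<W> K n D
  for J :: "'w::banach \<Rightarrow> 'h::{real_inner, banach, second_countable_topology}" and \<W> K n D +
  fixes w0 w1 :: 'w and \<epsilon> :: "nat \<Rightarrow> real" and z :: "nat \<Rightarrow> real \<Rightarrow> 'h" and y :: "real \<Rightarrow> 'h"
  assumes mp: "\<And>k. minimal_path J \<W> K n D w0 w1 (\<epsilon> k) (z k)" and eps: "\<epsilon> \<longlonglongrightarrow> 0"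
    and yb: "\<And>t. 0 \<le> t \<Longrightarrow> norm (y t) \<le> sqrt (2 * EE w0 w1)"
    and conv: "\<And>t h. 0 \<le> t \<Longrightarrow> (\<lambda>k. inner (vel (J w1) (z k) t) h) \<longlonglongrightarrow> inner (y t) h"

text \<open>Tested against images \<open>J h\<close> the velocities are Lipschitz continuous in time
  with a constant independent of \<open>\<epsilon>\<close>. The image of \<open>D\<close> is
  countable and dense, so \<open>weak_subsequence\<close> applies.\<close>

lemma (in potential) limit_path_exists:
  assumes mp: "\<And>k. minimal_path J \<W> K n D w0 w1 (\<epsilon> k) (z k)" and eps: "\<epsilon> \<longlonglongrightarrow> 0"
  obtains r y where "strict_mono r" "limit_path J \<W> K n D w0 w1 (\<lambda>k. \<epsilon> (r k)) (\<lambda>k. z (r k)) y"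
proof -
  let ?v = "\<lambda>k. vel (J w1) (z k)"
  show ?thesis
  proof (rule weak_subsequence[of ?v "\<lambda>t. sqrt (2 * EE w0 w1)" "J ` D"])
    show "norm (?v k t) \<le> sqrt (2 * EE w0 w1)" if "0 \<le> t" for k t by (rule minimal_path.vel_le[OF mp that])
    show "countable (J ` D)" by (rule countable_image[OF D(1)])
    have "range J \<subseteq> closure (J ` D)" using closure_bounded_linear_image_subset[OF J, of D] D(2) by simp
    then have "closure (range J) \<subseteq> closure (J ` D)" by (rule closure_minimal) simp
    then show "closure (J ` D) = UNIV" using dense by auto
    fix d and t e :: real assume "d \<in> J ` D" and t: "0 \<le> t" and e: "0 < e"
    then obtain h where d: "d = J h" by blast
    let ?C = "C2 w0 w1 * norm h"
    have C: "0 \<le> ?C" using C2_nonneg by simp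
    have lip: "\<bar>inner (?v k s - ?v k t) d\<bar> \<le> ?C * \<bar>s - t\<bar>" if s: "0 \<le> s" for k s
    proof (cases "s \<le> t")
      case True
      then show ?thesis using minimal_path.vel_lipschitz[OF mp s True, of k h] unfolding d
        by (simp add: inner_diff_left abs_minus_commute)
    next
      case False
      then show ?thesis using minimal_path.vel_lipschitz[OF mp t, of s k h] unfolding d by simp
    qed
    show "\<exists>\<delta>>0. \<forall>k. \<forall>s\<ge>0. \<bar>s - t\<bar> < \<delta> \<longrightarrow> \<bar>inner (?v k s - ?v k t) d\<bar> < e"
    proof (intro exI conjI allI impI)
      show "0 < e / (?C + 1)" using C e by simp
      fix k s assume s: "0 \<le> s" "\<bar>s - t\<bar> < e / (?C + 1)"
      have "\<bar>inner (?v k s - ?v k t) d\<bar> \<le> ?C * \<bar>s - t\<bar>" by (rule lip[OF s(1)])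
      also have "\<dots> \<le> ?C * (e / (?C + 1))" using C s(2) by (intro mult_left_mono) simp_all
      also have "\<dots> = e * (?C / (?C + 1))" by simp
      also have "\<dots> < e * 1" using C e by (intro mult_strict_left_mono) simp_all
      finally show "\<bar>inner (?v k s - ?v k t) d\<bar> < e" by simp
    qed
  next
    fix r y
    assume r: "strict_mono (r :: nat \<Rightarrow> nat)" and y: "\<And>t. 0 \<le> t \<Longrightarrow> norm (y t) \<le> sqrt (2 * EE w0 w1)"
      "\<And>t h. 0 \<le> t \<Longrightarrow> (\<lambda>k. inner (?v (r k) t) h) \<longlonglongrightarrow> inner (y t) h"
    have "limit_path J \<W> K n D w0 w1 (\<lambda>k. \<epsilon> (r k)) (\<lambda>k. z (r k)) y"
    proof (intro limit_path.intro limit_path_axioms.intro potential_axioms)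
      show "minimal_path J \<W> K n D w0 w1 (\<epsilon> (r k)) (z (r k))" for k by (rule mp)
      show "(\<lambda>k. \<epsilon> (r k)) \<longlonglongrightarrow> 0" using LIMSEQ_subseq_LIMSEQ[OF eps r] by (simp add: comp_def)
    qed (use y in simp_all)
    then show ?thesis using that r by blast
  qed
qed

context limit_path
begin

abbreviation "V \<equiv> sqrt (2 * EE w0 w1)"
abbreviation "vk k \<equiv> vel (J w1) (z k)"
abbreviation "uk k \<equiv> pth (J w0) (J w1) (z k)"

lemma zm: "z k \<in> borel_measurable borel" by (rule minimal_path.zm[OF mp])
lemma zi: "locint (z k)" by (rule minimal_path.zi[OF mp])
lemma vm: "vk k \<in> borel_measurable borel" by (rule measurable_vel[OF zi])
lemma vb: "0 \<le> t \<Longrightarrow> norm (vk k t) \<le> V" by (rule minimal_path.vel_le[OF mp])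
lemma e_pos: "0 < \<epsilon> k" and e_less: "\<epsilon> k < 1" by (rule minimal_path.e[OF mp], rule minimal_path.e1[OF mp])
lemma V0: "0 \<le> V" using EE_nonneg by simp

definition "x = (SOME x. x \<in> borel_measurable borel \<and> (\<forall>t. norm (x t) \<le> V) \<and> (AE t in lborel. 0 \<le> t \<longrightarrow> x t = y t))"
definition "w t = J w0 + prim x t"

lemma x: "x \<in> borel_measurable borel" "norm (x t) \<le> V" "AE t in lborel. 0 \<le> t \<longrightarrow> x t = y t"
proof -
  have "\<exists>x. x \<in> borel_measurable borel \<and> (\<forall>t. norm (x t) \<le> V) \<and> (AE t in lborel. 0 \<le> t \<longrightarrow> x t = y t)"
  proof (rule weak_limit_representative[of vk V y, OF vm], rule vb, assumption, rule conv, assumption)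
    fix c x assume x: "x \<in> borel_measurable borel" "\<And>t. norm (x t) \<le> V"
      and ae: "AE t in lborel. 0 \<le> t \<longrightarrow> x t = y t \<and> (\<lambda>n. comb (c n) (\<lambda>k. vk k t)) \<longlonglongrightarrow> x t"
    have "AE t in lborel. 0 \<le> t \<longrightarrow> x t = y t" using ae by (rule eventually_mono) simp
    with x show ?thesis by blast
  qed
  from someI_ex[OF this] show "x \<in> borel_measurable borel" "norm (x t) \<le> V" "AE t in lborel. 0 \<le> t \<longrightarrow> x t = y t"
    unfolding x_def by blast+
qed

lemma xl: "locL2 x" by (rule bounded_locL2[OF x(1,2)])

lemma w_0: "w 0 = J w0" by (simp add: w_def)

lemma w_continuous: "continuous_on A w"
  unfolding w_def[abs_def] by (intro continuous_intros continuous_prim locL2_locint xl)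

lemma y_0: "y 0 = J w1"
proof (rule vector_eq_rdot[THEN iffD1, rule_format])
  fix h
  show "inner (y 0) h = inner (J w1) h"
    by (rule LIMSEQ_unique[OF conv]) simp_all
qed

lemma y_lipschitz:
  assumes "0 \<le> s" "s \<le> t"
  shows "\<bar>inner (y t - y s) (J h)\<bar> \<le> C2 w0 w1 * norm h * (t - s)"
proof (rule LIMSEQ_le_const2)
  have "(\<lambda>k. \<bar>inner (vk k t) (J h) - inner (vk k s) (J h)\<bar>) \<longlonglongrightarrow> \<bar>inner (y t) (J h) - inner (y s) (J h)\<bar>"
    by (intro tendsto_intros conv) (use assms in simp_all)
  then show "(\<lambda>k. \<bar>inner (vk k t - vk k s) (J h)\<bar>) \<longlonglongrightarrow> \<bar>inner (y t - y s) (J h)\<bar>" by (simp only: inner_diff_left)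
  show "\<exists>N. \<forall>k\<ge>N. \<bar>inner (vk k t - vk k s) (J h)\<bar> \<le> C2 w0 w1 * norm h * (t - s)"
    using minimal_path.vel_lipschitz[OF mp assms] by blast
qed

text \<open>The Lipschitz bound survives the weak limit because it holds for each direction
  separately. The map is the representative demanded by \<open>initial_velocity\<close>.\<close>

lemma dual_lipschitz: "(C2 w0 w1)-lipschitz_on {0..} (\<lambda>t. dual (y t))"
proof (rule lipschitz_onI[OF _ C2_nonneg])
  fix s t :: real assume st: "s \<in> {0..}" "t \<in> {0..}"
  show "dist (dual (y s)) (dual (y t)) \<le> C2 w0 w1 * dist s t"
    unfolding dist_norm dual_diff
  proof (rule norm_dual_le)
    show "0 \<le> C2 w0 w1 * norm (s - t)" using C2_nonneg by simp
    fix h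
    have "\<bar>inner (y s - y t) (J h)\<bar> \<le> C2 w0 w1 * norm h * \<bar>s - t\<bar>"
    proof (cases "s \<le> t")
      case True
      then show ?thesis using y_lipschitz[of s t h] st by (simp add: inner_diff_left abs_minus_commute)
    next
      case False
      then show ?thesis using y_lipschitz[of t s h] st by simp
    qed
    then show "\<bar>inner (y s - y t) (J h)\<bar> \<le> C2 w0 w1 * norm (s - t) * norm h" by (simp add: mult_ac)
  qed
qed

lemma u_conv:
  assumes t: "0 \<le> t" shows "(\<lambda>k. inner (uk k t) h) \<longlonglongrightarrow> inner (w t) h"
proof -
  have "(\<lambda>k. inner (prim (vk k) t) h) \<longlonglongrightarrow> inner (prim x t) h"
  proof (rule inner_prim_tendsto[OF locint_vel[OF zi] locL2_locint[OF xl] vb])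
    show "AE s in lborel. 0 < s \<longrightarrow> (\<lambda>k. inner (vk k s) h) \<longlonglongrightarrow> inner (x s) h"
      using x(3) by (rule eventually_mono) (use conv in simp)
  qed
  then show ?thesis unfolding pth_def w_def inner_add_left by (rule tendsto_add[OF tendsto_const])
qed

lemma w_H1_weak:
  assumes "0 < T" "\<And>k t. 0 \<le> t \<Longrightarrow> U k t = uk k t"
  shows "H1_weak_conv {0<..<T} U w"
  by (rule H1_weak_conv_prim[of T vk V y x U "J w0" w, OF assms(1) vm], rule vb, assumption, rule conv, assumption)
     (use x in \<open>simp_all add: assms(2) pth_def w_def\<close>)

lemma w_weak_deriv: "weak_deriv_on {0<..} w x"
  by (rule weak_deriv_prim[OF locL2_locint[OF xl]]) (simp_all add: w_def)

lemma w_wderiv: "AE t in lborel. 0 < t \<longrightarrow> wderiv {0<..} w t = y t"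
  using wderiv_AE[OF open_greaterThan w_weak_deriv] x(3) by eventually_elim simp

lemma w_H1_loc: "H1_loc w"
  unfolding H1_loc_def
  by (intro allI impI bounded_prim_H1 bounded_primI[OF x(1) x(2)]) (simp add: w_def)

text \<open>From the choice behind \<open>wderiv\<close> only local integrability is available;
  measurability on the half line follows by exhausting it with compact intervals.\<close>

lemma w_Linf: "Linf_on {0<..} (wderiv {0<..} w)"
  unfolding Linf_on_def
proof (intro conjI exI)
  let ?d = "wderiv {0<..} w"
  have li: "loc_integrable_on {0<..} ?d"
    using wderiv_weak_deriv[OF w_weak_deriv] by (simp add: weak_deriv_on_def)
  show "set_borel_measurable lborel {0<..} ?d" unfolding set_borel_measurable_def
  proof (rule borel_measurable_LIMSEQ_metric)
    fix k
    have "compact {inverse (real (Suc k))..real k} \<and> {inverse (real (Suc k))..real k} \<subseteq> {0<..}"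
      by (auto intro: less_le_trans[of 0 "inverse (1 + real k)"])
    then have "set_integrable lborel {inverse (real (Suc k))..real k} ?d"
      using li unfolding loc_integrable_on_def by blast
    then show "(\<lambda>t. indicat_real {inverse (real (Suc k))..real k} t *\<^sub>R ?d t) \<in> borel_measurable lborel"
      using set_integrable_measurable by simp
  next
    fix t :: real
    show "(\<lambda>k. indicat_real {inverse (real (Suc k))..real k} t *\<^sub>R ?d t) \<longlonglongrightarrow> indicat_real {0<..} t *\<^sub>R ?d t"
    proof (cases "0 < t")
      case True
      have "\<forall>\<^sub>F k in sequentially. inverse (real (Suc k)) < t" by (rule order_tendstoD(2)[OF LIMSEQ_inverse_real_of_nat True])
      moreover have "\<forall>\<^sub>F k in sequentially. t \<le> real k"
        by (rule eventually_sequentiallyI[of "nat \<lceil>t\<rceil>"]) linarith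
      ultimately have "\<forall>\<^sub>F k in sequentially. indicat_real {inverse (real (Suc k))..real k} t *\<^sub>R ?d t = indicat_real {0<..} t *\<^sub>R ?d t"
        by eventually_elim (use True in \<open>simp add: less_imp_le\<close>)
      then show ?thesis by (rule tendsto_eventually)
    next
      case False
      have "t < inverse (real (Suc k))" for k using False by (rule_tac le_less_trans[of t 0]) simp_all
      then have "indicat_real {inverse (real (Suc k))..real k} t = 0" for k by (simp add: not_le)
      then show ?thesis using False by (simp only:) simp
    qed
  qed
  show "AE t in lborel. t \<in> {0<..} \<longrightarrow> norm (?d t) \<le> V"
    using w_wderiv by eventually_elim (use yb in simp)
qed

text \<open>After the substitution \<open>s = t + \<epsilon> k * r\<close> the kernel becomes
  \<open>r * exp (- r)\<close>, independent of \<open>k\<close> and of mass one, while the paths at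
  the shifted times converge weakly to \<open>w t\<close> for each \<open>r\<close>.\<close>

lemma energy_le:
  assumes t: "0 \<le> t"
  shows "ennreal ((norm (y t))\<^sup>2 / 2) + \<W> (w t) \<le> ennreal ((norm (J w1))\<^sup>2 / 2 + W0 w0)"
proof -
  define E where "E = (norm (J w1))\<^sup>2 / 2 + W0 w0"
  define A where "A = (norm (y t))\<^sup>2 / 2"
  define I where "I k = (\<integral>\<^sup>+r. (ennreal (exp (- r / 1) * (r / 1) ^ 1) * \<W> (uk k (t + \<epsilon> k * r))) * indicator {0..} r \<partial>lborel)" for k
  \<comment> \<open>The kinetic term is bounded below by the expression
    \<open>inner (vk k t) (y t) - A\<close>, whose limit is \<open>A\<close>. This contains the
    lower semicontinuity of the norm and makes the right-hand side convergent.\<close>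
  define B where "B k = E + \<epsilon> k * C1 w0 w1 - inner (vk k t) (y t) + A" for k
  have Wm [measurable]: "(\<lambda>t. \<W> (uk k t)) \<in> borel_measurable borel" for k by (rule W_measurable_pth[OF zi])
  have IB: "I k \<le> ennreal (B k) \<and> 0 \<le> B k" for k
  proof -
    interpret m: minimal_path J \<W> K n D w0 w1 "\<epsilon> k" "z k" by (rule mp)
    let ?L = "\<integral>\<^sup>+s. ennreal (m.kern t s) * \<W> (uk k s) \<partial>lborel"
    have "?L = ennreal \<bar>\<epsilon> k\<bar> * (\<integral>\<^sup>+r. ennreal (m.kern t (t + \<epsilon> k * r)) * \<W> (uk k (t + \<epsilon> k * r)) \<partial>lborel)"
      by (rule nn_integral_real_affine[of "\<lambda>s. ennreal (m.kern t s) * \<W> (uk k s)"]) (measurable, use m.e_nz in simp)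
    also have "\<dots> = (\<integral>\<^sup>+r. ennreal \<bar>\<epsilon> k\<bar> * (ennreal (m.kern t (t + \<epsilon> k * r)) * \<W> (uk k (t + \<epsilon> k * r))) \<partial>lborel)"
      by (rule nn_integral_cmult[symmetric]) measurable
    also have "\<dots> = I k" unfolding I_def
    proof (rule nn_integral_cong)
      fix r :: real
      show "ennreal \<bar>\<epsilon> k\<bar> * (ennreal (m.kern t (t + \<epsilon> k * r)) * \<W> (uk k (t + \<epsilon> k * r)))
        = ennreal (exp (- r / 1) * (r / 1) ^ 1) * \<W> (uk k (t + \<epsilon> k * r)) * indicator {0..} r"
      proof (cases "0 \<le> r")
        case True
        have "\<bar>\<epsilon> k\<bar> * m.kern t (t + \<epsilon> k * r) = exp (- r / 1) * (r / 1) ^ 1"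
          using True m.e by (simp add: m.kern_def power2_eq_square)
        then have "ennreal \<bar>\<epsilon> k\<bar> * ennreal (m.kern t (t + \<epsilon> k * r)) = ennreal (exp (- r / 1) * (r / 1) ^ 1)"
          by (simp only: ennreal_mult'[symmetric] abs_ge_zero)
        then show ?thesis using True by (simp add: mult.assoc[symmetric])
      next
        case False
        then have "m.kern t (t + \<epsilon> k * r) = 0" using m.e by (simp add: m.kern_def zero_le_mult_iff)
        then show ?thesis using False by simp
      qed
    qed
    finally have le: "ennreal ((norm (vk k t))\<^sup>2 / 2) + I k \<le> ennreal (E + \<epsilon> k * C1 w0 w1)"
      using m.energy_nn[OF t] by (simp only: E_def)
    then have "I k < \<infinity>" by (simp add: le_less_trans[OF order_trans[OF add_increasing[OF zero_le order_refl] le]])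
    then obtain i where i: "I k = ennreal i" "0 \<le> i" by (cases "I k") auto
    have EC: "0 \<le> E + \<epsilon> k * C1 w0 w1" using W0_nonneg C1_nonneg m.e by (simp add: E_def)
    have "ennreal ((norm (vk k t))\<^sup>2 / 2) + ennreal i = ennreal ((norm (vk k t))\<^sup>2 / 2 + i)"
      by (rule ennreal_plus[symmetric]) (use i in simp_all)
    then have "(norm (vk k t))\<^sup>2 / 2 + i \<le> E + \<epsilon> k * C1 w0 w1"
      using le EC unfolding i(1) by (simp only: ennreal_le_iff)
    moreover have "inner (vk k t) (y t) \<le> (norm (vk k t))\<^sup>2 / 2 + A"
    proof -
      have "0 \<le> (norm (vk k t - y t))\<^sup>2" by simp
      also have "\<dots> = (norm (vk k t))\<^sup>2 - 2 * inner (vk k t) (y t) + (norm (y t))\<^sup>2"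
        unfolding power2_norm_eq_inner by (simp add: inner_diff_left inner_diff_right inner_commute)
      finally show ?thesis by (simp add: A_def)
    qed
    ultimately have "i \<le> B k" unfolding B_def by linarith
    then show ?thesis using i by (simp add: ennreal_leI)
  qed
  have Blim: "B \<longlonglongrightarrow> E - A"
  proof -
    have "B \<longlonglongrightarrow> E + 0 * C1 w0 w1 - inner (y t) (y t) + A"
      unfolding B_def[abs_def] by (intro tendsto_intros eps conv t)
    moreover have "inner (y t) (y t) = A + A" by (simp add: A_def power2_norm_eq_inner)
    ultimately show ?thesis by simp
  qed
  have EA: "0 \<le> E - A" by (rule LIMSEQ_le_const[OF Blim]) (use IB in blast)
  have W_le: "\<W> (w t) \<le> liminf (\<lambda>k. \<W> (uk k (t + \<epsilon> k * r)))" if r: "0 \<le> r" for r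
  proof (rule lsc)
    have s: "0 \<le> \<epsilon> k * r" "\<epsilon> k * r \<le> r" for k
      using r e_pos[of k] e_less[of k] mult_left_le_one_le[of r "\<epsilon> k"] by simp_all
    show "norm (uk k (t + \<epsilon> k * r)) \<le> norm (J w0) + V * (t + r)" for k
    proof -
      have "norm (uk k (t + \<epsilon> k * r)) \<le> norm (J w0) + V * (t + \<epsilon> k * r)"
        using s[of k] t by (intro minimal_path.path_le[OF mp]) simp
      also have "\<dots> \<le> norm (J w0) + V * (t + r)" using s(2)[of k] V0 by (intro add_left_mono mult_left_mono) simp_all
      finally show ?thesis .
    qed
    fix h
    have "(\<lambda>k. inner (prim (vk k) (t + \<epsilon> k * r) - prim (vk k) t) h) \<longlonglongrightarrow> 0"
    proof (rule Lim_null_comparison)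
      have "(\<lambda>k. V * (\<epsilon> k * r) * norm h) \<longlonglongrightarrow> V * (0 * r) * norm h" by (intro tendsto_intros eps)
      then show "(\<lambda>k. V * (\<epsilon> k * r) * norm h) \<longlonglongrightarrow> 0" by simp
      show "\<forall>\<^sub>F k in sequentially. norm (inner (prim (vk k) (t + \<epsilon> k * r) - prim (vk k) t) h) \<le> V * (\<epsilon> k * r) * norm h"
      proof (intro always_eventually allI)
        fix k
        have "norm (prim (vk k) (t + \<epsilon> k * r) - prim (vk k) t) \<le> V * (t + \<epsilon> k * r - t)"
          by (rule prim_diff_bounded[OF locint_vel[OF zi] t]) (use s[of k] t in \<open>auto intro: vb\<close>)
        then have "norm (prim (vk k) (t + \<epsilon> k * r) - prim (vk k) t) * norm h \<le> V * (\<epsilon> k * r) * norm h"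
          by (intro mult_right_mono) simp_all
        then show "norm (inner (prim (vk k) (t + \<epsilon> k * r) - prim (vk k) t) h) \<le> V * (\<epsilon> k * r) * norm h"
          unfolding real_norm_def by (rule order_trans[OF Cauchy_Schwarz_ineq2])
      qed
    qed
    from tendsto_add[OF u_conv[OF t] this, of h]
    show "(\<lambda>k. inner (uk k (t + \<epsilon> k * r)) h) \<longlonglongrightarrow> inner (w t) h"
      by (simp add: pth_def inner_add_left inner_diff_left)
  qed
  have "\<W> (w t) = (\<integral>\<^sup>+r. ennreal (exp (- r / 1) * (r / 1) ^ 1) * indicator {0..} r * \<W> (w t) \<partial>lborel)"
    using nn_integral_exp_power[of 1 1] by (subst nn_integral_multc) simp_all
  also have "\<dots> \<le> (\<integral>\<^sup>+r. liminf (\<lambda>k. (ennreal (exp (- r / 1) * (r / 1) ^ 1) * \<W> (uk k (t + \<epsilon> k * r))) * indicator {0..} r) \<partial>lborel)"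
  proof (rule nn_integral_mono)
    fix r :: real
    show "ennreal (exp (- r / 1) * (r / 1) ^ 1) * indicator {0..} r * \<W> (w t)
      \<le> liminf (\<lambda>k. (ennreal (exp (- r / 1) * (r / 1) ^ 1) * \<W> (uk k (t + \<epsilon> k * r))) * indicator {0..} r)"
    proof (cases "0 \<le> r")
      case True
      have "ennreal (exp (- r / 1) * (r / 1) ^ 1) * \<W> (w t) \<le> ennreal (exp (- r / 1) * (r / 1) ^ 1) * liminf (\<lambda>k. \<W> (uk k (t + \<epsilon> k * r)))"
        by (rule mult_left_mono[OF W_le[OF True]]) simp
      also have "\<dots> = liminf (\<lambda>k. ennreal (exp (- r / 1) * (r / 1) ^ 1) * \<W> (uk k (t + \<epsilon> k * r)))"
        by (rule liminf_cmult_ennreal[symmetric]) simp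
      finally show ?thesis using True by simp
    qed simp
  qed
  also have "\<dots> \<le> liminf I" unfolding I_def by (rule nn_integral_liminf) measurable
  also have "\<dots> \<le> liminf (\<lambda>k. ennreal (B k))" using IB by (intro Liminf_mono always_eventually) blast
  also have "\<dots> = ennreal (E - A)" by (intro lim_imp_Liminf tendsto_ennrealI Blim) simp
  finally have "ennreal A + \<W> (w t) \<le> ennreal A + ennreal (E - A)" by (rule add_left_mono)
  also have "\<dots> = ennreal (A + (E - A))" by (rule ennreal_plus[symmetric]) (use EA in \<open>simp_all add: A_def\<close>)
  finally show ?thesis by (simp add: A_def E_def)
qed

text \<open>A weak-* limit of the accelerations, constructed for countably many directions at once.
  Their pairings are one bounded sequence in mean square on the product of the natural numbers and
  the half line, so a single choice of convex combinations converges at almost every time for all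
  directions of \<open>D\<close>; the uniform bound extends this to all of \<open>W\<close>.\<close>

lemma second_derivative:
  obtains Z :: "real \<Rightarrow> 'w \<Rightarrow> real" where "\<And>t. bounded_linear (Z t)" "\<And>t h. \<bar>Z t h\<bar> \<le> C2 w0 w1 * norm h"
    "\<And>h. (\<lambda>t. Z t h) \<in> borel_measurable borel"
    "\<And>t h. 0 \<le> t \<Longrightarrow> inner (y t) (J h) = inner (J w1) (J h) + prim (\<lambda>s. Z s h) t"
proof -
  let ?C = "C2 w0 w1"
  have C: "0 \<le> ?C" by (rule C2_nonneg)
  note [measurable] = zm
  have D0: "D \<noteq> {}" using D(2) by auto
  define e where "e = from_nat_into D"
  have e: "range e = D" unfolding e_def by (rule range_from_nat_into[OF D0 D(1)])
  let ?M = "(count_space UNIV :: nat measure) \<Otimes>\<^sub>M (lborel :: real measure)"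
  \<comment> \<open>The factors \<open>(1 / 2) ^ fst p\<close> and \<open>exp (- snd p / 2)\<close>
    make bounded pairings square summable in the direction and square integrable in time; division
    by \<open>1 + norm\<close> compensates the size of the direction.\<close>
  define f where "f k p = indicator {0..} (snd p) * (exp (- snd p / 2) * ((1 / 2) ^ fst p * (inner (z k (snd p)) (J (e (fst p))) / (1 + norm (e (fst p))))))" for k p
  have fm [measurable]: "f k \<in> borel_measurable ?M" for k
    by (rule measurable_pair_measure_countable1) (simp, unfold f_def[abs_def] fst_conv snd_conv, measurable)
  have ab: "AE t in lborel. \<forall>k. 0 < t \<longrightarrow> (\<forall>h. \<bar>inner (z k t) (J h)\<bar> \<le> ?C * norm h)"
    unfolding AE_all_countable using minimal_path.accel_bound[OF mp] by blast
  define S where "S = (\<Sum>j. ?C\<^sup>2 * (1 / 4 :: real) ^ j)"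
  have sm: "summable (\<lambda>j. ?C\<^sup>2 * (1 / 4 :: real) ^ j)" by (intro summable_mult summable_geometric) simp
  have S0: "0 \<le> S" unfolding S_def by (rule suminf_nonneg[OF sm]) simp
  have nn: "(\<integral>\<^sup>+p. ennreal ((norm (f k p))\<^sup>2) \<partial>?M) \<le> ennreal S" for k
  proof -
    have "(\<integral>\<^sup>+p. ennreal ((norm (f k p))\<^sup>2) \<partial>?M) = (\<integral>\<^sup>+j. \<integral>\<^sup>+t. ennreal ((norm (f k (j, t)))\<^sup>2) \<partial>lborel \<partial>count_space UNIV)"
      by (rule lborel.nn_integral_fst[symmetric]) measurable
    also have "\<dots> = (\<Sum>j. \<integral>\<^sup>+t. ennreal ((norm (f k (j, t)))\<^sup>2) \<partial>lborel)" by (rule nn_integral_count_space_nat)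
    also have "\<dots> \<le> (\<Sum>j. ennreal (?C\<^sup>2 * (1 / 4) ^ j))"
    proof (intro suminf_le summableI)
      fix j
      have "(\<integral>\<^sup>+t. ennreal ((norm (f k (j, t)))\<^sup>2) \<partial>lborel)
        \<le> (\<integral>\<^sup>+t. ennreal (?C\<^sup>2 * (1 / 4) ^ j) * (ennreal (exp (- t / 1) * (t / 1) ^ 0) * indicator {0..} t) \<partial>lborel)"
      proof (rule nn_integral_mono_AE)
        show "AE t in lborel. ennreal ((norm (f k (j, t)))\<^sup>2)
            \<le> ennreal (?C\<^sup>2 * (1 / 4) ^ j) * (ennreal (exp (- t / 1) * (t / 1) ^ 0) * indicator {0..} t)"
          using ab AE_lborel_singleton[of 0]
        proof eventually_elim
          case (elim t)
          show ?case
          proof (cases "0 < t")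
            case False
            then show ?thesis using elim by (simp add: f_def)
          next
            case True
            define q where "q = inner (z k t) (J (e j)) / (1 + norm (e j))"
            have d: "0 < 1 + norm (e j)" by (rule add_pos_nonneg) simp_all
            have "\<bar>inner (z k t) (J (e j))\<bar> \<le> ?C * norm (e j)" using elim(1) True by blast
            also have "\<dots> \<le> ?C * (1 + norm (e j))" by (intro mult_left_mono C) simp
            finally have "\<bar>q\<bar> \<le> ?C" using d by (simp add: q_def abs_divide pos_divide_le_eq)
            then have q: "q\<^sup>2 \<le> ?C\<^sup>2" using power_mono[of "\<bar>q\<bar>" ?C 2] by simp
            have "(norm (f k (j, t)))\<^sup>2 = (exp (- t / 2))\<^sup>2 * (((1 / 2) ^ j)\<^sup>2 * q\<^sup>2)"
            proof -
              have "f k (j, t) = exp (- t / 2) * ((1 / 2) ^ j * q)" using True by (simp add: f_def q_def)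
              then show ?thesis by (simp only: real_norm_def power2_abs power_mult_distrib)
            qed
            also have "(exp (- t / 2))\<^sup>2 = exp (- t)" by (simp add: power2_eq_square exp_add[symmetric])
            also have "((1 / 2 :: real) ^ j)\<^sup>2 = (1 / 4) ^ j" 
            proof -
              have "((1 / 2 :: real) ^ j)\<^sup>2 = ((1 / 2)\<^sup>2) ^ j" by (simp only: power_mult[symmetric] mult.commute)
              then show ?thesis by (simp add: power2_eq_square)
            qed
            also have "exp (- t) * ((1 / 4) ^ j * q\<^sup>2) \<le> exp (- t) * ((1 / 4) ^ j * ?C\<^sup>2)"
              by (intro mult_left_mono q) simp_all
            also have "\<dots> = ?C\<^sup>2 * (1 / 4) ^ j * exp (- t)" by simp
            finally have "ennreal ((norm (f k (j, t)))\<^sup>2) \<le> ennreal (?C\<^sup>2 * (1 / 4) ^ j * exp (- t))" by (rule ennreal_leI)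
            also have "\<dots> = ennreal (?C\<^sup>2 * (1 / 4) ^ j) * ennreal (exp (- t))" by (rule ennreal_mult') simp
            finally show ?thesis using True by simp
          qed
        qed
      qed
      also have "\<dots> = ennreal (?C\<^sup>2 * (1 / 4) ^ j) * (\<integral>\<^sup>+t. ennreal (exp (- t / 1) * (t / 1) ^ 0) * indicator {0..} t \<partial>lborel)"
        by (rule nn_integral_cmult) measurable
      also have "\<dots> = ennreal (?C\<^sup>2 * (1 / 4) ^ j)" unfolding nn_integral_exp_power[OF zero_less_one] by simp
      finally show "(\<integral>\<^sup>+t. ennreal ((norm (f k (j, t)))\<^sup>2) \<partial>lborel) \<le> ennreal (?C\<^sup>2 * (1 / 4) ^ j)" .
    qed
    also have "\<dots> = ennreal S" unfolding S_def by (rule suminf_ennreal2[OF _ sm]) simp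
    finally show ?thesis .
  qed
  have sf: "sqint ?M (f k)" for k by (rule sqint_nnI[OF fm le_less_trans[OF nn]]) simp
  have sb: "(\<integral>p. (norm (f k p))\<^sup>2 \<partial>?M) \<le> S" for k
    using nn[of k] S0 unfolding sqint_nn[OF sf] by (simp only: ennreal_le_iff)
  obtain c g where c: "\<And>n. c n \<in> fwd n" and cg: "AE p in ?M. (\<lambda>n. comb (c n) (\<lambda>k. f k p)) \<longlonglongrightarrow> g p"
    by (rule fwd_L2[OF sf sb]) (rule that)
  interpret P: pair_sigma_finite "count_space UNIV :: nat measure" "lborel :: real measure"
    by (intro pair_sigma_finite.intro sigma_finite_measure_count_space lborel.sigma_finite_measure_axioms)
  have "AE t in lborel. \<forall>j. (\<lambda>n. comb (c n) (\<lambda>k. f k (j, t))) \<longlonglongrightarrow> g (j, t)"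
    unfolding AE_all_countable using P.AE_pair[OF cg] by (simp add: AE_count_space)
  with ab have "AE t in lborel. (\<forall>k. 0 < t \<longrightarrow> (\<forall>h. \<bar>inner (z k t) (J h)\<bar> \<le> ?C * norm h))
      \<and> (\<forall>j. (\<lambda>n. comb (c n) (\<lambda>k. f k (j, t))) \<longlonglongrightarrow> g (j, t))" by eventually_elim (rule conjI)
  then obtain N where N: "N \<in> null_sets lborel"
    and bd: "\<And>t k h. t \<notin> N \<Longrightarrow> 0 < t \<Longrightarrow> \<bar>inner (z k t) (J h)\<bar> \<le> ?C * norm h"
    and cv: "\<And>t j. t \<notin> N \<Longrightarrow> (\<lambda>n. comb (c n) (\<lambda>k. f k (j, t))) \<longlonglongrightarrow> g (j, t)"
    by (elim AE_E3) simp
  have [measurable]: "N \<in> sets borel" using N by auto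
  \<comment> \<open>Outside \<open>G\<close> the combinations are set to zero, so that the bound and
    the convergence hold at every time and each \<open>Z t\<close> is bounded and linear.\<close>
  define G where "G = {0<..} - N"
  have [measurable]: "G \<in> sets borel" unfolding G_def by measurable
  let ?a = "\<lambda>n t h. comb (c n) (\<lambda>k. inner (z k t) (J h))"
  define F where "F n t h = indicator G t * ?a n t h" for n t h
  have lin: "linear J" using J by (rule bounded_linear.linear)
  have F_add: "F n t (h + h') = F n t h + F n t h'" for n t h h'
    unfolding F_def comb_def by (simp add: linear_add[OF lin] inner_add_right distrib_left sum.distrib)
  have F_scale: "F n t (r *\<^sub>R h) = r * F n t h" for n t r h
    unfolding F_def comb_def by (simp add: linear_scale[OF lin] sum_distrib_left mult_ac)
  have F_bound: "\<bar>F n t h\<bar> \<le> ?C * norm h" for n t h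
  proof (cases "t \<in> G")
    case True
    have "norm (?a n t h) \<le> ?C * norm h" by (rule comb_norm_le[OF c]) (use bd True in \<open>simp add: G_def\<close>)
    then show ?thesis using True by (simp add: F_def)
  qed (use C in \<open>simp add: F_def\<close>)
  have F_conv: "convergent (\<lambda>n. F n t h)" for t h
  proof (cases "t \<in> G")
    case False
    then show ?thesis by (simp add: F_def convergent_const)
  next
    case True
    then have t: "0 < t" "t \<notin> N" by (simp_all add: G_def)
    have D_conv: "convergent (\<lambda>n. F n t d)" if "d \<in> D" for d
    proof -
      have "d \<in> range e" using that by (simp only: e)
      then obtain j where j: "d = e j" by (rule rangeE)
      define \<kappa> where "\<kappa> = exp (- t / 2) * ((1 / 2) ^ j / (1 + norm d))"
      have "0 < 1 + norm d" by (rule add_pos_nonneg) simp_all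
      then have k0: "\<kappa> \<noteq> 0" by (simp add: \<kappa>_def)
      have "comb (c n) (\<lambda>k. f k (j, t)) = \<kappa> * F n t d" for n
        unfolding F_def comb_def using t True by (simp add: f_def j \<kappa>_def sum_distrib_left sum_divide_distrib mult_ac)
      then have "(\<lambda>n. \<kappa> * F n t d) \<longlonglongrightarrow> g (j, t)" using cv[OF t(2), of j] by simp
      then have "(\<lambda>n. (1 / \<kappa>) * (\<kappa> * F n t d)) \<longlonglongrightarrow> (1 / \<kappa>) * g (j, t)" by (intro tendsto_intros)
      then show ?thesis using k0 by (auto simp: convergent_def)
    qed
    show ?thesis
    proof (rule convergent_approx)
      fix r :: real assume r: "0 < r"
      have "h \<in> closure D" using D(2) by simp
      moreover have "0 < r / (?C + 1)" using r C by simp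
      ultimately obtain d where d: "d \<in> D" "dist d h < r / (?C + 1)" unfolding closure_approachable by blast
      have "\<bar>F n t h - F n t d\<bar> \<le> r" for n
      proof -
        have "F n t h = F n t (h - d) + F n t d" by (simp add: F_add[symmetric])
        then have "\<bar>F n t h - F n t d\<bar> \<le> ?C * norm (h - d)" using F_bound[of n t "h - d"] by simp
        also have "\<dots> \<le> (?C + 1) * (r / (?C + 1))"
          using d(2) C by (intro mult_mono) (simp_all add: dist_norm norm_minus_commute)
        also have "\<dots> = r" using C by simp
        finally show ?thesis .
      qed
      then show "\<exists>b. convergent b \<and> (\<forall>n. \<bar>F n t h - b n\<bar> \<le> r)" using D_conv[OF d(1)] by blast
    qed
  qed
  define Z where "Z t h = lim (\<lambda>n. F n t h)" for t h
  have FZ: "(\<lambda>n. F n t h) \<longlonglongrightarrow> Z t h" for t h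
    unfolding Z_def using F_conv by (simp add: convergent_LIMSEQ_iff)
  have Zb: "\<bar>Z t h\<bar> \<le> ?C * norm h" for t h
    by (rule LIMSEQ_le_const2[OF tendsto_rabs[OF FZ]]) (use F_bound in blast)
  have Zm [measurable]: "(\<lambda>t. Z t h) \<in> borel_measurable borel" for h
  proof (rule borel_measurable_LIMSEQ_real[OF FZ])
    show "(\<lambda>t. F n t h) \<in> borel_measurable borel" for n unfolding F_def comb_def by measurable
  qed
  show ?thesis
  proof (rule that[of Z])
    show "bounded_linear (Z t)" for t
    proof (rule bounded_linear_intro)
      show "Z t (h + h') = Z t h + Z t h'" for h h'
        using LIMSEQ_unique[OF FZ[of t "h + h'"]] tendsto_add[OF FZ FZ, of t h t h'] by (simp add: F_add)
      show "Z t (r *\<^sub>R h) = r *\<^sub>R Z t h" for r h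
        using LIMSEQ_unique[OF FZ[of t "r *\<^sub>R h"]] tendsto_mult_left[OF FZ, of r t h] by (simp add: F_scale)
      show "norm (Z t h) \<le> norm h * ?C" for h using Zb[of t h] by (simp add: mult.commute)
    qed
    show "\<bar>Z t h\<bar> \<le> ?C * norm h" for t h by (rule Zb)
    show "(\<lambda>t. Z t h) \<in> borel_measurable borel" for h by (rule Zm)
    fix t h assume t: "0 \<le> (t :: real)"
    have li: "locint (\<lambda>s. inner (z k s) (J h))" for k by (rule locint_inner[OF zi])
    have Pc: "(\<lambda>n. prim (\<lambda>s. ?a n s h) t) \<longlonglongrightarrow> prim (\<lambda>s. Z s h) t"
      unfolding prim_def set_lebesgue_integral_def
    proof (rule integral_dominated_convergence)
      have NAE: "AE s in lborel. s \<notin> N" by (rule AE_not_in[OF N])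
      show "integrable lborel (\<lambda>s. indicator {0..t} s * (?C * norm h))" by (rule integrable_indicator_const)
      show "AE s in lborel. (\<lambda>n. indicat_real {0..t} s *\<^sub>R ?a n s h) \<longlonglongrightarrow> indicat_real {0..t} s *\<^sub>R Z s h"
        using NAE AE_lborel_singleton[of 0]
      proof eventually_elim
        case (elim s)
        show ?case
        proof (cases "s \<in> {0..t}")
          case True
          then have "s \<in> G" using elim by (simp add: G_def)
          then have "F n s h = ?a n s h" for n by (simp add: F_def)
          then have "(\<lambda>n. ?a n s h) \<longlonglongrightarrow> Z s h" using FZ[of s h] by (simp only:)
          then show ?thesis using True by simp
        qed simp
      qed
      show "AE s in lborel. norm (indicat_real {0..t} s *\<^sub>R ?a n s h) \<le> indicator {0..t} s * (?C * norm h)" for n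
        using NAE AE_lborel_singleton[of 0]
      proof eventually_elim
        case (elim s)
        show ?case
        proof (cases "s \<in> {0..t}")
          case True
          then have "s \<in> G" using elim by (simp add: G_def)
          then have "F n s h = ?a n s h" by (simp add: F_def)
          then show ?thesis using True F_bound[of n s h] by simp
        qed simp
      qed
    qed (unfold comb_def, measurable)
    have eq: "comb (c n) (\<lambda>k. inner (vk k t) (J h)) = prim (\<lambda>s. ?a n s h) t + inner (J w1) (J h)" for n
    proof -
      have "comb (c n) (\<lambda>k. inner (vk k t) (J h)) = comb (c n) (\<lambda>k. prim (\<lambda>s. inner (z k s) (J h)) t - (- inner (J w1) (J h)))"
        by (simp add: vel_def inner_add_left prim_inner[OF zi] add.commute)
      also have "\<dots> = prim (\<lambda>s. ?a n s h) t + inner (J w1) (J h)"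
        unfolding comb_diff_const[OF c] prim_comb(2)[of "\<lambda>k s. inner (z k s) (J h)", OF li] by simp
      finally show ?thesis .
    qed
    have "(\<lambda>n. comb (c n) (\<lambda>k. inner (vk k t) (J h))) \<longlonglongrightarrow> inner (y t) (J h)" by (rule fwd_tendsto[OF c conv[OF t]])
    moreover have "(\<lambda>n. comb (c n) (\<lambda>k. inner (vk k t) (J h))) \<longlonglongrightarrow> prim (\<lambda>s. Z s h) t + inner (J w1) (J h)"
      unfolding eq by (intro tendsto_intros Pc)
    ultimately show "inner (y t) (J h) = inner (J w1) (J h) + prim (\<lambda>s. Z s h) t"
      using LIMSEQ_unique by (simp add: add.commute)
  qed
qed

lemma dual_second_derivative:
  "\<exists>Z. dual_Linf_on {0<..} Z \<and> dual_weak_deriv_on {0<..} (\<lambda>t. dual (wderiv {0<..} w t)) Z"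
proof -
  obtain Z :: "real \<Rightarrow> 'w \<Rightarrow> real" where Z: "\<And>t. bounded_linear (Z t)" "\<And>t h. \<bar>Z t h\<bar> \<le> C2 w0 w1 * norm h"
    "\<And>h. (\<lambda>t. Z t h) \<in> borel_measurable borel"
    "\<And>t h. 0 \<le> t \<Longrightarrow> inner (y t) (J h) = inner (J w1) (J h) + prim (\<lambda>s. Z s h) t"
    by (rule second_derivative) (rule that)
  have B: "blinfun_apply (Blinfun (Z t)) = Z t" for t by (rule bounded_linear_Blinfun_apply[OF Z(1)])
  show ?thesis
  proof (intro exI conjI)
    show "dual_Linf_on {0<..} (\<lambda>t. Blinfun (Z t))" unfolding dual_Linf_on_def B
    proof (intro conjI allI exI)
      show "set_borel_measurable lborel {0<..} (\<lambda>t. Z t v)" for v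
        unfolding set_borel_measurable_def using Z(3)[of v] by measurable
      have "norm (Blinfun (Z t)) \<le> C2 w0 w1" for t
        by (rule norm_blinfun_bound[OF C2_nonneg]) (simp add: B Z(2))
      then show "AE t in lborel. t \<in> {0<..} \<longrightarrow> norm (Blinfun (Z t)) \<le> C2 w0 w1" by simp
    qed
    show "dual_weak_deriv_on {0<..} (\<lambda>t. dual (wderiv {0<..} w t)) (\<lambda>t. Blinfun (Z t))"
      unfolding dual_weak_deriv_on_def B dual_apply
    proof
      fix h
      have "locL2 (\<lambda>t. Z t h)" by (rule bounded_locL2[OF Z(3)]) (use Z(2) in simp)
      then have "weak_deriv_on {0<..} (\<lambda>t. inner (y t) (J h)) (\<lambda>t. Z t h)"
        by (intro weak_deriv_prim[OF locL2_locint _ Z(4)]) auto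
      then show "weak_deriv_on {0<..} (\<lambda>t. inner (wderiv {0<..} w t) (J h)) (\<lambda>t. Z t h)"
      proof (rule weak_deriv_on_AE_cong)
        have "loc_integrable_on {0<..} (wderiv {0<..} w)"
          using wderiv_weak_deriv[OF w_weak_deriv] by (simp add: weak_deriv_on_def)
        then show "loc_integrable_on {0<..} (\<lambda>t. inner (wderiv {0<..} w t) (J h))"
          unfolding loc_integrable_on_def set_integrable_def
          using integrable_bounded_linear[OF bounded_linear_inner_left, of lborel _ "J h"] by fastforce
        show "AE t in lborel. t \<in> {0<..} \<longrightarrow> inner (y t) (J h) = inner (wderiv {0<..} w t) (J h)"
          using w_wderiv by eventually_elim simp
      qed
    qed
  qed
qed

end

section \<open>Transfer of the estimates and the limit from accelerations to minimizers\<close>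

theorem theorem2p4:
  fixes J :: "'w::banach \<Rightarrow> (real ^ 'n) L2" and \<W> :: "(real ^ 'n) L2 \<Rightarrow> ennreal" and w0 w1 :: 'w
  assumes "admissible_potential J \<W>"
  shows "(\<forall>\<epsilon>\<in>{0<..<1}. \<exists>w. minimizer J \<W> w0 w1 \<epsilon> w)
    \<and> (\<exists>C. \<forall>\<epsilon>\<in>{0<..<1}. \<forall>w. minimizer J \<W> w0 w1 \<epsilon> w \<longrightarrow>
          (\<forall>\<tau>\<ge>0. \<forall>T\<ge>\<epsilon>. (\<integral>\<^sup>+t\<in>{\<tau>..\<tau> + T}. \<W> (w t) \<partial>lborel) \<le> ennreal (C * T))
        \<and> (\<forall>t\<ge>0. (norm (wderiv {0<..} w t))\<^sup>2 \<le> C)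
        \<and> (\<forall>t\<ge>0. (norm (w t))\<^sup>2 \<le> C * (1 + t\<^sup>2))
        \<and> (AE t in lborel. 0 < t \<longrightarrow>
             norm (to_dual J (wderiv {0<..} (wderiv {0<..} w) t)) \<le> C))
    \<and> (\<forall>\<epsilon> u. decseq \<epsilon> \<and> \<epsilon> \<longlonglongrightarrow> 0 \<and> (\<forall>i. \<epsilon> i \<in> {0<..<1} \<and> minimizer J \<W> w0 w1 (\<epsilon> i) (u i)) \<longrightarrow>
          (\<exists>r w. strict_mono (r :: nat \<Rightarrow> nat) \<and> weak_limit (u \<circ> r) w
            \<and> H1_loc w \<and> Linf_on {0<..} (wderiv {0<..} w)
            \<and> (\<exists>z. dual_Linf_on {0<..} z \<and>
                 dual_weak_deriv_on {0<..} (\<lambda>t. to_dual J (wderiv {0<..} w t)) z)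
            \<and> w 0 = J w0 \<and> initial_velocity J w (J w1)))
    \<and> (\<forall>\<epsilon> u w. decseq \<epsilon> \<and> \<epsilon> \<longlonglongrightarrow> 0 \<and> (\<forall>i. \<epsilon> i \<in> {0<..<1} \<and> minimizer J \<W> w0 w1 (\<epsilon> i) (u i))
            \<and> weak_limit u w \<longrightarrow>
          (\<exists>p. initial_velocity J w p
            \<and> energy \<W> (w 0) p = ennreal ((norm (J w1))\<^sup>2 / 2) + \<W> (J w0)
            \<and> (AE t in lborel. 0 < t \<longrightarrow> energy \<W> (w t) (wderiv {0<..} w t) \<le> energy \<W> (w 0) p)))"
proof -
  obtain K n D where "potential J \<W> K n D" by (rule admissible_potential[OF assms])
  then interpret potential J \<W> K n D .
  have td: "to_dual J = dual" by (rule ext) (simp only: to_dual_def dual_def)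
  have path: "\<exists>z. minimal_path J \<W> K n D w0 w1 \<epsilon> z \<and> (\<forall>t\<ge>0. w t = pth (J w0) (J w1) z t)"
    if e: "\<epsilon> \<in> {0<..<1}" and w: "minimizer J \<W> w0 w1 \<epsilon> w" for \<epsilon> w
  proof -
    obtain z where z: "locL2 z" "\<And>t. t \<ge> 0 \<Longrightarrow> w t = pth (J w0) (J w1) z t"
      "\<And>z'. locL2 z' \<Longrightarrow> wfun \<W> (J w0) (J w1) \<epsilon> z \<le> wfun \<W> (J w0) (J w1) \<epsilon> z'"
      by (rule minimizer_rep[OF w]) (rule that)
    have "minimal_path J \<W> K n D w0 w1 \<epsilon> z" by unfold_locales (use e z in auto)
    then show ?thesis using z(2) by blast
  qed
  have limit: "\<exists>r z y. strict_mono (r :: nat \<Rightarrow> nat) \<and> limit_path J \<W> K n D w0 w1 (\<lambda>k. \<epsilon> (r k)) (\<lambda>k. z (r k)) y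
      \<and> (\<forall>i. \<forall>t\<ge>0. u i t = pth (J w0) (J w1) (z i) t)"
    if seq: "decseq \<epsilon> \<and> \<epsilon> \<longlonglongrightarrow> 0 \<and> (\<forall>i. \<epsilon> i \<in> {0<..<1} \<and> minimizer J \<W> w0 w1 (\<epsilon> i) (u i))" for \<epsilon> u
  proof -
    have "\<forall>i. \<exists>z. minimal_path J \<W> K n D w0 w1 (\<epsilon> i) z \<and> (\<forall>t\<ge>0. u i t = pth (J w0) (J w1) z t)"
      using seq path by blast
    then obtain z where z: "\<And>i. minimal_path J \<W> K n D w0 w1 (\<epsilon> i) (z i)" "\<And>i. \<forall>t\<ge>0. u i t = pth (J w0) (J w1) (z i) t"
      using choice[of "\<lambda>i z. minimal_path J \<W> K n D w0 w1 (\<epsilon> i) z \<and> (\<forall>t\<ge>0. u i t = pth (J w0) (J w1) z t)"] by blast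
    obtain r y where "strict_mono r" "limit_path J \<W> K n D w0 w1 (\<lambda>k. \<epsilon> (r k)) (\<lambda>k. z (r k)) y"
      by (rule limit_path_exists[of w0 w1 \<epsilon> z, OF z(1) conjunct1[OF conjunct2[OF seq]]]) (rule that)
    then show ?thesis using z(2) by blast
  qed
  have velocity: "initial_velocity J w (J w1)"
    if l: "limit_path J \<W> K n D w0 w1 \<epsilon> z y" and w: "AE t in lborel. 0 < t \<longrightarrow> wderiv {0<..} w t = y t" for \<epsilon> z y w
  proof -
    interpret limit_path J \<W> K n D w0 w1 \<epsilon> z y by (rule l)
    have "AE t in lborel. 0 < t \<longrightarrow> dual (y t) = dual (wderiv {0<..} w t)" using w by eventually_elim simp
    then show ?thesis unfolding initial_velocity_def td
      by (intro exI[of _ "\<lambda>t. dual (y t)"] exI[of _ "C2 w0 w1"] conjI dual_lipschitz) (simp_all only: y_0)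
  qed
  show ?thesis
  proof (intro conjI)
    show "\<forall>\<epsilon>\<in>{0<..<1}. \<exists>w. minimizer J \<W> w0 w1 \<epsilon> w"
    proof
      fix \<epsilon> :: real assume "\<epsilon> \<in> {0<..<1}"
      then have e: "0 < \<epsilon>" "\<epsilon> < 1" by simp_all
      obtain z where z: "locL2 z" "\<And>z'. locL2 z' \<Longrightarrow> wfun \<W> (J w0) (J w1) \<epsilon> z \<le> wfun \<W> (J w0) (J w1) \<epsilon> z'"
        by (rule exists_minimizer[OF e]) (rule that)
      show "\<exists>w. minimizer J \<W> w0 w1 \<epsilon> w" by (rule exI, rule minimizerI, rule z(1)) (rule z(2))
    qed
    define C where "C = max (max (2 * exp 2 * EE w0 w1) (2 * EE w0 w1)) (max (2 * (norm (J w0))\<^sup>2 + 4 * EE w0 w1) (C2 w0 w1))"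
    have C: "2 * exp 2 * EE w0 w1 \<le> C" "2 * EE w0 w1 \<le> C" "2 * (norm (J w0))\<^sup>2 + 4 * EE w0 w1 \<le> C" "C2 w0 w1 \<le> C"
      by (simp_all add: C_def)
    show "\<exists>C. \<forall>\<epsilon>\<in>{0<..<1}. \<forall>w. minimizer J \<W> w0 w1 \<epsilon> w \<longrightarrow>
          (\<forall>\<tau>\<ge>0. \<forall>T\<ge>\<epsilon>. (\<integral>\<^sup>+t\<in>{\<tau>..\<tau> + T}. \<W> (w t) \<partial>lborel) \<le> ennreal (C * T))
        \<and> (\<forall>t\<ge>0. (norm (wderiv {0<..} w t))\<^sup>2 \<le> C)
        \<and> (\<forall>t\<ge>0. (norm (w t))\<^sup>2 \<le> C * (1 + t\<^sup>2))
        \<and> (AE t in lborel. 0 < t \<longrightarrow> norm (to_dual J (wderiv {0<..} (wderiv {0<..} w) t)) \<le> C)"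
    proof (rule exI[of _ C], intro ballI allI impI)
      fix \<epsilon> w assume e: "\<epsilon> \<in> {0<..<1}" and "minimizer J \<W> w0 w1 \<epsilon> w"
      then obtain z where mp: "minimal_path J \<W> K n D w0 w1 \<epsilon> z" and w: "\<forall>t\<ge>0. w t = pth (J w0) (J w1) z t"
        using path by blast
      interpret m: minimal_path J \<W> K n D w0 w1 \<epsilon> z by (rule mp)
      have w': "w t = pth (J w0) (J w1) z t" if "t \<ge> 0" for t using w that by blast
      have w1': "wderiv {0<..} w t = vel (J w1) z t" if "t \<ge> 0" for t
        by (rule wderiv_pth(1)[OF m.zi _ that]) (rule w')
      have w2': "AE t in lborel. 0 < t \<longrightarrow> wderiv {0<..} (wderiv {0<..} w) t = z t"
        by (rule wderiv_pth(2)[OF m.zi]) (rule w')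
      show "(\<forall>\<tau>\<ge>0. \<forall>T\<ge>\<epsilon>. (\<integral>\<^sup>+t\<in>{\<tau>..\<tau> + T}. \<W> (w t) \<partial>lborel) \<le> ennreal (C * T))
        \<and> (\<forall>t\<ge>0. (norm (wderiv {0<..} w t))\<^sup>2 \<le> C)
        \<and> (\<forall>t\<ge>0. (norm (w t))\<^sup>2 \<le> C * (1 + t\<^sup>2))
        \<and> (AE t in lborel. 0 < t \<longrightarrow> norm (to_dual J (wderiv {0<..} (wderiv {0<..} w) t)) \<le> C)"
      proof (intro conjI allI impI)
        fix \<tau> T :: real assume t: "0 \<le> \<tau>" and T: "\<epsilon> \<le> T"
        have "(\<integral>\<^sup>+t\<in>{\<tau>..\<tau> + T}. \<W> (w t) \<partial>lborel) = (\<integral>\<^sup>+t\<in>{\<tau>..\<tau> + T}. \<W> (pth (J w0) (J w1) z t) \<partial>lborel)"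
          by (rule nn_integral_cong) (use t in \<open>simp add: indicator_def w'\<close>)
        also have "\<dots> \<le> ennreal (2 * exp 2 * EE w0 w1 * T)" by (rule m.W_estimate[OF t T])
        also have "\<dots> \<le> ennreal (C * T)" using T m.e by (intro ennreal_leI mult_right_mono C) simp
        finally show "(\<integral>\<^sup>+t\<in>{\<tau>..\<tau> + T}. \<W> (w t) \<partial>lborel) \<le> ennreal (C * T)" .
      next
        fix t :: real assume t: "0 \<le> t"
        show "(norm (wderiv {0<..} w t))\<^sup>2 \<le> C"
          unfolding w1'[OF t] using m.vel_bound[OF t] C(2) by linarith
        have "(2 * (norm (J w0))\<^sup>2 + 4 * EE w0 w1) * (1 + t\<^sup>2) \<le> C * (1 + t\<^sup>2)" by (intro mult_right_mono C) simp
        then show "(norm (w t))\<^sup>2 \<le> C * (1 + t\<^sup>2)" unfolding w'[OF t] using m.path_sq_le[OF t] by linarith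
      next
        show "AE t in lborel. 0 < t \<longrightarrow> norm (to_dual J (wderiv {0<..} (wderiv {0<..} w) t)) \<le> C"
          using w2' m.accel_bound
        proof eventually_elim
          case (elim t)
          show ?case
          proof
            assume t: "0 < t"
            have "norm (dual (z t)) \<le> C2 w0 w1" by (rule norm_dual_le[OF C2_nonneg]) (use elim(2) t in blast)
            then show "norm (to_dual J (wderiv {0<..} (wderiv {0<..} w) t)) \<le> C"
              using elim(1) t C(4) by (simp add: td)
          qed
        qed
      qed
    qed
    show "\<forall>\<epsilon> u. decseq \<epsilon> \<and> \<epsilon> \<longlonglongrightarrow> 0 \<and> (\<forall>i. \<epsilon> i \<in> {0<..<1} \<and> minimizer J \<W> w0 w1 (\<epsilon> i) (u i)) \<longrightarrow>
          (\<exists>r w. strict_mono (r :: nat \<Rightarrow> nat) \<and> weak_limit (u \<circ> r) w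
            \<and> H1_loc w \<and> Linf_on {0<..} (wderiv {0<..} w)
            \<and> (\<exists>z. dual_Linf_on {0<..} z \<and>
                 dual_weak_deriv_on {0<..} (\<lambda>t. to_dual J (wderiv {0<..} w t)) z)
            \<and> w 0 = J w0 \<and> initial_velocity J w (J w1))"
    proof (intro allI impI)
      fix \<epsilon> u assume "decseq \<epsilon> \<and> \<epsilon> \<longlonglongrightarrow> 0 \<and> (\<forall>i. \<epsilon> i \<in> {0<..<1} \<and> minimizer J \<W> w0 w1 (\<epsilon> i) (u i))"
      from limit[OF this] obtain r z y where r: "strict_mono (r :: nat \<Rightarrow> nat)"
        and l: "limit_path J \<W> K n D w0 w1 (\<lambda>k. \<epsilon> (r k)) (\<lambda>k. z (r k)) y"
        and u: "\<forall>i. \<forall>t\<ge>0. u i t = pth (J w0) (J w1) (z i) t" by blast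
      interpret l: limit_path J \<W> K n D w0 w1 "\<lambda>k. \<epsilon> (r k)" "\<lambda>k. z (r k)" y by (rule l)
      have "weak_limit (u \<circ> r) l.w" unfolding weak_limit_def
        by (intro conjI allI impI l.w_continuous l.w_H1_weak) (simp_all add: u)
      then show "\<exists>r w. strict_mono (r :: nat \<Rightarrow> nat) \<and> weak_limit (u \<circ> r) w
            \<and> H1_loc w \<and> Linf_on {0<..} (wderiv {0<..} w)
            \<and> (\<exists>z. dual_Linf_on {0<..} z \<and>
                 dual_weak_deriv_on {0<..} (\<lambda>t. to_dual J (wderiv {0<..} w t)) z)
            \<and> w 0 = J w0 \<and> initial_velocity J w (J w1)"
        unfolding td using r l.w_H1_loc l.w_Linf l.dual_second_derivative l.w_0 velocity[OF l l.w_wderiv] by blast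
    qed
    show "\<forall>\<epsilon> u w. decseq \<epsilon> \<and> \<epsilon> \<longlonglongrightarrow> 0 \<and> (\<forall>i. \<epsilon> i \<in> {0<..<1} \<and> minimizer J \<W> w0 w1 (\<epsilon> i) (u i))
            \<and> weak_limit u w \<longrightarrow>
          (\<exists>p. initial_velocity J w p
            \<and> energy \<W> (w 0) p = ennreal ((norm (J w1))\<^sup>2 / 2) + \<W> (J w0)
            \<and> (AE t in lborel. 0 < t \<longrightarrow> energy \<W> (w t) (wderiv {0<..} w t) \<le> energy \<W> (w 0) p))"
    proof (intro allI impI)
      fix \<epsilon> u w
      assume "decseq \<epsilon> \<and> \<epsilon> \<longlonglongrightarrow> 0 \<and> (\<forall>i. \<epsilon> i \<in> {0<..<1} \<and> minimizer J \<W> w0 w1 (\<epsilon> i) (u i)) \<and> weak_limit u w"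
      then have seq: "decseq \<epsilon> \<and> \<epsilon> \<longlonglongrightarrow> 0 \<and> (\<forall>i. \<epsilon> i \<in> {0<..<1} \<and> minimizer J \<W> w0 w1 (\<epsilon> i) (u i))"
        and lim: "weak_limit u w" by blast+
      from limit[OF seq] obtain r z y where r: "strict_mono (r :: nat \<Rightarrow> nat)"
        and l: "limit_path J \<W> K n D w0 w1 (\<lambda>k. \<epsilon> (r k)) (\<lambda>k. z (r k)) y"
        and u: "\<forall>i. \<forall>t\<ge>0. u i t = pth (J w0) (J w1) (z i) t" by blast
      interpret l: limit_path J \<W> K n D w0 w1 "\<lambda>k. \<epsilon> (r k)" "\<lambda>k. z (r k)" y by (rule l)
      \<comment> \<open>Here \<open>w\<close> is an arbitrary weak limit of the whole sequence. A
        subsequence leads to a constructed limit path, and uniqueness of weak limits shows that the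
        two agree.\<close>
      have wl: "w t = l.w t" if "0 \<le> t" for t
      proof (rule H1_weak_limit_unique[of w l.w "u \<circ> r" t, OF _ l.w_continuous _ _ that])
        show "continuous_on {0..} w" using lim by (simp add: weak_limit_def)
        fix T :: real assume T: "0 < T"
        show "H1_weak_conv {0<..<T} (u \<circ> r) l.w" by (rule l.w_H1_weak[OF T]) (simp add: u)
        have "H1_weak_conv {0<..<T} u w" using lim T by (simp add: weak_limit_def)
        then show "H1_weak_conv {0<..<T} (u \<circ> r) w"
          unfolding H1_weak_conv_def using LIMSEQ_subseq_LIMSEQ[OF _ r] by (fastforce simp: comp_def)
      qed
      have "wderiv {0<..} w = wderiv {0<..} l.w" by (rule wderiv_cong) (simp add: wl)
      then have d: "AE t in lborel. 0 < t \<longrightarrow> wderiv {0<..} w t = y t" using l.w_wderiv by simp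
      have E0: "energy \<W> (w 0) (J w1) = ennreal ((norm (J w1))\<^sup>2 / 2) + \<W> (J w0)"
        by (simp add: energy_def wl l.w_0)
      have "AE t in lborel. 0 < t \<longrightarrow> energy \<W> (w t) (wderiv {0<..} w t) \<le> energy \<W> (w 0) (J w1)"
        using d
      proof eventually_elim
        case (elim t)
        have "ennreal ((norm (J w1))\<^sup>2 / 2 + W0 w0) = ennreal ((norm (J w1))\<^sup>2 / 2) + \<W> (J w0)"
          unfolding W0 by (rule ennreal_plus) (simp_all add: W0_nonneg)
        then show ?case unfolding E0 using elim l.energy_le[of t] by (simp add: energy_def wl)
      qed
      then show "\<exists>p. initial_velocity J w p
            \<and> energy \<W> (w 0) p = ennreal ((norm (J w1))\<^sup>2 / 2) + \<W> (J w0)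
            \<and> (AE t in lborel. 0 < t \<longrightarrow> energy \<W> (w t) (wderiv {0<..} w t) \<le> energy \<W> (w 0) p)"
        using velocity[OF l d] E0 by blast
    qed
  qed
qed


end
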